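(* Let $Z$ be an irreducible hermitian Jordan triple of rank $r$ and let $1\le \ell\le r$. Then the Kepler variety $Z_\ell=\{z\in Z:\ \operatorname{rank} z\le \ell\}$ is a normal algebraic variety.
   Context: A hermitian Jordan triple is a finite-dimensional complex vector space $Z$ with a triple product $\{u;v;w\}=:D(u,v)w$, complex linear and symmetric in $u,w$, conjugate linear in $v$, satisfying the Jordan triple identity $[D(x,y),D(u,v)]=D(\{x;y;u\},v)-D(u,\{v;x;y\})$ and such that $(u,v)\mapsto \operatorname{tr}D(u,v)$ is a positive definite hermitian form. Irreducible means that it is not a direct sum of two non-zero ideals. Put $Q_uz=\frac12\{u;z;u\}$. A tripotent is $c\in Z$ with $Q_cc=c$; tripotents $c,c'$ are orthogonal if $D(c,c')=0$; a non-zero tripotent is minimal if it is not a sum of two non-zero orthogonal tripotents. A frame is a maximal system $e_1,\dots,e_r$ of orthogonal minimal tripotents; $r$ is the rank of $Z$. Let $K$ be the identity component of the group of linear automorphisms of the triple. Every $z\in Z$ can be written $z=k(\lambda_1e_1+\dots+\lambda_re_r)$ with $k\in K$ and unique $\lambda_1\ge\dots\ge\lambda_r\ge0$; $\operatorname{rank} z$ is the number of non-zero $\lambda_i$. *)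

theory Defs
  imports "HOL-Analysis.Analysis" "HOL-Algebra.Polynomials"
begin

section \<open>Fields of fractions and integrally closed domains\<close>

definition frac_rel :: "('r, 'm) ring_scheme \<Rightarrow> (('r \<times> 'r) \<times> ('r \<times> 'r)) set" where
  "frac_rel R =
     {((a, b), (c, d)).
        a \<in> carrier R \<and> b \<in> carrier R - {\<zero>\<^bsub>R\<^esub>} \<and>
        c \<in> carrier R \<and> d \<in> carrier R - {\<zero>\<^bsub>R\<^esub>} \<and>
        a \<otimes>\<^bsub>R\<^esub> d = c \<otimes>\<^bsub>R\<^esub> b}"

definition fraction :: "('r, 'm) ring_scheme \<Rightarrow> 'r \<Rightarrow> 'r \<Rightarrow> ('r \<times> 'r) set" where
  "fraction R a b = frac_rel R `` {(a, b)}"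

definition frac_field :: "('r, 'm) ring_scheme \<Rightarrow> ('r \<times> 'r) set ring" where
  "frac_field R =
     \<lparr> carrier = (carrier R \<times> (carrier R - {\<zero>\<^bsub>R\<^esub>})) // frac_rel R,
       mult = (\<lambda>x y. \<Union>(a, b)\<in>x. \<Union>(c, d)\<in>y. fraction R (a \<otimes>\<^bsub>R\<^esub> c) (b \<otimes>\<^bsub>R\<^esub> d)),
       one = fraction R \<one>\<^bsub>R\<^esub> \<one>\<^bsub>R\<^esub>,
       zero = fraction R \<zero>\<^bsub>R\<^esub> \<one>\<^bsub>R\<^esub>,
       add = (\<lambda>x y. \<Union>(a, b)\<in>x. \<Union>(c, d)\<in>y.
                fraction R (a \<otimes>\<^bsub>R\<^esub> d \<oplus>\<^bsub>R\<^esub> c \<otimes>\<^bsub>R\<^esub> b) (b \<otimes>\<^bsub>R\<^esub> d)) \<rparr>"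

text \<open>\<open>x\<close> is a root of a monic polynomial with coefficients in the subring \<open>A\<close> of \<open>F\<close>
  (coefficient lists start with the leading coefficient).\<close>

definition integral_over :: "('r, 'm) ring_scheme \<Rightarrow> 'r set \<Rightarrow> 'r \<Rightarrow> bool" where
  "integral_over F A x \<longleftrightarrow>
     (\<exists>p. p \<noteq> [] \<and> polynomial\<^bsub>F\<^esub> A p \<and> hd p = \<one>\<^bsub>F\<^esub> \<and> ring.eval F p x = \<zero>\<^bsub>F\<^esub>)"

definition integrally_closed_domain :: "('r, 'm) ring_scheme \<Rightarrow> bool" where
  "integrally_closed_domain R \<longleftrightarrow>
     domain R \<and>
     (let A = (\<lambda>a. fraction R a \<one>\<^bsub>R\<^esub>) ` carrier R
      in \<forall>x \<in> carrier (frac_field R). integral_over (frac_field R) A x \<longrightarrow> x \<in> A)"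


section \<open>Affine varieties in a complex vector space\<close>

inductive_set polynomial_functions ::
    "(complex \<Rightarrow> 'a::ab_group_add \<Rightarrow> 'a) \<Rightarrow> ('a \<Rightarrow> complex) set"
  for smul :: "complex \<Rightarrow> 'a \<Rightarrow> 'a" where
  const: "(\<lambda>z. a) \<in> polynomial_functions smul"
| linear: "Vector_Spaces.linear smul (*) \<phi> \<Longrightarrow> \<phi> \<in> polynomial_functions smul"
| add: "f \<in> polynomial_functions smul \<Longrightarrow> g \<in> polynomial_functions smul \<Longrightarrow>
         (\<lambda>z. f z + g z) \<in> polynomial_functions smul"
| mult: "f \<in> polynomial_functions smul \<Longrightarrow> g \<in> polynomial_functions smul \<Longrightarrow>
         (\<lambda>z. f z * g z) \<in> polynomial_functions smul"

definition algebraic_set :: "(complex \<Rightarrow> 'a::ab_group_add \<Rightarrow> 'a) \<Rightarrow> 'a set \<Rightarrow> bool" where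
  "algebraic_set smul V \<longleftrightarrow>
     (\<exists>S \<subseteq> polynomial_functions smul. V = {z. \<forall>f\<in>S. f z = 0})"

definition affine_variety :: "(complex \<Rightarrow> 'a::ab_group_add \<Rightarrow> 'a) \<Rightarrow> 'a set \<Rightarrow> bool" where
  "affine_variety smul V \<longleftrightarrow>
     algebraic_set smul V \<and> V \<noteq> {} \<and>
     (\<forall>A B. algebraic_set smul A \<longrightarrow> algebraic_set smul B \<longrightarrow> V = A \<union> B \<longrightarrow> V = A \<or> V = B)"

definition coordinate_ring ::
    "(complex \<Rightarrow> 'a::ab_group_add \<Rightarrow> 'a) \<Rightarrow> 'a set \<Rightarrow> ('a \<Rightarrow> complex) ring" where
  "coordinate_ring smul V =
     \<lparr> carrier = (\<lambda>f. restrict f V) ` polynomial_functions smul,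
       mult = (\<lambda>f g. \<lambda>z\<in>V. f z * g z),
       one = (\<lambda>z\<in>V. 1),
       zero = (\<lambda>z\<in>V. 0),
       add = (\<lambda>f g. \<lambda>z\<in>V. f z + g z) \<rparr>"

abbreviation function_field where
  "function_field smul V \<equiv> frac_field (coordinate_ring smul V)"

text \<open>The local ring of \<open>V\<close> at \<open>p\<close>: the rational functions on \<open>V\<close> that are regular at \<open>p\<close>.\<close>

definition local_ring ::
    "(complex \<Rightarrow> 'a::ab_group_add \<Rightarrow> 'a) \<Rightarrow> 'a set \<Rightarrow> 'a
       \<Rightarrow> (('a \<Rightarrow> complex) \<times> ('a \<Rightarrow> complex)) set ring" where
  "local_ring smul V p =
     (function_field smul V)
       \<lparr> carrier := {fraction (coordinate_ring smul V) f g | f g.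
            f \<in> carrier (coordinate_ring smul V) \<and>
            g \<in> carrier (coordinate_ring smul V) \<and> g p \<noteq> 0} \<rparr>"

definition normal_affine_variety ::
    "(complex \<Rightarrow> 'a::ab_group_add \<Rightarrow> 'a) \<Rightarrow> 'a set \<Rightarrow> bool" where
  "normal_affine_variety smul V \<longleftrightarrow>
     affine_variety smul V \<and> (\<forall>p\<in>V. integrally_closed_domain (local_ring smul V p))"


section \<open>Hermitian Jordan triples\<close>

context finite_dimensional_vector_space
begin

text \<open>The trace is independent of the basis, so it may be computed in the basis fixed
  by the locale.\<close>

definition lin_trace :: "('b \<Rightarrow> 'b) \<Rightarrow> 'a" where
  "lin_trace T = (\<Sum>b\<in>Basis. representation Basis (T b) b)"

end

locale hermitian_jordan_triple = finite_dimensional_vector_space smul Basis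
  for smul :: "complex \<Rightarrow> 'a::ab_group_add \<Rightarrow> 'a" and Basis :: "'a set" +
  fixes tp :: "'a \<Rightarrow> 'a \<Rightarrow> 'a \<Rightarrow> 'a"
  assumes tp_linear_right: "Vector_Spaces.linear smul smul (tp u v)"
    and tp_commute: "tp u v w = tp w v u"
    and tp_add_middle: "tp u (v + v') w = tp u v w + tp u v' w"
    and tp_scale_middle: "tp u (smul a v) w = smul (cnj a) (tp u v w)"
    and jordan_identity:
      "tp x y (tp u v w) - tp u v (tp x y w) = tp (tp x y u) v w - tp u (tp v x y) w"
    and trace_form_hermitian: "lin_trace (tp u v) = cnj (lin_trace (tp v u))"
    and trace_form_pos_def: "u \<noteq> 0 \<Longrightarrow> Re (lin_trace (tp u u)) > 0"
begin

definition triple_ideal :: "'a set \<Rightarrow> bool" where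
  "triple_ideal I \<longleftrightarrow>
     subspace I \<and> (\<forall>x\<in>I. \<forall>u v. tp x u v \<in> I \<and> tp u x v \<in> I)"

definition quad :: "'a \<Rightarrow> 'a \<Rightarrow> 'a" where
  "quad u z = smul (1/2) (tp u z u)"

definition tripotent :: "'a \<Rightarrow> bool" where
  "tripotent c \<longleftrightarrow> quad c c = c"

definition orthogonal_tripotents :: "'a \<Rightarrow> 'a \<Rightarrow> bool" where
  "orthogonal_tripotents c c' \<longleftrightarrow> tripotent c \<and> tripotent c' \<and> tp c c' = (\<lambda>w. 0)"

definition minimal_tripotent :: "'a \<Rightarrow> bool" where
  "minimal_tripotent c \<longleftrightarrow>
     tripotent c \<and> c \<noteq> 0 \<and>
     \<not> (\<exists>a b. a \<noteq> 0 \<and> b \<noteq> 0 \<and> orthogonal_tripotents a b \<and> c = a + b)"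

text \<open>The maximality clause needs no \<open>c \<notin> e ` {1..r}\<close>: a non-zero tripotent \<open>c\<close> is never
  orthogonal to itself, since \<open>tp c c c = 2c\<close>.\<close>

definition is_frame :: "nat \<Rightarrow> (nat \<Rightarrow> 'a) \<Rightarrow> bool" where
  "is_frame r e \<longleftrightarrow>
     (\<forall>i\<in>{1..r}. minimal_tripotent (e i)) \<and>
     (\<forall>i\<in>{1..r}. \<forall>j\<in>{1..r}. i \<noteq> j \<longrightarrow> orthogonal_tripotents (e i) (e j)) \<and>
     \<not> (\<exists>c. minimal_tripotent c \<and>
            (\<forall>i\<in>{1..r}. orthogonal_tripotents c (e i) \<and> orthogonal_tripotents (e i) c))"

definition triple_automorphisms :: "('a \<Rightarrow> 'a) set" where
  "triple_automorphisms =
     {g. Vector_Spaces.linear smul smul g \<and> bij g \<and>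
         (\<forall>u v w. g (tp u v w) = tp (g u) (g v) (g w))}"

text \<open>The usual topology of the finite-dimensional space of linear endomorphisms: the coarsest
  one for which all matrix coefficients \<open>T \<mapsto> \<phi> (T z)\<close> are continuous.\<close>

definition End_topology :: "('a \<Rightarrow> 'a) topology" where
  "End_topology = topology_generated_by
     {{T. Vector_Spaces.linear smul smul T \<and> \<phi> (T z) \<in> U} | \<phi> z U.
        Vector_Spaces.linear smul (*) \<phi> \<and> open U}"

text \<open>The identity component of the automorphism group.\<close>

definition K :: "('a \<Rightarrow> 'a) set" where
  "K = connected_component_of_set (subtopology End_topology triple_automorphisms) id"

definition spectral_values :: "nat \<Rightarrow> (nat \<Rightarrow> 'a) \<Rightarrow> 'a \<Rightarrow> (nat \<Rightarrow> real) \<Rightarrow> bool" where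
  "spectral_values r e z t \<longleftrightarrow>
     (\<forall>i\<in>{1..r}. 0 \<le> t i) \<and>
     (\<forall>i\<in>{1..r}. \<forall>j\<in>{1..r}. i \<le> j \<longrightarrow> t j \<le> t i) \<and>
     (\<exists>k\<in>K. z = k (\<Sum>i=1..r. smul (complex_of_real (t i)) (e i)))"

text \<open>The values \<open>t 1, \<dots>, t r\<close> are uniquely determined by \<open>z\<close>, hence so is the rank.\<close>

definition element_rank :: "nat \<Rightarrow> (nat \<Rightarrow> 'a) \<Rightarrow> 'a \<Rightarrow> nat" where
  "element_rank r e z =
     (THE n. \<exists>t. spectral_values r e z t \<and> n = card {i \<in> {1..r}. t i \<noteq> 0})"

definition kepler_variety :: "nat \<Rightarrow> (nat \<Rightarrow> 'a) \<Rightarrow> nat \<Rightarrow> 'a set" where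
  "kepler_variety r e l = {z. element_rank r e z \<le> l}"

end

locale irreducible_hermitian_jordan_triple = hermitian_jordan_triple +
  assumes irreducible:
    "\<not> (\<exists>I J. triple_ideal I \<and> triple_ideal J \<and> I \<noteq> {0} \<and> J \<noteq> {0} \<and>
            I \<inter> J = {0} \<and> {x + y | x y. x \<in> I \<and> y \<in> J} = UNIV)"

end

theory Submission
 imports Defs "Jordan_Normal_Form.Determinant" "HOL-Library.Function_Algebras"
  "HOL-Computational_Algebra.Fundamental_Theorem_Algebra"
begin

text \<open>Let \<open>c = e_1 + ... + e_l\<close> and let \<open>Z_0\<close>, \<open>Z_1\<close>, \<open>Z_2\<close> be its Peirce spaces. The proof has three parts.

 Rank. Every \<open>z\<close> is \<open>k (t_1 e_1 + ... + t_r e_r)\<close> with \<open>k\<close> in the group \<open>K\<close> (\<open>spectral_values_exist\<close>): a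
 point in the closure of an orbit at which the real part of \<open>(_ | a)\<close> is maximal, \<open>a\<close> a diagonal element with
 distinct positive entries, is diagonal. Irreducibility of \<open>Z\<close> allows the entries to be permuted, so they can
 be sorted. Hence \<open>rank z \<le> l\<close> if and only if the operator \<open>Q_z\<close> has rank at most \<open>dim Z_2\<close>
 (\<open>kepler_variety_rank\<close>). This describes the Kepler variety \<open>V\<close> by minors and shows that it is invariant
 under all automorphisms, which are unitary for the trace form.

 Geometry. The polynomial map \<open>(v, y) \<mapsto> exp(D(v, c)) y\<close> from \<open>Z_1 \<times> Z_2\<close> to \<open>V\<close> reaches every point of \<open>V\<close>
 outside the zero set of one polynomial (\<open>kepler_chart_covers\<close>), and \<open>V\<close> is the union of the images of \<open>Z_2\<close>
 under automorphisms. Two general points of \<open>V\<close> lie on a polynomial curve inside \<open>V\<close>, made of Peirce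
 scalings, so \<open>V\<close> is irreducible (\<open>kepler_irreducible\<close>). These facts are collected in the locale
 \<open>unitary_cone\<close>.

 Normality. Let a rational function on \<open>V\<close> be integral over the local ring at \<open>p\<close>. Its product \<open>u\<close> with a
 suitable polynomial that does not vanish at \<open>p\<close> satisfies a monic equation with polynomial coefficients, and
 therefore grows at most like a power of \<open>1 + (z | z)\<close>. It is enough that such a bounded rational function is
 a polynomial (\<open>bounded_rational_polynomial\<close>). Composed with the chart it becomes a rational function on a
 vector space that is locally bounded and of polynomial growth, hence a polynomial of bounded degree. So the
 bounded rational functions of growth \<open>n\<close> form a space of finite dimension modulo equality almost everywhere,
 and this space carries an inner product that is invariant under automorphisms
 (\<open>invariant_form_bounded_rational\<close>). Let \<open>h\<close> be orthogonal to the polynomials in it and let \<open>k\<close> be an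
 automorphism. In the chart \<open>h \<circ> k\<close> is a polynomial \<open>q(v, y)\<close>. The unitary rotations \<open>(v, y) \<mapsto> (\<tau> v, y)\<close> are
 induced by automorphisms, and averaging over them turns \<open>q(v, y)\<close> into \<open>q(0, y)\<close>, which comes from the
 polynomial \<open>z \<mapsto> q(0, P2 z)\<close> on \<open>V\<close>. The average is both a polynomial and orthogonal to all polynomials, so
 it is zero. Thus \<open>h\<close> vanishes on \<open>k Z_2\<close> for every \<open>k\<close>, that is, on \<open>V\<close>.\<close>

abbreviation endo where "endo s \<equiv> Vector_Spaces.linear s s"

section \<open>Hermitian forms\<close>

locale hermitian_form = vector_space scale
 for scale :: "complex => 'v::ab_group_add => 'v" +
 fixes S :: "'v set" and ip :: "'v => 'v => complex"
 assumes subspace_S: "subspace S"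
  and ip_add_left: "x \<in> S ==> y \<in> S ==> z \<in> S ==> ip (x + y) z = ip x z + ip y z"
  and ip_scale_left: "x \<in> S ==> z \<in> S ==> ip (scale a x) z = a * ip x z"
  and ip_cnj: "x \<in> S ==> y \<in> S ==> cnj (ip x y) = ip y x"
  and ip_nonneg: "x \<in> S ==> Re (ip x x) \<ge> 0"
begin

lemma S_closed [simp]: "x \<in> S ==> y \<in> S ==> x + y \<in> S" "x \<in> S ==> scale a x \<in> S"
 "0 \<in> S" "x \<in> S ==> y \<in> S ==> x - y \<in> S" "(\<And>i. i \<in> I ==> g i \<in> S) ==> sum g I \<in> S"
 using subspace_S by (auto intro: subspace_add subspace_scale subspace_0 subspace_diff subspace_sum)

lemma span_S: "F \<subseteq> S ==> span F \<subseteq> S" using subspace_S by (simp add: span_minimal)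

lemma ip_add_right: "x \<in> S ==> y \<in> S ==> z \<in> S ==> ip z (x + y) = ip z x + ip z y"
 by (metis S_closed(1) complex_cnj_add ip_add_left ip_cnj)

lemma ip_scale_right: "x \<in> S ==> z \<in> S ==> ip z (scale a x) = cnj a * ip z x"
 by (metis S_closed(2) complex_cnj_mult ip_cnj ip_scale_left)

lemma ip_zero [simp]: "z \<in> S ==> ip 0 z = 0" "z \<in> S ==> ip z 0 = 0"
 using ip_scale_left[of z z 0] ip_scale_right[of z z 0] by auto

lemma ip_diff_left: "x \<in> S ==> y \<in> S ==> z \<in> S ==> ip (x - y) z = ip x z - ip y z"
 using ip_add_left[of "x - y" y z] by simp

lemma ip_diff_right: "x \<in> S ==> y \<in> S ==> z \<in> S ==> ip z (x - y) = ip z x - ip z y"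
 using ip_add_right[of "x - y" y z] by simp

lemma ip_sum_left: "(\<And>i. i \<in> I ==> g i \<in> S) ==> z \<in> S ==> ip (sum g I) z = (\<Sum>i\<in>I. ip (g i) z)"
 by (induction I rule: infinite_finite_induct) (auto simp: ip_add_left)

lemma ip_sum_right: "(\<And>i. i \<in> I ==> g i \<in> S) ==> z \<in> S ==> ip z (sum g I) = (\<Sum>i\<in>I. ip z (g i))"
 by (induction I rule: infinite_finite_induct) (auto simp: ip_add_right)

lemma ip_self_real: "x \<in> S ==> ip x x = complex_of_real (Re (ip x x))"
 using ip_cnj[of x x] by (metis Reals_cnj_iff of_real_Re)

text \<open>The form is only semidefinite: forms on rational functions have null vectors, namely the functions that
 vanish outside a proper subvariety.\<close>

lemma ip_null:
 assumes x: "x \<in> S" and y: "y \<in> S" and 0: "ip x x = 0"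
 shows "ip x y = 0" "ip y x = 0"
proof -
 have False if nz: "ip x y \<noteq> 0"
 proof -
  define b where "b = ip x y"
  define r where "r = Re (ip y y)"
  have b: "b \<noteq> 0" using nz b_def by simp
  \<comment> \<open>this \<open>t\<close> gives \<open>z\<close> the squared length -1\<close>
  define t :: real where "t = - (r + 1) / (2 * (cmod b)\<^sup>2)"
  define z where "z = y + scale (of_real t * cnj b) x"
  have "ip z z = ip y y + complex_of_real t * cnj b * b + complex_of_real t * b * cnj b"
  proof -
   have yx: "ip y x = cnj b" using ip_cnj[OF x y] by (simp add: b_def)
   show ?thesis unfolding z_def using x y 0
    by (simp add: ip_add_left ip_add_right ip_scale_left ip_scale_right yx b_def[symmetric] algebra_simps)
  qed
  also have "... = ip y y + complex_of_real (2 * t * (cmod b)\<^sup>2)"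
   using complex_norm_square[of b] by (simp add: algebra_simps)
  finally have "Re (ip z z) = r + 2 * t * (cmod b)\<^sup>2" by (simp add: r_def)
  also have "... = -1" using b by (simp add: t_def field_simps)
  finally show False using ip_nonneg[of z] x y by (simp add: z_def)
 qed
 thus "ip x y = 0" by blast
 thus "ip y x = 0" using ip_cnj[OF x y] by simp
qed

text \<open>Gram-Schmidt for a semidefinite form: a vector of length zero is orthogonal to everything, so it is skipped.\<close>

lemma orthogonal_projection_exists:
 assumes "finite F" "F \<subseteq> S" "x \<in> S"
 shows "\<exists>a\<in>span F. \<forall>u\<in>span F. ip (x - a) u = 0" using assms
proof (induction F arbitrary: x)
 case empty
 thus ?case by (auto simp: span_empty)
next
 case (insert v F)
 have FS: "span F \<subseteq> S" using span_S insert.prems by auto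
 obtain a where a: "a \<in> span F" "\<And>u. u \<in> span F ==> ip (x - a) u = 0"
  using insert.IH[of x] insert.prems by auto
 obtain b where b: "b \<in> span F" "\<And>u. u \<in> span F ==> ip (v - b) u = 0"
  using insert.IH[of v] insert.prems by auto
 define w where "w = v - b"
 have inS: "w \<in> S" "a \<in> S" "b \<in> S" "x \<in> S" "v \<in> S" using a b FS insert.prems by (auto simp: w_def)
 define c where "c = (if ip w w = 0 then 0 else ip (x - a) w / ip w w)"
 define a' where "a' = a + scale c w"
 have vsp: "span F \<subseteq> span (insert v F)" by (simp add: span_mono subset_insertI)
 have "w \<in> span (insert v F)" unfolding w_def using b vsp by (meson in_mono insertI1 span_base span_diff)
 hence a'sp: "a' \<in> span (insert v F)" unfolding a'_def using a vsp by (meson in_mono span_add span_scale)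
 have orth_F: "ip (x - a') u = 0" if "u \<in> span F" for u
 proof -
  have uS: "u \<in> S" using that FS by blast
  have e: "x - a' = (x - a) - scale c w" by (simp add: a'_def)
  hence "ip (x - a') u = ip (x - a) u - c * ip w u"
   unfolding e using inS uS by (subst ip_diff_left) (auto simp: ip_scale_left)
  thus ?thesis using a(2) b(2) that by (simp add: w_def)
 qed
 have orth_w: "ip (x - a') w = 0"
 proof -
  have e: "x - a' = (x - a) - scale c w" by (simp add: a'_def)
  hence *: "ip (x - a') w = ip (x - a) w - c * ip w w"
   unfolding e using inS by (subst ip_diff_left) (auto simp: ip_scale_left)
  show ?thesis
  proof (cases "ip w w = 0")
   case True
   thus ?thesis using ip_null(2)[of w "x - a'"] inS by (simp add: a'_def)
  next
   case False
   thus ?thesis using * by (simp add: c_def)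
  qed
 qed
 have "ip (x - a') u = 0" if usp: "u \<in> span (insert v F)" for u
 proof -
  obtain k where k: "u - scale k v \<in> span F" using span_breakdown_eq[of u v F] usp by blast
  define f where "f = u - scale k v + scale k b"
  have f: "f \<in> span F" unfolding f_def using k b by (meson span_add span_scale)
  have "u = f + scale k w" by (simp add: f_def w_def scale_right_diff_distrib)
  moreover have "f \<in> S" "x - a' \<in> S" using f FS inS by (auto simp: a'_def)
  ultimately show ?thesis using orth_F[OF f] orth_w inS by (simp add: ip_add_right ip_scale_right)
 qed
 thus ?case using a'sp by blast
qed

definition orthonormal :: "'v set => bool" where
 "orthonormal E \<longleftrightarrow> finite E \<and> E \<subseteq> S \<and> (\<forall>x\<in>E. \<forall>y\<in>E. ip x y = (if x = y then 1 else 0))"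

lemma orthonormal_expansion:
 assumes "orthonormal E" "x \<in> span E"
 shows "x = (\<Sum>b\<in>E. scale (ip x b) b)"
proof -
 have fin: "finite E" and ES: "E \<subseteq> S" and on: "\<And>x y. x \<in> E ==> y \<in> E ==> ip x y = (if x = y then 1 else 0)"
  using assms by (auto simp: orthonormal_def)
 obtain u where u: "x = (\<Sum>b\<in>E. scale (u b) b)" using assms(2) fin by (auto simp: span_finite)
 have "ip x b = u b" if "b \<in> E" for b
 proof -
  have "ip x b = (\<Sum>b'\<in>E. u b' * ip b' b)"
   unfolding u using ES that by (subst ip_sum_left) (auto simp: ip_scale_left subset_eq)
  also have "... = (\<Sum>b'\<in>E. if b' = b then u b' else 0)" using on that by (intro sum.cong) auto
  finally show ?thesis using fin that by simp
 qed
 thus ?thesis using u by simp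
qed

lemma orthonormal_basis_exists:
 assumes pd: "\<And>x. x \<in> S ==> ip x x = 0 ==> x = 0" and "finite F" "F \<subseteq> S"
 shows "\<exists>E. orthonormal E \<and> span E = span F" using assms(2,3)
proof (induction F)
 case empty
 thus ?case by (intro exI[of _ "{}"]) (auto simp: orthonormal_def)
next
 case (insert v F)
 then obtain E where E: "orthonormal E" "span E = span F" by auto
 hence fin: "finite E" and ES: "E \<subseteq> S" by (auto simp: orthonormal_def)
 obtain a where a: "a \<in> span E" "\<And>u. u \<in> span E ==> ip (v - a) u = 0"
  using orthogonal_projection_exists[of E v] insert.prems fin ES by auto
 define w where "w = v - a"
 have vS: "v \<in> S" "a \<in> S" "w \<in> S" using insert.prems a span_S[OF ES] by (auto simp: w_def)
 have span_w: "span (insert w E) = span (insert v F)"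
 proof -
  have "span (insert w E) = span (insert v E)" using eq_span_insert_eq[of w v E] a(1) by (simp add: w_def span_neg)
  thus ?thesis using E(2) by (simp add: span_insert)
 qed
 show ?case
 proof (cases "w = 0")
  case True
  hence "v \<in> span E" using a by (simp add: w_def)
  hence "span (insert v F) = span E" using E(2) by (simp add: span_redundant)
  thus ?thesis using E by blast
 next
  case False
  define r where "r = sqrt (Re (ip w w))"
  have ne: "ip w w \<noteq> 0" using pd[OF vS(3)] False by blast
  hence "Re (ip w w) > 0" using ip_nonneg[OF vS(3)] ip_self_real[OF vS(3)] by (metis less_eq_real_def of_real_0)
  hence r: "r > 0" "complex_of_real r * complex_of_real r = ip w w"
   using ip_self_real[OF vS(3)] by (auto simp: r_def simp flip: of_real_mult)
  define z where "z = scale (1 / complex_of_real r) w"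
  have zS: "z \<in> S" using vS by (simp add: z_def)
  have zz: "ip z z = 1" using r ne vS by (simp add: z_def ip_scale_left ip_scale_right field_simps)
  have zE: "ip z u = 0" "ip u z = 0" if "u \<in> E" for u
  proof -
   have uS: "u \<in> S" using that ES by auto
   show "ip z u = 0" using a(2)[of u] that uS vS by (simp add: z_def w_def ip_scale_left span_base)
   thus "ip u z = 0" using ip_cnj[OF zS uS] by simp
  qed
  have "orthonormal (insert z E)" using E(1) zz zE zS by (auto simp: orthonormal_def)
  moreover have "span (insert z E) = span (insert w E)"
  proof (rule antisym)
   show "span (insert z E) \<subseteq> span (insert w E)"
    by (rule span_minimal) (auto simp: z_def intro: span_base span_scale)
   have "w = scale (of_real r) z" using r by (simp add: z_def)
   hence "w \<in> span (insert z E)" by (metis insertI1 span_base span_scale)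
   thus "span (insert w E) \<subseteq> span (insert z E)" by (intro span_minimal) (auto intro: span_base)
  qed
  ultimately show ?thesis using span_w by auto
 qed
qed

text \<open>The sum is the trace of the form \<open>B\<close> with respect to \<open>ip\<close>, hence independent of the orthonormal basis.\<close>

lemma sesquilinear_trace_unique:
 assumes E: "orthonormal E" and F: "orthonormal F" and EF: "span E = span F"
  and add_l: "\<And>x y z. x \<in> span E ==> y \<in> span E ==> z \<in> span E ==> B (x + y) z = B x z + B y z"
  and add_r: "\<And>x y z. x \<in> span E ==> y \<in> span E ==> z \<in> span E ==> B z (x + y) = B z x + B z y"
  and scale_l: "\<And>a x z. x \<in> span E ==> z \<in> span E ==> B (scale a x) z = a * B x z"
  and scale_r: "\<And>a x z. x \<in> span E ==> z \<in> span E ==> B z (scale a x) = cnj a * B z x"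
 shows "(\<Sum>b\<in>E. B b b) = (\<Sum>b\<in>F. B b b)"
proof -
 have fin: "finite E" "finite F" and ES: "E \<subseteq> S" and FS: "F \<subseteq> S" using E F by (auto simp: orthonormal_def)
 have zero: "B 0 z = 0" "B z 0 = 0" if "z \<in> span E" for z
  using scale_l[OF span_zero that, of 0] scale_r[OF span_zero that, of 0] by simp_all
 have sum_l: "B (\<Sum>b\<in>I. scale (g b) b) z = (\<Sum>b\<in>I. g b * B b z)"
  and sum_r: "B z (\<Sum>b\<in>I. scale (g b) b) = (\<Sum>b\<in>I. cnj (g b) * B z b)"
  if "finite I" "I \<subseteq> span E" "z \<in> span E" for I g z using that(1,2)
 proof (induction I)
  case (insert i I)
  have m: "I \<subseteq> span E ==> (\<Sum>b\<in>I. scale (g b) b) \<in> span E" by (intro span_sum span_scale) auto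
  case 1
  thus ?case using insert m that(3) by (simp add: add_l scale_l span_scale)
  case 2
  thus ?case using insert m that(3) by (simp add: add_r scale_r span_scale)
 qed (simp_all add: zero that)
 have Esp: "E \<subseteq> span E" and Fsp: "F \<subseteq> span E" using EF span_superset by auto
 have E_exp: "x = (\<Sum>b\<in>E. scale (ip x b) b)" and F_exp: "x = (\<Sum>b\<in>F. scale (ip x b) b)" if "x \<in> span E" for x
  using orthonormal_expansion[OF E that] orthonormal_expansion[OF F, of x] that EF by simp_all
 have "(\<Sum>b\<in>F. B b b) = (\<Sum>b\<in>F. \<Sum>x\<in>E. ip b x * B x b)"
 proof (rule sum.cong[OF refl])
  fix b assume b: "b \<in> F"
  hence "B b b = B (\<Sum>x\<in>E. scale (ip b x) x) b" using E_exp[of b] Fsp by auto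
  also have "... = (\<Sum>x\<in>E. ip b x * B x b)" using b Fsp by (intro sum_l fin Esp) auto
  finally show "B b b = (\<Sum>x\<in>E. ip b x * B x b)" .
 qed
 also have "... = (\<Sum>x\<in>E. \<Sum>b\<in>F. cnj (ip x b) * B x b)"
  using ES FS by (subst sum.swap) (intro sum.cong refl arg_cong2[of _ _ _ _ "(*)"] ip_cnj[symmetric], auto)
 also have "... = (\<Sum>x\<in>E. B x x)"
 proof (rule sum.cong[OF refl])
  fix x assume x: "x \<in> E"
  hence "B x x = B x (\<Sum>b\<in>F. scale (ip x b) b)" using F_exp[of x] Esp by auto
  also have "... = (\<Sum>b\<in>F. cnj (ip x b) * B x b)" using x Esp by (intro sum_r fin Fsp) auto
  finally show "(\<Sum>b\<in>F. cnj (ip x b) * B x b) = B x x" by simp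
 qed
 finally show ?thesis by simp
qed

end

section \<open>The trace form\<close>

locale fin_dim_complex_space = finite_dimensional_vector_space scale Basis
 for scale :: "complex => 'b::ab_group_add => 'b" and Basis :: "'b set"
begin

definition crd :: "'b => 'b => complex" where "crd b z = representation Basis z b"

lemma crd_add: "crd b (x + y) = crd b x + crd b y" by (simp add: crd_def independent_Basis representation_add span_Basis)

lemma crd_scale: "crd b (scale a x) = a * crd b x"
 by (simp add: crd_def independent_Basis representation_scale span_Basis)

lemma crd_zero: "crd b 0 = 0" by (simp add: crd_def independent_Basis representation_zero)

lemma crd_minus: "crd b (- x) = - crd b x" using crd_scale[of b "-1" x] by simp

lemma crd_diff: "crd b (x - y) = crd b x - crd b y" using crd_add[of b x "- y"] by (simp add: crd_minus)

lemmas crd_simps = crd_add crd_diff crd_minus crd_scale crd_zero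

lemma crd_sum: "crd b (sum g I) = (\<Sum>i\<in>I. crd b (g i))"
 by (induction I rule: infinite_finite_induct) (auto simp: crd_add crd_zero)

lemma crd_expansion: "(\<Sum>b\<in>Basis. scale (crd b z) b) = z" unfolding crd_def
 by (rule sum_representation_eq) (auto simp: independent_Basis span_Basis finite_Basis)

lemma linear_expansion:
 assumes "Vector_Spaces.linear scale s T"
 shows "T z = (\<Sum>b\<in>Basis. s (crd b z) (T b))"
proof -
 interpret T: Vector_Spaces.linear scale s T by fact
 have "T z = T (\<Sum>b\<in>Basis. scale (crd b z) b)" by (simp add: crd_expansion)
 thus ?thesis by (simp add: T.sum T.scale)
qed

lemma crd_linear: "Vector_Spaces.linear scale (*) (crd b)" by unfold_locales (auto simp: crd_add crd_scale algebra_simps)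

lemma crd_eqI: "(\<And>b. b \<in> Basis ==> crd b x = crd b y) ==> x = y"
 by (subst crd_expansion[of x, symmetric], subst crd_expansion[of y, symmetric]) (rule sum.cong, auto)

lemma lin_trace_crd: "lin_trace T = (\<Sum>b\<in>Basis. crd b (T b))" by (simp add: lin_trace_def crd_def)

lemma lin_trace_add: "lin_trace (\<lambda>z. S z + T z) = lin_trace S + lin_trace T"
 by (simp add: lin_trace_crd crd_add sum.distrib)

lemma lin_trace_scale: "lin_trace (\<lambda>z. scale a (T z)) = a * lin_trace T"
 by (simp add: lin_trace_crd crd_scale sum_distrib_left)

lemma lin_trace_sum: "lin_trace (\<lambda>z. \<Sum>i\<in>I. T i z) = (\<Sum>i\<in>I. lin_trace (T i))"
 by (simp add: lin_trace_crd crd_sum sum.swap[of _ I])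

lemma lin_trace_commute:
 assumes "endo scale S" "endo scale T"
 shows "lin_trace (\<lambda>z. S (T z)) = lin_trace (\<lambda>z. T (S z))"
proof -
 have e: "lin_trace (\<lambda>z. S (T z)) = (\<Sum>b\<in>Basis. \<Sum>b'\<in>Basis. crd b' (T b) * crd b (S b'))"
  if "endo scale S" for S T unfolding lin_trace_crd
  by (intro sum.cong refl) (subst linear_expansion[OF that], simp add: crd_sum crd_scale)
 show ?thesis unfolding e[OF assms(1)] e[OF assms(2)] by (subst sum.swap) (simp add: mult.commute)
qed

lemma lin_trace_rank_one:
 assumes "Vector_Spaces.linear scale (*) \<phi>"
 shows "lin_trace (\<lambda>z. scale (\<phi> z) u) = \<phi> u" using linear_expansion[OF assms, of u]
 by (simp add: lin_trace_crd crd_scale mult.commute)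

end

context hermitian_jordan_triple
begin

sublocale fin_dim_complex_space smul Basis ..

lemma tp_add_right: "tp u v (x + y) = tp u v x + tp u v y"
 using tp_linear_right[of u v] by (simp add: Vector_Spaces.linear_iff)

lemma tp_scale_right: "tp u v (smul a x) = smul a (tp u v x)"
 using tp_linear_right[of u v] by (simp add: Vector_Spaces.linear_iff)

lemma tp_add_left: "tp (x + y) v w = tp x v w + tp y v w" by (metis tp_add_right tp_commute)

lemma tp_scale_left: "tp (smul a x) v w = smul a (tp x v w)" by (metis tp_scale_right tp_commute)

lemma tp_zero [simp]: "tp 0 v w = 0" "tp u 0 w = 0" "tp u v 0 = 0"
 using tp_scale_left[of 0] tp_scale_middle[of _ 0] tp_scale_right[of _ _ 0] by auto

lemma tp_minus: "tp (- u) v w = - tp u v w" "tp u (- v) w = - tp u v w" "tp u v (- w) = - tp u v w"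
 using tp_scale_left[of "-1"] tp_scale_middle[of _ "-1"] tp_scale_right[of _ _ "-1"] by auto

lemma tp_diff_left: "tp (x - y) v w = tp x v w - tp y v w" using tp_add_left[of x "-y"] by (simp add: tp_minus)
lemma tp_diff_middle: "tp v (x - y) w = tp v x w - tp v y w" using tp_add_middle[of v x "-y"] by (simp add: tp_minus)
lemma tp_diff_right: "tp v w (x - y) = tp v w x - tp v w y" using tp_add_right[of v w x "-y"] by (simp add: tp_minus)

lemmas tp_simps = tp_add_left tp_add_middle tp_add_right tp_scale_left tp_scale_middle tp_scale_right
 tp_diff_left tp_diff_middle tp_diff_right tp_minus

lemma tp_sum_left: "tp (sum g I) v w = (\<Sum>i\<in>I. tp (g i) v w)"
 by (induction I rule: infinite_finite_induct) (auto simp: tp_simps)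
lemma tp_sum_middle: "tp v (sum g I) w = (\<Sum>i\<in>I. tp v (g i) w)"
 by (induction I rule: infinite_finite_induct) (auto simp: tp_simps)
lemma tp_sum_right: "tp v w (sum g I) = (\<Sum>i\<in>I. tp v w (g i))"
 by (induction I rule: infinite_finite_induct) (auto simp: tp_simps)

definition form :: "'a => 'a => complex" where "form x y = lin_trace (tp x y)"

lemma tp_fun_add: "tp (x + y) v = (\<lambda>w. tp x v w + tp y v w)"
 and tp_fun_scale: "tp (smul a x) v = (\<lambda>w. smul a (tp x v w))" by (auto simp: tp_simps)

sublocale herm: hermitian_form smul UNIV form
proof
 show "Re (form x x) \<ge> 0" for x
  using trace_form_pos_def[of x] by (cases "x = 0") (auto simp: form_def lin_trace_crd crd_zero)
 show "cnj (form x y) = form y x" for x y using trace_form_hermitian[of y x] by (simp add: form_def)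
qed (auto simp: form_def tp_fun_add tp_fun_scale lin_trace_add lin_trace_scale)

lemmas form_simps = herm.ip_add_left[OF UNIV_I UNIV_I UNIV_I] herm.ip_add_right[OF UNIV_I UNIV_I UNIV_I]
 herm.ip_diff_left[OF UNIV_I UNIV_I UNIV_I] herm.ip_diff_right[OF UNIV_I UNIV_I UNIV_I]
 herm.ip_scale_left[OF UNIV_I UNIV_I] herm.ip_scale_right[OF UNIV_I UNIV_I]

lemma form_cnj: "cnj (form x y) = form y x" using herm.ip_cnj by simp
lemma form_zero [simp]: "form 0 x = 0" "form x 0 = 0" by simp_all
lemma form_nonneg: "Re (form x x) \<ge> 0" by (simp add: herm.ip_nonneg)
lemma form_real: "form x x = complex_of_real (Re (form x x))" by (rule herm.ip_self_real[OF UNIV_I])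

lemma form_definite: "form x x = 0 \<longleftrightarrow> x = 0"
 using trace_form_pos_def[of x] by (cases "x = 0") (auto simp: form_def lin_trace_crd crd_zero simp del: Re_sum)

lemma form_pos: "x \<noteq> 0 ==> Re (form x x) > 0" using trace_form_pos_def[of x] by (simp add: form_def)

lemma form_eqI: "(\<And>y. form x y = form x' y) ==> x = x'" using form_definite[of "x - x'"] by (simp add: form_simps)

text \<open>The trace of a commutator vanishes, so the Jordan identity makes \<open>tp v u\<close> the adjoint of \<open>tp u v\<close>.\<close>

lemma form_adjoint: "form (tp u v x) y = form x (tp v u y)"
proof -
 have "lin_trace (tp (tp u v x) y) = lin_trace (\<lambda>w. (tp u v (tp x y w) - tp x y (tp u v w)) + tp x (tp y u v) w)"
  by (rule arg_cong[where f = lin_trace], rule ext) (simp add: jordan_identity)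
 also have "... = lin_trace (\<lambda>w. tp u v (tp x y w)) - lin_trace (\<lambda>w. tp x y (tp u v w)) + lin_trace (tp x (tp y u v))"
 proof -
  have "lin_trace (\<lambda>w. S w - T w) = lin_trace S - lin_trace T" for S T :: "'a => 'a"
   using lin_trace_add[of S "\<lambda>w. smul (-1) (T w)"] lin_trace_scale[of "-1" T] by simp
  thus ?thesis by (simp add: lin_trace_add)
 qed
 also have "... = lin_trace (tp x (tp y u v))"
  using lin_trace_commute[OF tp_linear_right[of u v] tp_linear_right[of x y]] by simp
 finally show ?thesis by (simp add: form_def tp_commute[of y])
qed

lemma orthonormal_basis_UNIV: "\<exists>E. herm.orthonormal E \<and> span E = UNIV"
proof -
 have "\<exists>E. herm.orthonormal E \<and> span E = span Basis"
  by (rule herm.orthonormal_basis_exists) (auto simp: form_definite finite_Basis)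
 thus ?thesis by (simp add: span_Basis)
qed

lemma linear_form_left: "Vector_Spaces.linear smul (*) (\<lambda>z. form z b)"
 by unfold_locales (auto simp: form_simps algebra_simps)

lemma lin_trace_orthonormal:
 assumes "endo smul T" "herm.orthonormal E" "span E = UNIV"
 shows "lin_trace T = (\<Sum>b\<in>E. form (T b) b)"
proof -
 interpret T: Vector_Spaces.linear smul smul T by fact
 have "T z = (\<Sum>b\<in>E. smul (form z b) (T b))" for z
 proof -
  have "T z = T (\<Sum>b\<in>E. smul (form z b) b)" using herm.orthonormal_expansion[OF assms(2), of z] assms(3) by simp
  thus ?thesis by (simp add: T.sum T.scale)
 qed
 hence "T = (\<lambda>z. \<Sum>b\<in>E. smul (form z b) (T b))" by blast
 hence "lin_trace T = lin_trace (\<lambda>z. \<Sum>b\<in>E. smul (form z b) (T b))" by simp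
 also have "... = (\<Sum>b\<in>E. form (T b) b)" by (simp add: lin_trace_sum lin_trace_rank_one[OF linear_form_left])
 finally show ?thesis .
qed

section \<open>Identities in a Jordan triple\<close>

lemma triple_eq_zero: "x + x + x = 0 ==> x = (0::'a)"
proof -
 assume "x + x + x = 0"
 hence "smul 3 x = 0" using scale_left_distrib[of 2 1 x] scale_left_distrib[of 1 1 x] by simp
 thus ?thesis by simp
qed

lemma double_eq: "x + x = smul 2 x" using scale_left_distrib[of 1 1 x] by simp

text \<open>The Jordan identity, with \<open>y\<close> and \<open>z\<close> in both orders, says that \<open>a - b = b - c\<close> and \<open>b - a = a - c\<close> for the
 three terms \<open>a\<close>, \<open>b\<close>, \<open>c\<close>. Hence \<open>3 (a - b) = 0\<close>.\<close>

lemma tp_homotope: "tp x y (tp x z x) = tp x z (tp x y x)" "tp x y (tp x z x) = tp x (tp y x z) x"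
proof -
 define a b c where "a = tp x y (tp x z x)" and "b = tp x z (tp x y x)" and "c = tp x (tp y x z) x"
 have 1: "a - b = b - c"
  using jordan_identity[of x y x z x] by (simp add: a_def b_def c_def tp_commute[of "tp x y x"] tp_commute[of z])
 have 2: "b - a = a - c" using jordan_identity[of x z x y x] by (simp add: a_def b_def c_def tp_commute[of "tp x z x"])
 have "a - c = (a - b) + (b - c)" by simp
 hence "b - a = (a - b) + (a - b)" using 1 2 by simp
 hence "(a - b) + (a - b) + (a - b) = (b - a) + (a - b)" by simp
 hence "(a - b) + (a - b) + (a - b) = 0" by simp
 hence "a = b" using triple_eq_zero[of "a - b"] by simp
 moreover have "a = c" using 1 calculation by simp
 ultimately show "tp x y (tp x z x) = tp x z (tp x y x)" "tp x y (tp x z x) = tp x (tp y x z) x"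
  by (auto simp: a_def b_def c_def)
qed

text \<open>The commutators of \<open>D(x, y)\<close>, \<open>D(x, w)\<close> in the two orders cancel; expanding both by the Jordan identity
 gives the formula.\<close>

lemma tp_shift: "tp (tp x y x) w z + tp (tp x w x) y z = smul 2 (tp x (tp w x y) z)"
proof -
 have "(tp (tp x y x) w z - tp x (tp w x y) z) + (tp (tp x w x) y z - tp x (tp y x w) z) = 0"
  unfolding jordan_identity[of x y x w z, symmetric] jordan_identity[of x w x y z, symmetric] by simp
 thus ?thesis by (simp add: tp_commute[of y] double_eq[symmetric] algebra_simps eq_neg_iff_add_eq_0)
qed

text \<open>An element whose cube is a multiple \<open>m x\<close> is a tripotent up to scaling once \<open>m > 0\<close>. The next identities
 express \<open>Q_x\<^sup>2\<close> by \<open>L = D(x, x)\<close> and lead to a cubic equation for \<open>L\<close>, the source of the Peirce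
 decomposition.\<close>

lemma cube_quad_quad:
 assumes "tp x x x = smul m x"
 shows "tp x (tp x w x) x = smul 2 (tp x x (tp x x w)) - smul m (tp x x w)" using jordan_identity[of w x x x x] assms
 by (simp add: tp_simps tp_commute[of w] tp_commute[of "tp x x w"] double_eq[symmetric] algebra_simps)

lemma cube_quad_eigen:
 assumes "tp x x x = smul m x"
 shows "tp x x (tp x w x) = smul m (tp x w x)" "tp x (tp x x w) x = smul m (tp x w x)"
proof -
 have "tp x x (tp x w x) + tp x x (tp x w x) = smul m (tp x w x) + smul m (tp x w x)"
  using jordan_identity[of x x x w x] assms tp_homotope(2)[of x x w]
  by (simp add: tp_simps tp_commute[of w] algebra_simps)
 hence "smul 2 (tp x x (tp x w x)) = smul 2 (smul m (tp x w x))" by (simp only: double_eq)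
 thus "tp x x (tp x w x) = smul m (tp x w x)" by (metis scale_left_imp_eq zero_neq_numeral)
 thus "tp x (tp x x w) x = smul m (tp x w x)" using tp_homotope(2)[of x x w] by simp
qed

lemma cube_cubic:
 assumes "tp x x x = smul m x"
 shows "smul 2 (tp x x (tp x x (tp x x w))) - smul (3 * m) (tp x x (tp x x w)) + smul (m\<^sup>2) (tp x x w) = 0"
proof -
 have "tp x x (tp x (tp x w x) x) = smul m (tp x (tp x w x) x)" by (rule cube_quad_eigen[OF assms])
 hence "smul 2 (tp x x (tp x x (tp x x w))) - smul m (tp x x (tp x x w)) =
   smul m (smul 2 (tp x x (tp x x w)) - smul m (tp x x w))" unfolding cube_quad_quad[OF assms] by (simp add: tp_simps)
 hence "smul 2 (tp x x (tp x x (tp x x w))) - smul m (tp x x (tp x x w)) -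
   smul (2 * m) (tp x x (tp x x w)) + smul (m\<^sup>2) (tp x x w) = 0"
  by (simp add: scale_right_diff_distrib power2_eq_square mult.commute)
 moreover have "smul (3 * m) v = smul m v + smul (2 * m) v" for v by (simp add: scale_left_distrib[symmetric])
 ultimately show ?thesis by (simp add: algebra_simps)
qed

text \<open>Since \<open>tp x x\<close> is annihilated by \<open>L (2 L - m) (L - m)\<close>, the form \<open>m (L w | w)\<close> is a sum of squares;
 comparing with the trace of \<open>L\<close>, which is \<open>(x | x)\<close>, shows that \<open>m\<close> is positive.\<close>

lemma cube_positive:
 assumes cube: "tp x x x = smul (of_real m) x" and x: "x \<noteq> 0"
 shows "m > 0"
proof (rule ccontr)
 assume "\<not> m > 0"
 hence m: "m \<le> 0" by simp
 obtain E where E: "herm.orthonormal E" "span E = UNIV" using orthonormal_basis_UNIV by blast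
 have "Re (form (tp x x w) w) \<le> 0" for w
 proof -
  define L where "L = tp x x"
  have adj: "form (L u) v = form u (L v)" for u v by (simp add: L_def form_adjoint)
  define \<alpha> \<beta> \<gamma> \<delta> where "\<alpha> = form (L w) w" and "\<beta> = form (L w) (L w)"
   and "\<gamma> = form (L (L w)) (L w)" and "\<delta> = form (L (L w)) (L (L w))"
  let ?m = "complex_of_real m"
  have cub: "form (smul 2 (L (L (L w))) - smul (3 * ?m) (L (L w)) + smul (?m\<^sup>2) (L w)) v = 0" for v
   using cube_cubic[OF cube, of w] by (simp add: L_def)
  have e1: "2 * \<gamma> - 3 * ?m * \<beta> + ?m\<^sup>2 * \<alpha> = 0"
   using cub[of w] by (simp add: form_simps adj \<alpha>_def \<beta>_def \<gamma>_def)
  have e2: "2 * \<delta> - 3 * ?m * \<gamma> + ?m\<^sup>2 * \<beta> = 0"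
   using cub[of "L w"] by (simp add: form_simps adj \<delta>_def \<beta>_def \<gamma>_def)
  have r: "Re (2 * \<gamma> - 3 * ?m * \<beta> + ?m\<^sup>2 * \<alpha>) = 0" "Re (2 * \<delta> - 3 * ?m * \<gamma> + ?m\<^sup>2 * \<beta>) = 0"
   using e1 e2 by simp_all
  hence r: "2 * Re \<gamma> - 3 * m * Re \<beta> + m\<^sup>2 * Re \<alpha> = 0" "2 * Re \<delta> - 3 * m * Re \<gamma> + m\<^sup>2 * Re \<beta> = 0"
   by (simp_all flip: of_real_power)
  have \<beta>: "Re \<beta> \<ge> 0" and \<delta>: "Re \<delta> \<ge> 0" by (auto simp: \<beta>_def \<delta>_def form_nonneg)
  show ?thesis
  proof (cases "m = 0")
   case True
   hence "Re \<delta> = 0" using r by simp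
   hence "L (L w) = 0" using form_pos[of "L (L w)"] by (force simp: \<delta>_def)
   hence "\<beta> = 0" by (simp add: \<beta>_def adj)
   hence "L w = 0" by (simp add: \<beta>_def form_definite)
   thus ?thesis by (simp add: L_def)
  next
   case False
   hence m: "m < 0" using m by simp
   have "Re (form (smul ?m (L w) - L (L w)) (smul ?m (L w) - L (L w))) \<ge> 0" by (rule form_nonneg)
   moreover have "form (L w) (L (L w)) = \<gamma>" by (simp add: \<gamma>_def adj)
   ultimately have pos: "m\<^sup>2 * Re \<beta> - 2 * m * Re \<gamma> + Re \<delta> \<ge> 0"
    by (simp add: form_simps \<beta>_def[symmetric] \<gamma>_def[symmetric] \<delta>_def[symmetric] power2_eq_square algebra_simps)
   have "m * (m\<^sup>2 * Re \<alpha>) = m\<^sup>2 * Re \<beta> + 4 * (m\<^sup>2 * Re \<beta> - 2 * m * Re \<gamma> + Re \<delta>)"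
   proof -
    have "m * (m\<^sup>2 * Re \<alpha>) = 3 * m\<^sup>2 * Re \<beta> - 2 * m * Re \<gamma>"
     using arg_cong[OF r(1), of "\<lambda>t. m * t"] by (simp add: algebra_simps power2_eq_square)
    thus ?thesis using r(2) by (simp add: algebra_simps)
   qed
   moreover have "m\<^sup>2 * Re \<beta> \<ge> 0" using \<beta> by simp
   moreover have "4 * (m\<^sup>2 * Re \<beta> - 2 * m * Re \<gamma> + Re \<delta>) \<ge> 0" using pos by simp
   ultimately have "m * (m\<^sup>2 * Re \<alpha>) \<ge> 0" by (simp only: add_nonneg_nonneg)
   hence "m\<^sup>2 * Re \<alpha> \<le> 0" using m by (simp add: zero_le_mult_iff)
   moreover have "m\<^sup>2 > 0" using m by simp
   ultimately have "Re \<alpha> \<le> 0" by (metis linorder_not_le mult_pos_pos)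
   thus ?thesis by (simp add: \<alpha>_def L_def)
  qed
 qed
 hence "Re (lin_trace (tp x x)) \<le> 0" using lin_trace_orthonormal[OF tp_linear_right E] by (simp add: sum_nonpos)
 thus False using trace_form_pos_def[OF x] by simp
qed

lemma cube_zero_imp_zero: "tp x x x = 0 ==> x = 0" using cube_positive[of x 0] by auto

end

section \<open>Peirce decomposition\<close>

context hermitian_jordan_triple
begin

lemma tripotent_iff: "tripotent c \<longleftrightarrow> tp c c c = smul 2 c"
proof -
 have "smul (1/2) (tp c c c) = c \<longleftrightarrow> tp c c c = smul 2 c"
 proof
  assume "smul (1/2) (tp c c c) = c"
  hence "smul 2 (smul (1/2) (tp c c c)) = smul 2 c" by simp
  thus "tp c c c = smul 2 c" by simp
 qed simp
 thus ?thesis by (simp add: tripotent_def quad_def)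
qed

definition peirce :: "'a => int => 'a set" where
 "peirce c k = {w. tp c c w = smul (of_int k) w}"

lemma peirce_subspace: "subspace (peirce c k)"
 by (auto simp: peirce_def subspace_def tp_simps scale_right_distrib mult.commute)

lemmas peirce_closed = subspace_add[OF peirce_subspace] subspace_diff[OF peirce_subspace]
 subspace_scale[OF peirce_subspace] subspace_0[OF peirce_subspace] subspace_sum[OF peirce_subspace]

lemma peirce_mult:
 assumes "x \<in> peirce c i" "y \<in> peirce c j" "z \<in> peirce c k"
 shows "tp x y z \<in> peirce c (i - j + k)"
proof -
 have "tp c c (tp x y z) = tp (tp c c x) y z - tp x (tp c c y) z + tp x y (tp c c z)"
  using jordan_identity[of c c x y z] by (simp add: tp_commute[of y] algebra_simps)
 also have "... = smul (of_int (i - j + k)) (tp x y z)"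
  using assms by (simp add: peirce_def tp_simps scale_left_distrib scale_left_diff_distrib algebra_simps)
 finally show ?thesis by (simp add: peirce_def)
qed

lemma tripotent_cubic:
 assumes "tripotent c"
 shows "tp c c (tp c c (tp c c w)) = smul 3 (tp c c (tp c c w)) - smul 2 (tp c c w)"
proof -
 have "tp c c c = smul 2 c" using assms by (simp add: tripotent_iff)
 from cube_cubic[OF this, of w]
 have *: "smul 2 (tp c c (tp c c (tp c c w))) - smul 6 (tp c c (tp c c w)) + smul 4 (tp c c w) = 0" by simp
 have "smul (1/2) (smul 2 (tp c c (tp c c (tp c c w))) - smul 6 (tp c c (tp c c w)) + smul 4 (tp c c w)) = 0"
  unfolding * by simp
 thus ?thesis by (simp add: scale_right_distrib scale_right_diff_distrib algebra_simps)
qed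

lemma peirce_trivial:
 assumes "tripotent c" "w \<in> peirce c k" "k \<notin> {0, 1, 2}"
 shows "w = 0"
proof -
 have "tp c c (tp c c (tp c c w)) = smul 3 (tp c c (tp c c w)) - smul 2 (tp c c w)"
  by (rule tripotent_cubic[OF assms(1)])
 hence "smul (of_int (k * k * k - (3 * k * k - 2 * k))) w = 0"
  using assms(2) by (simp add: peirce_def tp_simps scale_left_diff_distrib mult.assoc)
 moreover have "k * k * k - (3 * k * k - 2 * k) = k * (k - 1) * (k - 2)" by (simp add: algebra_simps)
 ultimately show ?thesis using assms(3) by auto
qed

text \<open>The Lagrange polynomials for the eigenvalues 0, 1, 2, evaluated at \<open>D(c, c)\<close>.\<close>

definition P0 where "P0 c w = w - smul (3/2) (tp c c w) + smul (1/2) (tp c c (tp c c w))"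
definition P1 where "P1 c w = smul 2 (tp c c w) - tp c c (tp c c w)"
definition P2 where "P2 c w = smul (1/2) (tp c c (tp c c w)) - smul (1/2) (tp c c w)"

lemma P_sum: "P0 c w + P1 c w + P2 c w = w"
proof -
 have "smul (3/2) v = smul (1/2) v + v" for v using scale_left_distrib[of "1/2" 1 v] by simp
 moreover have "smul (1/2) v + smul (1/2) v = v" for v using scale_left_distrib[of "1/2" "1/2" v] by simp
 moreover have "smul 2 v = v + v" for v by (simp add: double_eq)
 ultimately show ?thesis unfolding P0_def P1_def P2_def by (simp add: algebra_simps)
qed

lemma P_in:
 assumes "tripotent c"
 shows "P0 c w \<in> peirce c 0" "P1 c w \<in> peirce c 1" "P2 c w \<in> peirce c 2"
proof -
 note c = tripotent_cubic[OF assms]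
 show "P0 c w \<in> peirce c 0" "P1 c w \<in> peirce c 1" "P2 c w \<in> peirce c 2"
  by (simp_all add: peirce_def P0_def P1_def P2_def tp_simps c)
    (rule crd_eqI, simp add: crd_simps field_simps)+
qed

lemma P_linear: "endo smul (P0 c)" "endo smul (P1 c)"
 "endo smul (P2 c)" by (auto simp: Vector_Spaces.linear_iff vector_space_axioms P0_def P1_def P2_def tp_simps
   scale_right_distrib scale_right_diff_distrib algebra_simps)

lemma P_eq:
 assumes "tripotent c"
 shows "w \<in> peirce c 0 ==> P0 c w = w \<and> P1 c w = 0 \<and> P2 c w = 0"
  "w \<in> peirce c 1 ==> P0 c w = 0 \<and> P1 c w = w \<and> P2 c w = 0"
  "w \<in> peirce c 2 ==> P0 c w = 0 \<and> P1 c w = 0 \<and> P2 c w = w"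
proof -
 show 0: "w \<in> peirce c 0 ==> P0 c w = w \<and> P1 c w = 0 \<and> P2 c w = 0"
  by (simp add: peirce_def P0_def P1_def P2_def)
 show 1: "w \<in> peirce c 1 ==> P0 c w = 0 \<and> P1 c w = w \<and> P2 c w = 0"
 proof -
  assume "w \<in> peirce c 1"
  hence "P2 c w = 0" "P1 c w = w" by (auto simp: peirce_def P1_def P2_def double_eq[symmetric])
  thus ?thesis using P_sum[of c w] by simp
 qed
 show 2: "w \<in> peirce c 2 ==> P0 c w = 0 \<and> P1 c w = 0 \<and> P2 c w = w"
 proof -
  assume w: "w \<in> peirce c 2"
  hence "P1 c w = 0" by (simp add: peirce_def P1_def tp_simps)
  moreover have "P2 c w = w" using w scale_left_diff_distrib[of 2 1 w] by (simp add: peirce_def P2_def tp_simps)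
  ultimately show ?thesis using P_sum[of c w] by simp
 qed
qed

lemma peirce_2I: "tp c c w = smul 2 w ==> w \<in> peirce c 2" by (simp add: peirce_def)
lemma peirce_1I: "tp c c w = w ==> w \<in> peirce c 1" by (simp add: peirce_def)
lemma peirce_0_iff: "w \<in> peirce c 0 \<longleftrightarrow> tp c c w = 0" by (simp add: peirce_def)
lemma tripotent_in_peirce_2: "tripotent c ==> c \<in> peirce c 2" by (simp add: tripotent_iff peirce_2I)

lemma quad_quad:
 assumes "tripotent c"
 shows "quad c (quad c w) = P2 c w"
proof -
 have "tp c c c = smul 2 c" using assms by (simp add: tripotent_iff)
 from cube_quad_quad[OF this, of w] show ?thesis by (simp add: quad_def P2_def tp_simps scale_right_diff_distrib)
qed

lemma quad_linearity: "quad c (x + y) = quad c x + quad c y" "quad c (smul a x) = smul (cnj a) (quad c x)"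
 by (auto simp: quad_def tp_simps scale_right_distrib mult.commute)

lemma quad_in_peirce: "tripotent c ==> quad c w \<in> peirce c 2"
 using cube_quad_eigen(1)[of c 2 w] by (simp add: tripotent_iff peirce_def quad_def tp_simps)

lemma peirce_2_iff_quad: "tripotent c ==> w \<in> peirce c 2 \<longleftrightarrow> quad c (quad c w) = w"
 by (metis P_eq(3) quad_quad quad_in_peirce)

lemma quad_peirce_01:
 assumes "tripotent c" "w \<in> peirce c 0 \<or> w \<in> peirce c 1"
 shows "tp c w c = 0"
proof -
 have "tp c w c \<in> peirce c 4 \<or> tp c w c \<in> peirce c 3"
  using assms peirce_mult[of c c 2 w _ c 2] tripotent_in_peirce_2[OF assms(1)] by fastforce
 thus ?thesis using peirce_trivial[OF assms(1)] by fastforce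
qed

text \<open>The shifting identity relates \<open>D({c; c; c}, y) = 2 D(c, y)\<close> to terms with \<open>{c; y; c}\<close>, which vanishes by its
 Peirce degree, and \<open>{c; c; y} = 0\<close>. The second order of the arguments follows by taking adjoints.\<close>

lemma tp_tripotent_peirce_0:
 assumes "tripotent c" "y \<in> peirce c 0"
 shows "tp c y z = 0" "tp y c z = 0"
proof -
 have c: "tp c y c = 0" "tp c c c = smul 2 c" "tp y c c = 0"
  using quad_peirce_01 assms by (auto simp: tripotent_iff peirce_0_iff tp_commute[of y])
 have 0: "tp c y z = 0" for z using tp_shift[of c c y z] by (simp add: c tp_simps)
 thus "tp c y z = 0" .
 show "tp y c z = 0" by (rule form_eqI) (simp add: form_adjoint 0)
qed

lemma peirce_2_0_orthogonal:
 assumes c: "tripotent c" and x: "x \<in> peirce c 2" and y: "y \<in> peirce c 0"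
 shows "tp x y z = 0" "tp y x z = 0"
proof -
 define x' where "x' = quad c x"
 have "quad c (quad c x) = x" using x c by (simp add: peirce_2_iff_quad)
 hence "smul 2 (quad c (quad c x)) = smul 2 x" by simp
 hence "tp c x' c = smul 2 x" by (simp add: x'_def quad_def)
 moreover have "tp y c x' = 0" by (rule tp_tripotent_peirce_0(2)[OF c y])
 moreover have "tp c y c = 0" using quad_peirce_01[OF c] y by blast
 ultimately have "smul 2 (tp x y z) = 0" for z using tp_shift[of c x' y z] by (simp add: tp_simps)
 hence 0: "tp x y z = 0" for z by simp
 thus "tp x y z = 0" .
 show "tp y x z = 0" by (rule form_eqI) (simp add: form_adjoint 0)
qed

lemma orthogonal_tripotentsI:
 assumes "tripotent c" "tripotent d" "tp c c d = 0"
 shows "orthogonal_tripotents c d" "orthogonal_tripotents d c" using assms tp_tripotent_peirce_0[of c d]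
 by (auto simp: orthogonal_tripotents_def peirce_0_iff)

lemma orthogonal_tripotentsD:
 assumes "orthogonal_tripotents c d"
 shows "tp c d w = 0" "tp d c w = 0" "d \<in> peirce c 0" "c \<in> peirce d 0" "tripotent c" "tripotent d"
proof -
 show 1: "tp c d w = 0" for w using assms by (simp add: orthogonal_tripotents_def)
 show 2: "tp d c w = 0" for w by (rule form_eqI) (simp add: form_adjoint 1)
 show "d \<in> peirce c 0" using 2[of c] tp_commute[of d c c] by (simp add: peirce_0_iff)
 show "c \<in> peirce d 0" using 1[of d] tp_commute[of c d d] by (simp add: peirce_0_iff)
 show "tripotent c" "tripotent d" using assms by (auto simp: orthogonal_tripotents_def)
qed

lemma orthogonal_peirce_2_subset:
 assumes "orthogonal_tripotents c d" "x \<in> peirce c 2"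
 shows "x \<in> peirce d 0"
proof -
 note o = orthogonal_tripotentsD[OF assms(1)]
 have *: "tp c w c \<in> peirce d (- j)" if "w \<in> peirce d j" for w j using peirce_mult[OF o(4) that o(4)] by simp
 define w where "w = quad c x"
 have "tp c (P1 d w) c = 0" "tp c (P2 d w) c = 0"
  using *[OF P_in(2)[OF o(6), of w]] *[OF P_in(3)[OF o(6), of w]] peirce_trivial[OF o(6)] by fastforce+
 moreover have "tp c w c = tp c (P0 d w) c + tp c (P1 d w) c + tp c (P2 d w) c" by (simp flip: tp_add_middle add: P_sum)
 ultimately have "tp c w c = tp c (P0 d w) c" by simp
 hence "tp c w c \<in> peirce d 0" using *[OF P_in(1)[OF o(6), of w]] by simp
 moreover have "x = smul (1/2) (tp c w c)" using assms(2) o(5) by (simp add: w_def peirce_2_iff_quad quad_def)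
 ultimately show ?thesis by (metis peirce_closed(3))
qed

lemma tripotent_add:
 assumes "orthogonal_tripotents c d"
 shows "tripotent (c + d)" "tp (c + d) (c + d) w = tp c c w + tp d d w"
proof -
 note o = orthogonal_tripotentsD[OF assms]
 show e: "tp (c + d) (c + d) w = tp c c w + tp d d w" for w by (simp add: tp_simps o)
 show "tripotent (c + d)" using o(3-6) unfolding tripotent_iff e by (simp add: tp_simps peirce_0_iff scale_right_distrib)
qed

text \<open>Multiplication by \<open>s^k\<close> on the Peirce \<open>k\<close>-space. As \<open>{Z_i; Z_j; Z_k}\<close> lies in \<open>Z_{i-j+k}\<close>, it respects the
 triple product if the middle argument is scaled by the inverse of the conjugate of \<open>s\<close>; for unimodular \<open>s\<close>
 it is an automorphism.\<close>

definition peirce_scaling :: "'a => complex => 'a => 'a" where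
 "peirce_scaling c s w = P0 c w + smul s (P1 c w) + smul (s\<^sup>2) (P2 c w)"

lemma peirce_scaling_linear: "endo smul (peirce_scaling c s)" using P_linear[of c]
 by (auto simp: Vector_Spaces.linear_iff vector_space_axioms peirce_scaling_def
   scale_right_distrib algebra_simps)

lemma peirce_scaling_eigen:
 assumes "tripotent c" "w \<in> peirce c k"
 shows "peirce_scaling c s w = smul (s ^ nat k) w"
proof (cases "k \<in> {0, 1, 2}")
 case True
 thus ?thesis using P_eq[OF assms(1), of w] assms(2) by (auto simp: peirce_scaling_def)
next
 case False
 hence "w = 0" using peirce_trivial[OF assms] by blast
 thus ?thesis by (simp add: peirce_scaling_def P0_def P1_def P2_def)
qed

lemma linear_addD: "endo smul T ==> T (x + y) = T x + T y"
 and linear_scaleD: "endo smul T ==> T (smul a x) = smul a (T x)" by (auto simp: Vector_Spaces.linear_iff)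

lemma peirce_induct [consumes 1, case_names eigen add]:
 assumes "tripotent c" "\<And>k w. w \<in> peirce c k ==> k \<in> {0, 1, 2} ==> Q w"
  and "\<And>x y. Q x ==> Q y ==> Q (x + y)"
 shows "Q w"
proof -
 have "Q (P0 c w + P1 c w + P2 c w)"
  using assms(2)[OF P_in(1)[OF assms(1)]] assms(2)[OF P_in(2)[OF assms(1)]] assms(2)[OF P_in(3)[OF assms(1)]]
  by (intro assms(3)) auto
 thus ?thesis by (simp add: P_sum)
qed

lemma peirce_scaling_tp:
 assumes c: "tripotent c" and st: "s * cnj t = 1"
 shows "tp (peirce_scaling c s x) (peirce_scaling c t y) (peirce_scaling c s z) = peirce_scaling c s (tp x y z)"
proof -
 note add = linear_addD[OF peirce_scaling_linear]
 have "tp (peirce_scaling c s x) (peirce_scaling c t y) (peirce_scaling c s z) = peirce_scaling c s (tp x y z)"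
  if x: "x \<in> peirce c i" "i \<in> {0,1,2}" and y: "y \<in> peirce c j" "j \<in> {0,1,2}"
   and z: "z \<in> peirce c k" "k \<in> {0,1,2}" for i j k x y z
 proof -
  have m: "tp x y z \<in> peirce c (i - j + k)" by (rule peirce_mult[OF x(1) y(1) z(1)])
  have "tp (peirce_scaling c s x) (peirce_scaling c t y) (peirce_scaling c s z)
   = smul (s ^ nat i * cnj t ^ nat j * s ^ nat k) (tp x y z)"
   unfolding peirce_scaling_eigen[OF c x(1)] peirce_scaling_eigen[OF c y(1)] peirce_scaling_eigen[OF c z(1)]
   by (simp add: tp_simps mult_ac)
  also have "... = smul (s ^ nat (i - j + k)) (tp x y z)"
  proof (cases "i - j + k \<ge> 0")
   case True
   hence "nat i + nat k = nat j + nat (i - j + k)" using x(2) y(2) z(2) by auto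
   hence "s ^ nat i * s ^ nat k = s ^ nat j * s ^ nat (i - j + k)" by (metis power_add)
   hence "s ^ nat i * cnj t ^ nat j * s ^ nat k = (s * cnj t) ^ nat j * s ^ nat (i - j + k)"
    by (simp add: power_mult_distrib mult_ac)
   thus ?thesis by (simp add: st)
  next
   case False
   hence "tp x y z = 0" using peirce_trivial[OF c m] by auto
   thus ?thesis by simp
  qed
  also have "... = peirce_scaling c s (tp x y z)" using peirce_scaling_eigen[OF c m] by simp
  finally show ?thesis .
 qed
 note hom = this
 have z: "tp (peirce_scaling c s x) (peirce_scaling c t y) (peirce_scaling c s z) = peirce_scaling c s (tp x y z)"
  if "x \<in> peirce c i" "i \<in> {0,1,2}" "y \<in> peirce c j" "j \<in> {0,1,2}" for i j x y z using c
 proof (induction z rule: peirce_induct)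
  case (eigen k w)
  thus ?case by (rule hom[OF that])
 qed (simp add: add tp_add_right)
 have "tp (peirce_scaling c s x) (peirce_scaling c t y) (peirce_scaling c s z) = peirce_scaling c s (tp x y z)"
  if "x \<in> peirce c i" "i \<in> {0,1,2}" for i x y z using c
 proof (induction y rule: peirce_induct)
  case (eigen k w)
  thus ?case by (rule z[OF that])
 qed (simp add: add tp_add_middle)
 note y = this
 show ?thesis using c
 proof (induction x rule: peirce_induct)
  case (eigen k w)
  thus ?case by (rule y)
 qed (simp add: add tp_add_left)
qed

lemma peirce_scaling_mult:
 assumes "tripotent c"
 shows "peirce_scaling c s (peirce_scaling c t w) = peirce_scaling c (s * t) w" using assms
proof (induction w rule: peirce_induct)
 case (eigen k w)
 thus ?case
  by (simp add: peirce_scaling_eigen[OF assms eigen(1)] linear_scaleD[OF peirce_scaling_linear] power_mult_distrib mult.commute)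
qed (simp add: linear_addD[OF peirce_scaling_linear])

lemma peirce_scaling_1: "peirce_scaling c 1 w = w" by (simp add: peirce_scaling_def P_sum)

end

hide_const (open) up_ring.coeff up_ring.monom Polynomials.degree Module.smult Polynomials.lead_coeff Coset.order

section \<open>The spectral theorem for one element\<close>

context hermitian_jordan_triple
begin

definition odd_power :: "'a => nat => 'a" where "odd_power u n = (tp u u ^^ n) u"

lemma odd_power_0: "odd_power u 0 = u"
 and odd_power_Suc: "odd_power u (Suc n) = tp u u (odd_power u n)" by (simp_all add: odd_power_def)

lemma tp_odd_power_middle: "tp u (odd_power u n) u = odd_power u (Suc n)"
 by (induction n) (auto simp: odd_power_0 odd_power_Suc tp_homotope(2)[of u u, symmetric])

text \<open>The operators \<open>tp (odd_power u a) (odd_power u b)\<close> with \<open>a + b = n\<close> coincide: by the Jordan identity two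
 neighbours differ by an operator that does not depend on \<open>a\<close>, and the shifting identity forces this operator
 to vanish.\<close>

lemma tp_odd_powers:
 "a + b = n ==> tp (odd_power u a) (odd_power u b) = tp (odd_power u n) u"
proof (induction n arbitrary: a b)
 case 0
 thus ?case by (simp add: odd_power_0)
next
 case (Suc n)
 define P where "P = odd_power u"
 have P: "P 0 = u" "\<And>k. tp u u (P k) = P (Suc k)" "\<And>k. tp u (P k) u = P (Suc k)"
  by (auto simp: P_def odd_power_0 odd_power_Suc tp_odd_power_middle)
 have "tp (P a) (P b) w = tp (P (Suc n)) u w" for w
 proof -
  define F where "F j = tp (P (Suc n - j)) (P j) w" for j
  define e where "e = tp u u (tp (P n) u w) - tp (P n) u (tp u u w)"
  have step: "F (Suc j) = F j - e" if "j \<le> n" for j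
  proof -
   have IH: "tp (P (n - j)) (P j) = tp (P n) u" using Suc.IH[of "n - j" j] that by (simp add: P_def)
   have "e = tp (tp u u (P (n - j))) (P j) w - tp (P (n - j)) (tp (P j) u u) w"
    using jordan_identity[of u u "P (n - j)" "P j" w] by (simp add: IH e_def)
   also have "... = F j - F (Suc j)" using that by (simp add: F_def P tp_commute[of "P j" u u] Suc_diff_le)
   finally show ?thesis by simp
  qed
  have Fj: "j \<le> Suc n ==> F j = F 0 - smul (of_nat j) e" for j
   by (induction j) (auto simp: step scale_left_distrib algebra_simps)
  have "tp u u (P n) = P (Suc n)" "tp u u u = P 1" using P(2)[of 0] by (auto simp: P)
  hence "F 0 + F n = smul 2 (F (Suc n))" using tp_shift[of u "P n" u w] by (simp add: P F_def)
  hence "smul 2 (F 0) - smul (of_nat n) e = smul 2 (F 0) - smul 2 (smul (of_nat (Suc n)) e)"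
   using Fj[of n] Fj[of "Suc n"] by (simp add: scale_right_diff_distrib double_eq[of "F 0", symmetric] algebra_simps)
  hence "smul (of_nat (Suc n) * 2 - of_nat n) e = 0" by (simp add: scale_left_diff_distrib mult.commute)
  moreover have "of_nat (Suc n) * 2 - of_nat n = (of_nat (n + 2) :: complex)" by simp
  ultimately have "smul (of_nat (n + 2)) e = 0" by metis
  moreover have "(of_nat (n + 2) :: complex) \<noteq> 0" by (simp only: of_nat_eq_0_iff)
  ultimately have "e = 0" using scale_eq_0_iff by blast
  hence "F b = F 0" using Fj[of b] Suc.prems by simp
  thus ?thesis using Suc.prems by (simp add: F_def P(1)) (metis add_diff_cancel_right')
 qed
 thus ?case by (auto simp: P_def)
qed

lemma tp_odd_power_odd_power_odd_power:
 "tp (odd_power u a) (odd_power u b) (odd_power u c) = odd_power u (a + b + c + 1)"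
proof -
 have e: "tp (odd_power u n) u (odd_power u c) = odd_power u (n + c + 1)" for n c
 proof -
  have "tp (odd_power u n) u (odd_power u c) = tp u (odd_power u n) (odd_power u c)"
   using tp_odd_powers[of 0 n n u] by (simp add: odd_power_0)
  also have "... = tp (odd_power u c) (odd_power u n) u" by (rule tp_commute)
  also have "... = tp (odd_power u (c + n)) u u" by (simp add: tp_odd_powers)
  also have "... = tp u u (odd_power u (c + n))" by (rule tp_commute)
  finally show ?thesis by (simp add: odd_power_Suc add.commute)
 qed
 show ?thesis by (simp add: tp_odd_powers[of a b "a + b"] e)
qed

text \<open>The odd functional calculus: \<open>odd_calculus u p\<close> is the element usually written \<open>f(u)\<close> with
 \<open>f t = t p(2 t\<^sup>2)\<close>.\<close>

definition odd_calculus :: "'a => complex poly => 'a" where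
 "odd_calculus u p = (\<Sum>i\<le>degree p. smul (coeff p i) (odd_power u i))"

lemma odd_calculus_bound:
 assumes "degree p \<le> n"
 shows "odd_calculus u p = (\<Sum>i\<le>n. smul (coeff p i) (odd_power u i))" unfolding odd_calculus_def
 by (rule sum.mono_neutral_left) (use assms in \<open>auto simp: coeff_eq_0\<close>)

lemma odd_calculus_add: "odd_calculus u (p + q) = odd_calculus u p + odd_calculus u q"
proof -
 let ?n = "max (degree p) (degree q)"
 have "degree (p + q) \<le> ?n" by (rule degree_add_le_max)
 thus ?thesis by (simp add: odd_calculus_bound[of _ ?n] sum.distrib scale_left_distrib)
qed

lemma odd_calculus_smult: "odd_calculus u (smult a p) = smul a (odd_calculus u p)"
 by (simp add: odd_calculus_bound[of _ "degree p"] degree_smult_le scale_sum_right)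

lemma odd_calculus_minus: "odd_calculus u (p - q) = odd_calculus u p - odd_calculus u q"
 using odd_calculus_add[of u p "smult (-1) q"] odd_calculus_smult[of u "-1" q] by simp

lemma odd_calculus_0: "odd_calculus u 0 = 0" by (simp add: odd_calculus_def)

lemma odd_calculus_sum: "odd_calculus u (sum f I) = (\<Sum>i\<in>I. odd_calculus u (f i))"
 by (induction I rule: infinite_finite_induct) (auto simp: odd_calculus_add odd_calculus_0)

lemma odd_calculus_monom: "odd_calculus u (monom a n) = smul a (odd_power u n)"
proof -
 have "odd_calculus u (monom a n) = (\<Sum>i\<le>n. smul (if i = n then a else 0) (odd_power u i))"
  by (subst odd_calculus_bound[of _ n]) (auto simp: degree_monom_le eq_commute intro!: sum.cong)
 also have "... = smul a (odd_power u n)" by (subst sum.remove[of _ n]) auto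
 finally show ?thesis .
qed

lemma poly_monom_induct [case_names monom add]:
 assumes "\<And>a n. Q (monom (a::complex) n)" "\<And>p q. Q p ==> Q q ==> Q (p + q)"
 shows "Q p"
proof -
 have "Q (\<Sum>i\<le>n. monom (coeff p i) i)" for n by (induction n) (auto intro: assms)
 thus ?thesis by (metis poly_as_sum_of_monoms)
qed

lemma odd_calculus_pCons_add:
 "odd_calculus u (pCons 0 (p + q)) = odd_calculus u (pCons 0 p) + odd_calculus u (pCons 0 q)"
 by (simp flip: odd_calculus_add)

lemma odd_calculus_X: "tp u u (odd_calculus u p) = odd_calculus u (pCons 0 p)"
proof (induction p rule: poly_monom_induct)
 case (monom a n)
 thus ?case by (simp add: odd_calculus_monom odd_power_Suc tp_simps flip: monom_Suc)
qed (simp add: odd_calculus_add odd_calculus_pCons_add tp_simps)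

text \<open>Real coefficients for \<open>g\<close> compensate the conjugate linearity of the middle argument.\<close>

lemma tp_odd_calculus:
 assumes "\<And>i. coeff g i \<in> \<real>"
 shows "tp (odd_calculus u f) (odd_calculus u g) (odd_calculus u h) = odd_calculus u (pCons 0 (f * g * h))"
proof -
 have m: "pCons 0 (monom a i * monom b j * monom c k) = monom (a * b * c) (i + j + k + 1)" for a b c :: complex and i j k
  by (simp add: mult_monom flip: monom_Suc)
 have real: "tp (odd_calculus u f) (smul b (odd_power u j)) (odd_calculus u h)
    = odd_calculus u (pCons 0 (f * monom (cnj b) j * h))" for b j
 proof (induction f rule: poly_monom_induct)
  case (monom a i)
  show ?case
  proof (induction h rule: poly_monom_induct)
   case (monom c k)
   thus ?case by (simp only: m odd_calculus_monom tp_simps tp_odd_power_odd_power_odd_power) (simp add: mult_ac)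
  qed (simp add: odd_calculus_add odd_calculus_pCons_add tp_add_right distrib_left)
 qed (simp add: odd_calculus_add odd_calculus_pCons_add tp_add_left distrib_right)
 have sum0: "odd_calculus u (pCons 0 (sum F I)) = (\<Sum>i\<in>I. odd_calculus u (pCons 0 (F i)))" for F and I :: "nat set"
  by (induction I rule: infinite_finite_induct) (auto simp: odd_calculus_pCons_add odd_calculus_0)
 have "tp (odd_calculus u f) (odd_calculus u g) (odd_calculus u h)
   = (\<Sum>j\<le>degree g. tp (odd_calculus u f) (smul (coeff g j) (odd_power u j)) (odd_calculus u h))"
  unfolding odd_calculus_def[of u g] by (rule tp_sum_middle)
 also have "... = (\<Sum>j\<le>degree g. odd_calculus u (pCons 0 (f * monom (coeff g j) j * h)))"
  using assms unfolding real by (simp add: Reals_cnj_iff)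
 also have "... = odd_calculus u (pCons 0 (\<Sum>j\<le>degree g. f * monom (coeff g j) j * h))" by (rule sum0[symmetric])
 also have "(\<Sum>j\<le>degree g. f * monom (coeff g j) j * h) = f * (\<Sum>j\<le>degree g. monom (coeff g j) j) * h"
  by (simp add: sum_distrib_left sum_distrib_right)
 finally show ?thesis by (simp add: poly_as_sum_of_monoms)
qed

definition root_product :: "complex set => complex poly" where
 "root_product A = (\<Prod>a\<in>A. [:-a, 1:])"

lemma root_product_dvd:
 assumes "finite A" "\<And>a. a \<in> A ==> poly p a = 0"
 shows "root_product A dvd p" using assms
proof (induction A arbitrary: p)
 case (insert a A)
 obtain g where g: "p = [:-a, 1:] * g" using insert.prems[of a] by (auto simp: poly_eq_0_iff_dvd)
 have "poly g b = 0" if "b \<in> A" for b using insert.prems[of b] insert.hyps that by (auto simp: g)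
 hence "root_product A dvd g" using insert.IH by blast
 hence "[:-a, 1:] * root_product A dvd [:-a, 1:] * g" by (rule mult_dvd_mono[OF dvd_refl])
 thus ?case using insert.hyps by (simp add: root_product_def g)
qed (simp add: root_product_def)

lemma odd_calculus_dvd: "odd_calculus u p = 0 ==> p dvd q ==> odd_calculus u q = 0"
proof -
 assume p: "odd_calculus u p = 0" and "p dvd q"
 then obtain g where q: "q = p * g" by (auto simp: dvd_def)
 have "odd_calculus u (p * g) = 0"
 proof (induction g rule: poly_monom_induct)
  case (monom a n)
  show ?case
  proof (induction n)
   case 0
   have "p * monom a 0 = smult a p" by (simp add: monom_0)
   thus ?case by (simp only: odd_calculus_smult p scale_zero_right)
  next
   case (Suc n)
   have "p * monom a (Suc n) = pCons 0 (p * monom a n)" by (simp add: monom_Suc)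
   thus ?case using odd_calculus_X[of u "p * monom a n"] Suc by simp
  qed
 qed (simp add: distrib_left odd_calculus_add)
 thus ?thesis using q by simp
qed

text \<open>\<open>L = D(u, u)\<close> is self-adjoint. For an annihilating polynomial of least degree, removing a linear factor
 leaves an eigenvector of \<open>L\<close>, so the roots are real; a double root would give an eigenvector of length zero.\<close>

lemma annihilating_roots:
 "\<exists>A. finite A \<and> A \<subseteq> \<real> \<and> odd_calculus u (root_product A) = 0
   \<and> (\<forall>p. p \<noteq> 0 --> degree p < card A --> odd_calculus u p \<noteq> 0)"
proof -
 have "\<exists>p. p \<noteq> 0 \<and> odd_calculus u p = 0"
 proof (cases "inj (odd_power u)")
  case True
  define F where "F = odd_power u ` {..card Basis}"
  have fin: "finite F" and "card F = card Basis + 1"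
   using card_image[OF inj_on_subset[OF True subset_UNIV], of "{..card Basis}"] by (auto simp: F_def)
  hence "dependent F"
   using independent_span_bound[of Basis F] finite_Basis span_Basis by (metis Suc_eq_plus1 Suc_n_not_le_n subset_UNIV)
  then obtain g v where g: "(\<Sum>v\<in>F. smul (g v) v) = 0" "v \<in> F" "g v \<noteq> 0"
   using fin by (auto simp: dependent_finite)
  define p where "p = (\<Sum>i\<le>card Basis. monom (g (odd_power u i)) i)"
  have "odd_calculus u p = (\<Sum>i\<le>card Basis. smul (g (odd_power u i)) (odd_power u i))"
   by (simp add: p_def odd_calculus_sum odd_calculus_monom)
  also have "... = (\<Sum>v\<in>F. smul (g v) v)"
   unfolding F_def by (subst sum.reindex) (auto intro: inj_on_subset[OF True])
  finally have "odd_calculus u p = 0" using g by simp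
  moreover obtain i where i: "i \<le> card Basis" "v = odd_power u i" using g by (auto simp: F_def)
  have "coeff p i = g v" using i by (simp add: p_def coeff_sum if_distrib cong: if_cong)
  hence "p \<noteq> 0" using g by auto
  ultimately show ?thesis by blast
 next
  case False
  then obtain i j where ij: "i \<noteq> j" "odd_power u i = odd_power u j" by (auto simp: inj_def)
  define p where "p = monom (1::complex) i - monom 1 j"
  have "odd_calculus u p = 0" by (simp add: p_def odd_calculus_minus odd_calculus_monom ij)
  moreover have "coeff p i \<noteq> 0" using ij by (simp add: p_def)
  hence "p \<noteq> 0" by auto
  ultimately show ?thesis by blast
 qed
 then obtain p\<^sub>0 where "p\<^sub>0 \<noteq> 0 \<and> odd_calculus u p\<^sub>0 = 0" by blast
 from ex_has_least_nat[of "\<lambda>p. p \<noteq> 0 \<and> odd_calculus u p = 0", OF this, of degree]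
 obtain q where q: "q \<noteq> 0" "odd_calculus u q = 0"
  and min: "\<And>p. p \<noteq> 0 ==> odd_calculus u p = 0 ==> degree q \<le> degree p" by blast
 define L where "L = tp u u"
 have adj: "form (L x) y = form x (L y)" for x y by (simp add: L_def form_adjoint)
 have fac: "odd_calculus u ([:-a, 1:] * p) = L (odd_calculus u p) - smul a (odd_calculus u p)" for a p
 proof -
  have "[:-a, 1:] * p = pCons 0 p - smult a p" by simp
  thus ?thesis by (simp only: odd_calculus_minus odd_calculus_smult odd_calculus_X L_def)
 qed
 have root_real: "a \<in> \<real>" and root_simple: "\<not> [:-a, 1:] * [:-a, 1:] dvd q" if "poly q a = 0" for a
 proof -
  have "[:-a, 1:] dvd q" using that by (simp add: poly_eq_0_iff_dvd)
  then obtain p where p: "q = [:-a, 1:] * p" unfolding dvd_def by blast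
  have "p \<noteq> 0" using q(1) p by auto
  moreover have "degree q = degree [:-a, 1:] + degree p" unfolding p by (rule degree_mult_eq) (use \<open>p \<noteq> 0\<close> in auto)
  ultimately have "p \<noteq> 0" "degree p < degree q" by auto
  hence ne: "odd_calculus u p \<noteq> 0" using min[of p] by auto
  define w where "w = odd_calculus u p"
  have Lw: "L w = smul a w" using fac[of a p] q(2) p by (simp add: w_def)
  hence "a * form w w = cnj a * form w w" using adj[of w w] by (simp add: form_simps)
  hence "a = cnj a" using ne form_definite[of w] by (simp add: w_def)
  thus real: "a \<in> \<real>" by (simp add: Reals_cnj_iff)
  show "\<not> [:-a, 1:] * [:-a, 1:] dvd q"
  proof
   assume "[:-a, 1:] * [:-a, 1:] dvd q"
   then obtain p' where p': "q = [:-a, 1:] * ([:-a, 1:] * p')" unfolding dvd_def mult.assoc by blast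
   hence pp: "p = [:-a, 1:] * p'" using p q(1) by (metis mult_cancel_left mult_zero_left)
   define v where "v = odd_calculus u p'"
   have w: "w = L v - smul a v" using fac[of a p'] pp by (simp add: w_def v_def)
   have "form w w = form w (L v) - cnj a * form w v" by (subst (2) w) (simp add: form_simps)
   also have "form w (L v) = form (L w) v" by (simp add: adj)
   finally have "form w w = 0" using Lw real by (simp add: form_simps Reals_cnj_iff)
   thus False using ne by (simp add: form_definite w_def)
  qed
 qed
 define A where "A = {a. poly q a = 0}"
 have fin: "finite A" unfolding A_def by (rule poly_roots_finite[OF q(1)])
 have ord: "order a q = 1" if "a \<in> A" for a
 proof -
  have "order a q \<noteq> 0" using that q(1) by (simp add: A_def order_root)
  moreover have nd: "\<not> [:-a, 1:] ^ 2 dvd q" using root_simple[of a] that unfolding A_def power2_eq_square by blast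
  moreover have "\<not> 2 \<le> order a q" using nd q(1) by (simp only: order_divides) simp
  ultimately show ?thesis by linarith
 qed
 have dec: "smult (lead_coeff q) (root_product A) = q"
  using complex_poly_decompose[of q] ord by (simp add: root_product_def A_def)
 have "odd_calculus u (root_product A) = 0"
 proof -
  have "smul (lead_coeff q) (odd_calculus u (root_product A)) = 0"
   using q(2) by (subst odd_calculus_smult[symmetric]) (simp add: dec)
  thus ?thesis using q(1) by simp
 qed
 moreover have "degree q = card A"
 proof -
  have "degree q = degree (root_product A)" using q(1) by (subst dec[symmetric]) simp
  also have "... = card A" unfolding root_product_def by (subst degree_prod_eq_sum_degree) auto
  finally show ?thesis .
 qed
 moreover have "A \<subseteq> \<real>" using root_real by (auto simp: A_def)
 moreover have "p \<noteq> 0 --> degree p < card A --> odd_calculus u p \<noteq> 0" for p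
  using min[of p] \<open>degree q = card A\<close> by auto
 ultimately show ?thesis using fin by blast
qed

text \<open>Keeps the tripotents of the spectral decomposition of \<open>u\<close> inside a Peirce space, or a real form of one, that
 contains \<open>u\<close>.\<close>

definition real_closed_under :: "'a => 'a set => bool" where
 "real_closed_under u S \<longleftrightarrow> u \<in> S \<and> (\<forall>x\<in>S. tp u u x \<in> S) \<and> (\<forall>x\<in>S. \<forall>y\<in>S. x + y \<in> S)
   \<and> (\<forall>x\<in>S. \<forall>a. smul (of_real a) x \<in> S)"

lemma odd_calculus_real_closed:
 assumes S: "real_closed_under u S" and real: "\<And>i. coeff p i \<in> \<real>"
 shows "odd_calculus u p \<in> S"
proof -
 have pow: "odd_power u n \<in> S" for n
  using S by (induction n) (auto simp: odd_power_0 odd_power_Suc real_closed_under_def)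
 have "smul (of_real 0) u \<in> S" using S unfolding real_closed_under_def by blast
 hence 0: "0 \<in> S" by simp
 have "(\<Sum>i\<le>n. smul (coeff p i) (odd_power u i)) \<in> S" for n
 proof -
  have "smul (coeff p i) (odd_power u i) \<in> S" for i
   using S pow[of i] real[of i] by (auto simp: real_closed_under_def elim!: Reals_cases)
  thus ?thesis using S 0 by (induction n) (auto simp: real_closed_under_def)
 qed
 thus ?thesis by (simp add: odd_calculus_def)
qed

text \<open>Lagrange interpolation at the roots \<open>a\<close> of the annihilating polynomial. The interpolating polynomials give
 elements \<open>v a\<close> whose triple products vanish unless all three agree, and \<open>{v a; v a; v a} = a v a\<close>. By
 \<open>cube_positive\<close> each \<open>a\<close> is positive, and \<open>v a\<close> becomes a tripotent after rescaling.\<close>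

theorem spectral_decomposition:
 "\<exists>C \<mu>. finite C \<and> (\<forall>c\<in>C. tripotent c \<and> c \<noteq> 0 \<and> \<mu> c > 0)
  \<and> (\<forall>c\<in>C. \<forall>d\<in>C. c \<noteq> d --> orthogonal_tripotents c d)
  \<and> u = (\<Sum>c\<in>C. smul (of_real (\<mu> c)) c)
  \<and> (\<forall>S. real_closed_under u S --> C \<subseteq> S)"
proof -
 obtain A where fin: "finite A" and real: "A \<subseteq> \<real>" and ann: "odd_calculus u (root_product A) = 0"
  and min: "\<And>p. p \<noteq> 0 ==> degree p < card A ==> odd_calculus u p \<noteq> 0"
  using annihilating_roots[of u] by blast
 define lag where "lag a = smult (1 / (\<Prod>b\<in>A - {a}. a - b)) (root_product (A - {a}))" for a
 have poly_rp: "poly (root_product B) z = (\<Prod>b\<in>B. z - b)" for B z by (simp add: root_product_def poly_prod)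
 have lag_eval: "poly (lag a) b = (if a = b then 1 else 0)" if "a \<in> A" "b \<in> A" for a b
 proof -
  have "(\<Prod>b\<in>A - {a}. a - b) \<noteq> 0" using fin by auto
  moreover have "(\<Prod>c\<in>A - {a}. b - c) = 0" if "a \<noteq> b" using fin \<open>b \<in> A\<close> that by (intro prod_zero) auto
  ultimately show ?thesis by (auto simp: lag_def poly_rp)
 qed
 have lag_real: "coeff (lag a) i \<in> \<real>" if "a \<in> A" for a i
 proof -
  have "\<forall>i. coeff (root_product B) i \<in> \<real>" if "B \<subseteq> A" for B
   using finite_subset[OF that fin] that
  proof (induction B)
   case (insert b B)
   have "coeff (root_product (insert b B)) i \<in> \<real>" for i
    using insert real by (cases i) (auto simp: root_product_def)
   thus ?case by blast
  qed (simp add: root_product_def)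
  moreover have "(\<Prod>b\<in>A - {a}. a - b) \<in> \<real>" using real that by (intro prod_in_Reals Reals_diff) auto
  ultimately show ?thesis by (simp add: lag_def)
 qed
 define v where "v a = odd_calculus u (lag a)" for a
 have interp: "odd_calculus u f = (\<Sum>a\<in>A. smul (poly f a) (v a))" for f
 proof -
  define g where "g = f - (\<Sum>a\<in>A. smult (poly f a) (lag a))"
  have "poly g b = 0" if "b \<in> A" for b
  proof -
   have "(\<Sum>a\<in>A. poly f a * poly (lag a) b) = (\<Sum>a\<in>A. if a = b then poly f a else 0)"
    using lag_eval that by (intro sum.cong) auto
   thus ?thesis using that fin by (simp add: g_def poly_sum)
  qed
  hence "root_product A dvd g" by (rule root_product_dvd[OF fin])
  hence "odd_calculus u g = 0" by (rule odd_calculus_dvd[OF ann])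
  thus ?thesis by (simp add: g_def odd_calculus_minus odd_calculus_sum odd_calculus_smult v_def)
 qed
 have v0: "v a \<noteq> 0" if "a \<in> A" for a
 proof -
  have "lag a \<noteq> 0" using lag_eval[OF that that] by auto
  moreover have "degree (lag a) \<le> card (A - {a})" unfolding lag_def root_product_def
   by (rule order_trans[OF degree_smult_le]) (rule order_trans[OF degree_prod_sum_le], auto simp: fin)
  moreover have "card (A - {a}) < card A" using fin that by (rule card_Diff1_less)
  ultimately show ?thesis unfolding v_def by (intro min) auto
 qed
 have tp_v: "tp (v a) (v b) (v c) = (if a = b \<and> b = c then smul a (v a) else 0)"
  if "a \<in> A" "b \<in> A" "c \<in> A" for a b c
 proof -
  have "tp (v a) (v b) (v c) = odd_calculus u (pCons 0 (lag a * lag b * lag c))"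
   unfolding v_def by (rule tp_odd_calculus) (rule lag_real[OF that(2)])
  also have "... = (\<Sum>d\<in>A. if d = a then (if a = b \<and> b = c then smul a (v a) else 0) else 0)"
   unfolding interp by (intro sum.cong refl) (auto simp: lag_eval that)
  finally show ?thesis using fin that by simp
 qed
 have pos: "Re a > 0" "complex_of_real (Re a) = a" if "a \<in> A" for a
 proof -
  show 1: "complex_of_real (Re a) = a" using that real by (auto elim!: Reals_cases)
  have "tp (v a) (v a) (v a) = smul (of_real (Re a)) (v a)" using tp_v[OF that that that] 1 by simp
  thus "Re a > 0" using cube_positive v0[OF that] by blast
 qed
 define \<mu> where "\<mu> a = sqrt (Re a / 2)" for a
 have \<mu>: "\<mu> a > 0" "complex_of_real (\<mu> a) * complex_of_real (\<mu> a) = a / 2" if "a \<in> A" for a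
  using pos[OF that] by (auto simp: \<mu>_def simp flip: of_real_mult)
 define t where "t a = smul (1 / complex_of_real (\<mu> a)) (v a)" for a
 have tp_t: "tp (t a) (t b) (t c) = (if a = b \<and> b = c then smul 2 (t a) else 0)"
  if "a \<in> A" "b \<in> A" "c \<in> A" for a b c
 proof -
  have "smul (1 / complex_of_real (\<mu> a) * (1 / complex_of_real (\<mu> a)) * (1 / complex_of_real (\<mu> a)) * a) (v a)
    = smul 2 (t a)" using \<mu>[OF that(1)] by (simp add: t_def field_simps)
  thus ?thesis using tp_v[OF that] by (auto simp: t_def tp_simps mult_ac)
 qed
 have trip: "tripotent (t a)" if "a \<in> A" for a using tp_t that by (simp add: tripotent_iff)
 have t0: "t a \<noteq> 0" if "a \<in> A" for a using v0[OF that] \<mu>(1)[OF that] by (simp add: t_def)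
 have orth: "orthogonal_tripotents (t a) (t b)" if "a \<in> A" "b \<in> A" "a \<noteq> b" for a b
  using tp_t[of a a b] that trip by (intro orthogonal_tripotentsI) auto
 have inj: "inj_on t A"
 proof (rule inj_onI, rule ccontr)
  fix a b assume ab: "a \<in> A" "b \<in> A" "t a = t b" "a \<noteq> b"
  hence "tp (t a) (t a) (t a) = 0" using tp_t[of a a b] by simp
  thus False using t0 ab by (auto dest: cube_zero_imp_zero)
 qed
 define \<nu> where "\<nu> c = \<mu> (the_inv_into A t c)" for c
 have \<nu>: "\<nu> (t a) = \<mu> a" if "a \<in> A" for a using the_inv_into_f_f[OF inj that] by (simp add: \<nu>_def)
 have "u = (\<Sum>c\<in>t ` A. smul (of_real (\<nu> c)) c)"
 proof -
  have "odd_calculus u 1 = u" using odd_calculus_monom[of u 1 0] by (simp add: odd_power_0 monom_0 one_pCons)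
  hence "u = (\<Sum>a\<in>A. v a)" using interp[of 1] by simp
  also have "... = (\<Sum>a\<in>A. smul (of_real (\<nu> (t a))) (t a))"
  proof (rule sum.cong[OF refl])
   fix a assume a: "a \<in> A"
   show "v a = smul (of_real (\<nu> (t a))) (t a)" using \<mu>(1)[OF a] unfolding \<nu>[OF a] by (simp add: t_def)
  qed
  finally show ?thesis by (simp add: sum.reindex[OF inj])
 qed
 moreover have "t ` A \<subseteq> S" if S: "real_closed_under u S" for S
 proof
  fix c assume "c \<in> t ` A"
  then obtain a where a: "a \<in> A" "c = smul (of_real (1 / \<mu> a)) (v a)" by (auto simp: t_def)
  moreover have "v a \<in> S" unfolding v_def by (rule odd_calculus_real_closed[OF S lag_real[OF a(1)]])
  ultimately show "c \<in> S" using S unfolding real_closed_under_def by blast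
 qed
 moreover have "\<forall>c\<in>t ` A. tripotent c \<and> c \<noteq> 0 \<and> \<nu> c > 0"
  using trip t0 \<mu>(1) \<nu> by auto
 moreover have "\<forall>c\<in>t ` A. \<forall>d\<in>t ` A. c \<noteq> d --> orthogonal_tripotents c d"
  using orth by fastforce
 ultimately show ?thesis using fin by (intro exI[of _ "t ` A"] exI[of _ \<nu>]) simp
qed

lemma spectral_decompositionE:
 assumes "real_closed_under u S"
 obtains C \<mu> where "finite C" "\<And>c. c \<in> C ==> tripotent c" "\<And>c. c \<in> C ==> c \<noteq> 0" "C \<subseteq> S"
  "\<And>c d. c \<in> C ==> d \<in> C ==> c \<noteq> d ==> orthogonal_tripotents c d"
  "u = (\<Sum>c\<in>C. smul (of_real (\<mu> c)) c)"
proof -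
 from spectral_decomposition[of u] show thesis
 proof (elim exE conjE)
  fix C \<mu>
  assume *: "finite C" "\<forall>c\<in>C. tripotent c \<and> c \<noteq> 0 \<and> 0 < \<mu> c"
   "\<forall>c\<in>C. \<forall>d\<in>C. c \<noteq> d --> orthogonal_tripotents c d"
   "u = (\<Sum>c\<in>C. smul (of_real (\<mu> c)) c)" "\<forall>S. real_closed_under u S --> C \<subseteq> S"
  show thesis by (rule that[of C \<mu>]) (use *(1-3,5) assms in \<open>auto intro: *(4)\<close>)
 qed
qed

end

section \<open>Minimal tripotents and frames\<close>

context hermitian_jordan_triple
begin

text \<open>The fixed points of \<open>Q_e\<close> are the self-adjoint elements of the Peirce 2-space of \<open>e\<close>, a Jordan algebra with
 unit \<open>e\<close> and involution \<open>Q_e\<close>.\<close>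

lemma quad_fixed_tp: "quad e x = x \<longleftrightarrow> tp e x e = smul 2 x"
proof
 assume "quad e x = x"
 hence "smul 2 (quad e x) = smul 2 x" by simp
 thus "tp e x e = smul 2 x" by (simp add: quad_def)
qed (simp add: quad_def)

lemma quad_fixed_in_peirce: "tripotent e ==> quad e x = x ==> x \<in> peirce e 2" by (metis quad_in_peirce)

lemma quad_fixed_commute:
 assumes e: "tripotent e" and x: "quad e x = x"
 shows "tp e x z = tp x e z"
proof -
 have "tp e e x = smul 2 x" using quad_fixed_in_peirce[OF e x] by (simp add: peirce_def)
 hence "smul 2 (tp x e z) + smul 2 (tp e x z) = smul 2 (smul 2 (tp e x z))"
  using tp_shift[of e x e z] e x by (simp add: quad_fixed_tp tripotent_iff tp_simps)
 moreover have "smul 2 (smul 2 (tp e x z)) = smul 2 (tp e x z) + smul 2 (tp e x z)" by (simp only: double_eq)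
 ultimately have "smul 2 (tp x e z) = smul 2 (tp e x z)" by simp
 thus ?thesis by (metis scale_left_imp_eq zero_neq_numeral)
qed

lemma quad_fixed_square:
 assumes e: "tripotent e" and x: "quad e x = x"
 shows "smul 2 (tp x x z) = tp e (tp x e x) z"
proof -
 have "tp (tp e x e) x z + tp (tp e x e) x z = smul 2 (tp e (tp x e x) z)" by (rule tp_shift)
 hence "smul 2 (smul 2 (tp x x z)) = smul 2 (tp e (tp x e x) z)" using x by (simp add: quad_fixed_tp tp_simps double_eq)
 thus ?thesis by (metis scale_left_imp_eq zero_neq_numeral)
qed

text \<open>In the Jordan algebra with unit \<open>e\<close>, the element \<open>c\<close> has square \<open>e\<close>; so \<open>(e + c)/2\<close> and \<open>(e - c)/2\<close> are
 complementary idempotents.\<close>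

lemma half_sum_half_diff:
 assumes e: "tripotent e" and c: "tripotent c" and ec: "quad e c = c" and ce: "quad c e = e"
 defines "x \<equiv> smul (1/2) (e + c)" and "y \<equiv> smul (1/2) (e - c)"
 shows "orthogonal_tripotents x y" "x + y = e" "tp x x z = smul (1/2) (tp e e z + tp e c z)"
proof -
 have comm: "tp e c z = tp c e z" for z by (rule quad_fixed_commute[OF e ec])
 have sq: "tp c c z = tp e e z" for z
 proof -
  have "tp c e c = smul 2 e" using ce by (simp add: quad_fixed_tp)
  hence "smul 2 (tp c c z) = smul 2 (tp e e z)" using quad_fixed_square[OF e ec, of z] by (simp add: tp_simps)
  thus ?thesis by (metis scale_left_imp_eq zero_neq_numeral)
 qed
 have eee: "tp e e e = smul 2 e" and eec: "tp e e c = smul 2 c" and ece: "tp e c e = smul 2 c"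
  using e quad_fixed_in_peirce[OF e ec] ec by (auto simp: tripotent_iff peirce_def quad_fixed_tp)
 have ecc: "tp e c c = smul 2 e" using sq[of e] eee tp_commute[of e c c] by simp
 have tpx: "tp x x z = smul (1/2) (tp e e z + tp e c z)" for z
  unfolding x_def by (rule crd_eqI) (simp add: tp_simps sq comm[symmetric] crd_simps field_simps)
 have tpy: "tp y y z = smul (1/2) (tp e e z - tp e c z)" for z
  unfolding y_def by (rule crd_eqI) (simp add: tp_simps sq comm[symmetric] crd_simps field_simps)
 show "tp x x z = smul (1/2) (tp e e z + tp e c z)" by (rule tpx)
 have "tripotent x" unfolding tripotent_iff tpx
  by (rule crd_eqI) (simp add: x_def tp_simps eee eec ece ecc crd_simps field_simps)
 moreover have "tripotent y" unfolding tripotent_iff tpy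
  by (rule crd_eqI) (simp add: y_def tp_simps eee eec ece ecc crd_simps field_simps)
 moreover have "tp x y z = 0" for z
  unfolding x_def y_def by (rule crd_eqI) (simp add: tp_simps sq comm[symmetric] crd_simps field_simps)
 ultimately show "orthogonal_tripotents x y" by (auto simp: orthogonal_tripotents_def)
 show "x + y = e" unfolding x_def y_def by (rule crd_eqI) (simp add: crd_simps field_simps)
qed

lemma minimal_tripotentD: "minimal_tripotent e ==> tripotent e" "minimal_tripotent e ==> e \<noteq> 0"
 "minimal_tripotent e ==> orthogonal_tripotents a b ==> e = a + b ==> a = 0 \<or> b = 0"
 by (auto simp: minimal_tripotent_def)

text \<open>The Peirce components \<open>e2\<close> and \<open>e0\<close> of \<open>e\<close> with respect to \<open>c\<close> are orthogonal tripotents and \<open>e1\<close> is zero.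
 So one of them vanishes by minimality; if it is \<open>e0\<close>, then \<open>(e + c)/2\<close> and \<open>(e - c)/2\<close> split \<open>e\<close> again.\<close>

lemma minimal_tripotent_unique:
 assumes min: "minimal_tripotent e" and c: "tripotent c" "c \<noteq> 0" and ec: "quad e c = c"
 shows "c = e \<or> c = - e"
proof -
 have e: "tripotent e" by (rule minimal_tripotentD[OF min])
 define e0 e1 e2 where "e0 = P0 c e" and "e1 = P1 c e" and "e2 = P2 c e"
 have sum: "e0 + e1 + e2 = e" by (simp add: e0_def e1_def e2_def P_sum)
 have mem: "e0 \<in> peirce c 0" "e1 \<in> peirce c 1" "e2 \<in> peirce c 2"
  using P_in[OF c(1)] by (auto simp: e0_def e1_def e2_def)
 have "tp c c e = tp e c c" by (rule tp_commute)
 also have "... = tp c e c" by (rule quad_fixed_commute[OF e ec])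
 finally have cce: "tp c c e = smul 2 (quad c e)" by (simp add: quad_def)
 have cce': "tp c c e = e1 + smul 2 e2" using mem by (subst sum[symmetric]) (simp add: peirce_def tp_simps)
 have "e1 = smul 2 (quad c e) - smul 2 e2" unfolding cce[symmetric] cce' by simp
 hence "e1 \<in> peirce c 2" using mem quad_in_peirce[OF c(1)] by (simp add: peirce_closed)
 hence e1: "e1 = 0" using P_eq[OF c(1), of e1] mem by simp
 have "smul 2 (quad c e) = smul 2 e2" using cce cce' e1 by simp
 hence qce: "quad c e = e2" by (metis scale_left_imp_eq zero_neq_numeral)
 note o = peirce_2_0_orthogonal[OF c(1) mem(3,1)]
 have o': "tp e0 w e2 = 0" "tp e2 w e0 = 0" if "w = e0 \<or> w = e2" for w
  using that o[of e0] o[of e2] by (auto simp: tp_commute[of e0 e0 e2] tp_commute[of e2 e2 e0])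
 have "tp e0 e0 e0 + tp e2 e2 e2 = smul 2 e0 + smul 2 e2"
 proof -
  have "tp (e0 + e2) (e0 + e2) (e0 + e2) = smul 2 (e0 + e2)" using e sum e1 by (simp add: tripotent_iff)
  thus ?thesis by (simp add: tp_simps o o' scale_right_distrib)
 qed
 moreover have "tp e0 e0 e0 \<in> peirce c 0" "tp e2 e2 e2 \<in> peirce c 2"
  using peirce_mult[OF mem(1) mem(1) mem(1)] peirce_mult[OF mem(3) mem(3) mem(3)] by simp_all
 ultimately have "tp e0 e0 e0 - smul 2 e0 = smul 2 e2 - tp e2 e2 e2"
  "tp e0 e0 e0 - smul 2 e0 \<in> peirce c 0" "smul 2 e2 - tp e2 e2 e2 \<in> peirce c 2"
  using mem by (auto simp: peirce_closed algebra_simps)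
 hence "tp e0 e0 e0 - smul 2 e0 = 0" "smul 2 e2 - tp e2 e2 e2 = 0"
  using P_eq(1,3)[OF c(1), of "tp e0 e0 e0 - smul 2 e0"] by auto
 hence t: "tripotent e0" "tripotent e2" by (auto simp: tripotent_iff)
 have "orthogonal_tripotents e2 e0" using t o by (auto simp: orthogonal_tripotents_def)
 moreover have "e = e2 + e0" using sum e1 by (simp add: add.commute)
 ultimately have "e2 = 0 \<or> e0 = 0" by (rule minimal_tripotentD[OF min])
 thus ?thesis
 proof
  assume "e2 = 0"
  hence "tp e e c = 0" using e1 sum mem tp_tripotent_peirce_0(1)[OF c(1), of e e] by (simp add: tp_commute[of e e c])
  thus ?thesis using quad_fixed_in_peirce[OF e ec] c(2) by (simp add: peirce_def)
 next
  assume "e0 = 0"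
  hence "quad c e = e" using qce sum e1 by simp
  from half_sum_half_diff(1,2)[OF e c(1) ec this]
  have "smul (1/2) (e + c) = 0 \<or> smul (1/2) (e - c) = 0" using minimal_tripotentD(3)[OF min] by metis
  thus ?thesis by (auto simp: add_eq_0_iff)
 qed
qed

text \<open>The spectral decomposition of \<open>y\<close> takes place in the real form, where \<open>e\<close> and \<open>- e\<close> are the only tripotents.\<close>

lemma minimal_tripotent_real:
 assumes min: "minimal_tripotent e" and y: "quad e y = y"
 shows "\<exists>a. y = smul (of_real a) e"
proof -
 have e: "tripotent e" by (rule minimal_tripotentD[OF min])
 have comm: "tp e z (quad e w) = quad e (tp e z w)" if "quad e z = z" for z w
  using tp_homotope(2)[of e z w] quad_fixed_commute[OF e that, of w] by (simp add: quad_def tp_simps)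
 have "real_closed_under y {w. quad e w = w}"
 proof -
  have "quad e (tp y y x) = tp y y x" if x: "quad e x = x" for x
  proof -
   have "tp y e y = tp e y y" using quad_fixed_commute[OF e y, of y] by simp
   hence "quad e (tp y e y) = tp y e y" using comm[OF y, of y] y by simp
   hence "quad e (tp e (tp y e y) x) = tp e (tp y e y) x" using comm[of "tp y e y" x] x by simp
   hence "quad e (smul 2 (tp y y x)) = smul 2 (tp y y x)" by (simp add: quad_fixed_square[OF e y])
   thus ?thesis by (simp add: quad_linearity)
  qed
  thus ?thesis using y by (auto simp: real_closed_under_def quad_linearity)
 qed
 then obtain C \<mu> where C: "finite C" "\<And>c. c \<in> C ==> tripotent c" "\<And>c. c \<in> C ==> c \<noteq> 0" "C \<subseteq> {w. quad e w = w}"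
   "\<And>c d. c \<in> C ==> d \<in> C ==> c \<noteq> d ==> orthogonal_tripotents c d"
  and sum: "y = (\<Sum>c\<in>C. smul (of_real (\<mu> c)) c)" by (rule spectral_decompositionE) (rule that, assumption+)
 have "\<exists>s. c = smul (of_real s) e" if "c \<in> C" for c
 proof -
  have "tripotent c" "c \<noteq> 0" "quad e c = c" using C(2-4) that by blast+
  hence "c = e \<or> c = - e" by (rule minimal_tripotent_unique[OF min])
  thus ?thesis
  proof
   assume "c = e"
   thus ?thesis by (intro exI[of _ 1]) simp
  next
   assume "c = - e"
   thus ?thesis by (intro exI[of _ "-1"]) simp
  qed
 qed
 then obtain s where s: "\<And>c. c \<in> C ==> c = smul (of_real (s c)) e" by metis
 have "y = (\<Sum>c\<in>C. smul (of_real (\<mu> c * s c)) e)" unfolding sum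
 proof (rule sum.cong[OF refl])
  fix c assume "c \<in> C"
  show "smul (of_real (\<mu> c)) c = smul (of_real (\<mu> c * s c)) e"
   using arg_cong[OF s[OF \<open>c \<in> C\<close>], of "smul (of_real (\<mu> c))"] by (simp only: scale_scale of_real_mult)
 qed
 also have "... = smul (of_real (\<Sum>c\<in>C. \<mu> c * s c)) e" by (simp add: scale_sum_left)
 finally show ?thesis by blast
qed

lemma minimal_tripotent_peirce_2:
 assumes min: "minimal_tripotent e" and w: "w \<in> peirce e 2"
 shows "\<exists>a. w = smul a e"
proof -
 have e: "tripotent e" by (rule minimal_tripotentD[OF min])
 have qq: "quad e (quad e w) = w" using w e by (simp add: peirce_2_iff_quad)
 have "quad e (w - quad e w) = - (w - quad e w)"
  using quad_linearity(1)[of e "w - quad e w" "quad e w"] qq by (simp add: algebra_simps)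
 hence "quad e (smul \<i> (w - quad e w)) = smul \<i> (w - quad e w)"
  unfolding quad_linearity(2) by (simp only: scale_minus_right complex_cnj_i scale_minus_left minus_minus)
 moreover have "quad e (w + quad e w) = w + quad e w" using qq by (simp add: quad_linearity(1) add.commute)
 ultimately obtain a b where "w + quad e w = smul (of_real a) e" "smul \<i> (w - quad e w) = smul (of_real b) e"
  using minimal_tripotent_real[OF min] by blast
 moreover have "w = smul (1/2) (w + quad e w) + smul (- \<i> / 2) (smul \<i> (w - quad e w))"
  by (rule crd_eqI) (simp add: crd_simps field_simps)
 ultimately have "w = smul (1/2) (smul (of_real a) e) + smul (- \<i> / 2) (smul (of_real b) e)" by simp
 hence "w = smul (1/2 * complex_of_real a + - \<i> / 2 * complex_of_real b) e"
  by (simp only: scale_scale scale_left_distrib)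
 thus ?thesis by blast
qed

lemma dim_peirce_strict:
 assumes "orthogonal_tripotents a b" "b \<noteq> 0"
 shows "dim (peirce a 2) < dim (peirce (a + b) 2)"
proof -
 note o = orthogonal_tripotentsD[OF assms(1)]
 have "peirce a 2 \<subseteq> peirce (a + b) 2" using orthogonal_peirce_2_subset[OF assms(1)]
  by (auto simp: peirce_def tripotent_add(2)[OF assms(1)])
 moreover have "b \<in> peirce (a + b) 2" using o by (simp add: peirce_def tripotent_add(2)[OF assms(1)] tripotent_iff)
 moreover have "b \<notin> peirce a 2" using assms(2) o(3) by (auto simp: peirce_def)
 ultimately have "span (peirce a 2) \<subset> span (peirce (a + b) 2)"
  by (simp add: span_eq_iff[THEN iffD2, OF peirce_subspace]) blast
 thus ?thesis by (rule dim_psubset)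
qed

text \<open>A tripotent in the common Peirce 0-space whose own Peirce 2-space has least dimension is minimal, because
 that dimension grows strictly when an orthogonal tripotent is added.\<close>

lemma minimal_tripotent_exists:
 assumes "\<forall>d\<in>D. tripotent d" and x: "x \<noteq> 0" "\<forall>d\<in>D. x \<in> peirce d 0"
 shows "\<exists>c. minimal_tripotent c \<and> (\<forall>d\<in>D. orthogonal_tripotents c d \<and> orthogonal_tripotents d c)"
proof -
 define T where "T c \<longleftrightarrow> tripotent c \<and> c \<noteq> 0 \<and> (\<forall>d\<in>D. c \<in> peirce d 0)" for c
 have "real_closed_under x {w. \<forall>d\<in>D. w \<in> peirce d 0}"
 proof -
  have "tp x x y \<in> peirce d 0" if "y \<in> peirce d 0" "d \<in> D" for y d
   using peirce_mult[of x d 0 x 0 y 0] x that by simp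
  thus ?thesis using x by (auto simp: real_closed_under_def peirce_closed)
 qed
 then obtain C \<mu> where C: "finite C" "\<And>c. c \<in> C ==> tripotent c" "\<And>c. c \<in> C ==> c \<noteq> 0" "C \<subseteq> {w. \<forall>d\<in>D. w \<in> peirce d 0}"
   "\<And>c d. c \<in> C ==> d \<in> C ==> c \<noteq> d ==> orthogonal_tripotents c d"
  and "x = (\<Sum>c\<in>C. smul (of_real (\<mu> c)) c)" by (rule spectral_decompositionE) (rule that, assumption+)
 hence "C \<noteq> {}" using x(1) by (metis sum.empty)
 then obtain c0 where "c0 \<in> C" by blast
 hence "T c0" unfolding T_def using C(2-4) by blast
 from ex_has_least_nat[of T, OF \<open>T c0\<close>, of "\<lambda>c. dim (peirce c 2)"]
 obtain c where c: "T c" and least: "\<And>c'. T c' ==> dim (peirce c 2) \<le> dim (peirce c' 2)" by blast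
 have orth: "orthogonal_tripotents d c" "orthogonal_tripotents c d" if "d \<in> D" for d
  using orthogonal_tripotentsI[of d c] c assms(1) that by (auto simp: T_def peirce_0_iff)
 have False if ab: "a \<noteq> 0" "b \<noteq> 0" "orthogonal_tripotents a b" "c = a + b" for a b
 proof -
  note o = orthogonal_tripotentsD[OF ab(3)]
  have "a \<in> peirce c 2" using o by (simp add: peirce_def ab(4) tripotent_add(2)[OF ab(3)] tripotent_iff)
  hence "T a" using orthogonal_peirce_2_subset[OF orth(2)] ab(1) o(5) by (auto simp: T_def)
  thus False using least[of a] dim_peirce_strict[OF ab(3,2)] ab(4) by simp
 qed
 hence "minimal_tripotent c" using c by (auto simp: minimal_tripotent_def T_def)
 thus ?thesis using orth by blast
qed

text \<open>After a change of \<open>x\<close> into an element \<open>y\<close> fixed by the involution \<open>Q\<close> of \<open>E = a + b\<close>, a positive multiple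
 \<open>t\<close> of \<open>y\<close> is a tripotent with \<open>Q_t E = E\<close>. The Peirce reflection of \<open>c = (E + t)/2\<close> fixes \<open>c\<close> and \<open>E - c\<close>,
 hence \<open>a + b\<close>, and it negates \<open>a - b\<close>; therefore it exchanges \<open>a\<close> and \<open>b\<close>.\<close>

lemma exchanging_tripotent:
 assumes a: "minimal_tripotent a" and b: "minimal_tripotent b" and ab: "orthogonal_tripotents a b"
  and x: "x \<in> peirce a 1" "x \<in> peirce b 1" "x \<noteq> 0"
 shows "\<exists>c. tripotent c \<and> peirce_scaling c (-1) a = b \<and> peirce_scaling c (-1) b = a
  \<and> (\<forall>f. orthogonal_tripotents a f --> orthogonal_tripotents b f --> peirce_scaling c (-1) f = f)"
proof -
 note o = orthogonal_tripotentsD[OF ab]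
 define E where "E = a + b"
 have E: "tripotent E" "\<And>w. tp E E w = tp a a w + tp b b w" using tripotent_add[OF ab] by (auto simp: E_def)
 have inE2: "y \<in> peirce E 2" if "y \<in> peirce a 1" "y \<in> peirce b 1" for y
  using that double_eq[of y] by (simp add: peirce_def E)
 have a2: "a \<in> peirce a 2" "b \<in> peirce b 2" using tripotent_in_peirce_2 o by auto
 have quadE: "quad E y = tp a y b" "tp a y a = 0" "tp b y b = 0" if "y \<in> peirce a 1" "y \<in> peirce b 1" for y
 proof -
  show 1: "tp a y a = 0" "tp b y b = 0" using quad_peirce_01 o that by auto
  thus "quad E y = tp a y b" by (simp add: quad_def E_def tp_simps tp_commute[of b y a] double_eq)
 qed
 have quadE_mem: "quad E y \<in> peirce a 1" "quad E y \<in> peirce b 1" if "y \<in> peirce a 1" "y \<in> peirce b 1" for y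
  using peirce_mult[OF a2(1) that(1) o(3)] peirce_mult[OF o(4) that(2) a2(2)] quadE(1)[OF that] by auto
 obtain y where y: "y \<in> peirce a 1" "y \<in> peirce b 1" "y \<noteq> 0" "quad E y = y"
 proof (cases "x + quad E x = 0")
  case True
  hence "quad E x = - x" by (simp add: eq_neg_iff_add_eq_0 add.commute)
  hence "quad E (smul \<i> x) = smul \<i> x" by (simp add: quad_linearity)
  thus thesis using x by (intro that[of "smul \<i> x"]) (auto simp: peirce_closed)
 next
  case False
  have "quad E (quad E x) = x" using inE2[OF x(1,2)] E(1) by (simp add: peirce_2_iff_quad)
  hence "quad E (x + quad E x) = x + quad E x" by (simp add: quad_linearity add.commute)
  thus thesis using x quadE_mem[OF x(1,2)] False by (intro that[of "x + quad E x"]) (auto simp: peirce_closed)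
 qed
 have yy: "\<exists>g. g > 0 \<and> tp y y c = smul (of_real g) c" if c: "minimal_tripotent c" and yc: "y \<in> peirce c 1" for c
 proof -
  have "tp y y c \<in> peirce c 2"
   using peirce_mult[OF yc yc tripotent_in_peirce_2[OF minimal_tripotentD(1)[OF c]]] by simp
  then obtain g where g: "tp y y c = smul g c" using minimal_tripotent_peirce_2[OF c] by blast
  have "tp c c y = y" using yc by (simp add: peirce_def)
  hence "form (tp y y c) c = form y y"
   using form_adjoint[of c y y c] by (simp add: tp_commute[of y y c] tp_commute[of y c c])
  hence "g * form c c = form y y" using g by (simp add: form_simps)
  hence "g = complex_of_real (Re (form y y) / Re (form c c))"
  proof -
   have "form c c \<noteq> 0" using minimal_tripotentD(2)[OF c] by (simp add: form_definite)
   hence "g = form y y / form c c" using \<open>g * form c c = form y y\<close> by (simp add: field_simps)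
   also have "... = complex_of_real (Re (form y y)) / complex_of_real (Re (form c c))"
    by (simp only: form_real[symmetric])
   finally show ?thesis by simp
  qed
  moreover have "Re (form y y) / Re (form c c) > 0"
   using form_pos[OF y(3)] form_pos[OF minimal_tripotentD(2)[OF c]] by simp
  ultimately show ?thesis using g by blast
 qed
 obtain g where g: "g > 0" "tp y y a = smul (of_real g) a" using yy[OF a y(1)] by blast
 obtain h where h: "h > 0" "tp y y b = smul (of_real h) b" using yy[OF b y(2)] by blast
 have "tp y a y \<in> peirce b 2" "tp y b y \<in> peirce a 2"
  using peirce_mult[OF y(2) o(4) y(2)] peirce_mult[OF y(1) o(3) y(1)] by auto
 then obtain p q where p: "tp y a y = smul p b" and q: "tp y b y = smul q a"
  using minimal_tripotent_peirce_2[OF a] minimal_tripotent_peirce_2[OF b] by blast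
 have yEy: "tp y E y = smul p b + smul q a" by (simp add: E_def tp_simps p q)
 have tpE: "tp E a z = tp a a z" "tp E b z = tp b b z" for z by (auto simp: E_def tp_simps o)
 have aaa: "tp a a a = smul 2 a" "tp b b b = smul 2 b" using o by (auto simp: tripotent_iff)
 have aab: "tp a a b = 0" "tp b b a = 0" using o by (auto simp: peirce_0_iff)
 have two: "smul 2 (tp y y z) = smul (cnj p) (tp b b z) + smul (cnj q) (tp a a z)" for z
  using quad_fixed_square[OF E(1) y(4), of z] by (simp add: yEy tp_simps tpE)
 have "smul (2 * complex_of_real g) a = smul (cnj q * 2) a" using two[of a] by (simp add: g aaa aab)
 hence "2 * complex_of_real g = cnj q * 2" using minimal_tripotentD(2)[OF a] by (simp only: scale_cancel_right) simp
 hence "cnj (cnj q) = cnj (complex_of_real g)" by simp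
 hence q': "q = complex_of_real g" by simp
 have "smul (2 * complex_of_real h) b = smul (cnj p * 2) b" using two[of b] by (simp add: h aaa aab)
 hence "2 * complex_of_real h = cnj p * 2" using minimal_tripotentD(2)[OF b] by (simp only: scale_cancel_right) simp
 hence "cnj (cnj p) = cnj (complex_of_real h)" by simp
 hence p': "p = complex_of_real h" by simp
 have aay: "tp a a y = y" "tp b b y = y" using y by (auto simp: peirce_def)
 have "smul 2 (tp y y y) = smul (of_real (g + h)) y"
  using two[of y] by (simp add: p' q' aay scale_left_distrib add.commute)
 hence "smul (1/2) (smul 2 (tp y y y)) = smul (1/2) (smul (of_real (g + h)) y)" by simp
 hence yyy: "tp y y y = smul (of_real ((g + h) / 2)) y" by simp
 \<comment> \<open>comparing the two sides on the line of \<open>a\<close> yields \<open>h = g\<close>, so that \<open>y\<close> can be scaled to a tripotent\<close>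
 have "tp y (tp y a y) y = smul 2 (tp y y (tp y y a)) - smul (of_real ((g + h) / 2)) (tp y y a)"
  by (rule cube_quad_quad[OF yyy])
 hence "smul (of_real (h * g)) a = smul (of_real (2 * g * g - (g + h) / 2 * g)) a"
  by (simp add: p q p' q' g tp_simps scale_left_diff_distrib mult.assoc)
 hence "complex_of_real (h * g) = complex_of_real (2 * g * g - (g + h) / 2 * g)"
  using minimal_tripotentD(2)[OF a] by (simp only: scale_cancel_right) simp
 hence "h * g = 2 * g * g - (g + h) / 2 * g" by (simp only: of_real_eq_iff)
 hence "h = 2 * g - (g + h) / 2" using g(1) by (auto simp: field_simps)
 hence gh: "h = g" by (simp add: field_simps)
 define s where "s = sqrt (2 / g)"
 have s: "s > 0" "s * s = 2 / g" using g(1) by (auto simp: s_def)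
 have s2: "complex_of_real s * complex_of_real s * complex_of_real g = 2" using s g(1) by (simp flip: of_real_mult)
 define t where "t = smul (of_real s) y"
 have t: "tripotent t" "quad E t = t" "quad t E = E"
 proof -
  have "tp t t t = smul (of_real s * complex_of_real s * complex_of_real g) t"
   by (simp add: t_def tp_simps yyy gh mult_ac)
  thus "tripotent t" by (simp add: tripotent_iff s2)
  show "quad E t = t" by (simp add: t_def quad_linearity y)
  have "tp t E t = smul (of_real s * complex_of_real s * complex_of_real g) E"
   by (simp add: t_def tp_scale_left tp_scale_middle tp_scale_right yEy p' q' gh)
    (simp add: E_def scale_right_distrib mult_ac add.commute)
  thus "quad t E = E" by (simp add: quad_fixed_tp s2)
 qed
 define c d where "c = smul (1/2) (E + t)" and "d = smul (1/2) (E - t)"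
 note cd = half_sum_half_diff[OF E(1) t(1,2,3), folded c_def d_def]
 note cdo = orthogonal_tripotentsD[OF cd(1)]
 have tmem: "t \<in> peirce a 1" "t \<in> peirce b 1" using y by (auto simp: t_def peirce_closed)
 have atb: "tp a t b = t" "tp a t a = 0" "tp b t b = 0" using quadE[OF tmem] t(2) by auto
 define T where "T = peirce_scaling c (-1)"
 have lin: "T (u + v) = T u + T v" for u v unfolding T_def by (rule linear_addD[OF peirce_scaling_linear])
 have "tp c c (a - b) = a - b" unfolding cd(3) E(2)
  by (rule crd_eqI) (simp add: E_def tp_simps aaa aab atb tp_commute[of b t a] crd_simps field_simps)
 hence "a - b \<in> peirce c 1" by (rule peirce_1I)
 hence T1: "T (a - b) = - (a - b)" using peirce_scaling_eigen[OF cdo(5), of "a - b" 1 "-1"] by (simp add: T_def)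
 have "T c = c" "T d = d" using peirce_scaling_eigen[OF cdo(5) tripotent_in_peirce_2[OF cdo(5)], of "-1"]
   peirce_scaling_eigen[OF cdo(5) cdo(3), of "-1"] by (auto simp: T_def)
 hence T2: "T (a + b) = a + b" using lin[of c d] cd(2) by (simp add: E_def)
 have S1: "T a + T b = a + b" using T2 lin[of a b] by simp
 have S2: "T a = T b + (b - a)" using T1 lin[of "a - b" b] by simp
 have "smul 2 (T b) = smul 2 a" using S1 S2 by (simp add: double_eq[symmetric] algebra_simps)
 hence Tb: "T b = a" by simp
 hence Tab: "T a = b" "T b = a" using S2 by auto
 have "T f = f" if f: "orthogonal_tripotents a f" "orthogonal_tripotents b f" for f
 proof -
  note fo = orthogonal_tripotentsD[OF f(1)] orthogonal_tripotentsD[OF f(2)]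
  have "tp f f E = 0" using fo by (simp add: E_def tp_simps peirce_0_iff)
  hence fE: "orthogonal_tripotents E f" using orthogonal_tripotentsI(2)[OF fo(6) E(1)] by blast
  have "t \<in> peirce f 0" by (rule orthogonal_peirce_2_subset[OF fE quad_fixed_in_peirce[OF E(1) t(2)]])
  hence "tp E t f = 0" using tp_tripotent_peirce_0(1)[OF fo(6), of t E] by (simp add: tp_commute[of E t f])
  hence "f \<in> peirce c 0" using fo by (simp add: peirce_0_iff cd(3) E(2))
  thus ?thesis using peirce_scaling_eigen[OF cdo(5), of f 0 "-1"] by (simp add: T_def)
 qed
 thus ?thesis using cdo(5) Tab by (auto simp: T_def)
qed

end

section \<open>Exchanging the elements of a frame\<close>

context hermitian_jordan_triple
begin

text \<open>The subgroup of \<open>K\<close> generated by unimodular Peirce scalings. Its members are joined to the identity by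
 explicit paths and by explicit polynomial curves.\<close>

inductive_set peirce_group :: "('a => 'a) set" where
 one: "(\<lambda>z. z) \<in> peirce_group"
| step: "g \<in> peirce_group ==> tripotent c ==> cmod s = 1 ==> (\<lambda>z. peirce_scaling c s (g z)) \<in> peirce_group"

lemma peirce_group_scaling: "tripotent c ==> cmod s = 1 ==> peirce_scaling c s \<in> peirce_group"
 using peirce_group.step[OF peirce_group.one] by simp

lemma peirce_group_comp: "g \<in> peirce_group ==> h \<in> peirce_group ==> (\<lambda>z. g (h z)) \<in> peirce_group"
 by (induction rule: peirce_group.induct) (auto intro: peirce_group.intros)

lemma cmod_1_cnj: "cmod s = 1 ==> s * cnj s = 1" by (metis complex_norm_square of_real_1 one_power2)

lemma peirce_group_inverse:
 "g \<in> peirce_group ==> \<exists>h\<in>peirce_group. (\<forall>z. h (g z) = z) \<and> (\<forall>z. g (h z) = z)"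
proof (induction rule: peirce_group.induct)
 case one
 show ?case by (rule bexI[OF _ peirce_group.one]) simp
next
 case (step g c s)
 then obtain h where h: "h \<in> peirce_group" "\<forall>z. h (g z) = z" "\<forall>z. g (h z) = z" by (elim bexE conjE)
 have inv: "peirce_scaling c s (peirce_scaling c (cnj s) z) = z" "peirce_scaling c (cnj s) (peirce_scaling c s z) = z" for z
  unfolding peirce_scaling_mult[OF step(2)] using cmod_1_cnj[OF step(3)]
  by (simp_all add: peirce_scaling_1 mult.commute)
 have "(\<lambda>z. h (peirce_scaling c (cnj s) z)) \<in> peirce_group"
  using peirce_group_comp[OF h(1) peirce_group_scaling[OF step(2)]] step(3) by simp
 thus ?case by (rule bexI[rotated]) (simp add: h inv)
qed

lemma peirce_group_linear: "g \<in> peirce_group ==> endo smul g"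
proof (induction rule: peirce_group.induct)
 case (step g c s)
 thus ?case using peirce_scaling_linear[of c s] by (auto simp: Vector_Spaces.linear_iff)
qed (auto simp: Vector_Spaces.linear_iff vector_space_axioms)

lemma peirce_group_tp: "g \<in> peirce_group ==> tp (g x) (g y) (g z) = g (tp x y z)"
 by (induction rule: peirce_group.induct) (auto simp: peirce_scaling_tp cmod_1_cnj)

lemma peirce_group_automorphism: "g \<in> peirce_group ==> g \<in> triple_automorphisms"
proof -
 assume g: "g \<in> peirce_group"
 from peirce_group_inverse[OF g] obtain h where "\<forall>z. h (g z) = z" "\<forall>z. g (h z) = z" by (elim bexE conjE)
 hence "bij g" by (intro o_bij[of h g]) (auto simp: fun_eq_iff)
 thus ?thesis using peirce_group_linear[OF g] peirce_group_tp[OF g] by (simp add: triple_automorphisms_def)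
qed

end

locale framed_triple = hermitian_jordan_triple +
 fixes r :: nat and e :: "nat => 'a"
 assumes frame: "is_frame r e"
begin

lemma frame_minimal: "i \<in> {1..r} ==> minimal_tripotent (e i)"
 and frame_orthogonal: "i \<in> {1..r} ==> j \<in> {1..r} ==> i \<noteq> j ==> orthogonal_tripotents (e i) (e j)"
 using frame by (auto simp: is_frame_def)

lemmas frame_tripotent = minimal_tripotentD(1)[OF frame_minimal]
 and frame_nonzero = minimal_tripotentD(2)[OF frame_minimal]
 and frame_orthogonalD = orthogonal_tripotentsD[OF frame_orthogonal]

lemma frame_peirce_0:
 assumes "\<And>i. i \<in> {1..r} ==> x \<in> peirce (e i) 0"
 shows "x = 0"
proof (rule ccontr)
 assume "x \<noteq> 0"
 hence "\<exists>c. minimal_tripotent c \<and> (\<forall>d\<in>e ` {1..r}. orthogonal_tripotents c d \<and> orthogonal_tripotents d c)"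
  using assms by (intro minimal_tripotent_exists) (auto intro: frame_tripotent)
 thus False using frame by (auto simp: is_frame_def)
qed

definition frame_sum :: "nat set => 'a" where "frame_sum A = (\<Sum>i\<in>A. e i)"

lemma frame_sum_tripotent:
 assumes "A \<subseteq> {1..r}"
 shows "tripotent (frame_sum A) \<and> (\<forall>w. tp (frame_sum A) (frame_sum A) w = (\<Sum>i\<in>A. tp (e i) (e i) w))
  \<and> (\<forall>j\<in>{1..r} - A. orthogonal_tripotents (frame_sum A) (e j))"
 using finite_subset[OF assms finite_atLeastAtMost] assms
proof (induction A)
 case empty
 show ?case using frame_tripotent by (auto simp: frame_sum_def orthogonal_tripotents_def tripotent_def quad_def)
next
 case (insert i A)
 hence *: "tripotent (frame_sum A)" "\<And>w. tp (frame_sum A) (frame_sum A) w = (\<Sum>i\<in>A. tp (e i) (e i) w)"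
  "orthogonal_tripotents (frame_sum A) (e i)" and o: "\<And>j. j \<in> {1..r} - A ==> orthogonal_tripotents (frame_sum A) (e j)"
  by auto
 have s: "frame_sum (insert i A) = frame_sum A + e i" using insert by (simp add: frame_sum_def add.commute)
 have t: "tripotent (frame_sum (insert i A))"
  "\<And>w. tp (frame_sum (insert i A)) (frame_sum (insert i A)) w = (\<Sum>i\<in>insert i A. tp (e i) (e i) w)"
  using tripotent_add[OF *(3)] *(2) insert.hyps by (auto simp: s add.commute)
 moreover have "orthogonal_tripotents (frame_sum (insert i A)) (e j)" if "j \<in> {1..r} - insert i A" for j
 proof -
  have "i \<in> {1..r}" "j \<in> {1..r}" "i \<noteq> j" using insert.prems that by auto
  hence "tp (frame_sum (insert i A)) (e j) w = 0" for w
   using orthogonal_tripotentsD(1)[OF o, of j] frame_orthogonalD(1)[of i j] that by (simp add: s tp_simps)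
  thus ?thesis using t(1) frame_tripotent[of j] that by (auto simp: orthogonal_tripotents_def)
 qed
 ultimately show ?case by blast
qed

lemma frame_sum_orthogonal:
 assumes "A \<subseteq> {1..r}" "B \<subseteq> {1..r}" "A \<inter> B = {}"
 shows "orthogonal_tripotents (frame_sum A) (frame_sum B)"
proof -
 have "tp (frame_sum A) (frame_sum B) w = 0" for w
 proof -
  have "tp (frame_sum A) (e j) w = 0" if "j \<in> B" for j
  proof -
   have "orthogonal_tripotents (frame_sum A) (e j)" using frame_sum_tripotent[OF assms(1)] that assms(2,3) by blast
   thus ?thesis by (rule orthogonal_tripotentsD)
  qed
  thus ?thesis by (simp add: frame_sum_def[of B] tp_sum_middle)
 qed
 thus ?thesis using frame_sum_tripotent[OF assms(1)] frame_sum_tripotent[OF assms(2)]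
  by (auto simp: orthogonal_tripotents_def)
qed

lemma frame_sum_peirce_2: "A \<subseteq> {1..r} ==> i \<in> A ==> e i \<in> peirce (frame_sum A) 2"
proof -
 assume A: "A \<subseteq> {1..r}" "i \<in> A"
 have "(\<Sum>j\<in>A. tp (e j) (e j) (e i)) = (\<Sum>j\<in>A. if j = i then smul 2 (e i) else 0)"
  using A frame_orthogonalD(3) frame_tripotent by (intro sum.cong refl) (auto simp: peirce_0_iff tripotent_iff subset_eq)
 also have "... = smul 2 (e i)" using A finite_subset[OF A(1)] by (simp add: sum.delta)
 finally show ?thesis using frame_sum_tripotent[OF A(1)] by (auto intro: peirce_2I)
qed

lemma frame_sum_peirce_0:
 assumes "A \<subseteq> {1..r}" "x \<in> peirce (frame_sum A) 0" "i \<in> A"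
 shows "x \<in> peirce (e i) 0"
proof -
 have "tp x (e i) (e i) = 0"
  using peirce_2_0_orthogonal(2)[of "frame_sum A" "e i" x "e i"] frame_sum_tripotent[OF assms(1)]
   frame_sum_peirce_2[OF assms(1,3)] assms(2) by blast
 thus ?thesis by (simp add: peirce_0_iff tp_commute[of "e i" "e i" x])
qed

lemma orthogonal_commute:
 assumes "orthogonal_tripotents a b"
 shows "tp a a (tp b b z) = tp b b (tp a a z)"
 using jordan_identity[of a a b b z] orthogonal_tripotentsD[OF assms] tp_commute[of b a a] by (simp add: peirce_0_iff)

lemma orthogonal_P_commute:
 assumes "orthogonal_tripotents a b" "z \<in> peirce b k"
 shows "P0 a z \<in> peirce b k" "P1 a z \<in> peirce b k" "P2 a z \<in> peirce b k"
proof -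
 have *: "tp a a w \<in> peirce b k" if "w \<in> peirce b k" for w
  using orthogonal_commute[OF assms(1), of w] that by (simp add: peirce_def tp_simps)
 show "P0 a z \<in> peirce b k" "P1 a z \<in> peirce b k" "P2 a z \<in> peirce b k"
  using assms(2) *[OF assms(2)] *[OF *[OF assms(2)]] by (auto simp: P0_def P1_def P2_def intro!: peirce_closed)
qed

lemma peirce_disjoint: "x \<in> peirce c i ==> x \<in> peirce c j ==> i \<noteq> j ==> x = 0"
proof -
 assume "x \<in> peirce c i" "x \<in> peirce c j" "i \<noteq> j"
 hence "smul (of_int i) x = smul (of_int j) x" by (simp add: peirce_def)
 thus "x = 0" using \<open>i \<noteq> j\<close> by (simp only: scale_cancel_right of_int_eq_iff) simp
qed

text \<open>Let \<open>f\<close> and \<open>f'\<close> be the sums of the frame over \<open>A\<close> and over its complement. The intersection of their Peirce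
 1-spaces is made of the spaces joining \<open>A\<close> to its complement, so it is zero. Then \<open>Z\<close> is the sum of the
 Peirce 0-spaces of \<open>f'\<close> and of \<open>f\<close>, and \<open>D\<close> vanishes between these two spaces, which makes them ideals.\<close>

lemma frame_split_ideals:
 assumes A: "A \<subseteq> {1..r}" "A \<noteq> {}" "A \<noteq> {1..r}"
  and none: "\<And>i j x. i \<in> A ==> j \<in> {1..r} - A ==> x \<in> peirce (e i) 1 ==> x \<in> peirce (e j) 1 ==> x = 0"
 shows "\<exists>I J. triple_ideal I \<and> triple_ideal J \<and> I \<noteq> {0} \<and> J \<noteq> {0} \<and>
      I \<inter> J = {0} \<and> {x + y | x y. x \<in> I \<and> y \<in> J} = UNIV"
proof -
 define f f' where "f = frame_sum A" and "f' = frame_sum ({1..r} - A)"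
 have A': "{1..r} - A \<subseteq> {1..r}" by blast
 have ff': "orthogonal_tripotents f f'" unfolding f_def f'_def using A by (intro frame_sum_orthogonal) auto
 hence f'f: "orthogonal_tripotents f' f" unfolding f_def f'_def using A by (intro frame_sum_orthogonal) auto
 have trip: "tripotent f" "tripotent f'" using ff' by (auto simp: orthogonal_tripotents_def)
 have ef': "orthogonal_tripotents (e i) f'" if "i \<in> A" for i
  using frame_sum_orthogonal[of "{i}" "{1..r} - A"] A that by (auto simp: frame_sum_def f'_def)
 have zero: "x = 0" if "x \<in> peirce f 0" "x \<in> peirce f' 0" for x
 proof (rule frame_peirce_0)
  fix i assume "i \<in> {1..r}"
  thus "x \<in> peirce (e i) 0"
   using frame_sum_peirce_0[OF A(1)] frame_sum_peirce_0[OF A'] that by (cases "i \<in> A") (auto simp: f_def f'_def)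
 qed
 have one: "x = 0" if x: "x \<in> peirce f 1" "x \<in> peirce f' 1" for x
 proof -
  have "tp (e i) (e i) x = 0" if i: "i \<in> A" for i
  proof -
   have ir: "i \<in> {1..r}" using i A by auto
   note ti = frame_tripotent[OF ir]
   have "P2 (e i) x \<in> peirce f' 1" by (rule orthogonal_P_commute[OF ef'[OF i] x(2)])
   moreover have "P2 (e i) x \<in> peirce f' 0" using orthogonal_peirce_2_subset[OF ef'[OF i]] P_in(3)[OF ti] by blast
   ultimately have p2: "P2 (e i) x = 0" using peirce_disjoint[of _ f' 1 0] by simp
   define y where "y = P1 (e i) x"
   have y1: "y \<in> peirce (e i) 1" and yf: "y \<in> peirce f' 1"
    using P_in(2)[OF ti] orthogonal_P_commute(2)[OF ef'[OF i] x(2)] by (auto simp: y_def)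
   have "tp (e j) (e j) y = 0" if j: "j \<in> {1..r} - A" for j
   proof -
    have jr: "j \<in> {1..r}" "i \<noteq> j" using i j by auto
    note tj = frame_tripotent[OF jr(1)]
    have oji: "orthogonal_tripotents (e j) (e i)" by (rule frame_orthogonal) (use ir jr in auto)
    have "P1 (e j) y = 0" using none[OF i j orthogonal_P_commute(2)[OF oji y1] P_in(2)[OF tj]] .
    moreover have "P2 (e j) y = 0" using peirce_disjoint[OF orthogonal_P_commute(3)[OF oji y1]
      orthogonal_peirce_2_subset[OF oji P_in(3)[OF tj]]] by simp
    ultimately have "y = P0 (e j) y" using P_sum[of "e j" y] by simp
    thus ?thesis using P_in(1)[OF tj, of y] by (simp add: peirce_0_iff)
   qed
   hence "tp f' f' y = 0" using frame_sum_tripotent[OF A'] by (simp add: f'_def)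
   hence "y = 0" using yf by (simp add: peirce_def)
   hence "x = P0 (e i) x" using p2 P_sum[of "e i" x] by (simp add: y_def)
   thus ?thesis using P_in(1)[OF ti, of x] by (simp add: peirce_0_iff)
  qed
  hence "tp f f x = 0" using frame_sum_tripotent[OF A(1)] by (simp add: f_def)
  thus ?thesis using x(1) by (simp add: peirce_def)
 qed
 have sum: "\<exists>x y. x \<in> peirce f' 0 \<and> y \<in> peirce f 0 \<and> z = x + y" for z
 proof -
  define w where "w = P1 f' z"
  have w: "w \<in> peirce f' 1" using P_in trip by (simp add: w_def)
  have "P2 f w = 0"
   using peirce_disjoint[OF orthogonal_P_commute(3)[OF ff' w] orthogonal_peirce_2_subset[OF ff' P_in(3)[OF trip(1)]]] by simp
  moreover have "P1 f w = 0" using one[OF P_in(2)[OF trip(1)] orthogonal_P_commute(2)[OF ff' w]] .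
  ultimately have "w = P0 f w" using P_sum[of f w] by simp
  hence "w \<in> peirce f 0" using P_in(1)[OF trip(1)] by metis
  moreover have "P2 f' z \<in> peirce f 0" by (rule orthogonal_peirce_2_subset[OF f'f P_in(3)[OF trip(2)]])
  ultimately have "w + P2 f' z \<in> peirce f 0" by (rule peirce_closed)
  moreover have "z = P0 f' z + (w + P2 f' z)" using P_sum[of f' z] by (simp add: w_def add.assoc)
  ultimately show ?thesis using P_in(1)[OF trip(2)] by blast
 qed
 \<comment> \<open>the Jordan identity moves the Peirce 1-part of \<open>a\<close> past \<open>g\<close>, which annihilates \<open>b\<close>\<close>
 have vanish: "tp a b z = 0" "tp b a z = 0" if ab: "a \<in> peirce g' 0" "b \<in> peirce g 0"
   and g: "(g = f \<and> g' = f') \<or> (g = f' \<and> g' = f)" for a b z g g'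
 proof -
  have o: "orthogonal_tripotents g g'" "orthogonal_tripotents g' g" using g ff' f'f by blast+
  note t = orthogonal_tripotentsD(5,6)[OF o(1)]
  have zer: "x = 0" if "x \<in> peirce g 0" "x \<in> peirce g' 0" for x using zero[of x] that g by blast
  have on: "x = 0" if "x \<in> peirce g 1" "x \<in> peirce g' 1" for x using one[of x] that g by blast
  have "P0 g a = 0" by (rule zer[OF P_in(1)[OF t(1)] orthogonal_P_commute(1)[OF o(1) ab(1)]])
  hence a: "a = P1 g a + P2 g a" using P_sum[of g a] by simp
  define v where "v = tp b (P1 g a) g"
  have p1: "P1 g a \<in> peirce g 1" "P1 g a \<in> peirce g' 0"
   using P_in(2)[OF t(1)] orthogonal_P_commute(2)[OF o(1) ab(1)] by auto
  have gm: "g \<in> peirce g 2" "g \<in> peirce g' 0" using tripotent_in_peirce_2 t orthogonal_tripotentsD(4)[OF o(1)] by auto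
  have "P0 g' b = 0" by (rule zer[OF orthogonal_P_commute(1)[OF o(2) ab(2)] P_in(1)[OF t(2)]])
  hence b: "b = P1 g' b + P2 g' b" using P_sum[of g' b] by simp
  have m: "tp b' (P1 g a) g \<in> peirce g 1" if "b' \<in> peirce g 0" for b'
   using peirce_mult[OF that p1(1) gm(1)] by simp
  have m': "tp b' (P1 g a) g \<in> peirce g' k" if "b' \<in> peirce g' k" for b' k
   using peirce_mult[OF that p1(2) gm(2)] by simp
  have "tp (P1 g' b) (P1 g a) g = 0" by (rule on[OF m m']) (auto intro: orthogonal_P_commute[OF o(2) ab(2)] P_in t)
  moreover have "tp (P2 g' b) (P1 g a) g = 0"
  proof (rule peirce_disjoint)
   show "tp (P2 g' b) (P1 g a) g \<in> peirce g 1" by (rule m[OF orthogonal_P_commute(3)[OF o(2) ab(2)]])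
   show "tp (P2 g' b) (P1 g a) g \<in> peirce g 0"
    by (rule orthogonal_peirce_2_subset[OF o(2) m'[OF P_in(3)[OF t(2)]]])
  qed simp
  moreover have "v = tp (P1 g' b) (P1 g a) g + tp (P2 g' b) (P1 g a) g"
   using arg_cong[OF b, of "\<lambda>t. tp t (P1 g a) g"] unfolding v_def tp_add_left .
  ultimately have v: "v = 0" by simp
  have gb: "tp g b x = 0" for x using tp_tripotent_peirce_0(1)[OF t(1) ab(2)] .
  have gpa: "tp (P1 g a) g g = P1 g a" using p1(1) by (simp add: peirce_def tp_commute[of "P1 g a" g g])
  have "tp (P1 g a) b x = 0" for x using jordan_identity[of "P1 g a" g g b x] v by (simp add: gb gpa v_def)
  moreover have "tp (P2 g a) b x = 0" for x by (rule peirce_2_0_orthogonal(1)[OF t(1) P_in(3)[OF t(1)] ab(2)])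
  ultimately have 0: "tp a b x = 0" for x by (subst a) (simp add: tp_simps)
  thus "tp a b z = 0" .
  show "tp b a z = 0" by (rule form_eqI) (simp add: form_adjoint 0)
 qed
 have ideal: "triple_ideal (peirce g' 0)" if g: "(g = f \<and> g' = f') \<or> (g = f' \<and> g' = f)" for g g'
  unfolding triple_ideal_def
 proof (intro conjI ballI allI)
  show "subspace (peirce g' 0)" by (rule peirce_subspace)
  fix x u v assume x: "x \<in> peirce g' 0"
  have dec: "\<exists>p q. p \<in> peirce g' 0 \<and> q \<in> peirce g 0 \<and> z = p + q" for z
  proof -
   obtain p q where pq: "p \<in> peirce f' 0" "q \<in> peirce f 0" "z = p + q" using sum[of z] by blast
   hence "z = q + p" by (simp add: add.commute)
   thus ?thesis using g pq by blast
  qed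
  obtain u1 u2 where u: "u1 \<in> peirce g' 0" "u2 \<in> peirce g 0" "u = u1 + u2" using dec by blast
  obtain v1 v2 where v: "v1 \<in> peirce g' 0" "v2 \<in> peirce g 0" "v = v1 + v2" using dec by blast
  have "tp x u v = tp x u1 v" using vanish(1)[OF x u(2) g] by (simp add: u(3) tp_simps)
  also have "... = tp v1 u1 x" using vanish(2)[OF u(1) v(2) g] by (simp add: v(3) tp_simps tp_commute[of x])
  also have "... \<in> peirce g' 0" using peirce_mult[OF v(1) u(1) x] by simp
  finally show "tp x u v \<in> peirce g' 0" .
  have "tp u x v = tp u1 x v" using vanish(2)[OF x u(2) g] by (simp add: u(3) tp_simps)
  also have "... = tp v1 x u1" using vanish(2)[OF x v(2) g] by (simp add: v(3) tp_simps tp_commute[of u1])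
  also have "... \<in> peirce g' 0" using peirce_mult[OF v(1) x u(1)] by simp
  finally show "tp u x v \<in> peirce g' 0" .
 qed
 have "peirce f' 0 \<inter> peirce f 0 = {0}" using zero peirce_closed(4) by auto
 moreover have "peirce f' 0 \<noteq> {0}" "peirce f 0 \<noteq> {0}"
 proof -
  obtain i where i: "i \<in> A" using A by blast
  hence "e i \<in> peirce f' 0" "e i \<noteq> 0" using orthogonal_tripotentsD(4)[OF ef'[OF i]] frame_nonzero A by auto
  thus "peirce f' 0 \<noteq> {0}" by auto
  obtain j where j: "j \<in> {1..r} - A" using A by blast
  hence "orthogonal_tripotents f (e j)" using frame_sum_tripotent[OF A(1)] by (simp add: f_def)
  hence "e j \<in> peirce f 0" "e j \<noteq> 0" using orthogonal_tripotentsD(3) frame_nonzero j by auto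
  thus "peirce f 0 \<noteq> {0}" by auto
 qed
 moreover have "{x + y | x y. x \<in> peirce f' 0 \<and> y \<in> peirce f 0} = UNIV" using sum by blast
 moreover have "triple_ideal (peirce f' 0)" "triple_ideal (peirce f 0)" using ideal[of f f'] ideal[of f' f] by blast+
 ultimately show ?thesis by (intro exI[of _ "peirce f' 0"] exI[of _ "peirce f 0"] conjI)
qed

definition exchangeable :: "nat => nat => bool" where
 "exchangeable i j \<longleftrightarrow> (\<exists>k\<in>peirce_group. k (e i) = e j \<and> k (e j) = e i
   \<and> (\<forall>m\<in>{1..r} - {i, j}. k (e m) = e m))"

lemma exchangeable_refl: "exchangeable i i" unfolding exchangeable_def by (rule bexI[OF _ peirce_group.one]) auto

text \<open>The transposition \<open>(i k)\<close> is \<open>(i j) (j k) (i j)\<close>.\<close>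

lemma exchangeable_trans:
 assumes ij: "exchangeable i j" and jk: "exchangeable j k" and r: "i \<in> {1..r}" "j \<in> {1..r}" "k \<in> {1..r}"
 shows "exchangeable i k"
proof (cases "i = j \<or> j = k \<or> i = k")
 case True
 moreover have "exchangeable i k" if "i = j" using jk that by simp
 moreover have "exchangeable i k" if "j = k" using ij that by simp
 moreover have "exchangeable i k" if "i = k" using exchangeable_refl that by simp
 ultimately show ?thesis by blast
next
 case False
 obtain g where g: "g \<in> peirce_group" "g (e i) = e j" "g (e j) = e i" "\<forall>m\<in>{1..r} - {i, j}. g (e m) = e m"
  using ij unfolding exchangeable_def by (elim bexE conjE)
 obtain h where h: "h \<in> peirce_group" "h (e j) = e k" "h (e k) = e j" "\<forall>m\<in>{1..r} - {j, k}. h (e m) = e m"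
  using jk unfolding exchangeable_def by (elim bexE conjE)
 have "k \<in> {1..r} - {i, j}" "i \<in> {1..r} - {j, k}" using False r by blast+
 note gk = bspec[OF g(4) this(1)] and hi = bspec[OF h(4) this(2)]
 have fixed: "g (h (g (e m))) = e m" if "m \<in> {1..r} - {i, k}" for m
 proof (cases "m = j")
  case True
  thus ?thesis by (simp only: g(3) hi g(2))
 next
  case False
  have "g (e m) = e m" by (rule bspec[OF g(4)]) (use False that in blast)
  moreover have "h (e m) = e m" by (rule bspec[OF h(4)]) (use False that in blast)
  ultimately show ?thesis by simp
 qed
 have exch: "g (h (g (e i))) = e k" "g (h (g (e k))) = e i" by (simp_all only: g(2,3) h(2,3) gk)
 have "(\<lambda>z. g (h (g z))) \<in> peirce_group" by (rule peirce_group_comp[OF g(1) peirce_group_comp[OF h(1) g(1)]])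
 thus ?thesis unfolding exchangeable_def
 proof (rule bexI[rotated], intro conjI ballI)
  show "g (h (g (e i))) = e k" "g (h (g (e k))) = e i" by (rule exch)+
 qed (rule fixed)
qed

end

locale irreducible_framed_triple = irreducible_hermitian_jordan_triple + framed_triple
begin

text \<open>A non-zero element joining \<open>m\<close> and \<open>n\<close> makes them exchangeable, so no Peirce space joins an exchangeability
 class to its complement. A second class would split the triple into two ideals.\<close>

lemma all_exchangeable:
 assumes "i \<in> {1..r}" "j \<in> {1..r}"
 shows "exchangeable i j"
proof (rule ccontr)
 assume nij: "\<not> exchangeable i j"
 define A where "A = {m \<in> {1..r}. exchangeable i m}"
 have "A \<subseteq> {1..r}" "A \<noteq> {}" "A \<noteq> {1..r}"
  using assms nij exchangeable_refl[of i] unfolding A_def by blast+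
 moreover have "x = 0" if m: "m \<in> A" "n \<in> {1..r} - A" and x: "x \<in> peirce (e m) 1" "x \<in> peirce (e n) 1" for m n x
 proof (rule ccontr)
  assume "x \<noteq> 0"
  have mn: "m \<in> {1..r}" "n \<in> {1..r}" "m \<noteq> n" using m unfolding A_def by blast+
  obtain c where c: "tripotent c" "peirce_scaling c (-1) (e m) = e n" "peirce_scaling c (-1) (e n) = e m"
   "\<And>f. orthogonal_tripotents (e m) f ==> orthogonal_tripotents (e n) f ==> peirce_scaling c (-1) f = f"
   using exchanging_tripotent[OF frame_minimal[OF mn(1)] frame_minimal[OF mn(2)] frame_orthogonal[OF mn] x \<open>x \<noteq> 0\<close>]
   by blast
  have "exchangeable m n" unfolding exchangeable_def
  proof (intro bexI[of _ "peirce_scaling c (-1)"] conjI ballI)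
   show "peirce_scaling c (-1) \<in> peirce_group" by (rule peirce_group_scaling[OF c(1)]) simp
   show "peirce_scaling c (-1) (e l) = e l" if "l \<in> {1..r} - {m, n}" for l
    by (rule c(4)) (use that mn in \<open>auto intro: frame_orthogonal\<close>)
  qed (use c in simp_all)
  hence "exchangeable i n" using exchangeable_trans[of i m n] m mn assms unfolding A_def by blast
  thus False using m unfolding A_def by blast
 qed
 ultimately have "\<exists>I J. triple_ideal I \<and> triple_ideal J \<and> I \<noteq> {0} \<and> J \<noteq> {0} \<and>
      I \<inter> J = {0} \<and> {x + y | x y. x \<in> I \<and> y \<in> J} = UNIV"
  by (intro frame_split_ideals[of A])
 thus False using irreducible by (rule notE[rotated])
qed

end

section \<open>Limits of automorphisms and the group K\<close>

context hermitian_jordan_triple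
begin

abbreviation opinv :: "('a => 'a) => 'a => 'a" where "opinv g \<equiv> inv_into UNIV g"

lemma automorphismD:
 assumes "g \<in> triple_automorphisms"
 shows "endo smul g" "bij g" "g (tp u v w) = tp (g u) (g v) (g w)" using assms by (auto simp: triple_automorphisms_def)

text \<open>\<open>D(g x, g y)\<close> is conjugate to \<open>D(x, y)\<close> by \<open>g\<close>.\<close>

lemma automorphism_form:
 assumes g: "g \<in> triple_automorphisms"
 shows "form (g x) (g y) = form x y"
proof -
 note g' = automorphismD[OF g]
 have ginv: "opinv g (g z) = z" "g (opinv g z) = z" for z
  using g'(2) by (simp_all add: bij_is_inj bij_is_surj surj_f_inv_f)
 have lin: "endo smul (\<lambda>z. tp x y (opinv g z))" unfolding Vector_Spaces.linear_iff
 proof (intro conjI allI vector_space_axioms)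
  fix u v :: 'a and a
  have "opinv g (u + v) = opinv g u + opinv g v"
   using ginv(1)[of "opinv g u + opinv g v"] by (simp only: linear_addD[OF g'(1)] ginv(2))
  thus "tp x y (opinv g (u + v)) = tp x y (opinv g u) + tp x y (opinv g v)" by (simp add: tp_simps)
  have "opinv g (smul a u) = smul a (opinv g u)"
   using ginv(1)[of "smul a (opinv g u)"] by (simp only: linear_scaleD[OF g'(1)] ginv(2))
  thus "tp x y (opinv g (smul a u)) = smul a (tp x y (opinv g u))" by (simp add: tp_simps)
 qed
 have "tp (g x) (g y) = (\<lambda>z. g (tp x y (opinv g z)))" by (rule ext) (simp only: g'(3) ginv(2))
 hence "form (g x) (g y) = lin_trace (\<lambda>z. g (tp x y (opinv g z)))" by (simp add: form_def)
 also have "... = lin_trace (\<lambda>z. tp x y (opinv g (g z)))" by (rule lin_trace_commute[OF g'(1) lin])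
 finally show ?thesis by (simp add: ginv form_def)
qed

lemma form_bound: "cmod (form x y) \<le> Re (form x x) + Re (form y y)"
proof (cases "form x y = 0")
 case True
 thus ?thesis using form_nonneg[of x] form_nonneg[of y] by simp
next
 case False
 define b where "b = form x y"
 define s where "s = b / complex_of_real (cmod b)"
 have b: "cmod b > 0" using False by (simp add: b_def)
 have s: "cnj s * b = complex_of_real (cmod b)" "s * cnj s = 1"
  using b complex_norm_square[of b] by (auto simp: s_def field_simps power2_eq_square)
 have "form (x - smul s y) (x - smul s y) = form x x - cnj s * b - s * cnj b + s * cnj s * form y y"
  using form_cnj[of x y] by (simp add: form_simps b_def algebra_simps)
 also have "s * cnj b = cnj (cnj s * b)" by simp
 finally have "Re (form (x - smul s y) (x - smul s y)) = Re (form x x) - 2 * cmod b + Re (form y y)" unfolding s by simp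
 thus ?thesis using form_nonneg[of "x - smul s y"] form_nonneg[of x] form_nonneg[of y] by (simp add: b_def)
qed

text \<open>Convergence of matrix coefficients with respect to the trace form. For linear maps this is convergence in
 \<open>End_topology\<close>.\<close>

definition op_limit :: "(nat => 'a => 'a) => ('a => 'a) => bool" where
 "op_limit k T \<longleftrightarrow> (\<forall>x y. (\<lambda>m. form (k m x) y) \<longlonglongrightarrow> form (T x) y)"

lemma functional_form:
 assumes "Vector_Spaces.linear smul (*) \<phi>"
 shows "\<exists>E c. finite E \<and> (\<forall>z. \<phi> z = (\<Sum>b\<in>E. form z b * c b))"
proof -
 obtain E where E: "herm.orthonormal E" "span E = UNIV" using orthonormal_basis_UNIV by blast
 have "\<phi> z = (\<Sum>b\<in>E. form z b * \<phi> b)" for z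
 proof -
  interpret p: Vector_Spaces.linear smul "(*)" \<phi> by fact
  have "\<phi> z = \<phi> (\<Sum>b\<in>E. smul (form z b) b)"
   using herm.orthonormal_expansion[OF E(1), of z] E(2) by simp
  thus ?thesis by (simp add: p.sum p.scale)
 qed
 moreover have "finite E" using E(1) by (simp add: herm.orthonormal_def)
 ultimately show ?thesis by blast
qed

lemma op_limit_functional:
 assumes "op_limit k T" "Vector_Spaces.linear smul (*) \<phi>"
 shows "(\<lambda>m. \<phi> (k m z)) \<longlonglongrightarrow> \<phi> (T z)"
proof -
 obtain E c where E: "finite E" "\<And>z. \<phi> z = (\<Sum>b\<in>E. form z b * c b)" using functional_form[OF assms(2)] by blast
 show ?thesis unfolding E(2) using assms(1) by (intro tendsto_sum tendsto_mult tendsto_const) (auto simp: op_limit_def)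
qed

lemma op_limit_automorphism:
 assumes k: "\<And>m. k m \<in> triple_automorphisms" and lim: "op_limit k T"
 shows "T \<in> triple_automorphisms"
proof -
 note kD = automorphismD[OF k]
 have L: "(\<lambda>m. form (k m x) y) \<longlonglongrightarrow> form (T x) y" for x y using lim by (simp add: op_limit_def)
 have add: "T (x + y) = T x + T y" for x y
 proof (rule form_eqI)
  fix v
  have "(\<lambda>m. form (k m (x + y)) v) \<longlonglongrightarrow> form (T x) v + form (T y) v"
   using tendsto_add[OF L[of x v] L[of y v]] by (simp add: linear_addD[OF kD(1)] form_simps)
  thus "form (T (x + y)) v = form (T x + T y) v" using LIMSEQ_unique[OF L[of "x + y" v]] by (simp add: form_simps)
 qed
 have scale: "T (smul a x) = smul a (T x)" for a x
 proof (rule form_eqI)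
  fix v
  have "(\<lambda>m. form (k m (smul a x)) v) \<longlonglongrightarrow> a * form (T x) v"
   using tendsto_mult[OF tendsto_const[of a] L[of x v]] by (simp add: linear_scaleD[OF kD(1)] form_simps)
  thus "form (T (smul a x)) v = form (smul a (T x)) v"
   using LIMSEQ_unique[OF L[of "smul a x" v]] by (simp add: form_simps)
 qed
 have lin: "endo smul T" by (simp add: Vector_Spaces.linear_iff vector_space_axioms add scale)
 obtain E where E: "herm.orthonormal E" "span E = UNIV" using orthonormal_basis_UNIV by blast
 have fin: "finite E" using E(1) by (simp add: herm.orthonormal_def)
 have exp: "z = (\<Sum>b\<in>E. smul (form z b) b)" for z using herm.orthonormal_expansion[OF E(1), of z] E(2) by simp
 have unit: "form (T x) (T y) = form x y" for x y
 proof -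
  have e: "form u v = (\<Sum>b\<in>E. form u b * cnj (form v b))" for u v
  proof -
   have "form u v = form u (\<Sum>b\<in>E. smul (form v b) b)" using exp[of v] by simp
   thus ?thesis by (simp add: herm.ip_sum_right herm.ip_scale_right mult.commute)
  qed
  have "(\<lambda>m. \<Sum>b\<in>E. form (k m x) b * cnj (form (k m y) b)) \<longlonglongrightarrow> (\<Sum>b\<in>E. form (T x) b * cnj (form (T y) b))"
   by (intro tendsto_sum tendsto_mult tendsto_cnj L)
  hence "(\<lambda>m. form (k m x) (k m y)) \<longlonglongrightarrow> form (T x) (T y)" by (simp only: e[symmetric])
  thus ?thesis by (simp add: automorphism_form[OF k] LIMSEQ_const_iff)
 qed
 define G where "G a b c = (\<Sum>p\<in>Basis. \<Sum>q\<in>Basis. \<Sum>s\<in>Basis. smul (crd p a * cnj (crd q b) * crd s c) (tp p q s))" for a b c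
 have G: "tp a b c = G a b c" for a b c
 proof -
  have "tp a b c = tp (\<Sum>p\<in>Basis. smul (crd p a) p) (\<Sum>q\<in>Basis. smul (crd q b) q) (\<Sum>s\<in>Basis. smul (crd s c) s)"
   by (simp only: crd_expansion)
  also have "... = G a b c" unfolding G_def tp_sum_left tp_scale_left unfolding tp_sum_middle tp_scale_middle
   unfolding tp_sum_right tp_scale_right scale_sum_right scale_scale by (simp add: mult.assoc)
  finally show ?thesis .
 qed
 have tpL: "T (tp x y z) = tp (T x) (T y) (T z)" for x y z
 proof (rule form_eqI)
  fix v
  have "(\<lambda>m. form (G (k m x) (k m y) (k m z)) v) \<longlonglongrightarrow> form (G (T x) (T y) (T z)) v"
   unfolding G_def herm.ip_sum_left[OF UNIV_I UNIV_I] herm.ip_scale_left[OF UNIV_I UNIV_I]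
   by (intro tendsto_sum tendsto_mult tendsto_cnj tendsto_const op_limit_functional[OF lim crd_linear])
  hence "(\<lambda>m. form (k m (tp x y z)) v) \<longlonglongrightarrow> form (tp (T x) (T y) (T z)) v" by (simp add: kD(3) flip: G)
  thus "form (T (tp x y z)) v = form (tp (T x) (T y) (T z)) v" using LIMSEQ_unique[OF L] by blast
 qed
 have "inj T"
 proof (rule injI)
  fix x y assume "T x = T y"
  hence "T (x - y) = 0" using add[of "x - y" y] by simp
  hence "form (x - y) (x - y) = 0" using unit[of "x - y" "x - y"] by simp
  thus "x = y" by (simp add: form_definite)
 qed
 hence "bij T" using linear_inj_imp_surj[OF lin] by (simp add: bij_def)
 thus ?thesis using lin tpL by (simp add: triple_automorphisms_def)
qed

lemma op_limit_inverse:
 assumes k: "\<And>m. k m \<in> triple_automorphisms" and lim: "op_limit k T"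
 shows "op_limit (\<lambda>m. opinv (k m)) (opinv T)"
proof -
 have flip: "form (opinv g x) y = form x (g y)" if "g \<in> triple_automorphisms" for g x y
  using automorphism_form[OF that, of "opinv g x" y] automorphismD(2)[OF that] by (simp add: bij_is_surj surj_f_inv_f)
 have "(\<lambda>m. form x (k m y)) \<longlonglongrightarrow> form x (T y)" for x y
 proof -
  have "(\<lambda>m. cnj (form (k m y) x)) \<longlonglongrightarrow> cnj (form (T y) x)"
   using lim by (intro tendsto_cnj) (simp add: op_limit_def)
  thus ?thesis by (simp add: form_cnj)
 qed
 thus ?thesis by (simp add: op_limit_def flip[OF k] flip[OF op_limit_automorphism[OF k lim]])
qed

lemma finite_family_subsequence:
 assumes "finite I" "\<And>i. i \<in> I ==> bounded (range (f i))"
 shows "\<exists>\<sigma>. strict_mono (\<sigma> :: nat => nat) \<and> (\<forall>i\<in>I. convergent (\<lambda>m. f i (\<sigma> m) :: complex))"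
 using assms
proof (induction I)
 case empty
 show ?case by (intro exI[of _ id]) (auto simp: strict_mono_def)
next
 case (insert i I)
 have "\<exists>\<sigma>. strict_mono (\<sigma> :: nat => nat) \<and> (\<forall>j\<in>I. convergent (\<lambda>m. f j (\<sigma> m)))"
  by (rule insert.IH) (rule insert.prems, rule insertI2)
 then obtain \<sigma> :: "nat => nat" where \<sigma>: "strict_mono \<sigma>" "\<forall>j\<in>I. convergent (\<lambda>m. f j (\<sigma> m))" by (elim exE conjE)
 have "bounded (range (\<lambda>m. f i (\<sigma> m)))" by (rule bounded_subset[OF insert.prems[of i]]) auto
 from bounded_imp_convergent_subsequence[OF this]
 obtain l \<rho> where \<rho>: "strict_mono \<rho>" "((\<lambda>m. f i (\<sigma> m)) \<circ> \<rho>) \<longlonglongrightarrow> l" by (elim exE conjE)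
 have "convergent (\<lambda>m. f j (\<sigma> (\<rho> m)))" if "j \<in> I" for j
 proof -
  from bspec[OF \<sigma>(2) that] obtain L where "(\<lambda>m. f j (\<sigma> m)) \<longlonglongrightarrow> L" unfolding convergent_def by (elim exE)
  from LIMSEQ_subseq_LIMSEQ[OF this \<rho>(1)] show ?thesis unfolding convergent_def o_def by (rule exI)
 qed
 moreover have "convergent (\<lambda>m. f i (\<sigma> (\<rho> m)))" using \<rho>(2) by (auto simp: convergent_def o_def)
 moreover have "strict_mono (\<lambda>m. \<sigma> (\<rho> m))" using strict_mono_o[OF \<sigma>(1) \<rho>(1)] unfolding o_def .
 ultimately show ?case by (intro exI[of _ "\<lambda>m. \<sigma> (\<rho> m)"] conjI ballI) auto
qed

text \<open>Automorphisms are unitary for the trace form, so their finitely many matrix coefficients in an orthonormal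
 basis are bounded.\<close>

lemma automorphisms_compact:
 assumes k: "\<And>m. k m \<in> triple_automorphisms"
 shows "\<exists>\<sigma> T. strict_mono (\<sigma> :: nat => nat) \<and> op_limit (\<lambda>m. k (\<sigma> m)) T"
proof -
 obtain E where E: "herm.orthonormal E" "span E = UNIV" using orthonormal_basis_UNIV by blast
 have fin: "finite E" using E(1) by (simp add: herm.orthonormal_def)
 have exp: "z = (\<Sum>b\<in>E. smul (form z b) b)" for z using herm.orthonormal_expansion[OF E(1), of z] E(2) by simp
 define f where "f p m = form (k m (fst p)) (snd p)" for p m
 have "bounded (range (f p))" for p
 proof -
  have "norm (f p m) \<le> Re (form (fst p) (fst p)) + Re (form (snd p) (snd p))" for m
   using form_bound[of "k m (fst p)" "snd p"] by (simp add: f_def automorphism_form[OF k])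
  thus ?thesis by (auto simp: bounded_iff)
 qed
 then obtain \<sigma> where \<sigma>: "strict_mono \<sigma>" "\<forall>p\<in>E \<times> E. convergent (\<lambda>m. f p (\<sigma> m))"
  using finite_family_subsequence[of "E \<times> E" f] fin by blast
 define L where "L b b' = lim (\<lambda>m. form (k (\<sigma> m) b) b')" for b b'
 have L: "(\<lambda>m. form (k (\<sigma> m) b) b') \<longlonglongrightarrow> L b b'" if "b \<in> E" "b' \<in> E" for b b'
  using \<sigma>(2) that unfolding L_def f_def by (intro convergent_LIMSEQ_iff[THEN iffD1]) auto
 define T where "T z = (\<Sum>b\<in>E. \<Sum>b'\<in>E. smul (form z b * L b b') b')" for z
 have "(\<lambda>m. form (k (\<sigma> m) x) y) \<longlonglongrightarrow> form (T x) y" for x y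
 proof -
  have e: "form (k (\<sigma> m) x) y = (\<Sum>b\<in>E. \<Sum>b'\<in>E. form x b * form (k (\<sigma> m) b) b' * form b' y)" for m
  proof -
   interpret km: Vector_Spaces.linear smul smul "k (\<sigma> m)" by (rule automorphismD(1)[OF k])
   have "k (\<sigma> m) x = k (\<sigma> m) (\<Sum>b\<in>E. smul (form x b) b)" using exp[of x] by simp
   also have "... = (\<Sum>b\<in>E. smul (form x b) (k (\<sigma> m) b))" by (simp add: km.sum km.scale)
   also have "... = (\<Sum>b\<in>E. smul (form x b) (\<Sum>b'\<in>E. smul (form (k (\<sigma> m) b) b') b'))"
    using exp by (intro sum.cong refl arg_cong2[of _ _ _ _ smul]) simp
   finally show ?thesis by (simp add: herm.ip_sum_left herm.ip_scale_left sum_distrib_left mult.assoc)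
  qed
  have T: "form (T x) y = (\<Sum>b\<in>E. \<Sum>b'\<in>E. form x b * L b b' * form b' y)"
   by (simp add: T_def herm.ip_sum_left herm.ip_scale_left)
  show ?thesis unfolding e T by (intro tendsto_sum tendsto_mult tendsto_const L)
 qed
 thus ?thesis using \<sigma>(1) by (auto simp: op_limit_def)
qed

lemma End_topology_limit:
 assumes lim: "op_limit k T" and lin: "\<And>m. endo smul (k m)"
  and "openin End_topology W" "T \<in> W"
 shows "eventually (\<lambda>m. k m \<in> W) sequentially"
proof -
 have "generate_topology_on {{T. endo smul T \<and> \<phi> (T z) \<in> U} | \<phi> z U.
    Vector_Spaces.linear smul (*) \<phi> \<and> open U} W"
  using assms(3) by (simp add: End_topology_def openin_topology_generated_by_iff)
 thus ?thesis using \<open>T \<in> W\<close>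
 proof (induction rule: generate_topology_on.induct)
  case (Int a b)
  thus ?case by (auto intro: eventually_conj)
 next
  case (UN K)
  then obtain a where a: "a \<in> K" "T \<in> a" by blast
  hence "eventually (\<lambda>m. k m \<in> a) sequentially" using UN.IH by blast
  thus ?case by (rule eventually_mono) (use a in blast)
 next
  case (Basis s)
  then obtain \<phi> z U where s: "s = {T. endo smul T \<and> \<phi> (T z) \<in> U}"
   "Vector_Spaces.linear smul (*) \<phi>" "open U" by blast
  have "eventually (\<lambda>m. \<phi> (k m z) \<in> U) sequentially"
   using topological_tendstoD[OF op_limit_functional[OF lim s(2)] s(3)] Basis s(1) by simp
  thus ?case using lin by (simp add: s(1))
 qed simp
qed

lemma functional_zero: "Vector_Spaces.linear smul (*) (\<lambda>_. 0)" by unfold_locales (auto simp: algebra_simps)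

lemma topspace_End: "topspace End_topology = {T. endo smul T}"
proof -
 have "\<exists>\<phi> z U. {T. endo smul T} = {T. endo smul T \<and> \<phi> (T z) \<in> U}
   \<and> Vector_Spaces.linear smul (*) \<phi> \<and> open U"
  by (intro exI[of _ "\<lambda>_. 0"] exI[of _ 0] exI[of _ UNIV]) (auto simp: functional_zero)
 thus ?thesis unfolding End_topology_def topology_generated_by_topspace by blast
qed

text \<open>The arguments of the unimodular scaling parameters are shrunk linearly to zero.\<close>

lemma peirce_group_path:
 "g \<in> peirce_group ==> \<exists>A. A 0 = (\<lambda>z. z) \<and> A 1 = g \<and> (\<forall>t::real. A t \<in> peirce_group)
   \<and> (\<forall>z y. continuous_on UNIV (\<lambda>t. form (A t z) y))"
proof (induction rule: peirce_group.induct)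
 case one
 show ?case by (intro exI[of _ "\<lambda>_ z. z"]) (auto intro: peirce_group.one)
next
 case (step g c s)
 then obtain A where A0: "A 0 = (\<lambda>z. z)" "A 1 = g" "\<forall>t::real. A t \<in> peirce_group"
  "\<forall>z y. continuous_on UNIV (\<lambda>t. form (A t z) y)" by (elim exE conjE)
 note A = A0(1,2) A0(3)[rule_format] A0(4)[rule_format]
 define \<theta> where "\<theta> = Arg s"
 have s: "s = cis \<theta>" using rcis_cmod_Arg[of s] step(3) by (simp add: \<theta>_def rcis_def)
 define B where "B t z = peirce_scaling c (cis (\<theta> * t)) (A t z)" for t z
 have "B 0 = (\<lambda>z. z)" "B 1 = (\<lambda>z. peirce_scaling c s (g z))" by (auto simp: B_def A s peirce_scaling_1)
 moreover have "B t \<in> peirce_group" for t unfolding B_def by (rule peirce_group.step[OF A(3) step(2)]) simp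
 moreover have "continuous_on UNIV (\<lambda>t. form (B t z) y)" for z y
 proof -
  have sa: "form (P0 c u) v = form u (P0 c v)" "form (P1 c u) v = form u (P1 c v)" "form (P2 c u) v = form u (P2 c v)" for u v
   by (simp_all add: P0_def P1_def P2_def form_simps form_adjoint)
  have "form (B t z) y = form (A t z) (P0 c y) + cis (\<theta> * t) * form (A t z) (P1 c y)
    + (cis (\<theta> * t))\<^sup>2 * form (A t z) (P2 c y)" for t
   by (simp add: B_def peirce_scaling_def form_simps sa)
  thus ?thesis by (simp only:) (intro continuous_intros A(4))
 qed
 ultimately show ?case by (intro exI[of _ B]) simp
qed

lemma peirce_group_subset_K:
 assumes "g \<in> peirce_group"
 shows "g \<in> K"
proof -
 from peirce_group_path[OF assms] obtain A where A0: "A 0 = (\<lambda>z. z)" "A 1 = g" "\<forall>t::real. A t \<in> peirce_group"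
  "\<forall>z y. continuous_on UNIV (\<lambda>t. form (A t z) y)" by (elim exE conjE)
 note A = A0(1,2) A0(3)[rule_format] A0(4)[rule_format]
 let ?X = "subtopology End_topology triple_automorphisms"
 have cont: "continuous_map euclideanreal ?X A" unfolding continuous_map_in_subtopology
 proof
  show "continuous_map euclideanreal End_topology A" unfolding End_topology_def
  proof (rule continuous_on_generated_topo)
   fix U assume "U \<in> {{T. endo smul T \<and> \<phi> (T z) \<in> U} | \<phi> z U.
    Vector_Spaces.linear smul (*) \<phi> \<and> open U}"
   then obtain \<phi> z W where U: "U = {T. endo smul T \<and> \<phi> (T z) \<in> W}"
    "Vector_Spaces.linear smul (*) \<phi>" "open W" by blast
   obtain E c where E: "finite E" "\<And>z. \<phi> z = (\<Sum>b\<in>E. form z b * c b)" using functional_form[OF U(2)] by blast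
   have "continuous_on UNIV (\<lambda>t. \<phi> (A t z))" unfolding E(2) by (intro continuous_intros A(4))
   hence "open ((\<lambda>t. \<phi> (A t z)) -` W)" using U(3) by (simp add: open_vimage)
   moreover have "A -` U = (\<lambda>t. \<phi> (A t z)) -` W" using peirce_group_linear[OF A(3)] by (auto simp: U(1))
   ultimately show "openin euclideanreal (A -` U \<inter> topspace euclideanreal)" by simp
  next
   have "A ` UNIV \<subseteq> topspace End_topology" using peirce_group_linear[OF A(3)] by (auto simp: topspace_End)
   thus "A ` topspace euclideanreal \<subseteq> \<Union> {{T. endo smul T \<and> \<phi> (T z) \<in> U} | \<phi> z U.
    Vector_Spaces.linear smul (*) \<phi> \<and> open U}"
    unfolding End_topology_def topology_generated_by_topspace by simp
  qed
  show "A \<in> topspace euclideanreal \<rightarrow> triple_automorphisms"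
   using peirce_group_automorphism[OF A(3)] by auto
 qed
 have "connectedin ?X (A ` {0..1})"
  by (rule connectedin_continuous_map_image[OF cont]) (simp add: connectedin_iff_connected)
 moreover have "id \<in> A ` {0..1}" "g \<in> A ` {0..1}"
  using A(1,2) by (auto simp: id_def image_iff intro: bexI[of _ 0] bexI[of _ 1])
 ultimately show ?thesis unfolding K_def connected_component_of_def by blast
qed

lemma K_subset_automorphisms: "K \<subseteq> triple_automorphisms"
proof -
 have "K \<subseteq> topspace (subtopology End_topology triple_automorphisms)"
  unfolding K_def by (rule connected_component_of_subset_topspace)
 thus ?thesis by auto
qed

text \<open>Connected components are closed.\<close>

lemma K_limit:
 assumes k: "\<And>m. k m \<in> peirce_group" and lim: "op_limit k T"
 shows "T \<in> K"
proof (rule ccontr)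
 assume T: "T \<notin> K"
 let ?X = "subtopology End_topology triple_automorphisms"
 have aut: "k m \<in> triple_automorphisms" for m by (rule peirce_group_automorphism[OF k])
 have Taut: "T \<in> triple_automorphisms" by (rule op_limit_automorphism[OF aut lim])
 have "closedin ?X K" unfolding K_def by (rule closedin_connected_component_of)
 hence "openin ?X (topspace ?X - K)" by (simp add: closedin_def)
 then obtain W where W: "openin End_topology W" "topspace ?X - K = W \<inter> triple_automorphisms"
  by (auto simp: openin_subtopology)
 have "T \<in> topspace ?X" using Taut automorphismD(1) by (simp add: topspace_End)
 hence "T \<in> W" using W(2) T by blast
 hence "eventually (\<lambda>m. k m \<in> W) sequentially"
  by (rule End_topology_limit[OF lim automorphismD(1)[OF aut] W(1)])
 then obtain m where "k m \<in> W" by (auto simp: eventually_sequentially)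
 hence "k m \<notin> K" using W(2) aut by blast
 thus False using peirce_group_subset_K[OF k] by blast
qed

end

section \<open>Spectral values and rank\<close>

context hermitian_jordan_triple
begin

text \<open>\<open>S\<close> acts on the outer arguments and \<open>S'\<close> on the middle one; \<open>S\<close> maps the range of \<open>Q_x\<close> onto the range of
 \<open>Q_{S x}\<close>.\<close>

definition structure_pair :: "('a => 'a) => ('a => 'a) => bool" where
 "structure_pair S S' \<longleftrightarrow> endo smul S \<and> bij S \<and> surj S'
   \<and> (\<forall>x y z. tp (S x) (S' y) (S z) = S (tp x y z))"

text \<open>For \<open>z = k (t_1 e_1 + ... + t_n e_n)\<close> with positive \<open>t_i\<close> this is the dimension of the Peirce 2-space of
 \<open>e_1 + ... + e_n\<close>. It replaces the rank because it is controlled by minors and visibly invariant.\<close>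

definition rank_quad :: "'a => nat" where "rank_quad x = dim (range (quad x))"

lemma rank_quad_structure_pair:
 assumes "structure_pair S S'"
 shows "rank_quad (S x) = rank_quad x"
proof -
 interpret pair: finite_dimensional_vector_space_pair smul Basis smul Basis ..
 have S: "endo smul S" "inj S" "surj S'" "\<And>y. quad (S x) (S' y) = S (quad x y)"
  using assms linear_scaleD by (auto simp: structure_pair_def bij_def quad_def)
 have "range (quad (S x)) = S ` range (quad x)"
 proof
  show "range (quad (S x)) \<subseteq> S ` range (quad x)"
  proof (rule image_subsetI)
   fix w
   obtain y where "w = S' y" using S(3) by (meson surjD)
   thus "quad (S x) w \<in> S ` range (quad x)" by (simp add: S(4))
  qed
  show "S ` range (quad x) \<subseteq> range (quad (S x))" by (auto simp flip: S(4))
 qed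
 thus ?thesis using pair.dim_image_eq[OF S(1), of "range (quad x)"] inj_on_subset[OF S(2) subset_UNIV]
  by (simp add: rank_quad_def)
qed

lemma structure_pair_comp:
 "structure_pair S S' ==> structure_pair T T' ==> structure_pair (\<lambda>z. S (T z)) (\<lambda>z. S' (T' z))"
 using bij_comp[of T S] comp_surj[of T' S'] by (auto simp: structure_pair_def Vector_Spaces.linear_iff o_def)

lemma automorphism_structure_pair: "g \<in> triple_automorphisms ==> structure_pair g g"
 by (auto simp: structure_pair_def triple_automorphisms_def bij_def)

lemma peirce_scaling_bij: "tripotent c ==> s \<noteq> 0 ==> bij (peirce_scaling c s)"
 by (rule o_bij[of "peirce_scaling c (1 / s)"]) (auto simp: fun_eq_iff peirce_scaling_mult peirce_scaling_1)

lemma peirce_scaling_structure_pair: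
 "tripotent c ==> s \<noteq> 0 ==> structure_pair (peirce_scaling c s) (peirce_scaling c (cnj (1 / s)))"
 using peirce_scaling_bij[of c s] peirce_scaling_bij[of c "cnj (1 / s)"]
 by (auto simp: structure_pair_def peirce_scaling_linear peirce_scaling_tp bij_def)

lemma range_quad_tripotent: "tripotent c ==> range (quad c) = peirce c 2"
proof -
 assume c: "tripotent c"
 have "w \<in> range (quad c)" if "w \<in> peirce c 2" for w
  using that c rangeI[of "quad c" "quad c w"] by (simp add: peirce_2_iff_quad)
 thus ?thesis using quad_in_peirce[OF c] by blast
qed

lemma rank_quad_tripotent: "tripotent c ==> rank_quad c = dim (peirce c 2)"
 by (simp add: rank_quad_def range_quad_tripotent)

text \<open>A maximising sequence in the group has a limit \<open>T\<close> by compactness. As \<open>g \<circ> k m\<close> again belongs to the group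
 for every \<open>g\<close> in it, the value at \<open>g \<circ> T\<close> is not larger.\<close>

lemma peirce_group_maximum:
 "\<exists>k T. (\<forall>m. k m \<in> peirce_group) \<and> op_limit k T
   \<and> (\<forall>g\<in>peirce_group. Re (form (g (T z)) a) \<le> Re (form (T z) a))"
proof -
 define F where "F g = Re (form (g z) a)" for g
 have bd: "F g \<le> Re (form z z) + Re (form a a)" if "g \<in> peirce_group" for g
  using form_bound[of "g z" a] complex_Re_le_cmod[of "form (g z) a"]
   automorphism_form[OF peirce_group_automorphism[OF that], of z z] by (simp add: F_def)
 hence bdd: "bdd_above (F ` peirce_group)" by (auto simp: bdd_above_def)
 define M where "M = Sup (F ` peirce_group)"
 have ne: "F ` peirce_group \<noteq> {}" using peirce_group.one by blast
 have "\<exists>g\<in>peirce_group. M - 1 / real (Suc m) < F g" for m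
 proof -
  have "M - 1 / real (Suc m) < Sup (F ` peirce_group)" by (simp add: M_def)
  thus ?thesis using less_cSup_iff[OF ne bdd] by auto
 qed
 hence "\<forall>m. \<exists>g. g \<in> peirce_group \<and> M - 1 / real (Suc m) < F g" by blast
 from choice[OF this] obtain k0 where k0': "\<forall>m. k0 m \<in> peirce_group \<and> M - 1 / real (Suc m) < F (k0 m)" by (elim exE)
 have k0: "k0 m \<in> peirce_group" "M - 1 / real (Suc m) < F (k0 m)" for m using spec[OF k0', of m] by simp_all
 have "\<And>m. k0 m \<in> triple_automorphisms" by (rule peirce_group_automorphism[OF k0(1)])
 from automorphisms_compact[of k0, OF this] obtain \<sigma> T
  where \<sigma>: "strict_mono (\<sigma> :: nat => nat)" "op_limit (\<lambda>m. k0 (\<sigma> m)) T" by (elim exE conjE)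
 define k where "k m = k0 (\<sigma> m)" for m
 have k: "k m \<in> peirce_group" "M - 1 / real (Suc m) < F (k m)" for m
 proof -
  show "k m \<in> peirce_group" by (simp add: k_def k0)
  have "m \<le> \<sigma> m" using \<sigma>(1) by (rule strict_mono_imp_increasing)
  hence "1 / real (Suc (\<sigma> m)) \<le> 1 / real (Suc m)" by (simp add: frac_le)
  thus "M - 1 / real (Suc m) < F (k m)" using k0(2)[of "\<sigma> m"] by (simp add: k_def)
 qed
 have lim: "op_limit k T" using \<sigma>(2) by (simp add: k_def[abs_def])
 have "(\<lambda>m. F (k m)) \<longlonglongrightarrow> Re (form (T z) a)"
  unfolding F_def using lim by (intro tendsto_Re) (simp add: op_limit_def)
 moreover have "(\<lambda>m. M - 1 / real (Suc m)) \<longlonglongrightarrow> M - 0"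
  by (intro tendsto_diff tendsto_const LIMSEQ_Suc lim_1_over_n)
 ultimately have M: "M \<le> Re (form (T z) a)"
  by (intro LIMSEQ_le[of "\<lambda>m. M - 1 / real (Suc m)" M "\<lambda>m. F (k m)"]) (auto intro: less_imp_le[OF k(2)] simp del: of_nat_Suc)
 have "Re (form (g (T z)) a) \<le> Re (form (T z) a)" if g: "g \<in> peirce_group" for g
 proof -
  obtain h where h: "h \<in> peirce_group" "\<forall>x. h (g x) = x" "\<forall>x. g (h x) = x"
   using peirce_group_inverse[OF g] by (elim bexE conjE)
  have fl: "form (g x) a = form x (h a)" for x
   using automorphism_form[OF peirce_group_automorphism[OF g], of x "h a"] h(3) by simp
  have "(\<lambda>m. Re (form (k m z) (h a))) \<longlonglongrightarrow> Re (form (T z) (h a))"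
   using lim by (intro tendsto_Re) (simp add: op_limit_def)
  moreover have "Re (form (k m z) (h a)) \<le> M" for m
  proof -
   have "(\<lambda>z. g (k m z)) \<in> peirce_group" by (rule peirce_group_comp[OF g k(1)])
   hence "F (\<lambda>z. g (k m z)) \<le> M" unfolding M_def using bdd by (intro cSup_upper) auto
   thus ?thesis by (simp add: F_def fl)
  qed
  ultimately have "Re (form (T z) (h a)) \<le> M" by (intro LIMSEQ_le_const2[of "\<lambda>m. Re (form (k m z) (h a))"]) auto
  thus ?thesis using M by (simp add: fl)
 qed
 thus ?thesis using k(1) lim by (intro exI[of _ k] exI[of _ T]) simp
qed

text \<open>The derivative of \<open>\<theta> \<mapsto> Re (T_c(exp(i \<theta>)) w | a)\<close> at 0 is \<open>- Im (D(c, c) w | a)\<close>, so \<open>(D(c, c) w | a)\<close> is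
 real for all tripotents \<open>c\<close>. The spectral decomposition extends this to all \<open>D(u, u)\<close>, and polarisation
 turns it into the symmetry \<open>D(a, w) = D(w, a)\<close>.\<close>

lemma critical_point_commutes:
 assumes max: "\<And>g. g \<in> peirce_group ==> Re (form (g w) a) \<le> Re (form w a)"
 shows "tp a w v = tp w a v"
proof -
 have trip: "Im (form (tp c c w) a) = 0" if c: "tripotent c" for c
 proof -
  define \<alpha>0 \<alpha>1 \<alpha>2 where "\<alpha>0 = form (P0 c w) a" and "\<alpha>1 = form (P1 c w) a" and "\<alpha>2 = form (P2 c w) a"
  define f where "f \<theta> = Re \<alpha>0 + (cos \<theta> * Re \<alpha>1 - sin \<theta> * Im \<alpha>1) + (cos (2 * \<theta>) * Re \<alpha>2 - sin (2 * \<theta>) * Im \<alpha>2)" for \<theta> :: real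
  have f: "Re (form (peirce_scaling c (cis \<theta>) w) a) = f \<theta>" for \<theta>
  proof -
   have "form (peirce_scaling c (cis \<theta>) w) a = \<alpha>0 + cis \<theta> * \<alpha>1 + cis (2 * \<theta>) * \<alpha>2"
    by (simp add: peirce_scaling_def form_simps \<alpha>0_def \<alpha>1_def \<alpha>2_def power2_eq_square cis_mult)
   thus ?thesis by (simp add: f_def)
  qed
  have "f \<theta> \<le> f 0" for \<theta>
   using max[OF peirce_group_scaling[OF c, of "cis \<theta>"]] f[of \<theta>] f[of 0] by (simp add: peirce_scaling_1)
  moreover have "(f has_real_derivative - Im \<alpha>1 - 2 * Im \<alpha>2) (at 0)"
   unfolding f_def[abs_def] by (auto intro!: derivative_eq_intros)
  ultimately have "- Im \<alpha>1 - 2 * Im \<alpha>2 = 0"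
   using DERIV_local_max[of f "- Im \<alpha>1 - 2 * Im \<alpha>2" 0 1] by auto
  moreover have "tp c c w = P1 c w + smul 2 (P2 c w)"
  proof -
   have "tp c c w = tp c c (P0 c w) + tp c c (P1 c w) + tp c c (P2 c w)" by (simp flip: tp_add_right add: P_sum)
   thus ?thesis using P_in[OF c, of w] by (simp add: peirce_def)
  qed
  ultimately show ?thesis by (simp add: form_simps \<alpha>1_def \<alpha>2_def)
 qed
 have herm: "Im (form (tp u u w) a) = 0" for u
 proof -
  have "real_closed_under u UNIV" by (simp add: real_closed_under_def)
  then obtain C \<mu> where C: "finite C" "\<And>c. c \<in> C ==> tripotent c" "\<And>c. c \<in> C ==> c \<noteq> 0" "C \<subseteq> UNIV"
   "\<And>c d. c \<in> C ==> d \<in> C ==> c \<noteq> d ==> orthogonal_tripotents c d"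
   and u: "u = (\<Sum>c\<in>C. smul (of_real (\<mu> c)) c)" by (rule spectral_decompositionE) (rule that, assumption+)
  have "tp u u w = (\<Sum>d\<in>C. \<Sum>c\<in>C. smul (of_real (\<mu> c * \<mu> d)) (tp c d w))"
   unfolding u by (simp add: tp_sum_left tp_sum_middle tp_scale_left tp_scale_middle scale_sum_right mult.commute)
  also have "... = (\<Sum>d\<in>C. \<Sum>c\<in>C. if c = d then smul (of_real (\<mu> d * \<mu> d)) (tp d d w) else 0)"
   using orthogonal_tripotentsD(1)[OF C(5)] by (intro sum.cong refl) auto
  also have "... = (\<Sum>d\<in>C. smul (of_real (\<mu> d * \<mu> d)) (tp d d w))" using C(1) by simp
  finally have "form (tp u u w) a = (\<Sum>d\<in>C. complex_of_real (\<mu> d * \<mu> d) * form (tp d d w) a)"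
   by (simp add: herm.ip_sum_left herm.ip_scale_left)
  thus ?thesis using trip[OF C(2)] by simp
 qed
 have pol: "form (tp u v w) a = cnj (form (tp v u w) a)" for u v
 proof -
  have 1: "Im (form (tp u v w) a) + Im (form (tp v u w) a) = 0" for u v
   using herm[of "u + v"] herm[of u] herm[of v] by (simp add: tp_simps form_simps)
  have "Re (form (tp u v w) a) - Re (form (tp v u w) a) = 0" using 1[of "smul \<i> u" v]
   by (simp only: tp_scale_left tp_scale_middle form_simps) simp
  thus ?thesis using 1[of u v] by (simp add: complex_eq_iff)
 qed
 show ?thesis
 proof (rule form_eqI)
  fix u
  have "form u (tp a w v) = form (tp w a u) v" by (simp add: form_adjoint)
  also have "... = form (tp u a w) v" by (simp add: tp_commute[of w a u])
  also have "... = form w (tp a u v)" by (rule form_adjoint)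
  also have "... = form w (tp v u a)" by (simp add: tp_commute[of a u v])
  also have "... = form (tp u v w) a" by (simp add: form_adjoint)
  also have "... = cnj (form (tp v u w) a)" by (rule pol)
  also have "... = form a (tp v u w)" by (simp add: form_cnj)
  also have "... = form (tp u v a) w" by (simp add: form_adjoint)
  also have "... = form (tp a v u) w" by (simp add: tp_commute[of u v a])
  also have "... = form u (tp v a w)" by (simp add: form_adjoint)
  also have "... = form u (tp w a v)" by (simp add: tp_commute[of v a w])
  finally have "cnj (form u (tp a w v)) = cnj (form u (tp w a v))" by simp
  thus "form (tp a w v) u = form (tp w a v) u" by (simp add: form_cnj)
 qed
qed

end

(* keeps the index range {1..r} in this form *)
declare One_nat_def [simp del]

context framed_triple
begin

abbreviation diag :: "(nat => real) => 'a" where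
 "diag t \<equiv> (\<Sum>i=1..r. smul (of_real (t i)) (e i))"

lemma diag_delta:
 assumes "i \<in> {1..r}" "\<And>j. j \<in> {1..r} ==> j \<noteq> i ==> h j = 0"
 shows "(\<Sum>j=1..r. h j) = (h i :: 'b::comm_monoid_add)"
 using assms by (subst sum.remove[of _ i]) (auto intro!: sum.neutral)

text \<open>Both sides of the commutation relation are evaluated at \<open>e p\<close>. For the component \<open>v\<close> of \<open>w\<close> joining \<open>e p\<close>
 and \<open>e q\<close> the relation at \<open>p\<close> and at \<open>q\<close> gives \<open>a_p\<^sup>2 v = a_q\<^sup>2 v\<close>, so \<open>v = 0\<close>. The relation between the
 Peirce 2-parts says that the diagonal components are fixed by \<open>Q\<close>, that is, real.\<close>

lemma commuting_diagonal:
 assumes a: "\<And>i. i \<in> {1..r} ==> a i > 0" "\<And>i j. i \<in> {1..r} ==> j \<in> {1..r} ==> i \<noteq> j ==> a i \<noteq> a j"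
  and comm: "\<And>v. tp (diag a) w v = tp w (diag a) v"
 shows "\<exists>t. w = diag t"
proof -
 have key: "smul (of_real (a p)) (tp (e p) (e p) w) = (\<Sum>i=1..r. smul (of_real (a i)) (tp (e i) w (e p)))"
  if p: "p \<in> {1..r}" for p
 proof -
  have "tp w (diag a) (e p) = (\<Sum>i=1..r. smul (of_real (a i)) (tp w (e i) (e p)))"
   by (simp add: tp_sum_middle tp_scale_middle)
  also have "... = (\<Sum>i=1..r. smul (of_real (a i)) (tp (e p) (e i) w))" by (simp add: tp_commute[of w])
  also have "... = smul (of_real (a p)) (tp (e p) (e p) w)"
   using p frame_orthogonalD(1)[OF p] by (intro diag_delta) auto
  finally show ?thesis using comm[of "e p"] by (simp add: tp_sum_left tp_scale_left)
 qed
 note trip = frame_tripotent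
 have mem2: "e p \<in> peirce (e p) 2" if "p \<in> {1..r}" for p using tripotent_in_peirce_2[OF trip[OF that]] .
 have mem0: "e i \<in> peirce (e p) 0" if "p \<in> {1..r}" "i \<in> {1..r}" "i \<noteq> p" for p i
  using frame_orthogonalD(4)[OF that(2,1,3)] .
 have orth: "orthogonal_tripotents (e i) (e p)" if "p \<in> {1..r}" "i \<in> {1..r}" "i \<noteq> p" for p i
  using frame_orthogonal[OF that(2,1,3)] .
 have proj: "T (\<Sum>i\<in>A. g i) = (\<Sum>i\<in>A. T (g i))" if "endo smul T" for T g and A :: "nat set"
 proof -
  interpret T: Vector_Spaces.linear smul smul T by fact
  show ?thesis by (rule T.sum)
 qed
 \<comment> \<open>the projections of both sides of \<open>key\<close> to the Peirce 1-space\<close>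
 define x where "x p = P1 (e p) w" for p
 have xmem: "x p \<in> peirce (e p) 1" if "p \<in> {1..r}" for p using P_in(2)[OF trip[OF that]] by (simp add: x_def)
 have P1tp: "P1 (e p) (tp (e i) w (e p)) = tp (e i) (x p) (e p)" if p: "p \<in> {1..r}" and i: "i \<in> {1..r}" "i \<noteq> p" for p i
 proof -
  note tp = trip[OF p]
  have w: "w = P0 (e p) w + x p + P2 (e p) w" by (simp add: x_def P_sum)
  have m: "tp (e i) v (e p) \<in> peirce (e p) (2 - k)" if "v \<in> peirce (e p) k" for v k
   using peirce_mult[OF mem0[OF p i] that mem2[OF p]] by simp
  have "tp (e i) w (e p) = tp (e i) (P0 (e p) w) (e p) + tp (e i) (x p) (e p) + tp (e i) (P2 (e p) w) (e p)"
   by (subst w) (simp add: tp_simps)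
  thus ?thesis using m[OF P_in(1)[OF tp]] m[OF xmem[OF p]] m[OF P_in(3)[OF tp]] P_eq[OF tp]
   by (simp add: linear_addD[OF P_linear(2)])
 qed
 have P1pp: "P1 (e p) (tp (e p) w (e p)) = 0" if p: "p \<in> {1..r}" for p
 proof -
  have "quad (e p) w \<in> peirce (e p) 2" by (rule quad_in_peirce[OF trip[OF p]])
  hence "P1 (e p) (smul 2 (quad (e p) w)) = 0" using P_eq(3)[OF trip[OF p]] peirce_closed(3) by blast
  thus ?thesis by (simp add: quad_def)
 qed
 have P1L: "P1 c (tp c c w) = P1 c w" if "tripotent c" for c
 proof -
  have "tp c c w = tp c c (P0 c w) + tp c c (P1 c w) + tp c c (P2 c w)" by (simp flip: tp_add_right add: P_sum)
  also have "... = P1 c w + smul 2 (P2 c w)" using P_in[OF that, of w] by (simp add: peirce_def)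
  finally show ?thesis using P_in[OF that, of w] P_eq[OF that]
   by (simp add: linear_addD[OF P_linear(2)] linear_scaleD[OF P_linear(2)])
 qed
 have key1: "smul (of_real (a p)) (x p) = (\<Sum>i\<in>{1..r} - {p}. smul (of_real (a i)) (tp (e i) (x p) (e p)))"
  if p: "p \<in> {1..r}" for p
 proof -
  have "smul (of_real (a p)) (x p) = P1 (e p) (smul (of_real (a p)) (tp (e p) (e p) w))"
   by (simp add: linear_scaleD[OF P_linear(2)] P1L[OF trip[OF p]] x_def)
  also have "... = (\<Sum>i=1..r. smul (of_real (a i)) (P1 (e p) (tp (e i) w (e p))))"
   unfolding key[OF p] by (simp add: proj[OF P_linear(2)] linear_scaleD[OF P_linear(2)])
  also have "... = (\<Sum>i\<in>{1..r} - {p}. smul (of_real (a i)) (P1 (e p) (tp (e i) w (e p))))"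
   using p by (subst sum.remove[of _ p]) (auto simp: P1pp)
  also have "... = (\<Sum>i\<in>{1..r} - {p}. smul (of_real (a i)) (tp (e i) (x p) (e p)))"
   using p by (intro sum.cong refl arg_cong2[of _ _ _ _ smul] P1tp) auto
  finally show ?thesis .
 qed
 \<comment> \<open>the component joining two frame elements\<close>
 have comm_P: "P1 (e q) (P1 (e p) w) = P1 (e p) (P1 (e q) w)" if "p \<in> {1..r}" "q \<in> {1..r}" for p q
 proof -
  have "tp (e p) (e p) (tp (e q) (e q) v) = tp (e q) (e q) (tp (e p) (e p) v)" for v
   using orthogonal_commute[OF orth[OF that(2,1)]] by (cases "p = q") auto
  thus ?thesis by (simp add: P1_def tp_simps) (rule crd_eqI, simp add: crd_simps algebra_simps)
 qed
 have join: "smul (of_real (a p)) (P1 (e q) (x p)) = smul (of_real (a q)) (tp (e q) (P1 (e q) (x p)) (e p))"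
  if p: "p \<in> {1..r}" and q: "q \<in> {1..r}" and pq: "p \<noteq> q" for p q
 proof -
  have z: "P1 (e q) (tp (e i) (x p) (e p)) = (if i = q then tp (e q) (P1 (e q) (x p)) (e p) else 0)"
   if i: "i \<in> {1..r} - {p}" for i
  proof -
   note tq = trip[OF q]
   define j where "j = (if i = q then 2 else 0 :: int)"
   have ei: "e i \<in> peirce (e q) j" using mem2[OF q] mem0[OF q, of i] i by (auto simp: j_def)
   have m: "tp (e i) v (e p) \<in> peirce (e q) (j - k)" if "v \<in> peirce (e q) k" for v k
    using peirce_mult[OF ei that mem0[OF q p pq]] by simp
   have x: "x p = P0 (e q) (x p) + P1 (e q) (x p) + P2 (e q) (x p)" by (simp add: P_sum)
   have t: "tp (e i) (x p) (e p) = tp (e i) (P0 (e q) (x p)) (e p) + tp (e i) (P1 (e q) (x p)) (e p) + tp (e i) (P2 (e q) (x p)) (e p)"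
    by (subst x) (simp add: tp_simps)
   note ms = m[OF P_in(1)[OF tq, of "x p"]] m[OF P_in(2)[OF tq, of "x p"]] m[OF P_in(3)[OF tq, of "x p"]]
   show ?thesis
   proof (cases "i = q")
    case True
    thus ?thesis unfolding t using ms P_eq[OF tq] by (simp add: linear_addD[OF P_linear(2)] j_def)
   next
    case False
    hence j: "j = 0" by (simp add: j_def)
    have "tp (e i) (P1 (e q) (x p)) (e p) = 0" "tp (e i) (P2 (e q) (x p)) (e p) = 0"
     using peirce_trivial[OF tq ms(2)] peirce_trivial[OF tq ms(3)] j by simp_all
    thus ?thesis unfolding t using ms(1) P_eq(1)[OF tq] False by (simp add: linear_addD[OF P_linear(2)] j)
   qed
  qed
  have "smul (of_real (a p)) (P1 (e q) (x p)) = P1 (e q) (smul (of_real (a p)) (x p))"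
   by (simp add: linear_scaleD[OF P_linear(2)])
  also have "... = (\<Sum>i\<in>{1..r} - {p}. smul (of_real (a i)) (P1 (e q) (tp (e i) (x p) (e p))))"
   unfolding key1[OF p] by (simp add: proj[OF P_linear(2)] linear_scaleD[OF P_linear(2)])
  also have "... = (\<Sum>i\<in>{1..r} - {p}. if i = q then smul (of_real (a q)) (tp (e q) (P1 (e q) (x p)) (e p)) else 0)"
   by (intro sum.cong refl) (simp add: z)
  also have "... = smul (of_real (a q)) (tp (e q) (P1 (e q) (x p)) (e p))" using q pq by simp
  finally show ?thesis .
 qed
 have none: "P1 (e q) (x p) = 0" if p: "p \<in> {1..r}" and q: "q \<in> {1..r}" and pq: "p \<noteq> q" for p q
 proof -
  define v where "v = P1 (e q) (x p)"
  define u where "u = tp (e q) v (e p)"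
  have v': "v = P1 (e p) (x q)" using comm_P[OF p q] by (simp add: v_def x_def)
  have 1: "smul (of_real (a p)) v = smul (of_real (a q)) u" using join[OF p q pq] by (simp add: v_def u_def)
  have 2: "smul (of_real (a q)) v = smul (of_real (a p)) u"
   using join[OF q p] pq unfolding v'[symmetric] u_def tp_commute[of "e p" v "e q"] by simp
  have "smul (of_real (a p * a p)) v = smul (of_real (a p)) (smul (of_real (a p)) v)" by simp
  also have "... = smul (of_real (a q)) (smul (of_real (a p)) u)" unfolding 1 by (simp add: mult.commute)
  also have "... = smul (of_real (a q * a q)) v" unfolding 2[symmetric] by simp
  finally have "v = 0 \<or> complex_of_real (a p * a p) = complex_of_real (a q * a q)" by (simp only: scale_cancel_right) blast
  moreover have "a p * a p \<noteq> a q * a q"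
   using a(1)[OF p] a(1)[OF q] a(2)[OF p q pq] by (simp add: square_eq_iff flip: power2_eq_square)
  ultimately show ?thesis by (simp add: v_def flip: of_real_mult)
 qed
 have x0: "x p = 0" if p: "p \<in> {1..r}" for p
 proof -
  have "tp (e i) (x p) (e p) = 0" if i: "i \<in> {1..r} - {p}" for i
  proof -
   have ir: "i \<in> {1..r}" "p \<noteq> i" using i by auto
   note ti = trip[OF ir(1)]
   have oip: "orthogonal_tripotents (e i) (e p)" using orth[OF p ir(1)] ir by simp
   have "P2 (e i) (x p) \<in> peirce (e p) 1" by (rule orthogonal_P_commute[OF oip xmem[OF p]])
   moreover have "P2 (e i) (x p) \<in> peirce (e p) 0" by (rule orthogonal_peirce_2_subset[OF oip P_in(3)[OF ti]])
   ultimately have "P2 (e i) (x p) = 0" using peirce_disjoint[of _ "e p" 1 0] by simp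
   hence "x p = P0 (e i) (x p)" using none[OF p ir] P_sum[of "e i" "x p"] by simp
   hence "x p \<in> peirce (e i) 0" using P_in(1)[OF ti] by metis
   thus ?thesis by (rule tp_tripotent_peirce_0(1)[OF ti])
  qed
  hence "smul (of_real (a p)) (x p) = 0" unfolding key1[OF p] by simp
  thus ?thesis using a(1)[OF p] by simp
 qed
 define y where "y p = P2 (e p) w" for p
 have ymem: "y p \<in> peirce (e p) 2" if "p \<in> {1..r}" for p using P_in(3)[OF trip[OF that]] by (simp add: y_def)
 have "w - (\<Sum>p=1..r. y p) = 0"
 proof (rule frame_peirce_0)
  fix i assume i: "i \<in> {1..r}"
  have "tp (e i) (e i) (y p) = 0" if "p \<in> {1..r}" "p \<noteq> i" for p
   using orthogonal_peirce_2_subset[OF orth[OF i that] ymem[OF that(1)]] by (simp add: peirce_0_iff)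
  hence "(\<Sum>p=1..r. tp (e i) (e i) (y p)) = tp (e i) (e i) (y i)" using i by (intro diag_delta) auto
  also have "... = smul 2 (y i)" using ymem[OF i] by (simp add: peirce_def)
  also have "... = tp (e i) (e i) (P0 (e i) w + x i + y i)"
   using P_in(1)[OF trip[OF i], of w] ymem[OF i] x0[OF i] by (simp add: tp_simps peirce_def)
  also have "P0 (e i) w + x i + y i = w" by (simp add: x_def y_def P_sum)
  finally show "w - (\<Sum>p=1..r. y p) \<in> peirce (e i) 0" by (simp add: peirce_0_iff tp_simps tp_sum_right)
 qed
 hence w: "w = (\<Sum>p=1..r. y p)" by simp
 have ex: "\<exists>t. y p = smul (of_real t) (e p)" if p: "p \<in> {1..r}" for p
 proof (rule minimal_tripotent_real[OF frame_minimal[OF p]])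
  \<comment> \<open>the projection of \<open>key\<close> to the Peirce 2-space\<close>
  have "tp (e i) w (e p) = 0" if i: "i \<in> {1..r}" "i \<noteq> p" for i
  proof -
   have "tp (e i) (y q) (e p) = 0" if q: "q \<in> {1..r}" for q
   proof (cases "q = p")
    case True
    thus ?thesis using peirce_2_0_orthogonal(2)[OF trip[OF p] ymem[OF p] mem0[OF p i]] by simp
   next
    case False
    have "y q \<in> peirce (e p) 0"
     by (rule orthogonal_peirce_2_subset[OF _ ymem[OF q]]) (use orth[OF p q] False in simp)
    hence "tp (e p) (y q) (e i) = 0" by (rule tp_tripotent_peirce_0(1)[OF trip[OF p]])
    thus ?thesis by (simp add: tp_commute[of "e i" _ "e p"])
   qed
   thus ?thesis by (simp add: w tp_sum_middle)
  qed
  hence "(\<Sum>i=1..r. smul (of_real (a i)) (tp (e i) w (e p))) = smul (of_real (a p)) (tp (e p) w (e p))"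
   using p by (intro diag_delta) auto
  hence "smul (of_real (a p)) (tp (e p) (e p) w) = smul (of_real (a p)) (tp (e p) w (e p))" using key[OF p] by simp
  hence eq: "tp (e p) (e p) w = tp (e p) w (e p)" using a(1)[OF p] by simp
  have wd: "w = P0 (e p) w + y p" using x0[OF p] P_sum[of "e p" w] by (simp add: x_def y_def)
  have "tp (e p) (e p) w = smul 2 (y p)"
   using P_in(1)[OF trip[OF p], of w] ymem[OF p] by (subst wd) (simp add: tp_simps peirce_def)
  moreover have "tp (e p) w (e p) = tp (e p) (y p) (e p)"
   using quad_peirce_01[OF trip[OF p], of "P0 (e p) w"] P_in(1)[OF trip[OF p], of w] by (subst wd) (simp add: tp_simps)
  ultimately show "quad (e p) (y p) = y p" using eq by (simp add: quad_fixed_tp)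
 qed
 define t where "t p = (SOME t. y p = smul (of_real t) (e p))" for p
 have t: "y p = smul (of_real (t p)) (e p)" if "p \<in> {1..r}" for p unfolding t_def by (rule someI_ex[OF ex[OF that]])
 have "w = diag t" unfolding w by (rule sum.cong[OF refl t])
 thus ?thesis by (rule exI[of _ t])
qed

lemma frame_sum_Suc: "frame_sum {1..Suc n} = frame_sum {1..n} + e (Suc n)"
 by (simp add: frame_sum_def atLeastAtMostSuc_conv add.commute)

definition peirce_dim :: "nat => nat" where "peirce_dim n = dim (peirce (frame_sum {1..n}) 2)"

lemma peirce_dim_Suc: "Suc n \<le> r ==> peirce_dim n < peirce_dim (Suc n)" unfolding peirce_dim_def frame_sum_Suc
 by (rule dim_peirce_strict) (use frame_sum_tripotent[of "{1..n}"] frame_nonzero[of "Suc n"] in auto)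

lemma peirce_dim_strict: "m < n ==> n \<le> r ==> peirce_dim m < peirce_dim n"
proof (induction n)
 case (Suc n)
 thus ?case using peirce_dim_Suc[of n] by (cases "m = n") auto
qed simp

lemma peirce_dim_le_iff: "m \<le> r ==> n \<le> r ==> peirce_dim m \<le> peirce_dim n \<longleftrightarrow> m \<le> n"
 using peirce_dim_strict[of m n] peirce_dim_strict[of n m] by (cases m n rule: linorder_cases) auto

text \<open>A product of Peirce scalings of the \<open>e i\<close> with parameters \<open>sqrt (t i)\<close>, as \<open>e i\<close> has Peirce degree 2.\<close>

lemma frame_scaling:
 assumes "A \<subseteq> {1..r}" "\<And>i. i \<in> A ==> t i > 0"
 shows "\<exists>S S'. structure_pair S S' \<and> S (frame_sum A) = (\<Sum>i\<in>A. smul (of_real (t i)) (e i))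
  \<and> (\<forall>j\<in>{1..r} - A. S (e j) = e j)" using finite_subset[OF assms(1) finite_atLeastAtMost] assms
proof (induction A)
 case empty
 show ?case
 proof (intro exI conjI)
  show "structure_pair (\<lambda>z. z) (\<lambda>z. z)"
   using automorphism_structure_pair[OF peirce_group_automorphism[OF peirce_group.one]] .
 qed (simp_all add: frame_sum_def)
next
 case (insert i A)
 have ir: "i \<in> {1..r}" and Ar: "A \<subseteq> {1..r}" using insert.prems by auto
 have "\<exists>S S'. structure_pair S S' \<and> S (frame_sum A) = (\<Sum>i\<in>A. smul (of_real (t i)) (e i))
  \<and> (\<forall>j\<in>{1..r} - A. S (e j) = e j)" by (rule insert.IH[OF Ar insert.prems(2)]) simp
 then obtain S S' where S: "structure_pair S S'" "S (frame_sum A) = (\<Sum>i\<in>A. smul (of_real (t i)) (e i))"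
  "\<forall>j\<in>{1..r} - A. S (e j) = e j" by (elim exE conjE)
 define s where "s = complex_of_real (sqrt (t i))"
 have s: "s \<noteq> 0" "s\<^sup>2 = complex_of_real (t i)"
  using insert.prems(2)[of i] by (auto simp: s_def simp flip: of_real_power)
 define T where "T = peirce_scaling (e i) s"
 note Tlin = peirce_scaling_linear[of "e i" s, folded T_def]
 have Ti: "T (e i) = smul (of_real (t i)) (e i)"
  using peirce_scaling_eigen[OF frame_tripotent[OF ir] tripotent_in_peirce_2[OF frame_tripotent[OF ir]], of s] s(2)
  by (simp add: T_def)
 have Tj: "T (e j) = e j" if "j \<in> {1..r}" "j \<noteq> i" for j
  using peirce_scaling_eigen[OF frame_tripotent[OF ir] frame_orthogonalD(4)[OF that(1) ir that(2)], of s]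
  by (simp add: T_def)
 have Si: "S (e i) = e i" by (rule bspec[OF S(3)]) (use insert.hyps ir in simp)
 have Slin: "endo smul S" using S(1) by (simp add: structure_pair_def)
 show ?case
 proof (intro exI conjI ballI)
  show "structure_pair (\<lambda>z. T (S z)) (\<lambda>z. peirce_scaling (e i) (cnj (1 / s)) (S' z))" unfolding T_def
   by (rule structure_pair_comp[OF peirce_scaling_structure_pair[OF frame_tripotent[OF ir] s(1)] S(1)])
  have "T (\<Sum>i\<in>A. smul (of_real (t i)) (e i)) = (\<Sum>i\<in>A. T (smul (of_real (t i)) (e i)))"
  proof -
   interpret T: Vector_Spaces.linear smul smul T by (rule Tlin)
   show ?thesis by (rule T.sum)
  qed
  also have "... = (\<Sum>i\<in>A. smul (of_real (t i)) (e i))"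
  proof (rule sum.cong[OF refl])
   fix j assume "j \<in> A"
   hence "j \<in> {1..r}" "j \<noteq> i" using Ar insert.hyps by auto
   hence "T (e j) = e j" by (rule Tj)
   thus "T (smul (of_real (t j)) (e j)) = smul (of_real (t j)) (e j)" by (simp only: linear_scaleD[OF Tlin])
  qed
  finally have TA: "T (S (frame_sum A)) = (\<Sum>i\<in>A. smul (of_real (t i)) (e i))" by (simp only: S(2))
  have "frame_sum (insert i A) = e i + frame_sum A" using insert.hyps by (simp add: frame_sum_def)
  hence "T (S (frame_sum (insert i A))) = T (S (e i)) + T (S (frame_sum A))"
   by (simp only: linear_addD[OF Slin] linear_addD[OF Tlin])
  also have "... = (\<Sum>i\<in>insert i A. smul (of_real (t i)) (e i))" using insert.hyps by (simp add: Si Ti TA)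
  finally show "T (S (frame_sum (insert i A))) = (\<Sum>i\<in>insert i A. smul (of_real (t i)) (e i))" .
  fix j assume j: "j \<in> {1..r} - insert i A"
  have "S (e j) = e j" by (rule bspec[OF S(3)]) (use j in simp)
  thus "T (S (e j)) = e j" using Tj[of j] j by simp
 qed
qed

lemma support_initial:
 assumes "\<forall>i\<in>{1..r}. 0 \<le> t i" "\<forall>i\<in>{1..r}. \<forall>j\<in>{1..r}. i \<le> j --> t j \<le> (t i :: real)"
 shows "{i \<in> {1..r}. t i \<noteq> 0} = {1..card {i \<in> {1..r}. t i \<noteq> 0}}"
proof -
 define A where "A = {i \<in> {1..r}. t i \<noteq> 0}"
 have down: "j \<in> A" if "i \<in> A" "1 \<le> j" "j \<le> i" for i j
 proof -
  have ij: "i \<in> {1..r}" "j \<in> {1..r}" using that by (auto simp: A_def)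
  have "t i > 0" using assms(1) that(1) by (force simp: A_def)
  moreover have "t i \<le> t j" using assms(2) ij that(3) by blast
  ultimately show ?thesis using ij(2) by (simp add: A_def)
 qed
 have fin: "finite A" by (simp add: A_def)
 have "A = {1..card A}"
 proof (cases "A = {}")
  case False
  define n where "n = Max A"
  have n: "n \<in> A" "\<And>i. i \<in> A ==> i \<le> n" using fin False by (simp_all add: n_def)
  have "A = {1..n}"
  proof
   show "A \<subseteq> {1..n}" using n(2) by (auto simp: A_def)
   show "{1..n} \<subseteq> A" using down[OF n(1)] by auto
  qed
  thus ?thesis by simp
 qed simp
 thus ?thesis by (simp add: A_def)
qed

lemma spectral_values_rank:
 assumes "spectral_values r e z t"
 shows "rank_quad z = peirce_dim (card {i \<in> {1..r}. t i \<noteq> 0})" "card {i \<in> {1..r}. t i \<noteq> 0} \<le> r"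
proof -
 define n where "n = card {i \<in> {1..r}. t i \<noteq> 0}"
 have t: "\<forall>i\<in>{1..r}. 0 \<le> t i" "\<forall>i\<in>{1..r}. \<forall>j\<in>{1..r}. i \<le> j --> t j \<le> t i"
  using assms by (auto simp: spectral_values_def)
 have supp: "{i \<in> {1..r}. t i \<noteq> 0} = {1..n}" unfolding n_def by (rule support_initial[OF t])
 have "card {i \<in> {1..r}. t i \<noteq> 0} \<le> card {1..r}" by (intro card_mono) auto
 thus nr: "card {i \<in> {1..r}. t i \<noteq> 0} \<le> r" by simp
 have nsub: "{1..n} \<subseteq> {1..r}" using supp by blast
 obtain k where k: "k \<in> K" "z = k (diag t)" using assms unfolding spectral_values_def by blast
 have diag: "diag t = (\<Sum>i\<in>{1..n}. smul (of_real (t i)) (e i))"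
  unfolding supp[symmetric] by (rule sum.mono_neutral_right) auto
 have pos: "t i > 0" if "i \<in> {1..n}" for i using that t(1) unfolding supp[symmetric] by force
 have "\<exists>S S'. structure_pair S S' \<and> S (frame_sum {1..n}) = (\<Sum>i\<in>{1..n}. smul (of_real (t i)) (e i))
  \<and> (\<forall>j\<in>{1..r} - {1..n}. S (e j) = e j)" by (rule frame_scaling[OF nsub]) (rule pos)
 then obtain S S' where S1: "structure_pair S S'"
  and S2: "S (frame_sum {1..n}) = (\<Sum>i\<in>{1..n}. smul (of_real (t i)) (e i))" by (elim exE conjE)
 have S: "structure_pair S S'" "S (frame_sum {1..n}) = diag t" by (rule S1) (simp only: S2 diag)
 have trip: "tripotent (frame_sum {1..n})" using frame_sum_tripotent[OF nsub] by blast
 have "rank_quad z = rank_quad (diag t)"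
  using rank_quad_structure_pair[OF automorphism_structure_pair[of k], of "diag t"] k K_subset_automorphisms by auto
 also have "... = rank_quad (frame_sum {1..n})" using rank_quad_structure_pair[OF S(1)] S(2) by metis
 also have "... = peirce_dim n" by (simp add: rank_quad_tripotent[OF trip] peirce_dim_def)
 finally show "rank_quad z = peirce_dim (card {i \<in> {1..r}. t i \<noteq> 0})" by (simp add: n_def)
qed

end

context irreducible_framed_triple
begin

text \<open>Two kinds of group elements are compared with the identity: the Peirce scaling of \<open>e i\<close> by the imaginary
 unit, which only changes the sign of \<open>e i\<close>, and the exchange of two frame elements, which preserves their
 length \<open>N\<close>.\<close>

lemma frame_sorted_maximum:
 assumes max: "\<And>g. g \<in> peirce_group ==> Re (form (g (diag t)) (diag a)) \<le> Re (form (diag t) (diag a))"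
  and a: "\<And>i. i \<in> {1..r} ==> a i > 0" "\<And>i j. i \<in> {1..r} ==> j \<in> {1..r} ==> i < j ==> a j < a i"
 shows "\<forall>i\<in>{1..r}. 0 \<le> t i" "\<forall>i\<in>{1..r}. \<forall>j\<in>{1..r}. i \<le> j --> t j \<le> t i"
proof -
 define da where "da = diag a"
 define N where "N i = Re (form (e i) (e i))" for i
 have Npos: "N i > 0" if "i \<in> {1..r}" for i using form_pos[OF frame_nonzero[OF that]] by (simp add: N_def)
 have orth: "form (e i) (e j) = 0" if "i \<in> {1..r}" "j \<in> {1..r}" "i \<noteq> j" for i j
 proof -
  have "tp (e i) (e j) = (\<lambda>w. smul 0 w)" using frame_orthogonalD(1)[OF that] by auto
  thus ?thesis using lin_trace_scale[of 0 "\<lambda>w. w"] by (simp add: form_def)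
 qed
 have pair: "Re (form (e i) da) = a i * N i" if i: "i \<in> {1..r}" for i
 proof -
  have "form (e i) da = (\<Sum>j=1..r. complex_of_real (a j) * form (e i) (e j))"
   by (simp add: da_def herm.ip_sum_right herm.ip_scale_right)
  also have "... = complex_of_real (a i) * form (e i) (e i)" using i orth by (intro diag_delta) auto
  finally show ?thesis by (simp add: N_def)
 qed
 have glin: "Re (form (g (diag t)) da) = (\<Sum>j=1..r. t j * Re (form (g (e j)) da))" if "g \<in> peirce_group" for g
 proof -
  interpret g: Vector_Spaces.linear smul smul g by (rule peirce_group_linear[OF that])
  show ?thesis by (simp add: g.sum g.scale herm.ip_sum_left herm.ip_scale_left)
 qed
 have base: "Re (form (diag t) da) = (\<Sum>j=1..r. t j * (a j * N j))" using glin[OF peirce_group.one] pair by simp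
 show "\<forall>i\<in>{1..r}. 0 \<le> t i"
 proof
  fix i assume i: "i \<in> {1..r}"
  define g where "g = peirce_scaling (e i) \<i>"
  have g: "g \<in> peirce_group" unfolding g_def by (rule peirce_group_scaling[OF frame_tripotent[OF i]]) simp
  have gi: "g (e i) = smul (-1) (e i)"
   using peirce_scaling_eigen[OF frame_tripotent[OF i] tripotent_in_peirce_2[OF frame_tripotent[OF i]], of \<i>]
   by (simp add: g_def)
  have gj: "g (e j) = e j" if "j \<in> {1..r}" "j \<noteq> i" for j
   using peirce_scaling_eigen[OF frame_tripotent[OF i] frame_orthogonalD(4)[OF that(1) i that(2)], of \<i>]
   by (simp add: g_def)
  have "(\<Sum>j=1..r. t j * Re (form (g (e j)) da)) \<le> (\<Sum>j=1..r. t j * (a j * N j))"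
   using max[OF g, folded da_def] glin[OF g] base by simp
  moreover have "(\<Sum>j=1..r. t j * Re (form (g (e j)) da)) = t i * (- (a i * N i)) + (\<Sum>j\<in>{1..r} - {i}. t j * (a j * N j))"
   using i gj by (subst sum.remove[of _ i]) (auto simp: gi pair herm.ip_scale_left simp del: scale_minus_left scale_one intro!: sum.cong)
  moreover have "(\<Sum>j=1..r. t j * (a j * N j)) = t i * (a i * N i) + (\<Sum>j\<in>{1..r} - {i}. t j * (a j * N j))"
   using i by (intro sum.remove) auto
  ultimately have "0 \<le> t i * (a i * N i)" by simp
  moreover have "0 < a i * N i" using a(1)[OF i] Npos[OF i] by simp
  ultimately show "0 \<le> t i" by (simp add: zero_le_mult_iff)
 qed
 show "\<forall>i\<in>{1..r}. \<forall>j\<in>{1..r}. i \<le> j --> t j \<le> t i"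
 proof (intro ballI impI)
  fix i j assume i: "i \<in> {1..r}" and j: "j \<in> {1..r}" and le: "i \<le> j"
  show "t j \<le> t i"
  proof (cases "i = j")
   case False
   hence ij: "i < j" using le by simp
   obtain g where g: "g \<in> peirce_group" "g (e i) = e j" "g (e j) = e i" "\<forall>m\<in>{1..r} - {i, j}. g (e m) = e m"
    using all_exchangeable[OF i j] unfolding exchangeable_def by (elim bexE conjE)
   have NN: "N j = N i"
    using automorphism_form[OF peirce_group_automorphism[OF g(1)], of "e i" "e i"] by (simp add: g(2) N_def)
   have split: "(\<Sum>m=1..r. h m) = h i + (h j + (\<Sum>m\<in>{1..r} - {i, j}. h m))" for h :: "nat => real"
   proof -
    have "(\<Sum>m=1..r. h m) = h i + (\<Sum>m\<in>{1..r} - {i}. h m)" using i by (intro sum.remove) auto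
    also have "(\<Sum>m\<in>{1..r} - {i}. h m) = h j + (\<Sum>m\<in>{1..r} - {i} - {j}. h m)" using j False by (intro sum.remove) auto
    also have "{1..r} - {i} - {j} = {1..r} - {i, j}" by blast
    finally show ?thesis .
   qed
   have rest: "(\<Sum>m\<in>{1..r} - {i, j}. t m * Re (form (g (e m)) da)) = (\<Sum>m\<in>{1..r} - {i, j}. t m * (a m * N m))"
    using bspec[OF g(4)] by (intro sum.cong refl) (simp add: pair)
   have "(\<Sum>m=1..r. t m * Re (form (g (e m)) da)) \<le> (\<Sum>m=1..r. t m * (a m * N m))"
    using max[OF g(1), folded da_def] glin[OF g(1)] base by simp
   hence "t i * (a j * N i) + t j * (a i * N i) \<le> t i * (a i * N i) + t j * (a j * N i)"
    unfolding split rest by (simp add: g(2,3) pair[OF i] pair[OF j] NN)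
   hence "0 \<le> (t i - t j) * ((a i - a j) * N i)" by (simp add: algebra_simps)
   moreover have "0 < (a i - a j) * N i" using a(2)[OF i j ij] Npos[OF i] by simp
   ultimately show ?thesis by (simp add: zero_le_mult_iff)
  qed simp
 qed
qed

lemma spectral_values_exist:
 "\<exists>t k T. spectral_values r e z t \<and> (\<forall>m. k m \<in> peirce_group) \<and> op_limit k T \<and> z = T (diag t)"
proof -
 \<comment> \<open>the decreasing entries of a regular diagonal element\<close>
 define a where "a i = real (Suc r - i)" for i
 obtain k T where k: "\<forall>m. k m \<in> peirce_group" and lim: "op_limit k T"
  and max: "\<forall>g\<in>peirce_group. Re (form (g (T z)) (diag a)) \<le> Re (form (T z) (diag a))"
  using peirce_group_maximum[of z "diag a"] by (elim exE conjE)
 have kaut: "k m \<in> triple_automorphisms" for m by (rule peirce_group_automorphism[OF spec[OF k]])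
 have Taut: "T \<in> triple_automorphisms" by (rule op_limit_automorphism[OF kaut lim])
 have a: "a i > 0" if "i \<in> {1..r}" for i using that by (simp add: a_def)
 have a': "a j < a i" if "i \<in> {1..r}" "j \<in> {1..r}" "i < j" for i j using that by (simp add: a_def)
 have "\<exists>t. T z = diag t"
 proof (rule commuting_diagonal[of a])
  show "a i \<noteq> a j" if "i \<in> {1..r}" "j \<in> {1..r}" "i \<noteq> j" for i j
   using a'[of i j] a'[of j i] that by (cases i j rule: linorder_cases) auto
  show "tp (diag a) (T z) v = tp (T z) (diag a) v" for v by (rule critical_point_commutes) (rule bspec[OF max])
 qed (rule a)
 then obtain t where t: "T z = diag t" by (elim exE)
 have max': "Re (form (g (diag t)) (diag a)) \<le> Re (form (diag t) (diag a))" if "g \<in> peirce_group" for g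
  using bspec[OF max that] by (simp only: t)
 have sorted: "\<forall>i\<in>{1..r}. 0 \<le> t i" "\<forall>i\<in>{1..r}. \<forall>j\<in>{1..r}. i \<le> j --> t j \<le> t i"
  by (rule frame_sorted_maximum(1)[of t a], (erule max' a a' | assumption)+,
    rule frame_sorted_maximum(2)[of t a], (erule max' a a' | assumption)+)
 define h where "h m = opinv (k m)" for m
 have h: "h m \<in> peirce_group" for m
 proof -
  obtain h' where h': "h' \<in> peirce_group" "\<forall>x. h' (k m x) = x" "\<forall>x. k m (h' x) = x"
   using peirce_group_inverse[OF spec[OF k, of m]] by (elim bexE conjE)
  have "h m x = h' x" for x
  proof -
   have "k m (h m x) = x" unfolding h_def by (rule surj_f_inv_f[OF bij_is_surj[OF automorphismD(2)[OF kaut]]])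
   hence "h' (k m (h m x)) = h' x" by simp
   thus ?thesis using h'(2) by simp
  qed
  hence "h m = h'" by (rule ext)
  thus ?thesis using h'(1) by simp
 qed
 have hlim: "op_limit h (opinv T)" using op_limit_inverse[OF kaut lim] by (simp add: h_def[abs_def])
 have "opinv T (T z) = z" by (rule inv_f_f[OF bij_is_inj[OF automorphismD(2)[OF Taut]]])
 hence z: "z = opinv T (diag t)" by (simp only: t)
 have "opinv T \<in> K" by (rule K_limit[OF h hlim])
 hence "spectral_values r e z t" unfolding spectral_values_def using sorted z by (intro conjI bexI[of _ "opinv T"])
 thus ?thesis using h hlim z by (intro exI[of _ t] exI[of _ h] exI[of _ "opinv T"] conjI allI)
qed

lemma element_rank_eqI:
 assumes "spectral_values r e z t"
 shows "element_rank r e z = card {i \<in> {1..r}. t i \<noteq> 0}" unfolding element_rank_def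
proof (rule the_equality)
 show "\<exists>t'. spectral_values r e z t' \<and> card {i \<in> {1..r}. t i \<noteq> 0} = card {i \<in> {1..r}. t' i \<noteq> 0}"
  using assms by blast
 fix n assume "\<exists>t. spectral_values r e z t \<and> n = card {i \<in> {1..r}. t i \<noteq> 0}"
 then obtain t' where t': "spectral_values r e z t'" "n = card {i \<in> {1..r}. t' i \<noteq> 0}" by (elim exE conjE)
 note R = spectral_values_rank[OF assms] and R' = spectral_values_rank[OF t'(1), folded t'(2)]
 have "peirce_dim n = peirce_dim (card {i \<in> {1..r}. t i \<noteq> 0})" using R(1) R'(1) by simp
 thus "n = card {i \<in> {1..r}. t i \<noteq> 0}"
  using peirce_dim_le_iff[OF R(2) R'(2)] peirce_dim_le_iff[OF R'(2) R(2)] by simp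
qed

lemma kepler_variety_rank:
 assumes "l \<le> r"
 shows "kepler_variety r e l = {z. rank_quad z \<le> peirce_dim l}"
proof -
 have "element_rank r e z \<le> l \<longleftrightarrow> rank_quad z \<le> peirce_dim l" for z
 proof -
  obtain t where t: "spectral_values r e z t" using spectral_values_exist[of z] by (elim exE conjE)
  show ?thesis unfolding element_rank_eqI[OF t] spectral_values_rank(1)[OF t]
   by (rule peirce_dim_le_iff[OF spectral_values_rank(2)[OF t] assms, symmetric])
 qed
 thus ?thesis by (simp add: kepler_variety_def)
qed

end

declare One_nat_def [simp]

section \<open>Polynomial functions\<close>

text \<open>Every root of \<open>q\<close> is a root of \<open>p\<close>; after cancelling the linear factor the bound persists at the root by
 continuity.\<close>

lemma poly_dvd_if_bounded:
 fixes p q :: "complex poly" and B :: "complex => real"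
 assumes "q \<noteq> 0" "continuous_on UNIV B" "\<And>t. cmod (poly p t) \<le> B t * cmod (poly q t)"
 shows "q dvd p" using assms(1,3)
proof (induction "degree q" arbitrary: p q)
 case 0
 hence "is_unit q" by (simp add: is_unit_iff_degree)
 thus ?case by (rule unit_imp_dvd)
next
 case (Suc n)
 have "degree q \<noteq> 0" using Suc.hyps by simp
 then obtain a where a: "poly q a = 0" using fundamental_theorem_of_algebra[of q] by (auto simp: constant_degree)
 hence "poly p a = 0" using Suc.prems(2)[of a] by simp
 with a obtain p' q' where pq: "p = [:-a, 1:] * p'" "q = [:-a, 1:] * q'" by (metis dvdE poly_eq_0_iff_dvd)
 have q': "q' \<noteq> 0" using Suc.prems(1) pq by auto
 have deg: "degree q = Suc (degree q')" unfolding pq(2) by (subst degree_mult_eq) (use q' in auto)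
 have ineq: "cmod (poly p' t) \<le> B t * cmod (poly q' t)" if "t \<noteq> a" for t
 proof -
  have "cmod (t - a) * cmod (poly p' t) \<le> B t * (cmod (t - a) * cmod (poly q' t))"
   using Suc.prems(2)[of t] by (simp add: pq norm_mult[symmetric] left_diff_distrib)
  hence "cmod (t - a) * cmod (poly p' t) \<le> cmod (t - a) * (B t * cmod (poly q' t))" by (simp add: mult_ac)
  moreover have "cmod (t - a) > 0" using that by simp
  ultimately show ?thesis by (simp only: mult_le_cancel_left_pos)
 qed
 have "cmod (poly p' a) \<le> B a * cmod (poly q' a)"
 proof (rule tendsto_le[of "at a"])
  have cB: "isCont B a" using assms(2) by (simp add: continuous_on_eq_continuous_at)
  have "((\<lambda>t. cmod (poly p' t)) \<longlongrightarrow> cmod (poly p' a)) (at a)"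
   by (rule isContD) (intro continuous_intros)
  thus "((\<lambda>t. cmod (poly p' t)) \<longlongrightarrow> cmod (poly p' a)) (at a)" .
  show "((\<lambda>t. B t * cmod (poly q' t)) \<longlongrightarrow> B a * cmod (poly q' a)) (at a)"
   by (rule isContD) (intro continuous_intros cB)
  show "eventually (\<lambda>t. cmod (poly p' t) \<le> B t * cmod (poly q' t)) (at a)"
   using ineq by (simp add: eventually_at_filter)
 qed simp
 hence "cmod (poly p' t) \<le> B t * cmod (poly q' t)" for t using ineq by (cases "t = a") auto
 hence "q' dvd p'" using Suc.hyps deg q' by (intro Suc.hyps(1)) auto
 thus ?case unfolding pq by (rule mult_dvd_mono[OF dvd_refl])
qed

lemma poly_degree_if_bounded:
 fixes p :: "complex poly"
 assumes "finite A" "\<And>t. t \<notin> A ==> cmod (poly p t) \<le> C * (1 + cmod t) ^ n"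
 shows "degree p \<le> n"
proof (rule ccontr)
 assume n: "\<not> degree p \<le> n"
 define d where "d = degree p"
 have d: "n < d" using n by (simp add: d_def)
 have p0: "p \<noteq> 0" using d d_def by auto
 have lim: "((\<lambda>t. poly p t / t ^ d) \<longlongrightarrow> lead_coeff p) at_infinity"
  unfolding d_def by (rule poly_divide_tendsto_aux)
 obtain R where R: "\<And>t. t \<in> A ==> cmod t \<le> R"
  using finite_imp_bounded[OF assms(1)] by (auto simp: bounded_iff)
 have "cmod (poly p t / t ^ d) \<le> \<bar>C\<bar> * 2 ^ n * inverse (cmod t)" if t: "\<bar>R\<bar> + 1 \<le> cmod t" for t
 proof -
  have "t \<notin> A" and t1: "1 \<le> cmod t" using R[of t] t by auto
  hence "cmod (poly p t) \<le> C * (1 + cmod t) ^ n" using assms(2) by simp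
  also have "... \<le> \<bar>C\<bar> * (2 * cmod t) ^ n" using t1 by (intro mult_mono power_mono) auto
  also have "... \<le> \<bar>C\<bar> * 2 ^ n * cmod t ^ (d - 1)"
   using t1 d by (simp add: power_mult_distrib mult.assoc mult_left_mono power_increasing)
  also have "cmod t ^ (d - 1) = cmod t ^ d * inverse (cmod t)" using t1 d by (subst power_diff) (auto simp: divide_inverse)
  finally show ?thesis using t1 by (simp add: norm_divide norm_power divide_le_eq mult_ac)
 qed
 hence "eventually (\<lambda>t. cmod (poly p t / t ^ d) \<le> \<bar>C\<bar> * 2 ^ n * inverse (cmod t)) at_infinity"
  unfolding eventually_at_infinity by blast
 moreover have "((\<lambda>t::complex. \<bar>C\<bar> * 2 ^ n * inverse (cmod t)) \<longlongrightarrow> \<bar>C\<bar> * 2 ^ n * 0) at_infinity"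
  by (intro tendsto_intros tendsto_inverse_0_at_top filterlim_norm_at_top)
 ultimately have "((\<lambda>t. poly p t / t ^ d) \<longlongrightarrow> 0) at_infinity"
  using Lim_null_comparison[of "\<lambda>t. poly p t / t ^ d" "\<lambda>t. \<bar>C\<bar> * 2 ^ n * inverse (cmod t)"] by simp
 hence "lead_coeff p = 0" by (rule tendsto_unique[OF trivial_limit_at_infinity lim])
 thus False using p0 by simp
qed

context fin_dim_complex_space
begin

abbreviation polys :: "('b => complex) set" where "polys \<equiv> polynomial_functions scale"

lemmas polys_const = polynomial_functions.const[of _ scale]
 and polys_linear = polynomial_functions.linear[of scale]
 and polys_add = polynomial_functions.add[of _ scale]
 and polys_mult = polynomial_functions.mult[of _ scale]

lemma polys_crd: "crd b \<in> polys" by (rule polys_linear[OF crd_linear])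

lemma polys_cmult: "f \<in> polys ==> (\<lambda>z. c * f z) \<in> polys" using polys_mult[OF polys_const] .

lemma polys_minus: "f \<in> polys ==> (\<lambda>z. - f z) \<in> polys" using polys_cmult[of f "-1"] by simp

lemma polys_diff: "f \<in> polys ==> g \<in> polys ==> (\<lambda>z. f z - g z) \<in> polys"
 using polys_add[OF _ polys_minus] by fastforce

lemma polys_sum: "(\<And>i. i \<in> I ==> f i \<in> polys) ==> (\<lambda>z. \<Sum>i\<in>I. f i z) \<in> polys"
 by (induction I rule: infinite_finite_induct) (auto intro: polys_const polys_add)

lemma polys_prod: "(\<And>i. i \<in> I ==> f i \<in> polys) ==> (\<lambda>z. \<Prod>i\<in>I. f i z) \<in> polys"
 by (induction I rule: infinite_finite_induct) (auto intro: polys_const polys_mult)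

lemma polys_power: "f \<in> polys ==> (\<lambda>z. f z ^ n) \<in> polys"
 by (induction n) (auto intro: polys_const polys_mult)

lemmas polys_intros = polys_const polys_add polys_mult polys_minus polys_diff polys_sum polys_prod polys_power polys_crd

lemma functional_expansion:
 "Vector_Spaces.linear scale (*) \<phi> ==> \<phi> z = (\<Sum>b\<in>Basis. crd b z * \<phi> b)"
 by (rule linear_expansion)

lemma polys_comp:
 assumes "f \<in> polys" "\<And>b. b \<in> Basis ==> (\<lambda>z. crd b (\<Phi> z)) \<in> polys"
 shows "(\<lambda>z. f (\<Phi> z)) \<in> polys" using assms(1)
proof induction
 case (linear \<phi>)
 have "(\<lambda>z. \<Sum>b\<in>Basis. crd b (\<Phi> z) * \<phi> b) \<in> polys"
  using assms(2) by (intro polys_sum polys_mult polys_const)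
 thus ?case by (simp only: functional_expansion[OF linear, symmetric])
qed (auto intro: polys_intros)

lemma polys_comp_linear:
 assumes "f \<in> polys" "endo scale T"
 shows "(\<lambda>z. f (T z)) \<in> polys"
proof (rule polys_comp[OF assms(1)])
 fix b
 interpret T: Vector_Spaces.linear scale scale T by fact
 have "Vector_Spaces.linear scale (*) (\<lambda>z. crd b (T z))"
  by unfold_locales (auto simp: T.add T.scale crd_add crd_scale algebra_simps)
 thus "(\<lambda>z. crd b (T z)) \<in> polys" by (rule polys_linear)
qed

lemma polys_curve:
 assumes "f \<in> polys" "\<And>b. b \<in> Basis ==> \<exists>p. \<forall>t. crd b (\<gamma> t) = poly p t"
 shows "\<exists>p. \<forall>t. f (\<gamma> t) = poly p t" using assms(1)
proof induction
 case (const a)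
 show ?case by (intro exI[of _ "[:a:]"]) simp
next
 case (linear \<phi>)
 obtain p where p: "\<forall>b\<in>Basis. \<forall>t. crd b (\<gamma> t) = poly (p b) t" using bchoice[of Basis "\<lambda>b p. \<forall>t. crd b (\<gamma> t) = poly p t"] assms(2) by blast
 have "\<phi> (\<gamma> t) = poly (\<Sum>b\<in>Basis. smult (\<phi> b) (p b)) t" for t
  unfolding functional_expansion[OF linear, of "\<gamma> t"] using p by (simp add: poly_sum mult.commute)
 thus ?case by blast
next
 case (add f g)
 then obtain p q where "\<forall>t. f (\<gamma> t) = poly p t" "\<forall>t. g (\<gamma> t) = poly q t" by blast
 thus ?case by (intro exI[of _ "p + q"]) simp
next
 case (mult f g)
 then obtain p q where "\<forall>t. f (\<gamma> t) = poly p t" "\<forall>t. g (\<gamma> t) = poly q t" by blast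
 thus ?case by (intro exI[of _ "p * q"]) simp
qed

lemma polys_line: "f \<in> polys ==> \<exists>p. \<forall>t. f (x + scale t u) = poly p t"
proof (rule polys_curve)
 fix b
 show "\<exists>p. \<forall>t. crd b (x + scale t u) = poly p t"
  by (intro exI[of _ "[:crd b x, crd b u:]"]) (simp add: crd_add crd_scale)
qed

lemma poly_product_zero:
 assumes "\<And>t. poly p t * poly q t = (0::complex)"
 shows "p = 0 \<or> q = 0"
proof -
 have "poly (p * q) = poly 0" using assms by auto
 hence "p * q = 0" by (simp only: poly_eq_poly_eq_iff)
 thus ?thesis by simp
qed

lemma polys_domain:
 assumes f: "f \<in> polys" and g: "g \<in> polys" and fg: "\<And>z. f z * g z = 0" and "g y \<noteq> 0"
 shows "f x = 0"
proof -
 obtain p q where p: "\<forall>t. f (x + scale t (y - x)) = poly p t" and q: "\<forall>t. g (x + scale t (y - x)) = poly q t"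
  using polys_line[OF f] polys_line[OF g] by meson
 have "poly p t * poly q t = 0" for t using fg[of "x + scale t (y - x)"] by (simp add: p q)
 hence "p = 0 \<or> q = 0" by (rule poly_product_zero)
 moreover have "poly q 1 \<noteq> 0" using spec[OF q, of 1] assms(4) by simp
 ultimately have "p = 0" by auto
 thus ?thesis using spec[OF p, of 0] by simp
qed

inductive homogeneous :: "nat => ('b => complex) => bool" where
 zero: "homogeneous k (\<lambda>z. 0)"
| const: "homogeneous 0 (\<lambda>z. a)"
| linear: "Vector_Spaces.linear scale (*) \<phi> ==> homogeneous 1 \<phi>"
| add: "homogeneous k f ==> homogeneous k g ==> homogeneous k (\<lambda>z. f z + g z)"
| mult: "homogeneous k f ==> homogeneous l g ==> homogeneous (k + l) (\<lambda>z. f z * g z)"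

lemma homogeneous_polys: "homogeneous k f ==> f \<in> polys"
 by (induction rule: homogeneous.induct) (auto intro: polys_intros polys_linear)

lemma homogeneous_sum: "(\<And>i. i \<in> I ==> homogeneous k (f i)) ==> homogeneous k (\<lambda>z. \<Sum>i\<in>I. f i z)"
 by (induction I rule: infinite_finite_induct) (auto intro: homogeneous.intros)

lemma homogeneous_scale: "homogeneous k f ==> f (scale t z) = t ^ k * f z"
proof (induction rule: homogeneous.induct)
 case (linear \<phi>)
 thus ?case by (simp add: Vector_Spaces.linear_iff)
qed (auto simp: power_add algebra_simps)

definition polys_le :: "nat => ('b => complex) set" where
 "polys_le n = {f. \<exists>F. (\<forall>k. homogeneous k (F k)) \<and> f = (\<lambda>z. \<Sum>k\<le>n. F k z)}"

lemma polys_leI: "(\<And>k. homogeneous k (F k)) ==> (\<lambda>z. \<Sum>k\<le>n. F k z) \<in> polys_le n"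
 by (auto simp: polys_le_def)

lemma polys_le_polys: "f \<in> polys_le n ==> f \<in> polys"
 by (auto simp: polys_le_def intro: polys_sum homogeneous_polys)

lemma polys_le_mono:
 assumes "f \<in> polys_le m" "m \<le> n"
 shows "f \<in> polys_le n"
proof -
 obtain F where F: "\<forall>k. homogeneous k (F k)" "f = (\<lambda>z. \<Sum>k\<le>m. F k z)" using assms(1) by (auto simp: polys_le_def)
 define G where "G k = (if k \<le> m then F k else (\<lambda>z. 0))" for k
 have "(\<Sum>k\<le>n. G k z) = (\<Sum>k\<le>m. G k z)" for z
  by (rule sum.mono_neutral_right) (use assms(2) in \<open>auto simp: G_def\<close>)
 also have "(\<Sum>k\<le>m. G k z) = (\<Sum>k\<le>m. F k z)" for z by (intro sum.cong) (auto simp: G_def)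
 finally have "f = (\<lambda>z. \<Sum>k\<le>n. G k z)" using F(2) by simp
 moreover have "homogeneous k (G k)" for k using F(1) by (simp add: G_def homogeneous.zero)
 ultimately show ?thesis using polys_leI[of G n] by simp
qed

lemma homogeneous_polys_le: "homogeneous k f ==> f \<in> polys_le k"
proof -
 assume f: "homogeneous k f"
 have "(\<Sum>j\<le>k. (if j = k then f else (\<lambda>z. 0)) z) = f z" for z by (subst sum.remove[of _ k]) auto
 thus ?thesis using polys_leI[of "\<lambda>j. if j = k then f else (\<lambda>z. 0)" k] f by (simp add: homogeneous.zero)
qed

lemma polys_le_const: "(\<lambda>z. a) \<in> polys_le n"
 by (rule polys_le_mono[OF homogeneous_polys_le[OF homogeneous.const]]) simp

lemma polys_le_add: "f \<in> polys_le n ==> g \<in> polys_le n ==> (\<lambda>z. f z + g z) \<in> polys_le n"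
proof -
 assume "f \<in> polys_le n" "g \<in> polys_le n"
 then obtain F G where F: "\<forall>k. homogeneous k (F k)" "f = (\<lambda>z. \<Sum>k\<le>n. F k z)"
  and G: "\<forall>k. homogeneous k (G k)" "g = (\<lambda>z. \<Sum>k\<le>n. G k z)" by (auto simp: polys_le_def)
 have "(\<lambda>z. \<Sum>k\<le>n. (\<lambda>z. F k z + G k z) z) \<in> polys_le n"
  by (rule polys_leI) (use F G in \<open>auto intro: homogeneous.add\<close>)
 thus ?thesis by (simp add: F(2) G(2) sum.distrib)
qed

lemma polys_le_sum: "(\<And>i. i \<in> I ==> f i \<in> polys_le n) ==> (\<lambda>z. \<Sum>i\<in>I. f i z) \<in> polys_le n"
 by (induction I rule: infinite_finite_induct) (auto intro: polys_le_const polys_le_add)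

lemma polys_le_mult:
 assumes "f \<in> polys_le m" "g \<in> polys_le n"
 shows "(\<lambda>z. f z * g z) \<in> polys_le (m + n)"
proof -
 obtain F G where F: "\<forall>k. homogeneous k (F k)" "f = (\<lambda>z. \<Sum>k\<le>m. F k z)"
  and G: "\<forall>k. homogeneous k (G k)" "g = (\<lambda>z. \<Sum>k\<le>n. G k z)" using assms by (auto simp: polys_le_def)
 have "(\<lambda>z. \<Sum>i\<le>m. \<Sum>j\<le>n. F i z * G j z) \<in> polys_le (m + n)"
 proof (intro polys_le_sum)
  fix i j assume "i \<in> {..m}" "j \<in> {..n}"
  thus "(\<lambda>z. F i z * G j z) \<in> polys_le (m + n)"
   using F G by (intro polys_le_mono[OF homogeneous_polys_le[OF homogeneous.mult]]) auto
 qed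
 thus ?thesis by (simp add: F(2) G(2) sum_product)
qed

lemma polys_le_cmult: "f \<in> polys_le n ==> (\<lambda>z. c * f z) \<in> polys_le n"
 using polys_le_mult[OF polys_le_const[of c 0], of f n] by simp

lemma polys_degree: "f \<in> polys ==> \<exists>n. f \<in> polys_le n"
proof (induction rule: polynomial_functions.induct)
 case (const a)
 show ?case using polys_le_const by blast
next
 case (linear \<phi>)
 thus ?case using homogeneous_polys_le[OF homogeneous.linear] by blast
next
 case (add f g)
 then obtain m n where "f \<in> polys_le m" "g \<in> polys_le n" by blast
 hence "f \<in> polys_le (max m n)" "g \<in> polys_le (max m n)" by (auto intro: polys_le_mono)
 thus ?case using polys_le_add by blast
next
 case (mult f g)
 thus ?case using polys_le_mult by blast
qed

lemma poly_degree_le_sum: "degree p \<le> n ==> poly p (t::complex) = (\<Sum>i\<le>n. coeff p i * t ^ i)"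
 using arg_cong[OF poly_as_sum_of_monoms', of p n "\<lambda>p. poly p t"] by (simp add: poly_sum poly_monom)

lemma homogeneous_line:
 "homogeneous k f ==> \<exists>p. degree p \<le> k \<and> (\<forall>t. f (x + scale t u) = poly p t)"
proof (induction rule: homogeneous.induct)
 case (zero k)
 show ?case by (intro exI[of _ 0]) simp
next
 case (const a)
 show ?case by (intro exI[of _ "[:a:]"]) simp
next
 case (linear \<phi>)
 thus ?case by (intro exI[of _ "[:\<phi> x, \<phi> u:]"]) (simp add: Vector_Spaces.linear_iff)
next
 case (add k f g)
 then obtain p q where "degree p \<le> k" "\<forall>t. f (x + scale t u) = poly p t" "degree q \<le> k" "\<forall>t. g (x + scale t u) = poly q t"
  by (elim exE conjE)
 thus ?case by (intro exI[of _ "p + q"]) (simp add: degree_add_le)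
next
 case (mult k f l g)
 then obtain p q where "degree p \<le> k" "\<forall>t. f (x + scale t u) = poly p t" "degree q \<le> l" "\<forall>t. g (x + scale t u) = poly q t"
  by (elim exE conjE)
 thus ?case using degree_mult_le[of p q] by (intro exI[of _ "p * q"]) simp
qed

lemma polys_le_line:
 assumes "f \<in> polys_le n"
 shows "\<exists>c. \<forall>t. f (x + scale t u) = (\<Sum>i\<le>n. c i * t ^ i)"
proof -
 obtain F where F: "\<forall>k. homogeneous k (F k)" "f = (\<lambda>z. \<Sum>k\<le>n. F k z)" using assms by (auto simp: polys_le_def)
 have "\<forall>k. \<exists>p. degree p \<le> k \<and> (\<forall>t. F k (x + scale t u) = poly p t)" using homogeneous_line[OF spec[OF F(1)]] ..
 from choice[OF this] obtain p where p: "\<forall>k. degree (p k) \<le> k \<and> (\<forall>t. F k (x + scale t u) = poly (p k) t)" by (elim exE)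
 have "degree (\<Sum>k\<le>n. p k) \<le> n" using p by (intro degree_sum_le) (auto intro: order_trans)
 hence "f (x + scale t u) = (\<Sum>i\<le>n. coeff (\<Sum>k\<le>n. p k) i * t ^ i)" for t
  using p by (simp add: F(2) poly_sum flip: poly_degree_le_sum)
 thus ?thesis by (intro exI allI)
qed

lemma homogeneous_translate: "homogeneous k f ==> (\<lambda>z. f (z + y)) \<in> polys_le k"
proof (induction rule: homogeneous.induct)
 case (linear \<phi>)
 hence "(\<lambda>z. \<phi> z + \<phi> y) \<in> polys_le 1"
  by (intro polys_le_add polys_le_const homogeneous_polys_le homogeneous.linear)
 thus ?case using linear by (simp add: Vector_Spaces.linear_iff)
qed (auto intro: polys_le_const polys_le_add polys_le_mult)

lemma polys_le_translate:
 assumes "f \<in> polys_le n"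
 shows "(\<lambda>z. f (z + y)) \<in> polys_le n"
proof -
 obtain F where F: "\<forall>k. homogeneous k (F k)" "f = (\<lambda>z. \<Sum>k\<le>n. F k z)" using assms by (auto simp: polys_le_def)
 show ?thesis unfolding F(2) by (intro polys_le_sum polys_le_mono[OF homogeneous_translate[OF spec[OF F(1)]]]) simp
qed

text \<open>Along the lines through a point \<open>y\<close> with \<open>g y \<noteq> 0\<close> the quotient \<open>f / g\<close> is a power series whose coefficients
 are polynomial in the direction, because only the constant \<open>g y\<close> has to be inverted. The bound makes each of
 these series a polynomial of degree at most \<open>n\<close>.\<close>

lemma polys_quotient:
 assumes f: "f \<in> polys" and g: "g \<in> polys" and ne: "g y \<noteq> 0"
  and cont: "\<And>v. continuous_on UNIV (\<lambda>t. B (y + scale t v) :: real)"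
  and bound: "\<And>x. cmod (f x) \<le> B x * cmod (g x)"
  and growth: "\<And>v. \<exists>C. \<forall>t. B (y + scale t v) \<le> C * (1 + cmod t) ^ n"
 shows "\<exists>q\<in>polys_le n. \<forall>x. f x = q x * g x"
proof -
 have expansion: "\<exists>m F. (\<forall>k. homogeneous k (F k)) \<and> (\<forall>v. f (v + y) = (\<Sum>k\<le>m. F k v))" if f: "f \<in> polys" for f
 proof -
  obtain m where "f \<in> polys_le m" using polys_degree[OF f] by blast
  hence "(\<lambda>v. f (v + y)) \<in> polys_le m" by (rule polys_le_translate)
  thus ?thesis unfolding polys_le_def by (auto simp: fun_eq_iff)
 qed
 obtain m F where F: "\<forall>k. homogeneous k (F k)" "\<forall>v. f (v + y) = (\<Sum>k\<le>m. F k v)" using expansion[OF f] by (elim exE conjE)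
 obtain l G where G: "\<forall>k. homogeneous k (G k)" "\<forall>v. g (v + y) = (\<Sum>k\<le>l. G k v)" using expansion[OF g] by (elim exE conjE)
 define pf where "pf v = (\<Sum>k\<le>m. monom (F k v) k)" for v
 define pg where "pg v = (\<Sum>k\<le>l. monom (G k v) k)" for v
 have pf: "poly (pf v) t = f (y + scale t v)" for v t
  using spec[OF F(2), of "scale t v"] homogeneous_scale[OF spec[OF F(1)]]
  by (simp add: pf_def poly_sum poly_monom mult.commute add.commute)
 have pg: "poly (pg v) t = g (y + scale t v)" for v t
  using spec[OF G(2), of "scale t v"] homogeneous_scale[OF spec[OF G(1)]]
  by (simp add: pg_def poly_sum poly_monom mult.commute add.commute)
 have pg0: "coeff (pg v) 0 = g y" for v using pg[of v 0] by (simp add: poly_0_coeff_0)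
 have "\<forall>v. \<exists>r. degree r \<le> n \<and> pf v = pg v * r"
 proof
  fix v
  have nz: "pg v \<noteq> 0" using pg0[of v] ne by auto
  have bd: "cmod (poly (pf v) t) \<le> B (y + scale t v) * cmod (poly (pg v) t)" for t unfolding pf pg by (rule bound)
  obtain r where r: "pf v = pg v * r" using poly_dvd_if_bounded[OF nz cont bd] by (elim dvdE)
  obtain C where C: "\<forall>t. B (y + scale t v) \<le> C * (1 + cmod t) ^ n" using growth[of v] by (elim exE)
  have "degree r \<le> n"
  proof (rule poly_degree_if_bounded[OF poly_roots_finite[OF nz]])
   fix t assume t: "t \<notin> {t. poly (pg v) t = 0}"
   hence "cmod (poly r t) \<le> B (y + scale t v)" using bd[of t] by (simp add: r norm_mult)
   thus "cmod (poly r t) \<le> C * (1 + cmod t) ^ n" using spec[OF C, of t] by linarith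
  qed
  with r show "\<exists>r. degree r \<le> n \<and> pf v = pg v * r" by blast
 qed
 from choice[OF this] obtain r where r: "\<forall>v. degree (r v) \<le> n \<and> pf v = pg v * r v" by (elim exE)
 have co: "homogeneous k (\<lambda>v. coeff (pf v) k)" "homogeneous k (\<lambda>v. coeff (pg v) k)" for k
  using F(1) G(1) by (cases "k \<le> m"; cases "k \<le> l"; simp add: pf_def pg_def coeff_sum homogeneous.zero)+
 have hom: "homogeneous k (\<lambda>v. coeff (r v) k)" for k
 proof (induction k rule: less_induct)
  case (less k)
  have eq: "coeff (r v) k = (1 / g y) * (coeff (pf v) k + - 1 * (\<Sum>j<k. coeff (pg v) (k - j) * coeff (r v) j))" for v
  proof -
   have "coeff (pf v) k = (\<Sum>j\<le>k. coeff (pg v) (k - j) * coeff (r v) j)"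
    using r coeff_mult[of "r v" "pg v" k] by (simp add: mult.commute)
   also have "... = (\<Sum>j<k. coeff (pg v) (k - j) * coeff (r v) j) + g y * coeff (r v) k"
    by (simp add: pg0 flip: lessThan_Suc_atMost)
   finally show ?thesis using ne by (simp add: field_simps)
  qed
  have "homogeneous ((k - j) + j) (\<lambda>v. coeff (pg v) (k - j) * coeff (r v) j)" if "j < k" for j
   by (intro homogeneous.mult co less.IH that)
  hence "homogeneous k (\<lambda>v. \<Sum>j<k. coeff (pg v) (k - j) * coeff (r v) j)" by (intro homogeneous_sum) simp
  from homogeneous.mult[OF homogeneous.const[of "-1"] this]
  have "homogeneous k (\<lambda>v. - 1 * (\<Sum>j<k. coeff (pg v) (k - j) * coeff (r v) j))" by simp
  from homogeneous.mult[OF homogeneous.const[of "1 / g y"] homogeneous.add[OF co(1) this]]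
  show ?case unfolding eq by simp
 qed
 define q where "q x = (\<Sum>k\<le>n. coeff (r (x + - y)) k)" for x
 have "q \<in> polys_le n" unfolding q_def by (rule polys_le_translate[OF polys_leI]) (rule hom)
 moreover have "f x = q x * g x" for x
 proof -
  have "poly (pf (x - y)) 1 = poly (pg (x - y)) 1 * poly (r (x - y)) 1" using r by (metis poly_mult)
  thus ?thesis using poly_degree_le_sum[of "r (x - y)" n 1] conjunct1[OF spec[OF r]]
   by (simp add: pf pg q_def mult.commute)
 qed
 ultimately show ?thesis by blast
qed

end

interpretation fun_space: vector_space "\<lambda>(c::complex) (f :: 'x => complex) z. c * f z"
 by unfold_locales (auto simp: fun_eq_iff algebra_simps)

context fin_dim_complex_space
begin

lemma fun_span_add: "f \<in> fun_space.span A ==> g \<in> fun_space.span A ==> (\<lambda>z. f z + g z) \<in> fun_space.span A"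
 using fun_space.span_add[of f A g] by (simp add: plus_fun_def)

lemma fun_span_scale: "f \<in> fun_space.span A ==> (\<lambda>z. c * f z) \<in> fun_space.span A"
 by (rule fun_space.span_scale)

lemma fun_span_zero: "(\<lambda>z. 0) \<in> fun_space.span A" using fun_space.span_zero[of A] by (simp add: zero_fun_def)

lemma fun_span_sum: "(\<And>i. i \<in> I ==> f i \<in> fun_space.span A) ==> (\<lambda>z. \<Sum>i\<in>I. f i z) \<in> fun_space.span A"
 by (induction I rule: infinite_finite_induct) (auto intro: fun_span_add fun_span_zero)

lemma fun_span_induct [consumes 1, case_names base zero add scale]:
 assumes "f \<in> fun_space.span A" "\<And>a. a \<in> A ==> Q a" "Q (\<lambda>z. 0)"
  "\<And>f g. Q f ==> Q g ==> Q (\<lambda>z. f z + g z)" "\<And>c f. Q f ==> Q (\<lambda>z. c * f z)"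
 shows "Q f" using assms(1)
proof (induction rule: fun_space.span_induct_alt)
 case base
 thus ?case using assms(3) by (simp add: zero_fun_def)
next
 case (step c a g)
 thus ?case using assms(4)[OF assms(5)[OF assms(2)], of a g c] by (simp add: plus_fun_def)
qed

definition list_product :: "('b => complex) list => 'b => complex" where
 "list_product xs z = (\<Prod>\<psi>\<leftarrow>xs. \<psi> z)"

definition products :: "('b => complex) set => nat => ('b => complex) set" where
 "products A k = list_product ` {xs. set xs \<subseteq> A \<and> length xs = k}"

lemma finite_products: "finite A ==> finite (products A k)"
 unfolding products_def by (intro finite_imageI finite_lists_length_eq)

lemma list_product_append: "list_product (xs @ ys) z = list_product xs z * list_product ys z"
 by (simp add: list_product_def)

lemma homogeneous_span:
 assumes one: "(\<lambda>z. 1) \<in> A" and lin: "\<And>\<phi>. Vector_Spaces.linear scale (*) \<phi> ==> \<phi> \<in> fun_space.span A"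
 shows "homogeneous k f ==> f \<in> fun_space.span (products A k)"
proof (induction rule: homogeneous.induct)
 case (zero k)
 thus ?case by (rule fun_span_zero)
next
 case (const a)
 have "list_product [] \<in> products A 0" by (auto simp: products_def)
 hence "(\<lambda>z. a * list_product [] z) \<in> fun_space.span (products A 0)" by (intro fun_span_scale fun_space.span_base)
 thus ?case by (simp add: list_product_def)
next
 case (linear \<phi>)
 have "A \<subseteq> products A 1"
 proof
  fix \<psi> assume "\<psi> \<in> A"
  hence "list_product [\<psi>] \<in> products A 1" by (auto simp: products_def)
  thus "\<psi> \<in> products A 1" by (simp add: list_product_def[abs_def])
 qed
 thus ?case using lin[OF linear] fun_space.span_mono by blast
next
 case (add k f g)
 thus ?case by (intro fun_span_add)
next
 case (mult k f l g)
 show ?case using mult.IH(1)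
 proof (induction f rule: fun_span_induct)
  case (base a)
  show ?case using mult.IH(2)
  proof (induction g rule: fun_span_induct)
   case (base b)
   obtain xs ys where xs: "a = list_product xs" "set xs \<subseteq> A" "length xs = k" and ys: "b = list_product ys" "set ys \<subseteq> A" "length ys = l"
    using base \<open>a \<in> products A k\<close> by (auto simp: products_def)
   have "(\<lambda>z. a z * b z) = list_product (xs @ ys)" by (rule ext) (simp add: xs(1) ys(1) list_product_append)
   thus ?case using xs ys by (intro fun_space.span_base) (auto simp: products_def)
  next
   case (add f g)
   thus ?case using fun_span_add[OF add] by (simp add: distrib_left)
  next
   case (scale c f)
   thus ?case using fun_span_scale[OF scale, of c] by (simp add: mult_ac)
  qed (simp add: fun_span_zero)
 next
  case (add f g)
  thus ?case using fun_span_add[OF add] by (simp add: distrib_right)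
 next
  case (scale c f)
  thus ?case using fun_span_scale[OF scale, of c] by (simp add: mult_ac)
 qed (simp add: fun_span_zero)
qed

text \<open>As 1 belongs to \<open>A\<close>, the products of exactly \<open>n\<close> factors include all shorter ones.\<close>

lemma polys_le_span:
 assumes one: "(\<lambda>z. 1) \<in> A" and lin: "\<And>\<phi>. Vector_Spaces.linear scale (*) \<phi> ==> \<phi> \<in> fun_space.span A"
  and f: "f \<in> polys_le n"
 shows "f \<in> fun_space.span (products A n)"
proof -
 obtain F where F: "\<forall>k. homogeneous k (F k)" "f = (\<lambda>z. \<Sum>k\<le>n. F k z)" using f by (auto simp: polys_le_def)
 have sub: "products A k \<subseteq> products A n" if "k \<le> n" for k
 proof
  fix g assume "g \<in> products A k"
  then obtain xs where xs: "g = list_product xs" "set xs \<subseteq> A" "length xs = k" by (auto simp: products_def)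
  define ys where "ys = xs @ replicate (n - k) (\<lambda>z. 1)"
  have "list_product ys = g" by (rule ext) (simp add: ys_def xs(1) list_product_def)
  moreover have "set ys \<subseteq> A" "length ys = n" using xs one that by (auto simp: ys_def)
  ultimately show "g \<in> products A n" by (auto simp: products_def)
 qed
 show ?thesis unfolding F(2)
 proof (rule fun_span_sum)
  fix k assume "k \<in> {..n}"
  hence "fun_space.span (products A k) \<subseteq> fun_space.span (products A n)" using sub by (intro fun_space.span_mono) simp
  thus "F k \<in> fun_space.span (products A n)" using homogeneous_span[OF one lin spec[OF F(1)], of k] by blast
 qed
qed

lemma homogeneous_comp_linear:
 assumes "endo scale T"
 shows "homogeneous k f ==> homogeneous k (\<lambda>z. f (T z))"
proof (induction rule: homogeneous.induct)
 case (linear \<phi>)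
 have "Vector_Spaces.linear scale (*) (\<lambda>z. \<phi> (T z))"
  using linear assms by (auto simp: Vector_Spaces.linear_iff)
 thus ?case by (rule homogeneous.linear)
qed (auto intro: homogeneous.intros)

lemma polys_le_comp_linear:
 assumes "endo scale T" "f \<in> polys_le n"
 shows "(\<lambda>z. f (T z)) \<in> polys_le n"
 using assms(2) homogeneous_comp_linear[OF assms(1)] by (fastforce simp: polys_le_def)

lemma polys_le_growth:
 assumes "f \<in> polys_le n"
 shows "\<exists>C\<ge>0. \<forall>t. cmod (f (x + scale t u)) \<le> C * (1 + cmod t) ^ n"
proof -
 obtain c where c: "\<forall>t. f (x + scale t u) = (\<Sum>i\<le>n. c i * t ^ i)" using polys_le_line[OF assms] by blast
 have "cmod (f (x + scale t u)) \<le> (\<Sum>i\<le>n. cmod (c i)) * (1 + cmod t) ^ n" for t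
 proof -
  have "cmod (f (x + scale t u)) \<le> (\<Sum>i\<le>n. cmod (c i * t ^ i))" using c by (simp add: sum_norm_le)
  also have "... \<le> (\<Sum>i\<le>n. cmod (c i) * (1 + cmod t) ^ n)"
  proof (rule sum_mono)
   fix i assume "i \<in> {..n}"
   hence "cmod t ^ i \<le> (1 + cmod t) ^ i" "(1 + cmod t) ^ i \<le> (1 + cmod t) ^ n"
    by (auto intro: power_mono power_increasing)
   thus "cmod (c i * t ^ i) \<le> cmod (c i) * (1 + cmod t) ^ n" by (simp add: norm_mult norm_power mult_left_mono)
  qed
  finally show ?thesis by (simp add: sum_distrib_right)
 qed
 thus ?thesis by (intro exI[of _ "\<Sum>i\<le>n. cmod (c i)"]) (auto intro: sum_nonneg)
qed

end

section \<open>An invariant inner product on the regular functions of bounded degree\<close>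

locale hermitian_space = fin_dim_complex_space scale Basis + herm: hermitian_form scale UNIV ip
 for scale :: "complex => 'b::ab_group_add => 'b" and Basis ip +
 assumes definite: "ip x x = 0 ==> x = 0"
begin

text \<open>Features of the kernel \<open>1 + (z | w)\<close>: the constant 1 and the coordinates in an orthonormal basis. Products
 of \<open>n\<close> of them are features of the \<open>n\<close>-th power of the kernel.\<close>

definition affine_features :: "('b => complex) set => bool" where
 "affine_features A \<longleftrightarrow> finite A \<and> (\<lambda>z. 1) \<in> A \<and>
   (\<forall>\<phi>. Vector_Spaces.linear scale (*) \<phi> --> \<phi> \<in> fun_space.span A) \<and>
   (\<forall>\<phi>\<in>A. \<phi> \<in> polys_le 1) \<and>
   (\<forall>z w. 1 + ip z w = (\<Sum>\<phi>\<in>A. \<phi> z * cnj (\<phi> w)))"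

lemma ip_linear: "Vector_Spaces.linear scale (*) (\<lambda>z. ip z b)"
 by unfold_locales (auto simp: herm.ip_add_left herm.ip_scale_left algebra_simps)

lemma orthonormal_basis: "\<exists>E. herm.orthonormal E \<and> span E = UNIV"
proof -
 have "\<exists>E. herm.orthonormal E \<and> span E = span Basis"
  by (rule herm.orthonormal_basis_exists) (auto simp: definite finite_Basis)
 thus ?thesis by (simp add: span_Basis)
qed

lemma affine_features_exist: "\<exists>A. affine_features A"
proof -
 obtain E where E: "herm.orthonormal E" "span E = UNIV" using orthonormal_basis by blast
 have finE: "finite E" and on: "\<And>x y. x \<in> E ==> y \<in> E ==> ip x y = (if x = y then 1 else 0)"
  using E(1) by (auto simp: herm.orthonormal_def)
 have expansion: "z = (\<Sum>b\<in>E. scale (ip z b) b)" for z by (rule herm.orthonormal_expansion) (use E in auto)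
 define A where "A = insert (\<lambda>z. 1) ((\<lambda>b z. ip z b) ` E)"
 have inj: "inj_on (\<lambda>b z. ip z b) E"
 proof (rule inj_onI)
  fix b b' assume b: "b \<in> E" "b' \<in> E" "(\<lambda>z. ip z b) = (\<lambda>z. ip z b')"
  from fun_cong[OF b(3), of b] b(1,2) show "b = b'" by (simp add: on split: if_splits)
 qed
 have one: "(\<lambda>z. 1) \<notin> (\<lambda>b z. ip z b) ` E"
 proof
  assume "(\<lambda>z. 1) \<in> (\<lambda>b z. ip z b) ` E"
  then obtain b where "(\<lambda>z. 1) = (\<lambda>z. ip z b)" by blast
  from fun_cong[OF this, of 0] show False by simp
 qed
 have kernel: "1 + ip z w = (\<Sum>\<phi>\<in>A. \<phi> z * cnj (\<phi> w))" for z w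
 proof -
  have "ip z w = ip (\<Sum>b\<in>E. scale (ip z b) b) w" using expansion[of z] by simp
  also have "... = (\<Sum>b\<in>E. ip z b * cnj (ip w b))"
   by (simp add: herm.ip_sum_left herm.ip_scale_left herm.ip_cnj)
  finally show ?thesis using finE one inj by (simp add: A_def sum.reindex o_def)
 qed
 have span: "\<phi> \<in> fun_space.span A" if "Vector_Spaces.linear scale (*) \<phi>" for \<phi>
 proof -
  interpret p: Vector_Spaces.linear scale "(*)" \<phi> by fact
  have "\<phi> = (\<lambda>z. \<Sum>b\<in>E. \<phi> b * ip z b)"
  proof
   fix z
   have "\<phi> z = \<phi> (\<Sum>b\<in>E. scale (ip z b) b)" using expansion[of z] by simp
   thus "\<phi> z = (\<Sum>b\<in>E. \<phi> b * ip z b)" by (simp add: p.sum p.scale mult.commute)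
  qed
  moreover have "(\<lambda>z. \<Sum>b\<in>E. \<phi> b * ip z b) \<in> fun_space.span A"
   by (intro fun_span_sum fun_span_scale fun_space.span_base) (auto simp: A_def)
  ultimately show ?thesis by simp
 qed
 have "\<phi> \<in> polys_le 1" if "\<phi> \<in> A" for \<phi>
  using that by (auto simp: A_def polys_le_const homogeneous_polys_le[OF homogeneous.linear[OF ip_linear]]
    simp del: One_nat_def)
 with kernel span show ?thesis unfolding affine_features_def by (intro exI[of _ A]) (auto simp: A_def finE)
qed

lemma sum_power_list_product:
 fixes \<phi> :: "'i => complex"
 assumes "finite A"
 shows "(\<Sum>a\<in>A. \<phi> a) ^ n = (\<Sum>l | set l \<subseteq> A \<and> length l = n. prod_list (map \<phi> l))"
proof (induction n)
 case 0
 have "{l :: 'i list. set l \<subseteq> A \<and> length l = 0} = {[]}" by auto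
 thus ?case by simp
next
 case (Suc n)
 have "(\<Sum>l | set l \<subseteq> A \<and> length l = Suc n. prod_list (map \<phi> l)) =
  (\<Sum>(l, a)\<in>{l. set l \<subseteq> A \<and> length l = n} \<times> A. prod_list (map \<phi> (a # l)))"
  unfolding lists_length_Suc_eq by (subst sum.reindex) (auto simp: inj_on_def case_prod_beta intro!: sum.cong)
 also have "... = (\<Sum>a\<in>A. \<phi> a) * (\<Sum>a\<in>A. \<phi> a) ^ n"
  by (simp add: sum.cartesian_product[symmetric] Suc.IH sum_product) (rule sum.swap)
 finally show ?case by simp
qed

text \<open>Extension by zero turns equality on \<open>V\<close> into equality of functions.\<close>

definition on_set :: "'b set => ('b => complex) => 'b => complex" where
 "on_set V f z = (if z \<in> V then f z else 0)"

definition regular_functions :: "'b set => nat => ('b => complex) set" where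
 "regular_functions V n = on_set V ` polys_le n"

lemma regular_functions_subspace: "fun_space.subspace (regular_functions V n)"
proof (rule fun_space.subspaceI)
 show "0 \<in> regular_functions V n" unfolding regular_functions_def
  by (rule image_eqI[OF _ polys_le_const[of 0]]) (auto simp: on_set_def fun_eq_iff)
next
 fix x y assume "x \<in> regular_functions V n" "y \<in> regular_functions V n"
 then obtain f g where "f \<in> polys_le n" "g \<in> polys_le n" "x = on_set V f" "y = on_set V g"
  by (auto simp: regular_functions_def)
 thus "x + y \<in> regular_functions V n" unfolding regular_functions_def
  by (intro image_eqI[OF _ polys_le_add[of f n g]]) (auto simp: on_set_def fun_eq_iff)
next
 fix c x assume "x \<in> regular_functions V n"
 then obtain f where "f \<in> polys_le n" "x = on_set V f" by (auto simp: regular_functions_def)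
 thus "(\<lambda>z. c * x z) \<in> regular_functions V n" unfolding regular_functions_def
  by (intro image_eqI[OF _ polys_le_cmult[of f n c]]) (auto simp: on_set_def fun_eq_iff)
qed

definition isometry_of :: "'b set => ('b => 'b) => bool" where
 "isometry_of V k \<longleftrightarrow> endo scale k \<and> bij k \<and> k ` V = V \<and>
   (\<forall>x y. ip (k x) (k y) = ip x y)"

lemma isometry_ofD:
 assumes "isometry_of V k"
 shows "endo scale k" "bij k" "k z \<in> V \<longleftrightarrow> z \<in> V" "ip (k x) (k y) = ip x y"
proof -
 show lin: "endo scale k" and "bij k" and "ip (k x) (k y) = ip x y" using assms by (simp_all add: isometry_of_def)
 have "inj k" "k ` V = V" using assms by (simp_all add: isometry_of_def bij_def)
 thus "k z \<in> V \<longleftrightarrow> z \<in> V" by (metis inj_image_mem_iff)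
qed

lemma on_set_isometry:
 assumes "isometry_of V k" "f \<in> regular_functions V n"
 shows "(\<lambda>z. f (k z)) \<in> regular_functions V n"
proof -
 obtain g where g: "g \<in> polys_le n" "f = on_set V g" using assms(2) by (auto simp: regular_functions_def)
 thus ?thesis unfolding regular_functions_def
  by (intro image_eqI[OF _ polys_le_comp_linear[OF isometry_ofD(1)[OF assms(1)] g(1)]])
   (auto simp: on_set_def fun_eq_iff isometry_ofD(3)[OF assms(1)])
qed

text \<open>The inner product with reproducing kernel \<open>(1 + (z | w))^n\<close> on \<open>V\<close>. A regular function of degree at most \<open>n\<close>
 is \<open>z \<mapsto> (c | pt z)\<close> for a vector \<open>c\<close> of coefficients, where \<open>pt z\<close> is the vector of conjugated features at
 \<open>z\<close>, and \<open>c\<close> is unique in the span of these vectors. Isometries preserve the kernel and hence the inner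
 product.\<close>

lemma invariant_form_exists:
 "\<exists>F. hermitian_form (\<lambda>c f z. c * f z) (regular_functions V n) F \<and>
  (\<forall>f\<in>regular_functions V n. F f f = 0 --> f = 0) \<and>
  (\<forall>k f g. isometry_of V k --> f \<in> regular_functions V n --> g \<in> regular_functions V n -->
    F (\<lambda>z. f (k z)) (\<lambda>z. g (k z)) = F f g)"
proof -
 obtain A where A: "affine_features A" using affine_features_exist by blast
 have finA: "finite A" and one: "(\<lambda>z. 1) \<in> A"
  and lin: "\<And>\<phi>. Vector_Spaces.linear scale (*) \<phi> ==> \<phi> \<in> fun_space.span A"
  and le1: "\<And>\<phi>. \<phi> \<in> A ==> \<phi> \<in> polys_le 1"
  and kern: "\<And>z w. 1 + ip z w = (\<Sum>\<phi>\<in>A. \<phi> z * cnj (\<phi> w))"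
  using A by (auto simp: affine_features_def)
 define L where "L = {l. set l \<subseteq> A \<and> length l = n}"
 have finL: "finite L" unfolding L_def by (rule finite_lists_length_eq) fact
 define C :: "('b => complex) list => complex => complex" where "C = (\<lambda>l x. if l \<in> L then x else 0)"
 define cip where "cip x y = (\<Sum>l\<in>L. x l * cnj (y l))" for x y :: "('b => complex) list => complex"
 interpret c: hermitian_form "\<lambda>c f z. c * f z" UNIV cip
 proof
  show "fun_space.subspace (UNIV :: (('b => complex) list => complex) set)" by simp
  show "0 \<le> Re (cip x x)" for x by (auto simp: cip_def intro!: sum_nonneg)
 qed (auto simp: cip_def sum.distrib sum_distrib_left algebra_simps)
 have kern_power: "(1 + ip z w) ^ n = (\<Sum>l\<in>L. list_product l z * cnj (list_product l w))" for z w
 proof -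
  have "(1 + ip z w) ^ n = (\<Sum>l\<in>L. prod_list (map (\<lambda>\<phi>. \<phi> z * cnj (\<phi> w)) l))"
   unfolding kern L_def by (rule sum_power_list_product[OF finA])
  moreover have "prod_list (map (\<lambda>\<phi>. \<phi> z * cnj (\<phi> w)) l) = list_product l z * cnj (list_product l w)" for l
   by (induction l) (auto simp: list_product_def)
  ultimately show ?thesis by simp
 qed
 have lp_le: "list_product l \<in> polys_le (length l)" if "set l \<subseteq> A" for l using that
 proof (induction l)
  case Nil
  thus ?case using polys_le_const[of 1 0] by (simp add: list_product_def[abs_def])
 next
  case (Cons \<phi> l)
  have "(\<lambda>z. \<phi> z * list_product l z) \<in> polys_le (1 + length l)"
   by (rule polys_le_mult) (use Cons le1 in auto)
  thus ?case by (simp add: list_product_def[abs_def])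
 qed
 define T where "T c = on_set V (\<lambda>z. \<Sum>l\<in>L. c l * list_product l z)" for c
 define pt where "pt w = (\<lambda>l. C l (cnj (list_product l w)))" for w
 define Sp where "Sp = fun_space.span (pt ` V)"
 have T_pt: "T c z = cip c (pt z)" if "z \<in> V" for c z using that by (simp add: T_def on_set_def cip_def pt_def C_def)
 have T_add: "T (c + d) = T c + T d" for c d by (auto simp: T_def on_set_def fun_eq_iff sum.distrib algebra_simps)
 have T_scale: "T (\<lambda>l. a * c l) = (\<lambda>z. a * T c z)" for a c
  by (auto simp: T_def on_set_def fun_eq_iff sum_distrib_left algebra_simps)
 have T_diff: "T (c - d) = T c - T d" for c d by (auto simp: T_def on_set_def fun_eq_iff sum_subtractf algebra_simps)
 have supp: "c l = 0" if "c \<in> Sp" "l \<notin> L" for c l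
 proof -
  have "fun_space.subspace {c :: ('b => complex) list => complex. c l = 0}" by (rule fun_space.subspaceI) auto
  hence "Sp \<subseteq> {c. c l = 0}" unfolding Sp_def
   by (rule fun_space.span_minimal[rotated]) (use that in \<open>auto simp: pt_def C_def\<close>)
  with that show ?thesis by auto
 qed
 have T_inj: "c = 0" if "c \<in> Sp" "T c = 0" for c
 proof -
  have "fun_space.subspace {u. cip c u = 0}" by (rule fun_space.subspaceI) (auto simp: c.ip_add_right c.ip_scale_right)
  hence "Sp \<subseteq> {u. cip c u = 0}" unfolding Sp_def
   by (rule fun_space.span_minimal[rotated]) (use that T_pt[of _ c] in auto)
  with that have "cip c c = 0" by auto
  hence "complex_of_real (\<Sum>l\<in>L. (cmod (c l))\<^sup>2) = 0"
   by (simp add: cip_def complex_norm_square del: of_real_power)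
  hence "(\<Sum>l\<in>L. (cmod (c l))\<^sup>2) = 0" by (simp only: of_real_eq_0_iff)
  hence "\<forall>l\<in>L. c l = 0" using finL by (simp add: sum_nonneg_eq_0_iff)
  with supp[OF that(1)] show ?thesis by (auto simp: fun_eq_iff)
 qed
 obtain B where B: "B \<subseteq> pt ` V" "fun_space.independent B" "pt ` V \<subseteq> fun_space.span B"
  using fun_space.maximal_independent_subset[of "pt ` V"] by blast
 have finB: "finite B"
 proof -
  define D :: "(('b => complex) list => complex) set" where "D = (\<lambda>l m. if m = l then 1 else 0) ` L"
  have "pt w \<in> fun_space.span D" for w
  proof -
   have eq: "pt w = (\<Sum>l\<in>L. (\<lambda>m. pt w l * (if m = l then 1 else 0)))"
   proof
    fix m
    have "(\<Sum>l\<in>L. (\<lambda>m. pt w l * (if m = l then 1 else 0))) m = (\<Sum>l\<in>L. pt w l * (if m = l then 1 else 0))"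
     using finL by (induction L rule: finite_induct) auto
    also have "... = pt w m" using finL by (simp add: pt_def C_def if_distrib cong: if_cong)
    finally show "pt w m = (\<Sum>l\<in>L. (\<lambda>m. pt w l * (if m = l then 1 else 0))) m" by simp
   qed
   show ?thesis by (subst eq, intro fun_space.span_sum fun_space.span_scale fun_space.span_base) (auto simp: D_def)
  qed
  hence "B \<subseteq> fun_space.span D" using B(1) by auto
  thus ?thesis using fun_space.independent_span_bound[OF _ B(2), of D] finL by (auto simp: D_def)
 qed
 have SpB: "Sp = fun_space.span B" unfolding Sp_def
  by (rule antisym) (use B in \<open>auto intro: fun_space.span_mono[THEN subsetD] simp: fun_space.span_minimal\<close>)
 have T_regular: "T c \<in> regular_functions V n" for c unfolding T_def regular_functions_def
  by (intro imageI polys_le_sum polys_le_cmult) (use lp_le in \<open>force simp: L_def\<close>)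
 have T_surj: "\<exists>c\<in>Sp. T c = f" if f: "f \<in> regular_functions V n" for f
 proof -
  obtain g where g: "g \<in> polys_le n" "f = on_set V g" using f by (auto simp: regular_functions_def)
  have "g \<in> fun_space.span (products A n)" by (rule polys_le_span[OF one lin g(1)])
  hence "\<exists>c. \<forall>z. g z = (\<Sum>l\<in>L. c l * list_product l z)"
  proof (induction rule: fun_span_induct)
   case (base a)
   then obtain l where "l \<in> L" "a = list_product l" by (auto simp: products_def L_def)
   thus ?case using finL by (intro exI[of _ "\<lambda>m. if m = l then 1 else 0"]) (simp add: if_distrib[of "\<lambda>x. x * _"] cong: if_cong)
  next
   case zero
   thus ?case by (intro exI[of _ "\<lambda>l. 0"]) simp
  next
   case (add f g)
   then obtain c d where "\<forall>z. f z = (\<Sum>l\<in>L. c l * list_product l z)" "\<forall>z. g z = (\<Sum>l\<in>L. d l * list_product l z)"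
    by (elim exE)
   thus ?case by (intro exI[of _ "\<lambda>l. c l + d l"]) (simp add: sum.distrib algebra_simps)
  next
   case (scale a f)
   then obtain c where "\<forall>z. f z = (\<Sum>l\<in>L. c l * list_product l z)" by (elim exE)
   thus ?case by (intro exI[of _ "\<lambda>l. a * c l"]) (simp add: sum_distrib_left algebra_simps)
  qed
  then obtain c where c: "\<forall>z. g z = (\<Sum>l\<in>L. c l * list_product l z)" by (elim exE)
  have Tc: "T c = f" unfolding g(2) T_def using c by (simp add: fun_eq_iff on_set_def)
  obtain a where a: "a \<in> fun_space.span B" "\<forall>u\<in>fun_space.span B. cip (c - a) u = 0"
   using c.orthogonal_projection_exists[OF finB, of c] by auto
  have "T (c - a) z = 0" for z
  proof (cases "z \<in> V")
   case True
   hence "pt z \<in> fun_space.span B" using B(3) by auto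
   with a(2) True show ?thesis by (simp add: T_pt)
  qed (simp add: T_def on_set_def)
  hence "T a = f" using Tc by (auto simp: T_diff fun_eq_iff)
  with a(1) show ?thesis by (auto simp: SpB)
 qed
 have Sp_sub: "fun_space.subspace Sp" by (simp add: Sp_def fun_space.subspace_span)
 define cf where "cf f = (SOME c. c \<in> Sp \<and> T c = f)" for f
 have cf: "cf f \<in> Sp" "T (cf f) = f" if "f \<in> regular_functions V n" for f
 proof -
  have "\<exists>c. c \<in> Sp \<and> T c = f" using T_surj[OF that] by blast
  hence "cf f \<in> Sp \<and> T (cf f) = f" unfolding cf_def by (rule someI_ex)
  thus "cf f \<in> Sp" "T (cf f) = f" by auto
 qed
 have cf_eq: "cf f = c" if "c \<in> Sp" "T c = f" for f c
 proof -
  have "f \<in> regular_functions V n" using that(2) T_regular by blast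
  note f = cf[OF this]
  have "cf f - c = 0" by (rule T_inj) (use that f Sp_sub in \<open>auto simp: T_diff fun_space.subspace_diff\<close>)
  thus ?thesis by simp
 qed
 have cf_add: "cf (f + g) = cf f + cf g" if "f \<in> regular_functions V n" "g \<in> regular_functions V n" for f g
  by (rule cf_eq) (use cf that Sp_sub in \<open>auto simp: T_add fun_space.subspace_add\<close>)
 have cf_scale: "cf (\<lambda>z. a * f z) = (\<lambda>l. a * cf f l)" if "f \<in> regular_functions V n" for a f
  by (rule cf_eq) (use cf that Sp_sub in \<open>auto simp: T_scale fun_space.subspace_scale\<close>)
 define F where "F f g = cip (cf f) (cf g)" for f g
 have herm: "hermitian_form (\<lambda>c f z. c * f z) (regular_functions V n) F"
 proof
  show "fun_space.subspace (regular_functions V n)" by (rule regular_functions_subspace)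
 qed (auto simp: F_def cf_add cf_scale c.ip_add_left c.ip_scale_left c.ip_cnj c.ip_nonneg)
 have def0: "f = 0" if "f \<in> regular_functions V n" "F f f = 0" for f
 proof -
  have "cip (cf f) u = 0" for u by (rule c.ip_null) (use that in \<open>auto simp: F_def\<close>)
  hence "T (cf f) z = 0" for z by (cases "z \<in> V") (simp_all add: T_pt, simp add: T_def on_set_def)
  thus ?thesis using cf(2)[OF that(1)] by (auto simp: fun_eq_iff)
 qed
 have inv: "F (\<lambda>z. f (k z)) (\<lambda>z. g (k z)) = F f g"
  if k: "isometry_of V k" and f: "f \<in> regular_functions V n" and g: "g \<in> regular_functions V n" for k f g
 proof -
  note kD = isometry_ofD[OF k]
  have fk: "(\<lambda>z. f (k z)) \<in> regular_functions V n" by (rule on_set_isometry[OF k f])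
  have "\<exists>c'\<in>Sp. (\<forall>z. T c' z = T c (k z)) \<and> cip (cf (\<lambda>z. f (k z))) c' = cip (cf f) c" if "c \<in> Sp" for c
   using that unfolding Sp_def
  proof (induction rule: fun_space.span_induct_alt)
   case base
   show ?case by (intro bexI[of _ 0] conjI allI)
     (simp_all only: c.ip_zero UNIV_I fun_space.span_zero, simp add: T_def on_set_def)
  next
   case (step a x y)
   then obtain w where w: "w \<in> V" "x = pt w" by auto
   obtain w' where w': "w' \<in> V" "k w' = w" using w(1) k unfolding isometry_of_def by (metis imageE)
   obtain y' where y': "y' \<in> fun_space.span (pt ` V)" "\<forall>z. T y' z = T y (k z)"
    "cip (cf (\<lambda>z. f (k z))) y' = cip (cf f) y" using step by blast
   have ker: "T (pt v) z = (if z \<in> V then (1 + ip z v) ^ n else 0)" for v z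
    by (simp add: T_def on_set_def pt_def C_def kern_power mult.commute)
   have 1: "T (pt w') z = T (pt w) (k z)" for z using kD(4)[of z w'] by (simp add: ker kD(3) w'(2))
   have "cip (cf (\<lambda>z. f (k z))) (pt w') = T (cf (\<lambda>z. f (k z))) w'" using w'(1) by (simp add: T_pt)
   also have "... = f w" by (simp add: cf(2)[OF fk] w'(2))
   also have "... = T (cf f) w" by (simp add: cf(2)[OF f])
   also have "... = cip (cf f) (pt w)" using w(1) by (simp add: T_pt)
   finally have 2: "cip (cf (\<lambda>z. f (k z))) (pt w') = cip (cf f) (pt w)" .
   show ?case
   proof (intro bexI[of _ "(\<lambda>l. a * pt w' l) + y'"] conjI allI)
    show "(\<lambda>l. a * pt w' l) + y' \<in> fun_space.span (pt ` V)"
     by (intro fun_space.span_add fun_space.span_scale fun_space.span_base imageI w' y')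
    show "T ((\<lambda>l. a * pt w' l) + y') z = T ((\<lambda>z. a * x z) + y) (k z)" for z
     unfolding T_add T_scale w(2) using 1 y'(2) by simp
    show "cip (cf (\<lambda>z. f (k z))) ((\<lambda>l. a * pt w' l) + y') = cip (cf f) ((\<lambda>z. a * x z) + y)"
     unfolding w(2) c.ip_add_right[OF UNIV_I UNIV_I UNIV_I] c.ip_scale_right[OF UNIV_I UNIV_I] using 2 y'(3) by simp
   qed
  qed
  from this[OF cf(1)[OF g]] obtain c' where c': "c' \<in> Sp" "\<forall>z. T c' z = T (cf g) (k z)"
   "cip (cf (\<lambda>z. f (k z))) c' = cip (cf f) (cf g)" by blast
  have "cf (\<lambda>z. g (k z)) = c'" by (rule cf_eq[OF c'(1)]) (use c'(2) cf(2)[OF g] in \<open>auto simp: fun_eq_iff\<close>)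
  with c'(3) show ?thesis by (simp add: F_def)
 qed
 show ?thesis using herm def0 inv by (intro exI[of _ F]) blast
qed

end

section \<open>Bounded rational functions on a cone with unitary symmetries\<close>

text \<open>The properties of the Kepler variety on which normality depends. \<open>V\<close> has a group \<open>U\<close> of unitary symmetries,
 it is irreducible, and \<open>\<Psi>\<close> is a polynomial map with dense image in \<open>V\<close>. The parameter \<open>x\<close> of \<open>\<Psi>\<close> has a part
 \<open>P2 x\<close>, which \<open>\<Psi>\<close> preserves, and a part \<open>P1 x\<close>, which is rotated by symmetries \<open>\<rho> \<tau>\<close> of \<open>V\<close>. The points
 \<open>y = P2 y\<close> meet every orbit of \<open>U\<close> on \<open>V\<close>.\<close>

locale unitary_cone = hermitian_space scale Basis ip
 for scale :: "complex => 'b::ab_group_add => 'b" and Basis ip +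
 fixes V :: "'b set" and U :: "('b => 'b) set" and \<Psi> P1 P2 :: "'b => 'b" and \<rho> :: "complex => 'b => 'b"
 assumes U_isometry: "k \<in> U ==> isometry_of V k"
  and U_comp: "k \<in> U ==> k' \<in> U ==> (\<lambda>z. k (k' z)) \<in> U"
  and U_inv: "k \<in> U ==> inv_into UNIV k \<in> U"
  and V_nonempty: "V \<noteq> {}"
  and V_irreducible: "f \<in> polys ==> g \<in> polys ==> (\<And>z. z \<in> V ==> f z * g z = 0) ==>
   (\<forall>z\<in>V. f z = 0) \<or> (\<forall>z\<in>V. g z = 0)"
  and \<Psi>_V: "\<Psi> x \<in> V"
  and \<Psi>_dense: "f \<in> polys ==> (\<And>x. f (\<Psi> x) = 0) ==> z \<in> V ==> f z = 0"
  and \<Psi>_polys: "b \<in> Basis ==> (\<lambda>x. crd b (\<Psi> x)) \<in> polys"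
  and P1_linear: "endo scale P1"
  and P2_linear: "endo scale P2"
  and \<rho>_U: "cmod \<tau> = 1 ==> \<rho> \<tau> \<in> U"
  and \<rho>_\<Psi>: "cmod \<tau> = 1 ==> \<rho> \<tau> (\<Psi> x) = \<Psi> (P2 x + scale \<tau> (P1 x))"
  and P2_\<Psi>: "P2 (\<Psi> x) = P2 x"
  and \<Psi>_P2: "\<Psi> (P2 x) = P2 x"
  and V_cover: "z \<in> V ==> \<exists>k\<in>U. \<exists>y. P2 y = y \<and> z = k y"
begin

definition nonzero :: "('b => complex) => bool" where
 "nonzero g \<longleftrightarrow> g \<in> polys \<and> (\<exists>z\<in>V. g z \<noteq> 0)"

text \<open>What holds on \<open>V\<close> outside a proper algebraic subset holds generically. Irreducibility of \<open>V\<close> makes this a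
 proper filter, and rational functions on \<open>V\<close> are treated as complex functions up to generic equality \<open>sim\<close>,
 with arbitrary values at poles.\<close>

definition generic :: "'b filter" where
 "generic = Abs_filter (\<lambda>P. \<exists>g. nonzero g \<and> (\<forall>z\<in>V. g z \<noteq> 0 --> P z))"

lemma nonzero_mult: "nonzero f ==> nonzero g ==> nonzero (\<lambda>z. f z * g z)"
 using V_irreducible[of f g] unfolding nonzero_def by (metis polys_mult)

lemma eventually_generic: "eventually P generic \<longleftrightarrow> (\<exists>g. nonzero g \<and> (\<forall>z\<in>V. g z \<noteq> 0 --> P z))"
 unfolding generic_def
proof (rule eventually_Abs_filter, rule is_filter.intro)
 show "\<exists>g. nonzero g \<and> (\<forall>z\<in>V. g z \<noteq> 0 --> True)"
  using V_nonempty polys_const[of 1] by (intro exI[of _ "\<lambda>z. 1"]) (auto simp: nonzero_def)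
next
 fix P Q assume "\<exists>g. nonzero g \<and> (\<forall>z\<in>V. g z \<noteq> 0 --> P z)" "\<exists>g. nonzero g \<and> (\<forall>z\<in>V. g z \<noteq> 0 --> Q z)"
 then obtain f g where "nonzero f" "\<forall>z\<in>V. f z \<noteq> 0 --> P z" "nonzero g" "\<forall>z\<in>V. g z \<noteq> 0 --> Q z" by blast
 thus "\<exists>g. nonzero g \<and> (\<forall>z\<in>V. g z \<noteq> 0 --> P z \<and> Q z)"
  by (intro exI[of _ "\<lambda>z. f z * g z"] conjI nonzero_mult) auto
next
 fix P Q :: "'b => bool"
 assume "\<forall>x. P x --> Q x" "\<exists>g. nonzero g \<and> (\<forall>z\<in>V. g z \<noteq> 0 --> P z)"
 thus "\<exists>g. nonzero g \<and> (\<forall>z\<in>V. g z \<noteq> 0 --> Q z)" by blast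
qed

lemma generic_nonzero: "nonzero g ==> eventually (\<lambda>z. g z \<noteq> 0) generic" by (auto simp: eventually_generic)

lemma generic_V: "eventually (\<lambda>z. z \<in> V) generic"
 using V_nonempty polys_const[of 1] by (auto simp: eventually_generic nonzero_def intro!: exI[of _ "\<lambda>z. 1"])

lemma generic_poly_zero:
 assumes "f \<in> polys" "eventually (\<lambda>z. f z = 0) generic" "z \<in> V"
 shows "f z = 0"
proof -
 obtain g where g: "nonzero g" "\<forall>z\<in>V. g z \<noteq> 0 --> f z = 0" using assms(2) by (auto simp: eventually_generic)
 hence "(\<forall>z\<in>V. f z = 0) \<or> (\<forall>z\<in>V. g z = 0)"
  using assms(1) by (intro V_irreducible) (auto simp: nonzero_def)
 with g assms(3) show ?thesis by (auto simp: nonzero_def)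
qed

lemma generic_poly_eq:
 assumes "f \<in> polys" "g \<in> polys" "eventually (\<lambda>z. f z = g z) generic" "z \<in> V"
 shows "f z = g z" using generic_poly_zero[OF polys_diff[OF assms(1,2)]] assms(3,4) by simp

lemma U_linear: "k \<in> U ==> endo scale k" using U_isometry isometry_ofD(1) by blast

lemma U_V: "k \<in> U ==> k z \<in> V \<longleftrightarrow> z \<in> V" using U_isometry isometry_ofD(3) by blast

lemma U_inverse: assumes "k \<in> U" shows "k (inv_into UNIV k z) = z" "inv_into UNIV k (k z) = z"
proof -
 have "bij k" using U_isometry[OF assms] by (rule isometry_ofD)
 thus "k (inv_into UNIV k z) = z" "inv_into UNIV k (k z) = z" by (simp_all add: bij_is_surj bij_is_inj surj_f_inv_f)
qed

lemma nonzero_U: assumes "k \<in> U" "nonzero g" shows "nonzero (\<lambda>z. g (k z))"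
proof -
 obtain z where z: "z \<in> V" "g z \<noteq> 0" using assms(2) by (auto simp: nonzero_def)
 have "inv_into UNIV k z \<in> V" using U_V[OF assms(1), of "inv_into UNIV k z"] z(1) by (simp add: U_inverse[OF assms(1)])
 with z(2) show ?thesis using assms(2) polys_comp_linear[OF _ U_linear[OF assms(1)], of g]
  by (auto simp: nonzero_def U_inverse[OF assms(1)] intro!: bexI[of _ "inv_into UNIV k z"])
qed

lemma generic_U: assumes "k \<in> U" "eventually P generic" shows "eventually (\<lambda>z. P (k z)) generic"
proof -
 obtain g where "nonzero g" "\<forall>z\<in>V. g z \<noteq> 0 --> P z" using assms(2) by (auto simp: eventually_generic)
 thus ?thesis unfolding eventually_generic
  by (intro exI[of _ "\<lambda>z. g (k z)"]) (auto simp: nonzero_U[OF assms(1)] U_V[OF assms(1)])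
qed

definition sim :: "('b => complex) => ('b => complex) => bool" where
 "sim h h' \<longleftrightarrow> eventually (\<lambda>z. h z = h' z) generic"

lemma sim_refl: "sim h h" by (simp add: sim_def)
lemma sim_sym: "sim h h' ==> sim h' h" by (simp add: sim_def eq_commute)
lemma sim_trans: "sim h h' ==> sim h' h'' ==> sim h h''" unfolding sim_def by (auto elim: eventually_elim2)
lemma sim_add: "sim h h' ==> sim j j' ==> sim (h + j) (h' + j')" unfolding sim_def by (auto elim: eventually_elim2)
lemma sim_scale: "sim h h' ==> sim (\<lambda>z. c * h z) (\<lambda>z. c * h' z)"
 unfolding sim_def by (auto elim: eventually_mono)
lemma sim_mult: "sim h h' ==> sim (\<lambda>z. b z * h z) (\<lambda>z. b z * h' z)"
 unfolding sim_def by (auto elim: eventually_mono)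
lemma sim_U: "k \<in> U ==> sim h h' ==> sim (\<lambda>z. h (k z)) (\<lambda>z. h' (k z))"
 unfolding sim_def by (rule generic_U)

definition represents where
 "represents f g h \<longleftrightarrow> f \<in> polys \<and> nonzero g \<and> eventually (\<lambda>z. g z * h z = f z) generic"

lemma represents_sim: "represents f g h ==> sim h h' ==> represents f g h'"
 unfolding represents_def sim_def by (auto elim: eventually_elim2)

lemma represents_add:
 assumes "represents f g h" "represents f' g' h'"
 shows "represents (\<lambda>z. f z * g' z + f' z * g z) (\<lambda>z. g z * g' z) (h + h')"
proof -
 have "eventually (\<lambda>z. g z * g' z * (h + h') z = f z * g' z + f' z * g z) generic"
  using assms[unfolded represents_def, THEN conjunct2, THEN conjunct2] by eventually_elim (simp add: algebra_simps)
 moreover have "(\<lambda>z. f z * g' z + f' z * g z) \<in> polys"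
  using assms unfolding represents_def nonzero_def by (intro polys_add polys_mult) simp_all
 moreover have "nonzero (\<lambda>z. g z * g' z)" using assms unfolding represents_def by (intro nonzero_mult) simp_all
 ultimately show ?thesis by (simp add: represents_def)
qed

lemma represents_scale: "represents f g h ==> represents (\<lambda>z. c * f z) g (\<lambda>z. c * h z)"
 unfolding represents_def by (auto elim: eventually_mono intro: polys_cmult simp: mult.left_commute)

lemma represents_U:
 "k \<in> U ==> represents f g h ==> represents (\<lambda>z. f (k z)) (\<lambda>z. g (k z)) (\<lambda>z. h (k z))"
 unfolding represents_def using generic_U[of k "\<lambda>z. g z * h z = f z"]
 by (auto intro: nonzero_U polys_comp_linear U_linear)

lemma represents_poly: "a \<in> polys ==> represents a (\<lambda>z. 1) a"
 using V_nonempty polys_const[of 1] by (auto simp: represents_def nonzero_def)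

text \<open>The rational function \<open>h \<circ> \<Psi>\<close> is the polynomial \<open>p\<close>, in a form that avoids division.\<close>

definition pulls where
 "pulls h p \<longleftrightarrow> p \<in> polys \<and> (\<exists>f g. represents f g h \<and> (\<forall>x. f (\<Psi> x) = p x * g (\<Psi> x)))"

lemma polys_\<Psi>: "f \<in> polys ==> (\<lambda>x. f (\<Psi> x)) \<in> polys" by (rule polys_comp[OF _ \<Psi>_polys])

lemma nonzero_\<Psi>: assumes "nonzero g" shows "\<exists>y. g (\<Psi> y) \<noteq> 0"
 using assms \<Psi>_dense[of g] by (auto simp: nonzero_def)

text \<open>Any two representations of \<open>h\<close> agree after cross-multiplication on \<open>V\<close>, and the image of \<open>\<Psi>\<close> is dense.\<close>

lemma pulls_represents:
 assumes "pulls h p" "represents f g h"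
 shows "f (\<Psi> x) = p x * g (\<Psi> x)"
proof -
 obtain f' g' where 1: "represents f' g' h" "\<forall>x. f' (\<Psi> x) = p x * g' (\<Psi> x)" "p \<in> polys"
  using assms(1) by (auto simp: pulls_def)
 have P: "f \<in> polys" "g \<in> polys" "f' \<in> polys" "g' \<in> polys"
  using 1 assms(2) by (auto simp: represents_def nonzero_def)
 have "eventually (\<lambda>z. f' z * g z = f z * g' z) generic"
  using 1(1)[unfolded represents_def, THEN conjunct2, THEN conjunct2]
   assms(2)[unfolded represents_def, THEN conjunct2, THEN conjunct2] by eventually_elim (metis mult.assoc mult.commute)
 hence "f' z * g z = f z * g' z" if "z \<in> V" for z
  by (rule generic_poly_eq[rotated 2]) (use P that in \<open>auto intro: polys_intros\<close>)
 hence "p x * g' (\<Psi> x) * g (\<Psi> x) = f (\<Psi> x) * g' (\<Psi> x)" for x using 1(2) \<Psi>_V by metis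
 hence "(f (\<Psi> x) - p x * g (\<Psi> x)) * g' (\<Psi> x) = p x * g' (\<Psi> x) * g (\<Psi> x) - p x * g (\<Psi> x) * g' (\<Psi> x)" for x
  by (metis left_diff_distrib)
 hence 2: "(f (\<Psi> x) - p x * g (\<Psi> x)) * g' (\<Psi> x) = 0" for x by (simp add: mult.commute mult.left_commute)
 obtain y where y: "g' (\<Psi> y) \<noteq> 0" using 1(1) nonzero_\<Psi> by (auto simp: represents_def)
 have A: "(\<lambda>x. f (\<Psi> x) - p x * g (\<Psi> x)) \<in> polys" "(\<lambda>x. g' (\<Psi> x)) \<in> polys"
  using P 1(3) by (auto intro!: polys_intros polys_\<Psi>)
 have "f (\<Psi> x) - p x * g (\<Psi> x) = 0" by (rule polys_domain[OF A 2 y])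
 thus ?thesis by simp
qed

lemma pulls_sim: "pulls h p ==> sim h h' ==> pulls h' p" unfolding pulls_def using represents_sim by blast

lemma pulls_represented: "pulls h p ==> \<exists>f g. represents f g h" by (auto simp: pulls_def)

lemma pullsI:
 "represents f g h ==> p \<in> polys ==> (\<And>x. f (\<Psi> x) = p x * g (\<Psi> x)) ==> pulls h p"
 by (auto simp: pulls_def)

lemma pulls_polys: "pulls h p ==> p \<in> polys" by (simp add: pulls_def)

lemma pulls_unique: assumes "pulls h p" "pulls h p'" shows "p = p'"
proof
 fix x
 obtain f g where 1: "represents f g h" using pulls_represented[OF assms(1)] by blast
 obtain y where y: "g (\<Psi> y) \<noteq> 0" using 1 nonzero_\<Psi> by (auto simp: represents_def)
 have 2: "(p x - p' x) * g (\<Psi> x) = 0" for x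
  unfolding left_diff_distrib pulls_represents[OF assms(1) 1, symmetric] pulls_represents[OF assms(2) 1, symmetric]
  by simp
 have A: "(\<lambda>x. p x - p' x) \<in> polys" "(\<lambda>x. g (\<Psi> x)) \<in> polys"
  using assms 1 by (auto intro!: polys_diff polys_\<Psi> simp: pulls_polys represents_def nonzero_def)
 have "p x - p' x = 0" by (rule polys_domain[OF A 2 y])
 thus "p x = p' x" by simp
qed

lemma pulls_add: assumes "pulls h p" "pulls h' p'" shows "pulls (h + h') (\<lambda>x. p x + p' x)"
proof -
 obtain f g f' g' where 1: "represents f g h" and 2: "represents f' g' h'" using pulls_represented assms by meson
 show ?thesis by (rule pullsI[OF represents_add[OF 1 2] polys_add[OF pulls_polys pulls_polys, OF assms]])
   (simp add: pulls_represents[OF assms(1) 1] pulls_represents[OF assms(2) 2] algebra_simps)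
qed

lemma pulls_scale: assumes "pulls h p" shows "pulls (\<lambda>z. c * h z) (\<lambda>x. c * p x)"
proof -
 obtain f g where 1: "represents f g h" using pulls_represented assms by meson
 show ?thesis by (rule pullsI[OF represents_scale[OF 1] polys_cmult[OF pulls_polys[OF assms]]])
   (simp add: pulls_represents[OF assms(1) 1])
qed

lemma pulls_zero: assumes "pulls h (\<lambda>x. 0)" shows "sim h 0"
proof -
 obtain f g where 1: "represents f g h" using pulls_represented assms by meson
 have f0: "f z = 0" if "z \<in> V" for z
  by (rule \<Psi>_dense[of f]) (use pulls_represents[OF assms 1] 1 that in \<open>auto simp: represents_def\<close>)
 have "eventually (\<lambda>z. g z * h z = f z) generic" "eventually (\<lambda>z. g z \<noteq> 0) generic"
  using 1 generic_nonzero by (auto simp: represents_def)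
 hence "eventually (\<lambda>z. h z = 0) generic" using generic_V by eventually_elim (use f0 in auto)
 thus ?thesis by (simp add: sim_def)
qed

lemma pulls_inj: assumes "pulls h p" "pulls h' p" shows "sim h h'"
proof -
 have "pulls (h + (\<lambda>z. -1 * h' z)) (\<lambda>x. p x + -1 * p x)" by (intro pulls_add pulls_scale assms)
 hence "pulls (h + (\<lambda>z. -1 * h' z)) (\<lambda>x. 0)" by simp
 from pulls_zero[OF this] show ?thesis by (simp add: sim_def)
qed

lemma pulls_poly: "a \<in> polys ==> pulls a (\<lambda>x. a (\<Psi> x))"
 by (rule pullsI[OF represents_poly]) (auto intro: polys_\<Psi>)

text \<open>The bound refers to numerator and denominator, so that it is meaningful at the zeros of \<open>g\<close> and forces \<open>f\<close>
 to vanish there.\<close>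

definition bounded_rational :: "nat => ('b => complex) set" where
 "bounded_rational n = {h. \<exists>f g C. represents f g h \<and> (\<forall>z\<in>V. cmod (f z) \<le> C * (1 + Re (ip z z)) ^ n * cmod (g z))}"

lemma bounded_rational_add:
 assumes "h \<in> bounded_rational n" "h' \<in> bounded_rational n"
 shows "h + h' \<in> bounded_rational n"
proof -
 obtain f g C f' g' C' where 1: "represents f g h" "\<forall>z\<in>V. cmod (f z) \<le> C * (1 + Re (ip z z)) ^ n * cmod (g z)"
  and 2: "represents f' g' h'" "\<forall>z\<in>V. cmod (f' z) \<le> C' * (1 + Re (ip z z)) ^ n * cmod (g' z)"
  using assms unfolding bounded_rational_def by blast
 have "cmod (f z * g' z + f' z * g z) \<le> (C + C') * (1 + Re (ip z z)) ^ n * cmod (g z * g' z)" if "z \<in> V" for z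
 proof -
  have "cmod (f z * g' z + f' z * g z) \<le> cmod (f z) * cmod (g' z) + cmod (f' z) * cmod (g z)"
   by (metis norm_mult norm_triangle_ineq)
  also have "... \<le> C * (1 + Re (ip z z)) ^ n * cmod (g z) * cmod (g' z)
    + C' * (1 + Re (ip z z)) ^ n * cmod (g' z) * cmod (g z)"
   using 1(2) 2(2) that by (intro add_mono mult_right_mono) auto
  finally show ?thesis by (simp add: norm_mult algebra_simps)
 qed
 with represents_add[OF 1(1) 2(1)] show ?thesis unfolding bounded_rational_def by blast
qed

lemma bounded_rational_scale:
 assumes "h \<in> bounded_rational n"
 shows "(\<lambda>z. c * h z) \<in> bounded_rational n"
proof -
 obtain f g C where 1: "represents f g h" "\<forall>z\<in>V. cmod (f z) \<le> C * (1 + Re (ip z z)) ^ n * cmod (g z)"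
  using assms unfolding bounded_rational_def by blast
 have "cmod (c * f z) \<le> (cmod c * C) * (1 + Re (ip z z)) ^ n * cmod (g z)" if "z \<in> V" for z
  using mult_left_mono[OF bspec[OF 1(2) that], of "cmod c"] by (simp add: norm_mult algebra_simps)
 with represents_scale[OF 1(1)] show ?thesis unfolding bounded_rational_def by blast
qed

lemma bounded_rational_zero: "0 \<in> bounded_rational n"
proof -
 have "represents (\<lambda>z. 0) (\<lambda>z. 1) 0" using represents_poly[OF polys_const[of 0]] by (simp only: zero_fun_def)
 thus ?thesis unfolding bounded_rational_def
  by (intro CollectI exI[of _ "\<lambda>z. 0"] exI[of _ "\<lambda>z. 1"] exI[of _ 0]) simp
qed

lemma bounded_rational_subspace: "fun_space.subspace (bounded_rational n)"
 by (rule fun_space.subspaceI) (auto simp: bounded_rational_zero bounded_rational_add bounded_rational_scale)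

lemma bounded_rational_U:
 assumes "k \<in> U" "h \<in> bounded_rational n"
 shows "(\<lambda>z. h (k z)) \<in> bounded_rational n"
proof -
 obtain f g C where 1: "represents f g h" "\<forall>z\<in>V. cmod (f z) \<le> C * (1 + Re (ip z z)) ^ n * cmod (g z)"
  using assms unfolding bounded_rational_def by blast
 have "cmod (f (k z)) \<le> C * (1 + Re (ip z z)) ^ n * cmod (g (k z))" if "z \<in> V" for z
  using bspec[OF 1(2), of "k z"] that by (simp add: U_V[OF assms(1)] isometry_ofD(4)[OF U_isometry[OF assms(1)]])
 with represents_U[OF assms(1) 1(1)] show ?thesis unfolding bounded_rational_def by blast
qed

lemma continuous_polys_line:
 assumes "f \<in> polys" shows "continuous_on UNIV (\<lambda>t. f (x + scale t u))"
proof -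
 obtain p where "\<forall>t. f (x + scale t u) = poly p t" using polys_line[OF assms] by blast
 thus ?thesis by (simp add: continuous_on_poly[OF continuous_on_id])
qed

text \<open>On every line \<open>(\<Psi> | \<Psi>)\<close> is a finite sum of squared absolute values of polynomials, whose degrees do not
 depend on the line.\<close>

lemma norm_growth:
 "\<exists>D. (\<forall>x u. continuous_on UNIV (\<lambda>t. Re (ip (\<Psi> (x + scale t u)) (\<Psi> (x + scale t u)))))
  \<and> (\<forall>x u. \<exists>C\<ge>0. \<forall>t. Re (ip (\<Psi> (x + scale t u)) (\<Psi> (x + scale t u))) \<le> C * (1 + cmod t) ^ D)"
proof -
 obtain E where E: "herm.orthonormal E" "span E = UNIV" using orthonormal_basis by blast
 have finE: "finite E" using E(1) by (simp add: herm.orthonormal_def)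
 have expansion: "z = (\<Sum>b\<in>E. scale (ip z b) b)" for z by (rule herm.orthonormal_expansion) (use E in auto)
 have norm: "Re (ip z z) = (\<Sum>b\<in>E. (cmod (ip z b))\<^sup>2)" for z
 proof -
  have "ip z z = ip (\<Sum>b\<in>E. scale (ip z b) b) z" using expansion[of z] by simp
  also have "... = (\<Sum>b\<in>E. ip z b * cnj (ip z b))"
   by (simp add: herm.ip_sum_left herm.ip_scale_left herm.ip_cnj)
  also have "... = complex_of_real (\<Sum>b\<in>E. (cmod (ip z b))\<^sup>2)" by (simp add: complex_norm_square del: of_real_power)
  finally show ?thesis by simp
 qed
 have P: "(\<lambda>x. ip (\<Psi> x) b) \<in> polys" for b by (rule polys_\<Psi>[OF polys_linear[OF ip_linear]])
 have "\<forall>b. \<exists>n. (\<lambda>x. ip (\<Psi> x) b) \<in> polys_le n" using polys_degree[OF P] by blast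
 from choice[OF this] obtain n where n: "\<forall>b. (\<lambda>x. ip (\<Psi> x) b) \<in> polys_le (n b)" by (elim exE)
 define e where "e = Max (insert 0 (n ` E))"
 have e: "(\<lambda>x. ip (\<Psi> x) b) \<in> polys_le e" if "b \<in> E" for b
  by (rule polys_le_mono[OF spec[OF n]]) (use that finE in \<open>auto simp: e_def\<close>)
 show ?thesis
 proof (intro exI[of _ "2 * e"] conjI allI)
  fix x u
  show "continuous_on UNIV (\<lambda>t. Re (ip (\<Psi> (x + scale t u)) (\<Psi> (x + scale t u))))"
   unfolding norm by (intro continuous_intros continuous_polys_line[OF P])
 next
  fix x u
  have "\<forall>b. \<exists>C. b \<in> E --> (\<forall>t. cmod (ip (\<Psi> (x + scale t u)) b) \<le> C * (1 + cmod t) ^ e)"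
   using polys_le_growth[OF e] by blast
  from choice[OF this] obtain C where C: "\<forall>b. b \<in> E --> (\<forall>t. cmod (ip (\<Psi> (x + scale t u)) b) \<le> C b * (1 + cmod t) ^ e)"
   by (elim exE)
  have "Re (ip (\<Psi> (x + scale t u)) (\<Psi> (x + scale t u))) \<le> (\<Sum>b\<in>E. (C b)\<^sup>2) * (1 + cmod t) ^ (2 * e)" for t
  proof -
   have "(\<Sum>b\<in>E. (cmod (ip (\<Psi> (x + scale t u)) b))\<^sup>2) \<le> (\<Sum>b\<in>E. (C b * (1 + cmod t) ^ e)\<^sup>2)"
    using C by (intro sum_mono power_mono) auto
   thus ?thesis by (simp add: norm power_mult_distrib sum_distrib_right power_mult[symmetric] mult.commute)
  qed
  thus "\<exists>C\<ge>0. \<forall>t. Re (ip (\<Psi> (x + scale t u)) (\<Psi> (x + scale t u))) \<le> C * (1 + cmod t) ^ (2 * e)"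
   by (intro exI[of _ "\<Sum>b\<in>E. (C b)\<^sup>2"]) (auto simp: sum_nonneg)
 qed
qed

text \<open>The bound transfers to the numerator and denominator composed with \<open>\<Psi>\<close>, which are polynomials on a vector
 space; there \<open>polys_quotient\<close> applies.\<close>

lemma bounded_rational_pulls: "\<exists>D. \<forall>h\<in>bounded_rational n. \<exists>p\<in>polys_le D. pulls h p"
proof -
 define N where "N x = 1 + Re (ip (\<Psi> x) (\<Psi> x))" for x
 have N1: "N x \<ge> 1" for x by (simp add: N_def herm.ip_nonneg)
 obtain D where cont: "\<forall>x u. continuous_on UNIV (\<lambda>t. Re (ip (\<Psi> (x + scale t u)) (\<Psi> (x + scale t u))))"
  and D: "\<forall>x u. \<exists>C\<ge>0. \<forall>t. Re (ip (\<Psi> (x + scale t u)) (\<Psi> (x + scale t u))) \<le> C * (1 + cmod t) ^ D"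
  using norm_growth by (elim exE conjE)
 show ?thesis
 proof (intro exI[of _ "D * n"] ballI)
  fix h assume "h \<in> bounded_rational n"
  then obtain f g C where 1: "represents f g h" "\<forall>z\<in>V. cmod (f z) \<le> C * (1 + Re (ip z z)) ^ n * cmod (g z)"
   unfolding bounded_rational_def by blast
  obtain y where y: "g (\<Psi> y) \<noteq> 0" using 1 nonzero_\<Psi> by (auto simp: represents_def)
  have fg: "(\<lambda>x. f (\<Psi> x)) \<in> polys" "(\<lambda>x. g (\<Psi> x)) \<in> polys"
   using 1(1) by (auto simp: represents_def nonzero_def intro: polys_\<Psi>)
  have "\<exists>q\<in>polys_le (D * n). \<forall>x. f (\<Psi> x) = q x * g (\<Psi> x)"
  proof (rule polys_quotient[OF fg y, of "\<lambda>x. \<bar>C\<bar> * N x ^ n"])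
   show "continuous_on UNIV (\<lambda>t. \<bar>C\<bar> * N (y + scale t v) ^ n)" for v
    unfolding N_def by (intro continuous_on_mult continuous_on_power continuous_on_add continuous_on_const spec[OF spec[OF cont]])
   fix x
   have "cmod (f (\<Psi> x)) \<le> C * N x ^ n * cmod (g (\<Psi> x))" using 1(2) \<Psi>_V by (simp add: N_def)
   also have "... \<le> \<bar>C\<bar> * N x ^ n * cmod (g (\<Psi> x))" using N1[of x] by (intro mult_right_mono) auto
   finally show "cmod (f (\<Psi> x)) \<le> \<bar>C\<bar> * N x ^ n * cmod (g (\<Psi> x))" .
  next
   fix v
   obtain K where K: "K \<ge> 0" "\<forall>t. Re (ip (\<Psi> (y + scale t v)) (\<Psi> (y + scale t v))) \<le> K * (1 + cmod t) ^ D"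
    using spec[OF spec[OF D, of y], of v] by (elim exE conjE)
   have "\<bar>C\<bar> * N (y + scale t v) ^ n \<le> \<bar>C\<bar> * (1 + K) ^ n * (1 + cmod t) ^ (D * n)" for t
   proof -
    have "1 \<le> (1 + cmod t) ^ D" by simp
    hence "N (y + scale t v) \<le> (1 + K) * (1 + cmod t) ^ D"
     using spec[OF K(2), of t] unfolding N_def distrib_right by linarith
    hence "N (y + scale t v) ^ n \<le> ((1 + K) * (1 + cmod t) ^ D) ^ n"
     using N1[of "y + scale t v"] by (intro power_mono) auto
    hence "\<bar>C\<bar> * N (y + scale t v) ^ n \<le> \<bar>C\<bar> * ((1 + K) * (1 + cmod t) ^ D) ^ n" by (rule mult_left_mono) simp
    thus ?thesis by (simp add: power_mult_distrib power_mult[symmetric] mult.assoc)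
   qed
   thus "\<exists>C'. \<forall>t. \<bar>C\<bar> * N (y + scale t v) ^ n \<le> C' * (1 + cmod t) ^ (D * n)" by (intro exI allI)
  qed
  then obtain q where q: "q \<in> polys_le (D * n)" "\<forall>x. f (\<Psi> x) = q x * g (\<Psi> x)" by (elim bexE)
  show "\<exists>p\<in>polys_le (D * n). pulls h p"
   using pullsI[OF 1(1) polys_le_polys[OF q(1)] spec[OF q(2)]] q(1) by blast
 qed
qed

end

context unitary_cone
begin

text \<open>A bounded rational function is determined up to \<open>sim\<close> by its pullback, a polynomial of bounded degree.\<close>

lemma finite_modulo_sim:
 assumes Y: "Y \<subseteq> bounded_rational n" and sub: "fun_space.subspace Y"
 shows "\<exists>F. finite F \<and> F \<subseteq> Y \<and> (\<forall>h\<in>Y. \<exists>u\<in>fun_space.span F. sim h u)"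
proof -
 obtain D where D: "\<forall>h\<in>bounded_rational n. \<exists>p\<in>polys_le D. pulls h p" using bounded_rational_pulls by blast
 obtain A where A: "affine_features A" using affine_features_exist by blast
 define P where "P = {p \<in> polys_le D. \<exists>h\<in>Y. pulls h p}"
 obtain B where B: "B \<subseteq> P" "fun_space.independent B" "P \<subseteq> fun_space.span B"
  using fun_space.maximal_independent_subset[of P] by blast
 have "polys_le D \<subseteq> fun_space.span (products A D)"
  using polys_le_span[of A _ D] A unfolding affine_features_def by blast
 hence "B \<subseteq> fun_space.span (products A D)" using B(1) by (auto simp: P_def)
 hence finB: "finite B"
  using fun_space.independent_span_bound[OF _ B(2)] finite_products A unfolding affine_features_def by blast
 have "\<forall>p. \<exists>h. p \<in> B --> h \<in> Y \<and> pulls h p" using B(1) unfolding P_def by blast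
 from choice[OF this] obtain y where y: "\<forall>p. p \<in> B --> y p \<in> Y \<and> pulls (y p) p" by (elim exE)
 have span: "\<exists>u\<in>fun_space.span (y ` B). pulls u p" if "p \<in> fun_space.span B" for p using that
 proof (induction rule: fun_span_induct)
  case (base p)
  thus ?case using y by (intro bexI[of _ "y p"] fun_space.span_base) auto
 next
  case zero
  have "pulls (\<lambda>z. 0) (\<lambda>x. 0)" using pulls_poly[OF polys_const[of 0]] by simp
  thus ?case by (intro bexI[of _ "\<lambda>z. 0"]) (auto simp: fun_span_zero)
 next
  case (add p q)
  then obtain u v where "u \<in> fun_space.span (y ` B)" "pulls u p" "v \<in> fun_space.span (y ` B)" "pulls v q" by blast
  thus ?case by (intro bexI[of _ "u + v"] pulls_add fun_space.span_add)
 next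
  case (scale c p)
  then obtain u where "u \<in> fun_space.span (y ` B)" "pulls u p" by blast
  thus ?case by (intro bexI[of _ "\<lambda>z. c * u z"] pulls_scale fun_space.span_scale)
 qed
 show ?thesis
 proof (intro exI[of _ "y ` B"] conjI ballI)
  show "finite (y ` B)" using finB by simp
  show "y ` B \<subseteq> Y" using y by blast
  fix h assume h: "h \<in> Y"
  then obtain p where p: "p \<in> polys_le D" "pulls h p" using D Y by blast
  hence "p \<in> fun_space.span B" using B(3) h unfolding P_def by blast
  from span[OF this] show "\<exists>u\<in>fun_space.span (y ` B). sim h u" using pulls_inj[OF p(2)] by blast
 qed
qed

lemma sim_poly_degree:
 assumes "finite H" "\<And>h. h \<in> H ==> \<exists>a\<in>polys. sim (b h) a"
 shows "\<exists>M. \<forall>h\<in>H. \<exists>a\<in>polys_le M. sim (b h) a" using assms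
proof (induction H rule: finite_induct)
 case (insert h H)
 obtain M where M: "\<forall>h\<in>H. \<exists>a\<in>polys_le M. sim (b h) a" using insert.IH insert.prems by auto
 obtain a where a: "a \<in> polys" "sim (b h) a" using insert.prems[of h] by auto
 obtain m where m: "a \<in> polys_le m" using polys_degree[OF a(1)] by blast
 show ?case
 proof (intro exI[of _ "max M m"] ballI)
  fix h' assume "h' \<in> insert h H"
  thus "\<exists>a\<in>polys_le (max M m). sim (b h') a"
  proof
   assume "h' = h"
   thus ?thesis using a(2) polys_le_mono[OF m, of "max M m"] by auto
  next
   assume "h' \<in> H"
   then obtain c where "c \<in> polys_le M" "sim (b h') c" using M by blast
   thus ?thesis using polys_le_mono[of c M "max M m"] by auto
  qed
 qed
qed simp

text \<open>The product of denominators of a finite generating set.\<close>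

lemma common_denominator:
 "\<exists>d M. nonzero d \<and> d \<in> polys_le M \<and> (\<forall>h\<in>bounded_rational n. \<exists>a\<in>polys_le M. sim (\<lambda>z. d z * h z) a)"
proof -
 obtain H where H: "finite H" "H \<subseteq> bounded_rational n" "\<forall>h\<in>bounded_rational n. \<exists>u\<in>fun_space.span H. sim h u"
  using finite_modulo_sim[OF order.refl bounded_rational_subspace[of n]] by (elim exE conjE)
 have "\<exists>d. nonzero d \<and> (\<forall>h\<in>H. \<exists>a\<in>polys. sim (\<lambda>z. d z * h z) a)" using H(1,2)
 proof (induction H rule: finite_induct)
  case empty
  have "nonzero (\<lambda>z. 1)" using V_nonempty polys_const[of 1] by (auto simp: nonzero_def)
  thus ?case by blast
 next
  case (insert h H)
  obtain d where d: "nonzero d" "\<forall>h\<in>H. \<exists>a\<in>polys. sim (\<lambda>z. d z * h z) a" using insert by auto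
  obtain f g where fg: "represents f g h" using insert.prems by (auto simp: bounded_rational_def)
  hence g: "g \<in> polys" "nonzero g" "f \<in> polys" by (auto simp: represents_def nonzero_def)
  show ?case
  proof (intro exI[of _ "\<lambda>z. g z * d z"] conjI ballI nonzero_mult g(2) d(1))
   fix h' assume "h' \<in> insert h H"
   thus "\<exists>a\<in>polys. sim (\<lambda>z. g z * d z * h' z) a"
   proof
    assume h': "h' = h"
    have "eventually (\<lambda>z. g z * h z = f z) generic" using fg by (simp add: represents_def)
    hence "sim (\<lambda>z. g z * d z * h' z) (\<lambda>z. d z * f z)" unfolding sim_def h'
     by eventually_elim (simp add: algebra_simps)
    moreover have "(\<lambda>z. d z * f z) \<in> polys" using d(1) g by (auto simp: nonzero_def intro: polys_mult)
    ultimately show ?thesis by blast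
   next
    assume "h' \<in> H"
    then obtain a where a: "a \<in> polys" "sim (\<lambda>z. d z * h' z) a" using d(2) by blast
    have "sim (\<lambda>z. g z * d z * h' z) (\<lambda>z. g z * a z)" using sim_mult[OF a(2), of g] by (simp add: mult.assoc)
    thus ?thesis using polys_mult[OF g(1) a(1)] by blast
   qed
  qed
 qed
 then obtain d where d: "nonzero d" "\<forall>h\<in>H. \<exists>a\<in>polys. sim (\<lambda>z. d z * h z) a" by blast
 obtain M1 where M1: "\<forall>h\<in>H. \<exists>a\<in>polys_le M1. sim (\<lambda>z. d z * h z) a"
  using sim_poly_degree[OF H(1), of "\<lambda>h z. d z * h z"] d(2) by blast
 obtain M2 where M2: "d \<in> polys_le M2" using polys_degree d(1) by (auto simp: nonzero_def)
 have span: "\<exists>a\<in>polys_le (max M1 M2). sim (\<lambda>z. d z * u z) a" if "u \<in> fun_space.span H" for u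
  using that
 proof (induction rule: fun_span_induct)
  case (base h)
  then obtain c where "c \<in> polys_le M1" "sim (\<lambda>z. d z * h z) c" using M1 by blast
  thus ?case using polys_le_mono[of c M1 "max M1 M2"] by auto
 next
  case zero
  thus ?case using sim_refl polys_le_const[of 0] by (intro bexI[of _ "\<lambda>z. 0"]) auto
 next
  case (add f g)
  then obtain a c where "a \<in> polys_le (max M1 M2)" "sim (\<lambda>z. d z * f z) a"
   "c \<in> polys_le (max M1 M2)" "sim (\<lambda>z. d z * g z) c" by blast
  thus ?case using sim_add[of "\<lambda>z. d z * f z" a "\<lambda>z. d z * g z" c]
   by (intro bexI[of _ "\<lambda>z. a z + c z"] polys_le_add) (auto simp: plus_fun_def distrib_left)
 next
  case (scale c f)
  then obtain a where "a \<in> polys_le (max M1 M2)" "sim (\<lambda>z. d z * f z) a" by blast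
  thus ?case using sim_scale[of "\<lambda>z. d z * f z" a c]
   by (intro bexI[of _ "\<lambda>z. c * a z"] polys_le_cmult) (auto simp: mult.left_commute)
 qed
 show ?thesis
 proof (intro exI[of _ d] exI[of _ "max M1 M2"] conjI ballI d(1))
  show "d \<in> polys_le (max M1 M2)" by (rule polys_le_mono[OF M2]) simp
  fix h assume "h \<in> bounded_rational n"
  then obtain u where u: "u \<in> fun_space.span H" "sim h u" using H(3) by blast
  with span[OF u(1)] show "\<exists>a\<in>polys_le (max M1 M2). sim (\<lambda>z. d z * h z) a"
   using sim_trans sim_mult[OF u(2), of d] by blast
 qed
qed

lemma on_set_sim: "sim (on_set V f) f" unfolding sim_def by (rule eventually_mono[OF generic_V]) (simp add: on_set_def)

lemma regular_functions_sim_eq: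
 assumes "a \<in> regular_functions V M" "a' \<in> regular_functions V M" "sim a a'"
 shows "a = a'"
proof -
 obtain f f' where f: "f \<in> polys" "a = on_set V f" "f' \<in> polys" "a' = on_set V f'"
  using assms(1,2) polys_le_polys by (auto simp: regular_functions_def)
 have "sim f f'" using assms(3) f(2,4) on_set_sim sim_sym sim_trans by metis
 hence "f z = f' z" if "z \<in> V" for z using generic_poly_eq[OF f(1,3)] that by (simp add: sim_def)
 thus ?thesis unfolding f by (auto simp: on_set_def fun_eq_iff)
qed

lemma regular_functions_finite: "\<exists>G. finite G \<and> regular_functions V M \<subseteq> fun_space.span G"
proof -
 obtain A where A: "affine_features A" using affine_features_exist by blast
 have "on_set V f \<in> fun_space.span (on_set V ` products A M)" if "f \<in> fun_space.span (products A M)" for f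
  using that
 proof (induction rule: fun_span_induct)
  case (base a)
  thus ?case by (intro fun_space.span_base imageI)
 next
  case zero
  have "on_set V (\<lambda>z. 0) = (\<lambda>z. 0)" by (auto simp: on_set_def)
  thus ?case using fun_span_zero by simp
 next
  case (add f g)
  have "on_set V (\<lambda>z. f z + g z) = (\<lambda>z. on_set V f z + on_set V g z)" by (auto simp: on_set_def)
  thus ?case using fun_span_add[OF add] by simp
 next
  case (scale c f)
  have "on_set V (\<lambda>z. c * f z) = (\<lambda>z. c * on_set V f z)" by (auto simp: on_set_def)
  thus ?case using fun_span_scale[OF scale] by simp
 qed
 moreover have "polys_le M \<subseteq> fun_space.span (products A M)"
  using polys_le_span[of A _ M] A unfolding affine_features_def by blast
 ultimately have "regular_functions V M \<subseteq> fun_space.span (on_set V ` products A M)"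
  by (auto simp: regular_functions_def)
 moreover have "finite (on_set V ` products A M)" using finite_products A unfolding affine_features_def by blast
 ultimately show ?thesis by blast
qed

lemma regular_functions_finite_span:
 assumes "J \<subseteq> regular_functions V M" "fun_space.subspace J"
 shows "\<exists>B. finite B \<and> B \<subseteq> J \<and> fun_space.span B = J"
proof -
 obtain G where G: "finite G" "regular_functions V M \<subseteq> fun_space.span G" using regular_functions_finite by blast
 obtain B where B: "B \<subseteq> J" "fun_space.independent B" "J \<subseteq> fun_space.span B"
  using fun_space.maximal_independent_subset[of J] by blast
 have "B \<subseteq> fun_space.span G" using B(1) assms(1) G(2) by (meson subset_trans)
 hence "finite B" using fun_space.independent_span_bound[OF G(1) B(2)] by blast
 moreover have "fun_space.span B = J" using fun_space.span_minimal[OF B(1) assms(2)] B(3) by blast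
 ultimately show ?thesis using B(1) by blast
qed

text \<open>Let \<open>J\<close> be the space of all regular functions of degree at most \<open>M\<close> that are denominators for every bounded
 rational function of growth \<open>n\<close>, and \<open>F\<close> the invariant inner product of regular functions. The form
 \<open>B h h' = \<Sum>b. F (b h) (b h')\<close>, over an orthonormal basis of \<open>J\<close>, is a trace and does not depend on the
 basis; since \<open>U\<close> acts on \<open>J\<close> by unitary operators, \<open>B\<close> is invariant. It is definite up to \<open>sim\<close> because \<open>J\<close>
 contains a denominator that is not identically zero on \<open>V\<close>.\<close>

lemma invariant_form_bounded_rational:
 "\<exists>B. hermitian_form (\<lambda>c f z. c * f z) (bounded_rational n) B \<and>
  (\<forall>h\<in>bounded_rational n. B h h = 0 --> sim h 0) \<and>
  (\<forall>h\<in>bounded_rational n. \<forall>u\<in>bounded_rational n. \<forall>u'\<in>bounded_rational n. sim u u' --> B h u = B h u') \<and>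
  (\<forall>k\<in>U. \<forall>h\<in>bounded_rational n. \<forall>h'\<in>bounded_rational n. B (\<lambda>z. h (k z)) (\<lambda>z. h' (k z)) = B h h')"
proof -
 obtain d M where d: "nonzero d" "d \<in> polys_le M"
  "\<forall>h\<in>bounded_rational n. \<exists>a\<in>polys_le M. sim (\<lambda>z. d z * h z) a" using common_denominator by blast
 define R where "R = regular_functions V M"
 define W where "W = bounded_rational n"
 have subR: "fun_space.subspace R" unfolding R_def by (rule regular_functions_subspace)
 have subW: "fun_space.subspace W" unfolding W_def by (rule bounded_rational_subspace)
 obtain F where F: "hermitian_form (\<lambda>c f z. c * f z) R F"
  and F_def: "\<forall>f\<in>R. F f f = 0 --> f = 0"
  and F_inv: "\<forall>k f g. isometry_of V k --> f \<in> R --> g \<in> R --> F (\<lambda>z. f (k z)) (\<lambda>z. g (k z)) = F f g"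
  using invariant_form_exists[of V M] unfolding R_def by (elim exE conjE)
 interpret F: hermitian_form "\<lambda>c f z. c * f z" R F by (rule F)
 have R_U: "(\<lambda>z. f (k z)) \<in> R" if "k \<in> U" "f \<in> R" for f k
  using on_set_isometry[OF U_isometry[OF that(1)]] that(2) by (simp add: R_def)
 have W_U: "(\<lambda>z. f (k z)) \<in> W" if "k \<in> U" "f \<in> W" for f k
  using bounded_rational_U that by (simp add: W_def)
 have R_eq: "a = a'" if "a \<in> R" "a' \<in> R" "sim a a'" for a a'
  using regular_functions_sim_eq that unfolding R_def by blast
 define J where "J = {b \<in> R. \<forall>h\<in>W. \<exists>a\<in>R. sim (\<lambda>z. b z * h z) a}"
 have JR: "J \<subseteq> R" by (auto simp: J_def)
 \<comment> \<open>\<open>mul b h\<close> is the regular function that equals \<open>b h\<close> generically\<close>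
 define mul where "mul b h = (SOME a. a \<in> R \<and> sim (\<lambda>z. b z * h z) a)" for b h
 have mul: "mul b h \<in> R" "sim (\<lambda>z. b z * h z) (mul b h)" if "b \<in> J" "h \<in> W" for b h
 proof -
  have "\<exists>a. a \<in> R \<and> sim (\<lambda>z. b z * h z) a" using that unfolding J_def by blast
  hence "mul b h \<in> R \<and> sim (\<lambda>z. b z * h z) (mul b h)" unfolding mul_def by (rule someI_ex)
  thus "mul b h \<in> R" "sim (\<lambda>z. b z * h z) (mul b h)" by auto
 qed
 have mul_eq: "mul b h = a" if "a \<in> R" "sim (\<lambda>z. b z * h z) a" for a b h
 proof -
  have "\<exists>a. a \<in> R \<and> sim (\<lambda>z. b z * h z) a" using that by blast
  hence "mul b h \<in> R \<and> sim (\<lambda>z. b z * h z) (mul b h)" unfolding mul_def by (rule someI_ex)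
  thus ?thesis using R_eq[of "mul b h" a] that sim_sym sim_trans by blast
 qed
 have sim_l: "sim (\<lambda>z. (b + b') z * h z) (a + a')"
  if "sim (\<lambda>z. b z * h z) a" "sim (\<lambda>z. b' z * h z) a'" for b b' h a a'
  using that unfolding sim_def by eventually_elim (simp add: algebra_simps)
 have sim_r: "sim (\<lambda>z. b z * (h + h') z) (a + a')"
  if "sim (\<lambda>z. b z * h z) a" "sim (\<lambda>z. b z * h' z) a'" for b h h' a a'
  using that unfolding sim_def by eventually_elim (simp add: algebra_simps)
 have sim_sl: "sim (\<lambda>z. (c * b z) * h z) (\<lambda>z. c * a z)" if "sim (\<lambda>z. b z * h z) a" for b h a c
  using that unfolding sim_def by eventually_elim (simp add: algebra_simps)
 have sim_sr: "sim (\<lambda>z. b z * (c * h z)) (\<lambda>z. c * a z)" if "sim (\<lambda>z. b z * h z) a" for b h a c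
  using that unfolding sim_def by eventually_elim (simp add: algebra_simps)
 have subJ: "fun_space.subspace J"
 proof (rule fun_space.subspaceI)
  show "0 \<in> J" using sim_refl F.S_closed(3) by (auto simp: J_def zero_fun_def intro!: bexI[of _ "\<lambda>z. 0"])
 next
  fix b b' assume b: "b \<in> J" "b' \<in> J"
  show "b + b' \<in> J" unfolding J_def
  proof (intro CollectI conjI ballI)
   show "b + b' \<in> R" using b JR by (intro F.S_closed) auto
   fix h assume h: "h \<in> W"
   show "\<exists>a\<in>R. sim (\<lambda>z. (b + b') z * h z) a"
    by (rule bexI, rule sim_l[OF mul(2)[OF b(1) h] mul(2)[OF b(2) h]]) (intro F.S_closed mul b h)
  qed
 next
  fix c b assume b: "b \<in> J"
  show "(\<lambda>z. c * b z) \<in> J" unfolding J_def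
  proof (intro CollectI conjI ballI)
   show "(\<lambda>z. c * b z) \<in> R" using b JR by (intro F.S_closed) auto
   fix h assume h: "h \<in> W"
   show "\<exists>a\<in>R. sim (\<lambda>z. (c * b z) * h z) a"
    by (rule bexI, rule sim_sl[OF mul(2)[OF b h]]) (intro F.S_closed mul b h)
  qed
 qed
 have mul_U: "(\<lambda>z. b (k z)) \<in> J" "\<And>h. h \<in> W ==> mul (\<lambda>z. b (k z)) (\<lambda>z. h (k z)) = (\<lambda>z. mul b h (k z))"
  if k: "k \<in> U" and b: "b \<in> J" for b k
 proof -
  have s: "(\<lambda>z. mul b h (k z)) \<in> R" "sim (\<lambda>z. b (k z) * h (k z)) (\<lambda>z. mul b h (k z))" if "h \<in> W" for h
   using R_U[OF k mul(1)[OF b that]] sim_U[OF k mul(2)[OF b that]] by auto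
  show "mul (\<lambda>z. b (k z)) (\<lambda>z. h (k z)) = (\<lambda>z. mul b h (k z))" if "h \<in> W" for h
   by (rule mul_eq[OF s[OF that]])
  show "(\<lambda>z. b (k z)) \<in> J" unfolding J_def
  proof (intro CollectI conjI ballI)
   show "(\<lambda>z. b (k z)) \<in> R" using R_U k b JR by blast
   fix h assume "h \<in> W"
   hence "(\<lambda>z. h (inv_into UNIV k z)) \<in> W" by (rule W_U[OF U_inv[OF k]])
   from s[OF this] show "\<exists>a\<in>R. sim (\<lambda>z. b (k z) * h z) a" unfolding U_inverse[OF k] by blast
  qed
 qed
 have "on_set V d \<in> J" unfolding J_def
 proof (intro CollectI conjI ballI)
  show "on_set V d \<in> R" using d(2) by (auto simp: R_def regular_functions_def)
  fix h assume "h \<in> W"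
  then obtain a where a: "a \<in> polys_le M" "sim (\<lambda>z. d z * h z) a" using d(3) unfolding W_def by blast
  have "sim (\<lambda>z. on_set V d z * h z) (\<lambda>z. d z * h z)"
   unfolding sim_def by (rule eventually_mono[OF generic_V]) (simp add: on_set_def)
  hence "sim (\<lambda>z. on_set V d z * h z) (on_set V a)" using a(2) on_set_sim sim_sym sim_trans by blast
  thus "\<exists>a\<in>R. sim (\<lambda>z. on_set V d z * h z) a" using a(1) unfolding R_def regular_functions_def by blast
 qed
 note dJ = this
 obtain B0 where B0: "finite B0" "B0 \<subseteq> J" "fun_space.span B0 = J"
  using regular_functions_finite_span[OF _ subJ] JR unfolding R_def by blast
 obtain E where E: "F.orthonormal E" "fun_space.span E = J" using F.orthonormal_basis_exists[of B0] F_def B0 JR by blast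
 have EJ: "E \<subseteq> J" using fun_space.span_superset[of E] E(2) by blast
 have finE: "finite E" using E(1) by (simp add: F.orthonormal_def)
 define B where "B h h' = (\<Sum>b\<in>E. F (mul b h) (mul b h'))" for h h'
 have mul_add_r: "mul b (h + h') = mul b h + mul b h'" if "b \<in> J" "h \<in> W" "h' \<in> W" for b h h'
  by (rule mul_eq[OF F.S_closed(1) sim_r]) (use mul that in auto)
 have mul_scale_r: "mul b (\<lambda>z. c * h z) = (\<lambda>z. c * mul b h z)" if "b \<in> J" "h \<in> W" for b h c
  by (rule mul_eq[OF F.S_closed(2) sim_sr]) (use mul that in auto)
 have mul_add_l: "mul (b + b') h = mul b h + mul b' h" if "b \<in> J" "b' \<in> J" "h \<in> W" for b b' h
  by (rule mul_eq[OF F.S_closed(1) sim_l]) (use mul that in auto)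
 have mul_scale_l: "mul (\<lambda>z. c * b z) h = (\<lambda>z. c * mul b h z)" if "b \<in> J" "h \<in> W" for b h c
  by (rule mul_eq[OF F.S_closed(2) sim_sl]) (use mul that in auto)
 have herm: "hermitian_form (\<lambda>c f z. c * f z) W B"
 proof
  show "fun_space.subspace W" by (rule subW)
 next
  fix x y z assume "x \<in> W" "y \<in> W" "z \<in> W"
  thus "B (x + y) z = B x z + B y z" unfolding B_def sum.distrib[symmetric]
   by (intro sum.cong refl) (use EJ mul in \<open>auto simp: mul_add_r F.ip_add_left simp del: plus_fun_apply\<close>)
 next
  fix x z c assume "x \<in> W" "z \<in> W"
  thus "B (\<lambda>z. c * x z) z = c * B x z" unfolding B_def sum_distrib_left
   by (intro sum.cong refl) (use EJ mul in \<open>auto simp: mul_scale_r F.ip_scale_left\<close>)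
 next
  fix x y assume "x \<in> W" "y \<in> W"
  thus "cnj (B x y) = B y x" unfolding B_def cnj_sum by (intro sum.cong refl F.ip_cnj) (use EJ mul in auto)
 next
  fix x assume "x \<in> W"
  thus "0 \<le> Re (B x x)" unfolding B_def Re_sum by (intro sum_nonneg F.ip_nonneg) (use EJ mul in auto)
 qed
 have B_def0: "sim h 0" if h: "h \<in> W" and 0: "B h h = 0" for h
 proof -
  have "(\<Sum>b\<in>E. Re (F (mul b h) (mul b h))) = 0" using 0 by (simp add: B_def Re_sum[symmetric])
  moreover have "\<forall>b\<in>E. 0 \<le> Re (F (mul b h) (mul b h))" using EJ mul h F.ip_nonneg by blast
  ultimately have 1: "\<forall>b\<in>E. Re (F (mul b h) (mul b h)) = 0" using finE by (simp add: sum_nonneg_eq_0_iff)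
  have 2: "mul b h = 0" if "b \<in> E" for b
  proof -
   have R: "mul b h \<in> R" using that EJ mul h by blast
   hence "F (mul b h) (mul b h) = 0" using F.ip_self_real[OF R] 1 that by simp
   with R show ?thesis using F_def by blast
  qed
  have "fun_space.subspace {b \<in> J. mul b h = 0}"
  proof (rule fun_space.subspaceI)
   show "0 \<in> {b \<in> J. mul b h = 0}"
    using fun_space.subspace_0[OF subJ] mul_eq[of 0 0 h] F.S_closed(3) sim_refl[of 0] by (simp add: zero_fun_def)
  next
   fix x y assume "x \<in> {b \<in> J. mul b h = 0}" "y \<in> {b \<in> J. mul b h = 0}"
   thus "x + y \<in> {b \<in> J. mul b h = 0}" using fun_space.subspace_add[OF subJ] mul_add_l[OF _ _ h] by simp
  next
   fix c x assume "x \<in> {b \<in> J. mul b h = 0}"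
   thus "(\<lambda>z. c * x z) \<in> {b \<in> J. mul b h = 0}"
    using fun_space.subspace_scale[OF subJ] mul_scale_l[OF _ h] by (simp add: zero_fun_def)
  qed
  from fun_space.span_minimal[OF _ this, of E] have "J \<subseteq> {b \<in> J. mul b h = 0}" using EJ 2 E(2) by blast
  with dJ mul(2)[OF dJ h] have "sim (\<lambda>z. on_set V d z * h z) 0" by auto
  hence "eventually (\<lambda>z. on_set V d z * h z = 0) generic" by (simp add: sim_def)
  hence "eventually (\<lambda>z. h z = 0) generic" using generic_nonzero[OF d(1)] generic_V
   by eventually_elim (simp add: on_set_def)
  thus ?thesis by (simp add: sim_def)
 qed
 have B_sim: "B h u = B h u'" if "h \<in> W" "u \<in> W" "u' \<in> W" "sim u u'" for h u u'
 proof -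
  have "mul b u = mul b u'" if b: "b \<in> E" for b
   by (rule mul_eq) (use mul[of b u'] sim_mult[OF \<open>sim u u'\<close>, of b] sim_trans EJ b \<open>u' \<in> W\<close> in blast)+
  thus ?thesis by (simp add: B_def)
 qed
 have B_U: "B (\<lambda>z. h (k z)) (\<lambda>z. h' (k z)) = B h h'" if k: "k \<in> U" and h: "h \<in> W" "h' \<in> W" for k h h'
 proof -
  define k' where "k' = inv_into UNIV k"
  have k': "k' \<in> U" "\<And>z. k (k' z) = z" "\<And>z. k' (k z) = z" using U_inv[OF k] U_inverse[OF k] by (auto simp: k'_def)
  define E' where "E' = (\<lambda>b z. b (k' z)) ` E"
  have inj: "inj_on (\<lambda>b z. b (k' z)) E"
  proof (rule inj_onI, rule ext)
   fix b b' z assume "(\<lambda>z. b (k' z)) = (\<lambda>z. b' (k' z))"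
   from fun_cong[OF this, of "k z"] show "b z = b' z" by (simp add: k'(3))
  qed
  have E'J: "E' \<subseteq> J" using EJ mul_U(1)[OF k'(1)] by (auto simp: E'_def)
  have on': "F.orthonormal E'" unfolding F.orthonormal_def
  proof (intro conjI ballI)
   show "finite E'" using finE by (simp add: E'_def)
   show "E' \<subseteq> R" using E'J JR by blast
   fix x y assume "x \<in> E'" "y \<in> E'"
   then obtain b c where bc: "b \<in> E" "c \<in> E" "x = (\<lambda>z. b (k' z))" "y = (\<lambda>z. c (k' z))" by (auto simp: E'_def)
   have "F x y = F b c" unfolding bc using F_inv U_isometry[OF k'(1)] bc(1,2) EJ JR by blast
   also have "... = (if b = c then 1 else 0)" using E(1) bc by (auto simp: F.orthonormal_def)
   also have "... = (if x = y then 1 else 0)" using inj_onD[OF inj, of b c] bc by auto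
   finally show "F x y = (if x = y then 1 else 0)" .
  qed
  have span': "(\<lambda>z. b (k' z)) \<in> fun_space.span E'" if "b \<in> fun_space.span E" for b using that
  proof (induction rule: fun_span_induct)
   case (base a)
   thus ?case by (intro fun_space.span_base) (auto simp: E'_def)
  qed (auto intro: fun_span_zero fun_span_add fun_span_scale)
  have "J \<subseteq> fun_space.span E'"
  proof
   fix b assume "b \<in> J"
   hence "(\<lambda>z. b (k z)) \<in> fun_space.span E" using mul_U(1)[OF k] E(2) by blast
   from span'[OF this] show "b \<in> fun_space.span E'" by (simp add: k'(2))
  qed
  hence spanE': "fun_space.span E' = J" using fun_space.span_minimal[OF E'J subJ] by blast
  have "B (\<lambda>z. h (k z)) (\<lambda>z. h' (k z)) = (\<Sum>b\<in>E. F (mul (\<lambda>z. b (k' z)) h) (mul (\<lambda>z. b (k' z)) h'))"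
   unfolding B_def
  proof (rule sum.cong[OF refl])
   fix b assume b: "b \<in> E"
   hence bJ: "(\<lambda>z. b (k' z)) \<in> J" using EJ mul_U(1)[OF k'(1)] by blast
   have "mul b (\<lambda>z. h (k z)) = (\<lambda>z. mul (\<lambda>z. b (k' z)) h (k z))" if "h \<in> W" for h
    using mul_U(2)[OF k bJ that] by (simp add: k'(3))
   thus "F (mul b (\<lambda>z. h (k z))) (mul b (\<lambda>z. h' (k z))) = F (mul (\<lambda>z. b (k' z)) h) (mul (\<lambda>z. b (k' z)) h')"
    using F_inv U_isometry[OF k] mul(1)[OF bJ] h by simp
  qed
  also have "... = (\<Sum>b\<in>E'. F (mul b h) (mul b h'))" unfolding E'_def by (simp add: sum.reindex[OF inj])
  also have "... = B h h'" unfolding B_def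
  proof (rule F.sesquilinear_trace_unique[OF on' E(1), where B = "\<lambda>b c. F (mul b h) (mul c h')"])
   show "fun_space.span E' = fun_space.span E" using spanE' E(2) by simp
  qed (simp_all add: spanE' mul h mul_add_l mul_scale_l F.ip_add_left F.ip_add_right F.ip_scale_left F.ip_scale_right
    del: plus_fun_apply)
  finally show ?thesis .
 qed
 show ?thesis using herm B_def0 B_sim B_U unfolding W_def by (intro exI[of _ B] conjI ballI impI)
qed

end

text \<open>\<open>\<omega>\<close> is a primitive root of unity of order \<open>D + 1\<close>, so the powers of \<open>\<omega>^i\<close> sum to zero for \<open>0 < i \<le> D\<close>.\<close>

lemma root_of_unity_average:
 "\<exists>\<omega> :: complex. cmod \<omega> = 1 \<and> (\<forall>c. (\<Sum>j<Suc D. \<Sum>i\<le>D. c i * (\<omega> ^ j) ^ i) = of_nat (Suc D) * c 0)"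
proof -
 define m where "m = real (Suc D)"
 have m: "m > 0" by (simp add: m_def)
 define \<omega> where "\<omega> = cis (2 * pi / m)"
 have one: "\<omega> ^ i \<noteq> 1" if "0 < i" "i \<le> D" for i
 proof
  assume "\<omega> ^ i = 1"
  hence "cis (real i * (2 * pi / m)) = 1" unfolding \<omega>_def Complex.DeMoivre .
  hence "cos (real i * (2 * pi / m)) = 1" by (metis cis.simps(1) one_complex.simps(1))
  then obtain k :: int where "real i * (2 * pi / m) = of_int k * (2 * pi)" unfolding cos_one_2pi_int by (auto simp: algebra_simps)
  hence "real i = of_int k * m" using m by (simp add: field_simps)
  hence "real i = of_int (k * int (Suc D))" by (simp add: m_def)
  hence "int i = k * int (Suc D)" by linarith
  hence "int (Suc D) dvd int i" by simp
  hence "Suc D \<le> i" using that zdvd_imp_le[of "int (Suc D)" "int i"] by simp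
  with that show False by simp
 qed
 have root: "\<omega> ^ Suc D = 1" using m unfolding \<omega>_def Complex.DeMoivre m_def[symmetric] by simp
 have geo: "(\<Sum>j<Suc D. (\<omega> ^ i) ^ j) = (if i = 0 then of_nat (Suc D) else 0)" if "i \<le> D" for i
 proof (cases "i = 0")
  case False
  hence "\<omega> ^ i \<noteq> 1" using one that by simp
  hence "(\<Sum>j<Suc D. (\<omega> ^ i) ^ j) = ((\<omega> ^ i) ^ Suc D - 1) / (\<omega> ^ i - 1)" by (rule geometric_sum)
  also have "(\<omega> ^ i) ^ Suc D = (\<omega> ^ Suc D) ^ i" by (simp only: power_mult[symmetric] mult.commute)
  finally show ?thesis using False root by (simp del: power_Suc)
 qed simp
 have "(\<Sum>j<Suc D. \<Sum>i\<le>D. c i * (\<omega> ^ j) ^ i) = of_nat (Suc D) * c 0" for c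
 proof -
  have "(\<Sum>j<Suc D. \<Sum>i\<le>D. c i * (\<omega> ^ j) ^ i) = (\<Sum>i\<le>D. c i * (\<Sum>j<Suc D. (\<omega> ^ i) ^ j))"
   by (subst sum.swap) (simp add: sum_distrib_left power_mult[symmetric] mult.commute del: sum.lessThan_Suc)
  also have "... = (\<Sum>i\<le>D. if i = 0 then of_nat (Suc D) * c 0 else 0)"
   by (intro sum.cong refl) (simp only: geo atMost_iff, simp)
  also have "... = of_nat (Suc D) * c 0" by simp
  finally show ?thesis .
 qed
 thus ?thesis by (intro exI[of _ \<omega>]) (simp add: \<omega>_def)
qed

context unitary_cone
begin

lemma sim_polynomial_subspace: "fun_space.subspace {h \<in> bounded_rational n. \<exists>a\<in>polys. sim h a}"
proof (rule fun_space.subspaceI)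
 have "sim 0 (\<lambda>z. 0)" by (simp add: sim_def)
 thus "0 \<in> {h \<in> bounded_rational n. \<exists>a\<in>polys. sim h a}" using bounded_rational_zero polys_const by blast
next
 fix x y assume x: "x \<in> {h \<in> bounded_rational n. \<exists>a\<in>polys. sim h a}"
  and y: "y \<in> {h \<in> bounded_rational n. \<exists>a\<in>polys. sim h a}"
 obtain a where a: "a \<in> polys" "sim x a" using x by blast
 obtain b where b: "b \<in> polys" "sim y b" using y by blast
 have "sim (x + y) (\<lambda>z. a z + b z)" using sim_add[OF a(2) b(2)] by (simp add: plus_fun_def)
 thus "x + y \<in> {h \<in> bounded_rational n. \<exists>a\<in>polys. sim h a}"
  using polys_add[OF a(1) b(1)] bounded_rational_add x y by blast
next
 fix c x assume x: "x \<in> {h \<in> bounded_rational n. \<exists>a\<in>polys. sim h a}"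
 obtain a where a: "a \<in> polys" "sim x a" using x by blast
 show "(\<lambda>z. c * x z) \<in> {h \<in> bounded_rational n. \<exists>a\<in>polys. sim h a}"
  using polys_cmult[OF a(1)] sim_scale[OF a(2)] bounded_rational_scale x by blast
qed

text \<open>The pullback of \<open>h \<circ> k \<circ> \<rho> \<tau>\<close> is \<open>x \<mapsto> q (P2 x + \<tau> P1 x)\<close>, a polynomial in \<open>\<tau>\<close> whose average over enough
 roots of unity is its constant term. As \<open>P2 (\<Psi> x) = P2 x\<close>, this constant term is also the pullback of
 \<open>z \<mapsto> q (P2 z)\<close>.\<close>

lemma rotation_average_polynomial:
 assumes h: "h \<in> bounded_rational n" and k: "k \<in> U" and q: "pulls (\<lambda>z. h (k z)) q"
 shows "\<exists>\<omega> D. cmod \<omega> = 1 \<and>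
  sim (\<lambda>z. \<Sum>j<Suc D. (1 / of_nat (Suc D)) * h (k (\<rho> (\<omega> ^ j) z))) (\<lambda>z. q (P2 z))"
proof -
 obtain D where D: "q \<in> polys_le D" using polys_degree pulls_polys[OF q] by blast
 obtain \<omega> :: complex where \<omega>: "cmod \<omega> = 1"
  "\<forall>c. (\<Sum>j<Suc D. \<Sum>i\<le>D. c i * (\<omega> ^ j) ^ i) = of_nat (Suc D) * c 0"
  using root_of_unity_average[of D] by (elim exE conjE)
 have unit: "cmod (\<omega> ^ j) = 1" for j using \<omega>(1) by (simp add: norm_power)
 have pulls_rot: "pulls (\<lambda>z. h (k (\<rho> \<tau> z))) (\<lambda>x. q (P2 x + scale \<tau> (P1 x)))" if "cmod \<tau> = 1" for \<tau>
 proof -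
  obtain f g where fg: "represents f g (\<lambda>z. h (k z))" using pulls_represented[OF q] by blast
  have lin: "endo scale (\<lambda>x. P2 x + scale \<tau> (P1 x))"
   using P1_linear P2_linear by (auto simp: Vector_Spaces.linear_iff scale_right_distrib ac_simps)
  show ?thesis by (rule pullsI[OF represents_U[OF \<rho>_U[OF that] fg] polys_comp_linear[OF pulls_polys[OF q] lin]])
    (simp add: \<rho>_\<Psi>[OF that] pulls_represents[OF q fg])
 qed
 have pulls_sum: "pulls (\<lambda>z. \<Sum>j<m. (1 / of_nat (Suc D)) * h (k (\<rho> (\<omega> ^ j) z)))
   (\<lambda>x. \<Sum>j<m. (1 / of_nat (Suc D)) * q (P2 x + scale (\<omega> ^ j) (P1 x)))" for m
 proof (induction m)
  case 0
  thus ?case using pulls_poly[OF polys_const[of 0]] by simp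
 next
  case (Suc m)
  show ?case using pulls_add[OF Suc pulls_scale[OF pulls_rot[OF unit[of m]], of "1 / of_nat (Suc D)"]]
   by (simp add: plus_fun_def)
 qed
 have avg: "(\<Sum>j<Suc D. (1 / of_nat (Suc D)) * q (P2 x + scale (\<omega> ^ j) (P1 x))) = q (P2 x)" for x
 proof -
  obtain c where c: "\<forall>t. q (P2 x + scale t (P1 x)) = (\<Sum>i\<le>D. c i * t ^ i)" using polys_le_line[OF D] by blast
  have "(\<Sum>j<Suc D. q (P2 x + scale (\<omega> ^ j) (P1 x))) = of_nat (Suc D) * c 0" using c \<omega>(2) by simp
  moreover have "q (P2 x) = c 0"
  proof -
   have "q (P2 x) = (\<Sum>i\<le>D. c i * 0 ^ i)" using spec[OF c, of 0] by simp
   also have "... = (\<Sum>i\<in>{0}. c i * 0 ^ i)" by (rule sum.mono_neutral_right) auto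
   finally show ?thesis by simp
  qed
  ultimately show ?thesis unfolding sum_distrib_left[symmetric] by (simp del: of_nat_Suc sum.lessThan_Suc)
 qed
 have "pulls (\<lambda>z. q (P2 z)) (\<lambda>x. q (P2 x))"
  using pulls_poly[OF polys_comp_linear[OF pulls_polys[OF q] P2_linear]] by (simp add: P2_\<Psi>)
 moreover have "pulls (\<lambda>z. \<Sum>j<Suc D. (1 / of_nat (Suc D)) * h (k (\<rho> (\<omega> ^ j) z))) (\<lambda>x. q (P2 x))"
  using pulls_sum[of "Suc D"] unfolding avg .
 ultimately show ?thesis using pulls_inj \<omega>(1) by blast
qed

text \<open>\<open>h'\<close> is the part of \<open>h\<close> orthogonal to the space \<open>A\<close> of polynomials. The average \<open>h0\<close> of the translates of
 \<open>h' \<circ> k\<close> under rotations is orthogonal to \<open>A\<close> by invariance and lies in \<open>A\<close>, so it vanishes. This says that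
 \<open>h' \<circ> k\<close> vanishes at the points \<open>y\<close> with \<open>P2 y = y\<close>, and the images of these points cover \<open>V\<close>.\<close>

theorem bounded_rational_polynomial:
 assumes h: "h \<in> bounded_rational n"
 shows "\<exists>a\<in>polys. sim h a"
proof -
 define A where "A = {h \<in> bounded_rational n. \<exists>a\<in>polys. sim h a}"
 have subA: "fun_space.subspace A" unfolding A_def by (rule sim_polynomial_subspace)
 have AW: "A \<subseteq> bounded_rational n" by (auto simp: A_def)
 obtain B where herm: "hermitian_form (\<lambda>c f z. c * f z) (bounded_rational n) B"
  and B_0: "\<forall>h\<in>bounded_rational n. B h h = 0 --> sim h 0"
  and B_sim: "\<forall>h\<in>bounded_rational n. \<forall>u\<in>bounded_rational n. \<forall>u'\<in>bounded_rational n. sim u u' --> B h u = B h u'"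
  and B_U: "\<forall>k\<in>U. \<forall>h\<in>bounded_rational n. \<forall>h'\<in>bounded_rational n. B (\<lambda>z. h (k z)) (\<lambda>z. h' (k z)) = B h h'"
  using invariant_form_bounded_rational[of n] by (elim exE conjE)
 interpret B: hermitian_form "\<lambda>c f z. c * f z" "bounded_rational n" B by (rule herm)
 obtain F where F: "finite F" "F \<subseteq> A" "\<forall>h\<in>A. \<exists>u\<in>fun_space.span F. sim h u"
  using finite_modulo_sim[OF AW subA] by (elim exE conjE)
 have spanF: "fun_space.span F \<subseteq> bounded_rational n" using B.span_S F(2) AW by blast
 obtain a where a: "a \<in> fun_space.span F" "\<forall>u\<in>fun_space.span F. B (h - a) u = 0"
  using B.orthogonal_projection_exists[OF F(1) _ h] F(2) AW by blast
 have aA: "a \<in> A" using fun_space.span_minimal[OF F(2) subA] a(1) by blast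
 define h' where "h' = h - a"
 have h': "h' \<in> bounded_rational n" unfolding h'_def using h aA AW by (intro B.S_closed) auto
 have orth: "B h' u = 0" if u: "u \<in> A" for u
 proof -
  obtain v where v: "v \<in> fun_space.span F" "sim u v" using F(3) u by blast
  have "B h' u = B h' v"
   by (rule mp[OF bspec[OF bspec[OF bspec[OF B_sim h'] subsetD[OF AW u]] subsetD[OF spanF v(1)]] v(2)])
  with a(2) v(1) show ?thesis by (simp add: h'_def)
 qed
 have A_U: "(\<lambda>z. u (k z)) \<in> A" if k: "k \<in> U" and u: "u \<in> A" for k u
 proof -
  obtain b where b: "b \<in> polys" "sim u b" using u by (auto simp: A_def)
  have "u \<in> bounded_rational n" using u AW by blast
  thus ?thesis using sim_U[OF k b(2)] polys_comp_linear[OF b(1) U_linear[OF k]] bounded_rational_U[OF k]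
   unfolding A_def by (intro CollectI conjI bexI)
 qed
 have orth_U: "B (\<lambda>z. h' (k z)) u = 0" if k: "k \<in> U" and u: "u \<in> A" for k u
 proof -
  have v: "(\<lambda>z. u (inv_into UNIV k z)) \<in> A" by (rule A_U[OF U_inv[OF k] u])
  have "B (\<lambda>z. h' (k z)) (\<lambda>z. u (inv_into UNIV k (k z))) = B h' (\<lambda>z. u (inv_into UNIV k z))"
   by (rule bspec[OF bspec[OF bspec[OF B_U k] h'] subsetD[OF AW v]])
  thus ?thesis using orth[OF v] by (simp add: U_inverse[OF k])
 qed
 have q0: "q (P2 x) = 0" if k: "k \<in> U" and q: "pulls (\<lambda>z. h' (k z)) q" for k q x
 proof -
  obtain \<omega> D where \<omega>: "cmod \<omega> = 1"
   "sim (\<lambda>z. \<Sum>j<Suc D. (1 / of_nat (Suc D)) * h' (k (\<rho> (\<omega> ^ j) z))) (\<lambda>z. q (P2 z))"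
   using rotation_average_polynomial[OF h' k q] by (elim exE conjE)
  define t where "t j z = (1 / of_nat (Suc D)) * h' (k (\<rho> (\<omega> ^ j) z))" for j z
  have rot: "(\<lambda>z. k (\<rho> (\<omega> ^ j) z)) \<in> U" for j
   using \<omega>(1) by (intro U_comp[OF k \<rho>_U]) (simp add: norm_power)
  have t: "t j \<in> bounded_rational n" for j
   unfolding t_def[abs_def] by (rule bounded_rational_scale[OF bounded_rational_U[OF rot h']])
  have sum_t: "(\<lambda>z. \<Sum>j<m. t j z) = sum t {..<m}" for m by (induction m) (auto simp: fun_eq_iff)
  define h0 where "h0 = sum t {..<Suc D}"
  have h0W: "h0 \<in> bounded_rational n" unfolding h0_def by (intro B.S_closed t)
  have h0_sim: "sim h0 (\<lambda>z. q (P2 z))" using \<omega>(2) unfolding h0_def sum_t[symmetric] t_def .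
  have h0A: "h0 \<in> A" unfolding A_def
   by (intro CollectI conjI bexI[of _ "\<lambda>z. q (P2 z)"] h0W h0_sim polys_comp_linear[OF pulls_polys[OF q] P2_linear])
  have "B h0 h0 = (\<Sum>j<Suc D. B (t j) h0)" unfolding h0_def by (rule B.ip_sum_left) (use t h0W in \<open>auto simp: h0_def\<close>)
  also have "... = 0"
  proof (rule sum.neutral, rule ballI)
   fix j
   have "B (t j) h0 = (1 / of_nat (Suc D)) * B (\<lambda>z. h' (k (\<rho> (\<omega> ^ j) z))) h0"
    unfolding t_def by (rule B.ip_scale_left[OF bounded_rational_U[OF rot h'] h0W])
   thus "B (t j) h0 = 0" using orth_U[OF rot h0A] by simp
  qed
  finally have "sim h0 0" using B_0 h0W by blast
  hence "sim (\<lambda>z. q (P2 z)) 0" using h0_sim sim_sym sim_trans by blast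
  hence "pulls (\<lambda>z. 0) (\<lambda>x. q (P2 (\<Psi> x)))"
   using pulls_sim[OF pulls_poly[OF polys_comp_linear[OF pulls_polys[OF q] P2_linear]]] by (simp add: zero_fun_def)
  moreover have "pulls (\<lambda>z. 0) (\<lambda>x. 0)" using pulls_poly[OF polys_const[of 0]] by simp
  ultimately have "(\<lambda>x. q (P2 (\<Psi> x))) = (\<lambda>x. 0)" by (rule pulls_unique)
  from fun_cong[OF this, of x] show ?thesis by (simp add: P2_\<Psi>)
 qed
 obtain f g where fg: "represents f g h'" using h' by (auto simp: bounded_rational_def)
 have "f z = 0" if z: "z \<in> V" for z
 proof -
  obtain k y where k: "k \<in> U" "P2 y = y" "z = k y" using V_cover[OF z] by blast
  obtain D where "\<forall>h\<in>bounded_rational n. \<exists>p\<in>polys_le D. pulls h p" using bounded_rational_pulls[of n] by (elim exE)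
  from bspec[OF this bounded_rational_U[OF k(1) h']] obtain q where q: "pulls (\<lambda>z. h' (k z)) q" by (elim bexE)
  have "f (k (\<Psi> y)) = q y * g (k (\<Psi> y))" by (rule pulls_represents[OF q represents_U[OF k(1) fg]])
  moreover have "\<Psi> y = y" using \<Psi>_P2[of y] k(2) by simp
  moreover have "q y = 0" using q0[OF k(1) q, of y] k(2) by simp
  ultimately show ?thesis using k(3) by simp
 qed
 note f0 = this
 have "eventually (\<lambda>z. g z * h' z = f z) generic" "eventually (\<lambda>z. g z \<noteq> 0) generic"
  using fg generic_nonzero by (auto simp: represents_def)
 hence "eventually (\<lambda>z. h' z = 0) generic" using generic_V by eventually_elim (use f0 in auto)
 hence "sim h a" by (simp add: sim_def h'_def)
 moreover obtain b where "b \<in> polys" "sim a b" using aA unfolding A_def by (elim CollectE conjE bexE)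
 ultimately show ?thesis using sim_trans[of h a b] by (intro bexI[of _ b])
qed

end

section \<open>Polynomial parametrisation of the Kepler variety\<close>

context hermitian_jordan_triple
begin

text \<open>The exponential \<open>exp(D(v, c))\<close>: for \<open>v\<close> in the Peirce 1-space, \<open>D(v, c)\<close> lowers the Peirce degree by one, so
 the series stops after the quadratic term.\<close>

definition frobenius :: "'a => 'a => 'a => 'a" where
 "frobenius c v z = z + tp v c z + smul (1/2) (tp v c (tp v c z))"

text \<open>The exponential \<open>exp(D(c, v))\<close>, which acts on the middle argument.\<close>

definition frobenius_adjoint :: "'a => 'a => 'a => 'a" where
 "frobenius_adjoint c v z = z + tp c v z + smul (1/2) (tp c v (tp c v z))"

lemma frobenius_linear: "endo smul (frobenius c v)" unfolding Vector_Spaces.linear_iff frobenius_def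
 by (auto simp: vector_space_axioms tp_simps scale_right_distrib algebra_simps)

lemma peirce_nilpotent:
 assumes c: "tripotent c" and v: "v \<in> peirce c 1"
 shows "tp v c (tp v c (tp v c z)) = 0" "tp c v (tp c v (tp c v z)) = 0"
proof -
 note c2 = tripotent_in_peirce_2[OF c]
 have 1: "tp v c (tp v c (tp v c z)) = 0" if z: "z \<in> peirce c k" "k \<in> {0, 1, 2}" for z k
 proof -
  have "tp v c (tp v c (tp v c z)) \<in> peirce c (1 - 2 + (1 - 2 + (1 - 2 + k)))" by (intro peirce_mult v c2 z)
  thus ?thesis by (rule peirce_trivial[OF c]) (use z in auto)
 qed
 have 2: "tp c v (tp c v (tp c v z)) = 0" if z: "z \<in> peirce c k" "k \<in> {0, 1, 2}" for z k
 proof -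
  have "tp c v (tp c v (tp c v z)) \<in> peirce c (2 - 1 + (2 - 1 + (2 - 1 + k)))" by (intro peirce_mult v c2 z)
  thus ?thesis by (rule peirce_trivial[OF c]) (use z in auto)
 qed
 show "tp v c (tp v c (tp v c z)) = 0" by (induction z rule: peirce_induct[OF c]) (auto simp: tp_simps dest: 1)
 show "tp c v (tp c v (tp c v z)) = 0" by (induction z rule: peirce_induct[OF c]) (auto simp: tp_simps dest: 2)
qed

text \<open>\<open>A = D(v, c)\<close> and \<open>B = D(c, v)\<close> satisfy \<open>A {a; u; b} = {A a; u; b} - {a; B u; b} + {a; u; A b}\<close>; the formula
 is the exponentiated form. The functions \<open>t0\<close>, ..., \<open>t5\<close> are the terms of \<open>{g z; u; g z}\<close> for the
 exponential \<open>g\<close> of \<open>A\<close>.\<close>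

lemma frobenius_quad:
 assumes c: "tripotent c" and v: "v \<in> peirce c 1"
 shows "tp (frobenius c v z) w (frobenius c v z) = frobenius c v (tp z (frobenius_adjoint c v w) z)"
proof -
 define A where "A = tp v c"
 define B where "B = tp c v"
 have A3: "A (A (A u)) = 0" and B3: "B (B (B u)) = 0" for u using peirce_nilpotent[OF c v] by (simp_all add: A_def B_def)
 have A_add: "A (a + b) = A a + A b" "A (smul q a) = smul q (A a)" "A (a - b) = A a - A b" for a b q
  by (simp_all add: A_def tp_simps tp_diff_right)
 have zero: "tp 0 u u' = 0" "tp u u' 0 = 0" "tp u 0 u' = 0" "A 0 = 0" for u u'
  using tp_scale_left[of 0 0 u u'] tp_scale_right[of u u' 0 0] tp_scale_middle[of u 0 0 u'] tp_scale_right[of v c 0 0]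
  by (simp_all add: A_def)
 have J: "A (tp a u b) = tp (A a) u b + tp a u (A b) - tp a (B u) b" for a u b
  using jordan_identity[of v c a u b] by (simp add: A_def B_def tp_commute[of u v c] algebra_simps)
 define t0 t1 t2 t3 t4 t5 where "t0 u = tp z u z" and "t1 u = tp z u (A z)" and "t2 u = tp z u (A (A z))"
  and "t3 u = tp (A z) u (A z)" and "t4 u = tp (A z) u (A (A z))" and "t5 u = tp (A (A z)) u (A (A z))" for u
 have rules: "A (t0 u) = smul 2 (t1 u) - t0 (B u)" "A (t1 u) = t3 u + t2 u - t1 (B u)"
  "A (t2 u) = t4 u - t2 (B u)" "A (t3 u) = smul 2 (t4 u) - t3 (B u)" "A (t4 u) = t5 u - t4 (B u)"
  "A (t5 u) = - t5 (B u)" for u unfolding t0_def t1_def t2_def t3_def t4_def t5_def J A3 zero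
  by (simp_all add: tp_commute[of "A z" _ z] tp_commute[of "A (A z)" _ "A z"] scale_left_distrib[of 1 1, simplified])
 have t_zero: "t0 0 = 0" "t1 0 = 0" "t2 0 = 0" "t3 0 = 0" "t4 0 = 0" "t5 0 = 0"
  by (simp_all add: t0_def t1_def t2_def t3_def t4_def t5_def zero)
 \<comment> \<open>the vanishing terms with coefficients 1/6 and 1/24 complete an exponential series, so that powers of the derivation appear\<close>
 have "frobenius c v (tp z (frobenius_adjoint c v w) z) = t0 w + (A (t0 w) + t0 (B w))
   + smul (1/2) (A (A (t0 w)) + smul 2 (A (t0 (B w))) + t0 (B (B w)))
   + smul (1/6) (A (A (A (t0 w))) + smul 3 (A (A (t0 (B w)))) + smul 3 (A (t0 (B (B w)))))
   + smul (1/24) (A (A (A (A (t0 w)))) + smul 4 (A (A (A (t0 (B w))))) + smul 6 (A (A (t0 (B (B w))))))"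
  unfolding A3 frobenius_def frobenius_adjoint_def A_def[symmetric] B_def[symmetric]
  by (rule crd_eqI) (simp add: zero tp_simps t0_def A_add crd_simps field_simps)
 also have "... = t0 w + smul 2 (t1 w) + t2 w + t3 w + t4 w + smul (1/4) (t5 w)"
  by (rule crd_eqI) (simp add: rules A_add B3 t_zero crd_simps field_simps)
 also have "... = tp (frobenius c v z) w (frobenius c v z)"
  unfolding frobenius_def A_def[symmetric] t0_def t1_def t2_def t3_def t4_def t5_def
  by (rule crd_eqI) (simp add: tp_simps tp_commute[of "A z" _ z] tp_commute[of "A (A z)" _ z]
    tp_commute[of "A (A z)" _ "A z"] crd_simps field_simps)
 finally show ?thesis ..
qed

lemma frobenius_rank:
 assumes c: "tripotent c" and v: "v \<in> peirce c 1"
 shows "rank_quad (frobenius c v z) \<le> rank_quad z"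
proof -
 interpret pair: finite_dimensional_vector_space_pair smul Basis smul Basis ..
 have "range (quad (frobenius c v z)) \<subseteq> frobenius c v ` range (quad z)"
  by (auto simp: quad_def frobenius_quad[OF c v] linear_scaleD[OF frobenius_linear, symmetric])
 hence "dim (range (quad (frobenius c v z))) \<le> dim (frobenius c v ` range (quad z))" by (rule dim_subset)
 also have "... \<le> dim (range (quad z))" by (rule pair.dim_image_le[OF frobenius_linear])
 finally show ?thesis by (simp add: rank_quad_def)
qed

lemma frobenius_inverse:
 assumes c: "tripotent c" and v: "v \<in> peirce c 1"
 shows "frobenius c (- v) (frobenius c v z) = z"
 by (rule crd_eqI) (simp add: frobenius_def tp_simps tp_minus peirce_nilpotent[OF c v] crd_simps field_simps)

lemma quad_peirce_2:
 assumes c: "tripotent c" and y: "y \<in> peirce c 2"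
 shows "quad y w \<in> peirce c 2" using c
proof (induction w rule: peirce_induct)
 case (eigen k w)
 have "tp y w y \<in> peirce c (2 - k + 2)" by (intro peirce_mult y eigen)
 thus ?case using eigen(2) peirce_trivial[OF c, of "tp y w y" "2 - k + 2"] by (auto simp: quad_def peirce_closed)
next
 case (add x y)
 thus ?case by (simp add: quad_linearity peirce_closed)
qed

lemma rank_quad_peirce_2:
 assumes "tripotent c" "y \<in> peirce c 2"
 shows "rank_quad y \<le> dim (peirce c 2)"
 unfolding rank_quad_def by (rule dim_subset) (use quad_peirce_2[OF assms] in auto)

definition kepler_chart :: "'a => 'a => 'a" where
 "kepler_chart c x = frobenius c (P1 c x) (P2 c x)"

lemma frobenius_components:
 assumes c: "tripotent c" and v: "v \<in> peirce c 1" and y: "y \<in> peirce c 2"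
 shows "tp v c y \<in> peirce c 1" "tp v c (tp v c y) \<in> peirce c 0"
proof -
 note c2 = tripotent_in_peirce_2[OF c]
 show 1: "tp v c y \<in> peirce c 1" using peirce_mult[OF v c2 y] by simp
 show "tp v c (tp v c y) \<in> peirce c 0" using peirce_mult[OF v c2 1] by simp
qed

lemma P_add: "P0 c (x + y) = P0 c x + P0 c y" "P1 c (x + y) = P1 c x + P1 c y" "P2 c (x + y) = P2 c x + P2 c y"
 by (simp_all add: linear_addD P_linear)

lemma P_scale: "P0 c (smul a x) = smul a (P0 c x)" "P1 c (smul a x) = smul a (P1 c x)" "P2 c (smul a x) = smul a (P2 c x)"
 by (simp_all add: linear_scaleD P_linear)

lemma P_frobenius:
 assumes c: "tripotent c" and v: "v \<in> peirce c 1" and y: "y \<in> peirce c 2"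
 shows "P2 c (frobenius c v y) = y" "P1 c (frobenius c v y) = tp v c y"
  "P0 c (frobenius c v y) = smul (1/2) (tp v c (tp v c y))"
 using P_eq(3)[OF c y] P_eq(2)[OF c frobenius_components(1)[OF assms]] P_eq(1)[OF c frobenius_components(2)[OF assms]]
 by (simp_all add: frobenius_def P_add P_scale)

lemma P_P:
 assumes "tripotent c"
 shows "P2 c (P2 c x) = P2 c x" "P1 c (P2 c x) = 0" "P2 c (P1 c x) = 0" "P1 c (P1 c x) = P1 c x"
 using P_eq(2)[OF assms P_in(2)[OF assms]] P_eq(3)[OF assms P_in(3)[OF assms]] by auto

lemma P2_kepler_chart: "tripotent c ==> P2 c (kepler_chart c x) = P2 c x" by (simp add: kepler_chart_def P_frobenius P_in)

lemma kepler_chart_P2: "tripotent c ==> kepler_chart c (P2 c x) = P2 c x"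
 using tp_scale_left[of 0 0] by (simp add: kepler_chart_def P_P frobenius_def)

lemma kepler_chart_rank: "tripotent c ==> rank_quad (kepler_chart c x) \<le> dim (peirce c 2)"
 using frobenius_rank[of c "P1 c x" "P2 c x"] rank_quad_peirce_2[of c "P2 c x"] by (simp add: kepler_chart_def P_in)

text \<open>Multiplication by \<open>\<tau>^(2-k)\<close> on the Peirce \<open>k\<close>-space: it fixes \<open>Z_2\<close> and rotates \<open>Z_1\<close> by \<open>\<tau>\<close>.\<close>

definition peirce_rotation :: "'a => complex => 'a => 'a" where
 "peirce_rotation c \<tau> z = smul (\<tau>\<^sup>2) (peirce_scaling c (1 / \<tau>) z)"

lemma unit_scaling_automorphism: "cmod a = 1 ==> smul a \<in> triple_automorphisms"
proof -
 assume a: "cmod a = 1"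
 hence a0: "a \<noteq> 0" and aa: "a * cnj a = 1" using cmod_1_cnj[OF a] by auto
 have "bij (smul a)" by (rule o_bij[of "smul (1 / a)"]) (use a0 in \<open>auto simp: fun_eq_iff\<close>)
 moreover have "smul a (tp u v w) = tp (smul a u) (smul a v) (smul a w)" for u v w
  using aa by (simp add: tp_simps mult.commute)
 ultimately show ?thesis
  by (auto simp: triple_automorphisms_def Vector_Spaces.linear_iff vector_space_axioms scale_right_distrib mult.commute)
qed

lemma automorphism_comp: "g \<in> triple_automorphisms ==> h \<in> triple_automorphisms ==> (\<lambda>z. g (h z)) \<in> triple_automorphisms"
 using bij_comp[of h g] by (auto simp: triple_automorphisms_def Vector_Spaces.linear_iff o_def)

lemma peirce_rotation_automorphism:
 assumes c: "tripotent c" and \<tau>: "cmod \<tau> = 1"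
 shows "peirce_rotation c \<tau> \<in> triple_automorphisms"
proof -
 have "cmod (\<tau>\<^sup>2) = 1" "cmod (1 / \<tau>) = 1" using \<tau> by (simp_all add: norm_power norm_divide)
 thus ?thesis unfolding peirce_rotation_def[abs_def]
  by (intro automorphism_comp[OF unit_scaling_automorphism peirce_group_automorphism] peirce_group_scaling[OF c])
qed

lemma peirce_rotation_chart:
 assumes c: "tripotent c" and \<tau>: "cmod \<tau> = 1"
 shows "peirce_rotation c \<tau> (kepler_chart c x) = kepler_chart c (P2 c x + smul \<tau> (P1 c x))"
proof -
 have t0: "\<tau> \<noteq> 0" using \<tau> by auto
 note P = P_in[OF c]
 have "kepler_chart c (P2 c x + smul \<tau> (P1 c x)) = frobenius c (smul \<tau> (P1 c x)) (P2 c x)"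
  by (simp add: kepler_chart_def P_add P_scale P_P[OF c])
 moreover have "peirce_rotation c \<tau> (kepler_chart c x) = frobenius c (smul \<tau> (P1 c x)) (P2 c x)"
  unfolding peirce_rotation_def peirce_scaling_def kepler_chart_def P_frobenius[OF c P(2) P(3)] unfolding frobenius_def
  by (rule crd_eqI) (use t0 in \<open>simp add: tp_simps crd_simps field_simps power2_eq_square\<close>)
 ultimately show ?thesis by simp
qed

text \<open>The operator is block diagonal: it is surjective when \<open>v \<mapsto> {v; c; y}\<close> is onto the Peirce 1-space and \<open>Q_y\<close>
 onto the Peirce 2-space. Choose \<open>v\<close> with \<open>{v; c; y} = P1 z\<close>; then \<open>exp(- D(v, c)) z\<close> is \<open>y + u0\<close> with \<open>u0\<close>
 in the Peirce 0-space. The range of \<open>Q\<close> at \<open>y + u0\<close> contains the whole Peirce 2-space and \<open>Q_{u0} u0\<close>, so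
 the rank bound forces \<open>u0 = 0\<close>.\<close>

lemma kepler_chart_covers:
 assumes c: "tripotent c" and rank: "rank_quad z \<le> dim (peirce c 2)"
  and surj: "surj (\<lambda>x. tp (P1 c x) c (P2 c z) + quad (P2 c z) (quad c (P2 c x)) + P0 c x)"
 shows "\<exists>x. z = kepler_chart c x"
proof -
 define y where "y = P2 c z"
 define R where "R x = tp (P1 c x) c y + quad y (quad c (P2 c x)) + P0 c x" for x
 have y: "y \<in> peirce c 2" unfolding y_def by (rule P_in[OF c])
 have R_surj: "\<exists>x. R x = u" for u using surj unfolding R_def y_def surj_def by metis
 have R_P: "P1 c (R x) = tp (P1 c x) c y" "P2 c (R x) = quad y (quad c (P2 c x))" for x
  using P_eq(2)[OF c frobenius_components(1)[OF c P_in(2)[OF c, of x] y]]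
   P_eq(3)[OF c quad_peirce_2[OF c y], of "quad c (P2 c x)"] P_eq(1)[OF c P_in(1)[OF c, of x]]
  by (simp_all add: R_def P_add)
 obtain x where x: "R x = P1 c z" using R_surj by blast
 define v where "v = P1 c x"
 have v: "v \<in> peirce c 1" unfolding v_def by (rule P_in[OF c])
 have vy: "tp v c y = P1 c z" using R_P(1)[of x] x by (simp add: v_def P_P[OF c])
 define u0 where "u0 = z - frobenius c v y"
 have minus: "P1 c (a - b) = P1 c a - P1 c b" "P2 c (a - b) = P2 c a - P2 c b" for a b
  using P_add(2)[of c "a - b" b] P_add(3)[of c "a - b" b] by simp_all
 have "P1 c u0 = 0" "P2 c u0 = 0" by (simp_all add: u0_def minus P_frobenius[OF c v y] vy, simp add: y_def)
 hence "P0 c u0 = u0" using P_sum[of c u0] by simp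
 hence u0: "u0 \<in> peirce c 0" using P_in(1)[OF c, of u0] by simp
 have "tp v c u0 = 0" using tp_tripotent_peirce_0(2)[OF c u0] by (simp add: tp_tripotent_peirce_0(2)[OF c u0] tp_commute[of v c u0])
 hence "frobenius c v u0 = u0" using tp_scale_right[of v c 0 0] by (simp add: frobenius_def)
 hence z: "z = frobenius c v (y + u0)" using linear_addD[OF frobenius_linear, of c v y u0] by (simp add: u0_def)
 have "rank_quad (y + u0) \<le> rank_quad z"
  using frobenius_rank[OF c, of "- v" z] peirce_closed(3)[OF v, of "-1"] frobenius_inverse[OF c v, of "y + u0"] z by simp
 hence dim: "dim (range (quad (y + u0))) \<le> dim (peirce c 2)" using rank by (simp add: rank_quad_def)
 note orth = peirce_2_0_orthogonal[OF c]
 have Z2: "quad (y + u0) w = quad y w" if w: "w \<in> peirce c 2" for w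
  using orth(2)[OF w u0] tp_commute[of y w u0] by (simp add: quad_def tp_simps)
 have q: "quad (y + u0) u0 = quad u0 u0" using orth(1)[OF y u0] tp_commute[of u0 u0 y] by (simp add: quad_def tp_simps)
 have q0: "quad u0 u0 \<in> peirce c 0" using peirce_mult[OF u0 u0 u0] by (simp add: quad_def peirce_closed)
 have "u0 = 0"
 proof (rule ccontr)
  assume "u0 \<noteq> 0"
  hence "quad u0 u0 \<noteq> 0" using cube_zero_imp_zero[of u0] by (auto simp: quad_def)
  hence notin: "quad u0 u0 \<notin> span (peirce c 2)"
   using P_eq(1)[OF c q0] P_eq(3)[OF c, of "quad u0 u0"] by (auto simp: span_eq_iff[THEN iffD2, OF peirce_subspace])
  have "peirce c 2 \<subseteq> range (quad (y + u0))"
  proof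
   fix u assume u: "u \<in> peirce c 2"
   obtain x where "R x = u" using R_surj by blast
   hence "quad y (quad c (P2 c x)) = u" using R_P(2)[of x] P_eq(3)[OF c u] by simp
   thus "u \<in> range (quad (y + u0))" using Z2[OF quad_in_peirce[OF c]] by (metis rangeI)
  qed
  hence "insert (quad u0 u0) (peirce c 2) \<subseteq> range (quad (y + u0))" using q by (metis insert_subset rangeI)
  from dim_subset[OF this] dim show False by (simp add: dim_insert notin)
 qed
 hence "z = kepler_chart c (y + v)" using z P_eq(3)[OF c y] P_eq(2)[OF c v] by (simp add: kepler_chart_def P_add)
 thus ?thesis by blast
qed

end

section \<open>Minors and polynomial curves\<close>

context fin_dim_complex_space
begin

definition polymap :: "('b => 'b) => bool" where
 "polymap f \<longleftrightarrow> (\<forall>b\<in>Basis. (\<lambda>z. crd b (f z)) \<in> polys)"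

lemma polymap_id: "polymap (\<lambda>z. z)" by (simp add: polymap_def polys_crd)

lemma polymap_const: "polymap (\<lambda>z. x)" by (simp add: polymap_def polys_const)

lemma polymap_add: "polymap f ==> polymap g ==> polymap (\<lambda>z. f z + g z)"
 by (simp add: polymap_def crd_add polys_add)

lemma polymap_linear:
 assumes T: "endo scale T" and f: "polymap f"
 shows "polymap (\<lambda>z. T (f z))"
proof -
 have "crd b (T (f z)) = (\<Sum>b'\<in>Basis. crd b' (f z) * crd b (T b'))" for b z
  using linear_expansion[OF T, of "f z"] by (simp add: crd_sum crd_scale)
 thus ?thesis using f by (auto simp: polymap_def intro!: polys_sum polys_mult polys_const)
qed

lemma polymap_bilinear:
 assumes 1: "\<And>w. endo scale (\<lambda>u. T u w)" and 2: "\<And>u. endo scale (T u)"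
  and f: "polymap f" and g: "polymap g"
 shows "polymap (\<lambda>z. T (f z) (g z))"
proof -
 have "crd b (T (f z) (g z)) = (\<Sum>b'\<in>Basis. crd b' (f z) * crd b (T b' (g z)))" for b z
  using linear_expansion[OF 1, of "f z" "g z"] by (simp add: crd_sum crd_scale)
 moreover have "(\<lambda>z. crd b (T b' (g z))) \<in> polys" if "b \<in> Basis" for b b'
  using polymap_linear[OF 2 g] that by (simp add: polymap_def)
 ultimately show ?thesis using f by (auto simp: polymap_def intro!: polys_sum polys_mult)
qed

lemma polymap_functional:
 assumes "Vector_Spaces.linear scale (*) \<phi>" "polymap f" shows "(\<lambda>z. \<phi> (f z)) \<in> polys"
 by (rule polys_comp[OF polys_linear[OF assms(1)]]) (use assms(2) in \<open>simp add: polymap_def\<close>)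

text \<open>The determinant of the coefficients with respect to a basis that extends the vectors at \<open>z0\<close>; at \<open>z0\<close> it is
 the determinant of the identity matrix.\<close>

lemma nonvanishing_minor:
 fixes F :: "nat => 'b => 'b"
 assumes F: "\<And>j. j < m ==> polymap (F j)"
  and ind: "independent ((\<lambda>j. F j z0) ` {..<m})" and inj: "inj_on (\<lambda>j. F j z0) {..<m}"
 shows "\<exists>\<delta>\<in>polys. \<delta> z0 \<noteq> 0 \<and>
  (\<forall>z. \<delta> z \<noteq> 0 --> independent ((\<lambda>j. F j z) ` {..<m}) \<and> inj_on (\<lambda>j. F j z) {..<m})"
proof -
 define B where "B = extend_basis ((\<lambda>j. F j z0) ` {..<m})"
 have B: "(\<lambda>j. F j z0) ` {..<m} \<subseteq> B" "independent B" "span B = UNIV"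
  using extend_basis_superset[OF ind] independent_extend_basis[OF ind] span_extend_basis[OF ind] by (auto simp: B_def)
 define \<phi> where "\<phi> i x = representation B x (F i z0)" for i x
 have \<phi>: "Vector_Spaces.linear scale (*) (\<phi> i)" for i
  unfolding \<phi>_def by (rule linear_representation[OF B(2,3)])
 define A where "A z = mat m m (\<lambda>(i, j). \<phi> i (F j z))" for z
 have carr: "A z \<in> carrier_mat m m" for z by (simp add: A_def)
 define \<delta> where "\<delta> z = Determinant.det (A z)" for z
 have "\<delta> = (\<lambda>z. \<Sum>p | p permutes {0..<m}. signof p * (\<Prod>i = 0..<m. \<phi> i (F (p i) z)))"
  unfolding \<delta>_def Determinant.det_def
  by (auto simp: A_def fun_eq_iff intro!: sum.cong prod.cong arg_cong2[where f = "(*)"])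
 moreover have "(\<lambda>z. \<phi> i (F (p i) z)) \<in> polys" if "p permutes {0..<m}" "i \<in> {0..<m}" for p i
  using that permutes_in_image[OF that(1), of i] F[of "p i"] by (intro polymap_functional[OF \<phi>]) auto
 ultimately have \<delta>_poly: "\<delta> \<in> polys" by (auto intro!: polys_sum polys_mult polys_const polys_prod)
 have "A z0 = 1\<^sub>m m"
 proof (rule eq_matI)
  fix i j assume ij: "i < dim_row (1\<^sub>m m)" "j < dim_col (1\<^sub>m m)"
  hence "\<phi> i (F j z0) = (if F j z0 = F i z0 then 1 else 0)"
   using B(1) by (auto simp: \<phi>_def representation_basis[OF B(2)])
  also have "... = (if i = j then 1 else 0)" using inj ij by (auto simp: inj_on_def)
  finally show "A z0 $$ (i, j) = 1\<^sub>m m $$ (i, j)" using ij by (simp add: A_def)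
 qed (simp_all add: A_def)
 hence \<delta>0: "\<delta> z0 \<noteq> 0" by (simp add: \<delta>_def)
 have coeff: "c j = 0" if nz: "\<delta> z \<noteq> 0" and dep: "(\<Sum>j<m. scale (c j) (F j z)) = 0" and j: "j < m" for z c j
 proof -
  have "A z *\<^sub>v vec m c = 0\<^sub>v m"
  proof (rule eq_vecI)
   fix i assume i: "i < dim_vec (0\<^sub>v m)"
   have "\<phi> i (\<Sum>j<m. scale (c j) (F j z)) = (\<Sum>j<m. c j * \<phi> i (F j z))"
   proof -
    interpret p: Vector_Spaces.linear scale "(*)" "\<phi> i" by (rule \<phi>)
    show ?thesis by (simp add: p.sum p.scale)
   qed
   moreover have "\<phi> i 0 = 0" using \<phi>[of i] by (simp add: \<phi>_def representation_zero)
   ultimately have "(\<Sum>j<m. c j * \<phi> i (F j z)) = 0" using dep by simp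
   thus "(A z *\<^sub>v vec m c) $ i = 0\<^sub>v m $ i"
    using i by (simp add: A_def scalar_prod_def atLeast0LessThan mult.commute)
  qed (simp add: A_def)
  hence "vec m c = 0\<^sub>v m"
   using det_0_iff_vec_prod_zero[OF carr, of z] nz unfolding \<delta>_def by (metis vec_carrier)
  hence "vec m c $ j = 0\<^sub>v m $ j" by simp
  thus ?thesis using j by simp
 qed
 have "independent ((\<lambda>j. F j z) ` {..<m}) \<and> inj_on (\<lambda>j. F j z) {..<m}" if nz: "\<delta> z \<noteq> 0" for z
 proof
  show inj_z: "inj_on (\<lambda>j. F j z) {..<m}"
  proof (rule inj_onI, rule ccontr)
   fix i j assume ij: "i \<in> {..<m}" "j \<in> {..<m}" "F i z = F j z" "i \<noteq> j"
   have "(\<Sum>l<m. scale ((if l = i then 1 else 0) - (if l = j then 1 else 0)) (F l z)) = 0"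
    using ij by (simp add: scale_left_diff_distrib sum_subtractf if_distrib[of "\<lambda>c. scale c _"] cong: if_cong)
   from coeff[OF nz this, of i] ij show False by simp
  qed
  show "independent ((\<lambda>j. F j z) ` {..<m})"
  proof (rule independent_if_scalars_zero)
   fix f x assume sum: "(\<Sum>x\<in>(\<lambda>j. F j z) ` {..<m}. scale (f x) x) = 0" and "x \<in> (\<lambda>j. F j z) ` {..<m}"
   then obtain j where j: "j < m" "x = F j z" by auto
   have "(\<Sum>j<m. scale (f (F j z)) (F j z)) = 0" using sum by (simp add: sum.reindex[OF inj_z])
   from coeff[OF nz this j(1)] show "f x = 0" by (simp add: j)
  qed simp
 qed
 with \<delta>_poly \<delta>0 show ?thesis by blast
qed

lemma polynomial_operator_surj:
 assumes T: "\<And>z. endo scale (T z)" and poly: "\<And>x. polymap (\<lambda>z. T z x)"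
  and id: "\<And>x. T z0 x = x"
 shows "\<exists>\<delta>\<in>polys. \<delta> z0 \<noteq> 0 \<and> (\<forall>z. \<delta> z \<noteq> 0 --> surj (T z))"
proof -
 obtain f where f: "bij_betw f {..<card Basis} Basis"
  using ex_bij_betw_nat_finite[OF finite_Basis] by (auto simp: atLeast0LessThan)
 have "independent ((\<lambda>j. T z0 (f j)) ` {..<card Basis})" "inj_on (\<lambda>j. T z0 (f j)) {..<card Basis}"
  using f independent_Basis by (auto simp: id bij_betw_def)
 from nonvanishing_minor[of "card Basis" "\<lambda>j z. T z (f j)" z0, OF poly this] obtain \<delta> where \<delta>: "\<delta> \<in> polys" "\<delta> z0 \<noteq> 0"
  "\<forall>z. \<delta> z \<noteq> 0 --> independent ((\<lambda>j. T z (f j)) ` {..<card Basis}) \<and> inj_on (\<lambda>j. T z (f j)) {..<card Basis}"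
  by blast
 have "surj (T z)" if nz: "\<delta> z \<noteq> 0" for z
 proof -
  interpret T: Vector_Spaces.linear scale scale "T z" by (rule T)
  define S where "S = (\<lambda>j. T z (f j)) ` {..<card Basis}"
  have S: "independent S" "card S = card Basis" using \<delta>(3) nz by (auto simp: S_def card_image)
  have "UNIV \<subseteq> span S" by (rule card_ge_dim_independent[OF _ S(1)]) (simp_all add: S(2) dim_UNIV)
  moreover have "span S \<subseteq> range (T z)" by (rule span_minimal) (auto simp: S_def T.subspace_image)
  ultimately show ?thesis by blast
 qed
 with \<delta>(1,2) show ?thesis by blast
qed

end

context hermitian_jordan_triple
begin

lemma tp_linear_left: "endo smul (\<lambda>u. tp u v w)"
 unfolding Vector_Spaces.linear_iff by (auto simp: vector_space_axioms tp_simps)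

lemma polymap_tp: "polymap f ==> polymap g ==> polymap (\<lambda>z. tp (f z) w (g z))"
 by (rule polymap_bilinear[of "\<lambda>u. tp u w"]) (auto intro: tp_linear_left tp_linear_right)

lemma scale_linear: "endo smul (smul a)"
 unfolding Vector_Spaces.linear_iff by (auto simp: vector_space_axioms scale_right_distrib mult.commute)

lemma polymap_quad: "polymap f ==> polymap (\<lambda>z. quad (f z) w)"
 unfolding quad_def by (intro polymap_linear[OF scale_linear] polymap_tp)

text \<open>A point of larger rank is separated from the set by a minor of \<open>Q_z\<close>.\<close>

lemma rank_variety_algebraic: "algebraic_set smul {z. rank_quad z \<le> d}" unfolding algebraic_set_def
proof (intro exI[of _ "{f \<in> polys. \<forall>z. rank_quad z \<le> d --> f z = 0}"] conjI)
 show "{z. rank_quad z \<le> d} = {z. \<forall>f\<in>{f \<in> polys. \<forall>z. rank_quad z \<le> d --> f z = 0}. f z = 0}"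
 proof (intro equalityI subsetI)
  fix z0 assume z0: "z0 \<in> {z. \<forall>f\<in>{f \<in> polys. \<forall>z. rank_quad z \<le> d --> f z = 0}. f z = 0}"
  show "z0 \<in> {z. rank_quad z \<le> d}"
  proof (rule ccontr)
   assume "z0 \<notin> {z. rank_quad z \<le> d}"
   hence d: "Suc d \<le> dim (range (quad z0))" by (simp add: rank_quad_def)
   obtain B where B: "B \<subseteq> range (quad z0)" "independent B" "card B = dim (range (quad z0))"
    using basis_exists[of "range (quad z0)"] by metis
   obtain S where S: "S \<subseteq> B" "card S = Suc d" "finite S"
    using obtain_subset_with_card_n[of "Suc d" B] d B(3) by (metis card.infinite nat.simps(3))
   obtain f where f: "bij_betw f {..<Suc d} S" using ex_bij_betw_nat_finite[OF S(3)] S(2) by (auto simp: atLeast0LessThan)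
   have "\<forall>j. \<exists>w. j < Suc d --> f j = quad z0 w"
    using f S(1) B(1) by (metis UNIV_I bij_betwE imageE lessThan_iff subsetD)
   from choice[OF this] obtain w where w: "\<forall>j. j < Suc d --> f j = quad z0 (w j)" by (elim exE)
   have eq: "(\<lambda>j. quad z0 (w j)) ` {..<Suc d} = S" "inj_on (\<lambda>j. quad z0 (w j)) {..<Suc d}"
    using f w by (auto simp: bij_betw_def inj_on_def)
   obtain \<delta> where \<delta>: "\<delta> \<in> polys" "\<delta> z0 \<noteq> 0"
    "\<forall>z. \<delta> z \<noteq> 0 --> independent ((\<lambda>j. quad z (w j)) ` {..<Suc d}) \<and> inj_on (\<lambda>j. quad z (w j)) {..<Suc d}"
    using nonvanishing_minor[of "Suc d" "\<lambda>j z. quad z (w j)" z0] polymap_quad[OF polymap_id] eq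
     independent_mono[OF B(2) S(1)] by auto
   have "\<delta> z = 0" if "rank_quad z \<le> d" for z
   proof (rule ccontr)
    assume "\<delta> z \<noteq> 0"
    hence i: "independent ((\<lambda>j. quad z (w j)) ` {..<Suc d})" and c: "inj_on (\<lambda>j. quad z (w j)) {..<Suc d}"
     using \<delta>(3) by auto
    have "card ((\<lambda>j. quad z (w j)) ` {..<Suc d}) \<le> dim (range (quad z))"
     by (rule independent_card_le_dim[OF _ i]) auto
    thus False using that c by (simp add: card_image rank_quad_def)
   qed
   thus False using z0 \<delta>(1,2) by auto
  qed
 qed auto
qed auto

text \<open>The operator in \<open>kepler_chart_covers\<close> is the identity for \<open>z = c\<close>, so its determinant does not vanish
 identically.\<close>

lemma kepler_chart_generic:
 assumes c: "tripotent c"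
 shows "\<exists>\<delta>\<in>polys. \<delta> c \<noteq> 0 \<and> (\<forall>z. rank_quad z \<le> dim (peirce c 2) --> \<delta> z \<noteq> 0 --> (\<exists>x. z = kepler_chart c x))"
proof -
 define T where "T z x = tp (P1 c x) c (P2 c z) + quad (P2 c z) (quad c (P2 c x)) + P0 c x" for z x
 have "endo smul (T z)" for z unfolding Vector_Spaces.linear_iff T_def
  by (auto simp: vector_space_axioms P_add P_scale quad_linearity tp_simps scale_right_distrib)
 moreover have "polymap (\<lambda>z. T z x)" for x
  unfolding T_def by (intro polymap_add polymap_tp polymap_quad polymap_const polymap_linear[OF P_linear(3)] polymap_id)
 moreover have "T c x = x" for x
 proof -
  have "tp (P1 c x) c c = P1 c x" using P_in(2)[OF c, of x] by (simp add: peirce_def tp_commute[of _ c c])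
  moreover have "quad c (quad c (P2 c x)) = P2 c x" using P_in(3)[OF c, of x] by (simp add: peirce_2_iff_quad[OF c])
  moreover have "P2 c c = c" using P_eq(3)[OF c tripotent_in_peirce_2[OF c]] by simp
  ultimately show ?thesis using P_sum[of c x] by (simp add: T_def add.assoc add.commute add.left_commute)
 qed
 ultimately obtain \<delta> where "\<delta> \<in> polys" "\<delta> c \<noteq> 0" "\<forall>z. \<delta> z \<noteq> 0 --> surj (T z)"
  using polynomial_operator_surj[of T c] by blast
 thus ?thesis using kepler_chart_covers[OF c] unfolding T_def by blast
qed

lemma polymap_kepler_chart: "polymap (kepler_chart c)"
proof -
 have eq: "kepler_chart c = (\<lambda>x. P2 c x + tp (P1 c x) c (P2 c x) + smul (1/2) (tp (P1 c x) c (tp (P1 c x) c (P2 c x))))"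
  by (rule ext) (simp add: kepler_chart_def frobenius_def)
 show ?thesis unfolding eq
  by (intro polymap_add polymap_tp polymap_linear[OF scale_linear] polymap_linear[OF P_linear(3)]
    polymap_linear[OF P_linear(2)] polymap_id)
qed

end

definition polyfun :: "(complex => complex) => bool" where "polyfun f \<longleftrightarrow> (\<exists>p. \<forall>t. f t = poly p t)"

lemma polyfun_const: "polyfun (\<lambda>t. a)" unfolding polyfun_def by (intro exI[of _ "[:a:]"]) simp

lemma polyfun_id: "polyfun (\<lambda>t. t)" unfolding polyfun_def by (intro exI[of _ "[:0, 1:]"]) simp

lemma polyfun_add: "polyfun f ==> polyfun g ==> polyfun (\<lambda>t. f t + g t)" unfolding polyfun_def by (metis poly_add)

lemma polyfun_mult: "polyfun f ==> polyfun g ==> polyfun (\<lambda>t. f t * g t)"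
 unfolding polyfun_def by (metis poly_mult)

lemma polyfun_sum: "(\<And>i. i \<in> I ==> polyfun (f i)) ==> polyfun (\<lambda>t. \<Sum>i\<in>I. f i t)"
 by (induction I rule: infinite_finite_induct) (auto intro: polyfun_const polyfun_add)

lemmas polyfun_intros = polyfun_const polyfun_id polyfun_add polyfun_mult polyfun_sum

context hermitian_jordan_triple
begin

text \<open>Such a family turns the lines in a Peirce 2-space into polynomial curves that stay in the Kepler variety
 except at finitely many parameters.\<close>

definition scaling_curve :: "(complex => 'a => 'a) => bool" where
 "scaling_curve A \<longleftrightarrow> (\<forall>t. endo smul (A t)) \<and>
   (\<forall>b\<in>Basis. \<forall>z. polyfun (\<lambda>t. crd b (A t z))) \<and>
   (\<exists>S. finite S \<and> (\<forall>t. t \<notin> S --> (\<forall>z. rank_quad (A t z) = rank_quad z)))"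

lemma scaling_curve_applied:
 assumes A: "scaling_curve A" and \<gamma>: "\<And>b. b \<in> Basis ==> polyfun (\<lambda>t. crd b (\<gamma> t))" and b: "b \<in> Basis"
 shows "polyfun (\<lambda>t. crd b (A t (\<gamma> t)))"
proof -
 have "crd b (A t (\<gamma> t)) = (\<Sum>b'\<in>Basis. crd b' (\<gamma> t) * crd b (A t b'))" for t
  using linear_expansion[of smul "A t" "\<gamma> t"] A by (simp add: scaling_curve_def crd_sum crd_scale)
 thus ?thesis using A b \<gamma> by (auto simp: scaling_curve_def intro!: polyfun_sum polyfun_mult)
qed

lemma scaling_curve_comp:
 assumes A: "scaling_curve A" and B: "scaling_curve B"
 shows "scaling_curve (\<lambda>t z. A t (B t z))"
proof -
 obtain S where S: "finite S" "\<forall>t. t \<notin> S --> (\<forall>z. rank_quad (A t z) = rank_quad z)" using A by (auto simp: scaling_curve_def)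
 obtain S' where S': "finite S'" "\<forall>t. t \<notin> S' --> (\<forall>z. rank_quad (B t z) = rank_quad z)" using B by (auto simp: scaling_curve_def)
 have "endo smul (\<lambda>z. A t (B t z))" for t
  using A B unfolding scaling_curve_def by (auto simp: Vector_Spaces.linear_iff)
 moreover have "polyfun (\<lambda>t. crd b (A t (B t z)))" if "b \<in> Basis" for b z
  by (rule scaling_curve_applied[OF A _ that]) (use B in \<open>auto simp: scaling_curve_def\<close>)
 moreover have "\<exists>S. finite S \<and> (\<forall>t. t \<notin> S --> (\<forall>z. rank_quad (A t (B t z)) = rank_quad z))"
  using S S' by (intro exI[of _ "S \<union> S'"]) auto
 ultimately show ?thesis unfolding scaling_curve_def by blast
qed

text \<open>The scaling parameter moves along the line through 1 and \<open>s\<close>; only the scaling parameter 0 is exceptional.\<close>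

lemma peirce_scaling_curve:
 assumes c: "tripotent c" shows "scaling_curve (\<lambda>t. peirce_scaling c (1 + t * (s - 1)))"
proof -
 have "polyfun (\<lambda>t. crd b (peirce_scaling c (1 + t * (s - 1)) z))" for b z
  unfolding peirce_scaling_def crd_simps power2_eq_square by (intro polyfun_intros)
 moreover have "rank_quad (peirce_scaling c (1 + t * (s - 1)) z) = rank_quad z" if "t \<notin> {1 / (1 - s)}" for t z
 proof (rule rank_quad_structure_pair[OF peirce_scaling_structure_pair[OF c]])
  show "1 + t * (s - 1) \<noteq> 0"
  proof
   assume eq: "1 + t * (s - 1) = 0"
   hence "s \<noteq> 1" by auto
   hence "t = 1 / (1 - s)" using eq by (simp add: field_simps)
   with that show False by simp
  qed
 qed
 ultimately show ?thesis unfolding scaling_curve_def using peirce_scaling_linear by (meson finite.emptyI finite.insertI)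
qed

lemma peirce_group_curve:
 "k \<in> peirce_group ==> \<exists>A. scaling_curve A \<and> A 0 = (\<lambda>z. z) \<and> A 1 = k"
proof (induction rule: peirce_group.induct)
 case one
 have "scaling_curve (\<lambda>t z. z)" unfolding scaling_curve_def
  by (auto simp: Vector_Spaces.linear_iff vector_space_axioms polyfun_const intro: exI[of _ "{}"])
 thus ?case by (intro exI[of _ "\<lambda>t z. z"]) simp
next
 case (step g c s)
 then obtain A where A: "scaling_curve A" "A 0 = (\<lambda>z. z)" "A 1 = g" by blast
 show ?case by (intro exI[of _ "\<lambda>t z. peirce_scaling c (1 + t * (s - 1)) (A t z)"] conjI
    scaling_curve_comp[OF peirce_scaling_curve[OF step.hyps(2)] A(1)]) (simp_all add: A peirce_scaling_1)
qed

lemma polys_op_limit: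
 assumes f: "f \<in> polys" and lim: "op_limit k T"
 shows "(\<lambda>m. f (k m z)) \<longlonglongrightarrow> f (T z)"
 using f by (induction rule: polynomial_functions.induct) (auto intro: tendsto_intros op_limit_functional[OF lim])

lemma polys_op_limit_nonzero:
 assumes f: "f \<in> polys" and lim: "op_limit k T" and nz: "f (T z) \<noteq> 0"
 shows "\<exists>m. f (k m z) \<noteq> 0"
proof (rule ccontr)
 assume "\<nexists>m. f (k m z) \<noteq> 0"
 hence "(\<lambda>m. f (k m z)) = (\<lambda>m. 0)" by auto
 hence "(\<lambda>m. 0) \<longlonglongrightarrow> f (T z)" using polys_op_limit[OF f lim, of z] by simp
 from LIMSEQ_unique[OF tendsto_const this] show False using nz by simp
qed

end

context irreducible_framed_triple
begin

lemma kepler_element: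
 assumes "l \<le> r" "rank_quad z \<le> peirce_dim l"
 shows "\<exists>k T y. (\<forall>m. k m \<in> peirce_group) \<and> op_limit k T \<and> y \<in> peirce (frame_sum {1..l}) 2 \<and> z = T y"
proof -
 obtain t k T where t: "spectral_values r e z t" and k: "\<forall>m. k m \<in> peirce_group" "op_limit k T" "z = T (diag t)"
  using spectral_values_exist[of z] by (elim exE conjE)
 define n where "n = card {i \<in> {1..r}. t i \<noteq> 0}"
 have n: "n \<le> l" using spectral_values_rank(1,2)[OF t] assms peirce_dim_le_iff[of n l] by (simp add: n_def)
 have "{i \<in> {1..r}. t i \<noteq> 0} = {1..n}"
  unfolding n_def by (rule support_initial) (use t in \<open>auto simp: spectral_values_def\<close>)
 hence "diag t = (\<Sum>i=1..n. smul (of_real (t i)) (e i))" by (intro sum.mono_neutral_right) (auto simp: set_eq_iff)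
 moreover have "(\<Sum>i=1..n. smul (of_real (t i)) (e i)) \<in> peirce (frame_sum {1..l}) 2"
  using n assms(1) by (intro peirce_closed(5) peirce_closed(3) frame_sum_peirce_2) auto
 ultimately have "diag t \<in> peirce (frame_sum {1..l}) 2" by simp
 with k show ?thesis by (intro exI[of _ k] exI[of _ T] exI[of _ "diag t"]) simp
qed

text \<open>Points with \<open>f \<noteq> 0\<close> and \<open>g \<noteq> 0\<close> may be taken as \<open>k y\<close> and \<open>k' y'\<close> with \<open>k\<close>, \<open>k'\<close> in the Peirce group and
 \<open>y\<close>, \<open>y'\<close> in the Peirce 2-space of \<open>c\<close>. The segment from \<open>y'\<close> to \<open>y\<close>, moved by a polynomial curve from \<open>k'\<close>
 to \<open>k\<close>, stays in the variety except for finitely many parameters. Along it \<open>f\<close> and \<open>g\<close> are polynomials in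
 one variable with product zero.\<close>

lemma kepler_irreducible:
 assumes l: "l \<le> r" and f: "f \<in> polys" and g: "g \<in> polys"
  and fg: "\<And>z. rank_quad z \<le> peirce_dim l ==> f z * g z = 0"
 shows "(\<forall>z. rank_quad z \<le> peirce_dim l --> f z = 0) \<or> (\<forall>z. rank_quad z \<le> peirce_dim l --> g z = 0)"
proof (rule ccontr)
 assume "\<not> ?thesis"
 then obtain z z' where z: "rank_quad z \<le> peirce_dim l" "f z \<noteq> 0" and z': "rank_quad z' \<le> peirce_dim l" "g z' \<noteq> 0"
  by blast
 define c where "c = frame_sum {1..l}"
 have c: "tripotent c" using frame_sum_tripotent[of "{1..l}"] l by (simp add: c_def)
 obtain k y where k: "k \<in> peirce_group" "y \<in> peirce c 2" "f (k y) \<noteq> 0"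
 proof -
  obtain k T y where "\<forall>m. k m \<in> peirce_group" "op_limit k T" "y \<in> peirce c 2" "z = T y"
   using kepler_element[OF l z(1)] unfolding c_def by (elim exE conjE)
  thus thesis using polys_op_limit_nonzero[OF f, of k T y] z(2) that by blast
 qed
 obtain k' y' where k': "k' \<in> peirce_group" "y' \<in> peirce c 2" "g (k' y') \<noteq> 0"
 proof -
  obtain k T y where "\<forall>m. k m \<in> peirce_group" "op_limit k T" "y \<in> peirce c 2" "z' = T y"
   using kepler_element[OF l z'(1)] unfolding c_def by (elim exE conjE)
  thus thesis using polys_op_limit_nonzero[OF g, of k T y] z'(2) that by blast
 qed
 obtain h where h: "h \<in> peirce_group" "\<forall>z. k' (h z) = z" using peirce_group_inverse[OF k'(1)] by blast
 obtain A where A: "scaling_curve A" "A 0 = (\<lambda>z. z)" "A 1 = (\<lambda>z. h (k z))"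
  using peirce_group_curve[OF peirce_group_comp[OF h(1) k(1)]] by blast
 obtain A' where A': "scaling_curve A'" "A' 1 = k'" using peirce_group_curve[OF k'(1)] by blast
 define C where "C t z = k' (A t z)" for t z
 have "scaling_curve (\<lambda>t. A' 1)" using A'(1) peirce_group_automorphism[OF k'(1)] peirce_group_linear[OF k'(1)]
   rank_quad_structure_pair[OF automorphism_structure_pair] unfolding A'(2) by (auto simp: scaling_curve_def polyfun_const intro!: exI[of _ "{}"])
 from scaling_curve_comp[OF this A(1)] have C: "scaling_curve C" unfolding C_def[abs_def] A'(2) .
 define \<gamma> where "\<gamma> t = y' + smul t (y - y')" for t
 have \<gamma>: "\<gamma> t \<in> peirce c 2" for t unfolding \<gamma>_def by (intro peirce_closed k k')
 have "polyfun (\<lambda>t. crd b (\<gamma> t))" for b unfolding \<gamma>_def crd_add crd_scale by (intro polyfun_intros)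
 hence curve: "\<exists>p. \<forall>t. crd b (C t (\<gamma> t)) = poly p t" if "b \<in> Basis" for b
  using scaling_curve_applied[OF C _ that] unfolding polyfun_def by blast
 obtain p where p: "\<forall>t. f (C t (\<gamma> t)) = poly p t" using polys_curve[OF f curve] by blast
 obtain q where q: "\<forall>t. g (C t (\<gamma> t)) = poly q t" using polys_curve[OF g curve] by blast
 obtain S where S: "finite S" "\<forall>t. t \<notin> S --> (\<forall>z. rank_quad (C t z) = rank_quad z)" using C by (auto simp: scaling_curve_def)
 have "poly (p * q) t = 0" if "t \<notin> S" for t
 proof -
  have "rank_quad (C t (\<gamma> t)) \<le> peirce_dim l"
   using S(2) that rank_quad_peirce_2[OF c \<gamma>, of t] by (simp add: peirce_dim_def c_def)
  from fg[OF this] show ?thesis using p q by simp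
 qed
 hence "- S \<subseteq> {t. poly (p * q) t = 0}" by auto
 moreover have "infinite (- S)" using S(1) infinite_UNIV_char_0[where 'a = complex] by (metis Compl_eq_Diff_UNIV finite_Diff2)
 ultimately have "p * q = 0" using poly_roots_finite[of "p * q"] infinite_super by blast
 hence "p = 0 \<or> q = 0" by simp
 moreover have "poly p 1 \<noteq> 0" using spec[OF p, of 1] k(3) by (simp add: C_def A h(2) \<gamma>_def)
 moreover have "poly q 0 \<noteq> 0" using spec[OF q, of 0] k'(3) by (simp add: C_def A \<gamma>_def)
 ultimately show False by auto
qed

lemma kepler_unitary_cone:
 assumes l: "l \<le> r"
 shows "unitary_cone smul Basis form {z. rank_quad z \<le> peirce_dim l} triple_automorphisms
  (kepler_chart (frame_sum {1..l})) (P1 (frame_sum {1..l})) (P2 (frame_sum {1..l})) (peirce_rotation (frame_sum {1..l}))"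
proof -
 define c where "c = frame_sum {1..l}"
 have c: "tripotent c" using frame_sum_tripotent[of "{1..l}"] l by (simp add: c_def)
 have d: "peirce_dim l = dim (peirce c 2)" by (simp add: peirce_dim_def c_def)
 have inv: "opinv k \<in> triple_automorphisms" if "k \<in> triple_automorphisms" for k
 proof -
  note k = automorphismD[OF that]
  interpret k: Vector_Spaces.linear smul smul k by (rule k)
  have i: "inj k" "surj k" using k(2) by (auto simp: bij_def)
  have "endo smul (opinv k)" unfolding Vector_Spaces.linear_iff using i
   by (auto simp: vector_space_axioms inv_f_eq k.add k.scale surj_f_inv_f)
  moreover have "opinv k (tp u v w) = tp (opinv k u) (opinv k v) (opinv k w)" for u v w
   using i by (intro inv_f_eq) (auto simp: k(3) surj_f_inv_f)
  ultimately show ?thesis using bij_imp_bij_inv[OF k(2)] by (auto simp: triple_automorphisms_def)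
 qed
 interpret fin_dim_complex_space smul Basis ..
 interpret H: hermitian_space smul Basis form by unfold_locales (simp add: form_definite)
 have rank: "rank_quad (k z) = rank_quad z" if "k \<in> triple_automorphisms" for k z
  by (rule rank_quad_structure_pair[OF automorphism_structure_pair[OF that]])
 show ?thesis unfolding c_def[symmetric]
 proof
  fix k assume k: "k \<in> triple_automorphisms"
  note kD = automorphismD[OF k]
  have "k ` {z. rank_quad z \<le> peirce_dim l} = {z. rank_quad z \<le> peirce_dim l}"
  proof (intro equalityI subsetI)
   fix z assume "z \<in> {z. rank_quad z \<le> peirce_dim l}"
   moreover obtain u where "z = k u" using kD(2) by (metis bij_pointE)
   ultimately show "z \<in> k ` {z. rank_quad z \<le> peirce_dim l}" by (auto simp: rank[OF k])
  qed (auto simp: rank[OF k])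
  thus "H.isometry_of {z. rank_quad z \<le> peirce_dim l} k"
   unfolding H.isometry_of_def using kD(1,2) automorphism_form[OF k] by blast
  show "opinv k \<in> triple_automorphisms" by (rule inv[OF k])
 next
  show "{z. rank_quad z \<le> peirce_dim l} \<noteq> {}" using rank_quad_tripotent[OF c] d
   by (metis (mono_tags) empty_Collect_eq order.refl)
 next
  fix f g assume "f \<in> polys" "g \<in> polys" "\<And>z. z \<in> {z. rank_quad z \<le> peirce_dim l} ==> f z * g z = 0"
  thus "(\<forall>z\<in>{z. rank_quad z \<le> peirce_dim l}. f z = 0) \<or> (\<forall>z\<in>{z. rank_quad z \<le> peirce_dim l}. g z = 0)"
   using kepler_irreducible[OF l, of f g] by simp
 next
  fix x show "kepler_chart c x \<in> {z. rank_quad z \<le> peirce_dim l}" using kepler_chart_rank[OF c] d by simp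
 next
  fix f z assume f: "f \<in> polys" "\<And>x. f (kepler_chart c x) = 0" and z: "z \<in> {z. rank_quad z \<le> peirce_dim l}"
  obtain \<delta> where \<delta>: "\<delta> \<in> polys" "\<delta> c \<noteq> 0"
   "\<forall>z. rank_quad z \<le> dim (peirce c 2) --> \<delta> z \<noteq> 0 --> (\<exists>x. z = kepler_chart c x)"
   using kepler_chart_generic[OF c] by blast
  \<comment> \<open>\<open>\<delta>\<close> vanishes outside the image of the chart, and irreducibility cancels it\<close>
  have "f z * \<delta> z = 0" if "rank_quad z \<le> peirce_dim l" for z using \<delta>(3) f(2) that d by force
  from kepler_irreducible[OF l f(1) \<delta>(1) this] show "f z = 0"
   using z \<delta>(2) rank_quad_tripotent[OF c] d by auto
 next
  fix b assume "b \<in> Basis"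
  thus "(\<lambda>x. crd b (kepler_chart c x)) \<in> polys" using polymap_kepler_chart by (simp add: polymap_def)
 next
  fix z assume z: "z \<in> {z. rank_quad z \<le> peirce_dim l}"
  obtain k T y where k: "\<forall>m. k m \<in> peirce_group" "op_limit k T" "y \<in> peirce c 2" "z = T y"
   using kepler_element[OF l, of z] z unfolding c_def by auto
  have "T \<in> triple_automorphisms" by (rule op_limit_automorphism[OF _ k(2)]) (use k(1) peirce_group_automorphism in blast)
  thus "\<exists>k\<in>triple_automorphisms. \<exists>y. P2 c y = y \<and> z = k y" using k(3,4) P_eq(3)[OF c k(3)] by blast
 qed (simp_all add: P_add P_scale P2_kepler_chart[OF c] kepler_chart_P2[OF c] peirce_rotation_automorphism[OF c]
   peirce_rotation_chart[OF c] automorphism_comp)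
qed

end

section \<open>Fields of fractions and their evaluation at general points\<close>

context domain
begin

definition fraction_pairs :: "('a \<times> 'a) set" where "fraction_pairs = carrier R \<times> (carrier R - {\<zero>})"

lemma cross_cancel:
 assumes "a \<in> carrier R" "b \<in> carrier R" "c \<in> carrier R" "d \<in> carrier R" "e \<in> carrier R" "f \<in> carrier R"
  and "d \<noteq> \<zero>" and 1: "a \<otimes> d = c \<otimes> b" and 2: "c \<otimes> f = e \<otimes> d"
 shows "a \<otimes> f = e \<otimes> b"
proof -
 note cl = assms(1-6)
 have "d \<otimes> (a \<otimes> f) = (a \<otimes> d) \<otimes> f" using cl by (simp add: m_ac)
 also have "... = (c \<otimes> f) \<otimes> b" unfolding 1 using cl by (simp add: m_ac)
 also have "... = d \<otimes> (e \<otimes> b)" unfolding 2 using cl by (simp add: m_ac)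
 finally show ?thesis using m_lcancel[of d "a \<otimes> f" "e \<otimes> b"] assms by simp
qed

lemma frac_rel_equiv: "equiv fraction_pairs (frac_rel R)"
proof (rule equivI)
 show "frac_rel R \<subseteq> fraction_pairs \<times> fraction_pairs" by (auto simp: frac_rel_def fraction_pairs_def)
 show "refl_on fraction_pairs (frac_rel R)" by (auto simp: refl_on_def frac_rel_def fraction_pairs_def)
 show "sym (frac_rel R)" by (auto simp: sym_def frac_rel_def)
 show "trans (frac_rel R)"
 proof (rule transI, clarify)
  fix a b c d e f assume 1: "((a, b), (c, d)) \<in> frac_rel R" and 2: "((c, d), (e, f)) \<in> frac_rel R"
  thus "((a, b), (e, f)) \<in> frac_rel R" using cross_cancel[of a b c d e f] unfolding frac_rel_def by simp
 qed
qed

lemma fraction_eq_iff: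
 assumes "a \<in> carrier R" "b \<in> carrier R" "b \<noteq> \<zero>" "c \<in> carrier R" "d \<in> carrier R" "d \<noteq> \<zero>"
 shows "fraction R a b = fraction R c d \<longleftrightarrow> a \<otimes> d = c \<otimes> b"
 unfolding fraction_def using eq_equiv_class_iff[OF frac_rel_equiv, of "(a, b)" "(c, d)"] assms
 by (auto simp: fraction_pairs_def frac_rel_def)

lemma fraction_mem: "(c, d) \<in> fraction R a b \<longleftrightarrow>
  a \<in> carrier R \<and> b \<in> carrier R \<and> b \<noteq> \<zero> \<and> c \<in> carrier R \<and> d \<in> carrier R \<and> d \<noteq> \<zero> \<and> a \<otimes> d = c \<otimes> b"
 by (auto simp: fraction_def frac_rel_def)

lemma frac_carrier: "carrier (frac_field R) = {fraction R a b | a b. a \<in> carrier R \<and> b \<in> carrier R \<and> b \<noteq> \<zero>}"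
 unfolding frac_field_def quotient_def fraction_def by auto

lemma fraction_closed [simp]: "a \<in> carrier R ==> b \<in> carrier R ==> b \<noteq> \<zero> ==> fraction R a b \<in> carrier (frac_field R)"
 unfolding frac_carrier by blast

lemma nonzero_product: "a \<in> carrier R ==> b \<in> carrier R ==> a \<noteq> \<zero> ==> b \<noteq> \<zero> ==> a \<otimes> b \<noteq> \<zero>"
 using integral by blast

lemma union_constant: "x \<noteq> {} ==> y \<noteq> {} ==> (\<And>a b c d. (a, b) \<in> x ==> (c, d) \<in> y ==> F a b c d = S)
  ==> (\<Union>(a, b)\<in>x. \<Union>(c, d)\<in>y. F a b c d) = S" by (fastforce simp: ex_in_conv[symmetric])

lemma fraction_nonempty: "a \<in> carrier R ==> b \<in> carrier R ==> b \<noteq> \<zero> ==> fraction R a b \<noteq> {}"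
 using fraction_mem[of a b a b] by auto

lemma frac_mult:
 assumes a: "a \<in> carrier R" "b \<in> carrier R" "b \<noteq> \<zero>" and c: "c \<in> carrier R" "d \<in> carrier R" "d \<noteq> \<zero>"
 shows "fraction R a b \<otimes>\<^bsub>frac_field R\<^esub> fraction R c d = fraction R (a \<otimes> c) (b \<otimes> d)"
 unfolding frac_field_def monoid.simps partial_object.simps
proof (simp, rule union_constant)
 fix a' b' c' d' assume 1: "(a', b') \<in> fraction R a b" and 2: "(c', d') \<in> fraction R c d"
 have m: "a' \<in> carrier R" "b' \<in> carrier R" "b' \<noteq> \<zero>" "c' \<in> carrier R" "d' \<in> carrier R" "d' \<noteq> \<zero>"
  and e: "a \<otimes> b' = a' \<otimes> b" "c \<otimes> d' = c' \<otimes> d" using 1 2 unfolding fraction_mem by auto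
 note m = m assms
 have "(a' \<otimes> c') \<otimes> (b \<otimes> d) = (a' \<otimes> b) \<otimes> (c' \<otimes> d)" using m by (simp add: m_ac)
 also have "... = (a \<otimes> b') \<otimes> (c \<otimes> d')" by (simp add: e)
 also have "... = (a \<otimes> c) \<otimes> (b' \<otimes> d')" using m by (simp add: m_ac)
 finally show "fraction R (a' \<otimes> c') (b' \<otimes> d') = fraction R (a \<otimes> c) (b \<otimes> d)"
  using m by (simp add: fraction_eq_iff nonzero_product)
qed (use assms fraction_nonempty in auto)

lemma frac_add:
 assumes a: "a \<in> carrier R" "b \<in> carrier R" "b \<noteq> \<zero>" and c: "c \<in> carrier R" "d \<in> carrier R" "d \<noteq> \<zero>"
 shows "fraction R a b \<oplus>\<^bsub>frac_field R\<^esub> fraction R c d = fraction R (a \<otimes> d \<oplus> c \<otimes> b) (b \<otimes> d)"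
 unfolding frac_field_def ring_record_simps
proof (rule union_constant)
 fix a' b' c' d' assume 1: "(a', b') \<in> fraction R a b" and 2: "(c', d') \<in> fraction R c d"
 have m: "a' \<in> carrier R" "b' \<in> carrier R" "b' \<noteq> \<zero>" "c' \<in> carrier R" "d' \<in> carrier R" "d' \<noteq> \<zero>"
  and e: "a \<otimes> b' = a' \<otimes> b" "c \<otimes> d' = c' \<otimes> d" using 1 2 unfolding fraction_mem by auto
 note m = m assms
 have "(a' \<otimes> d' \<oplus> c' \<otimes> b') \<otimes> (b \<otimes> d) = (a' \<otimes> b) \<otimes> (d' \<otimes> d) \<oplus> (c' \<otimes> d) \<otimes> (b' \<otimes> b)"
  using m by (simp add: l_distr r_distr m_ac)
 also have "... = (a \<otimes> b') \<otimes> (d' \<otimes> d) \<oplus> (c \<otimes> d') \<otimes> (b' \<otimes> b)" by (simp add: e)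
 also have "... = (a \<otimes> d \<oplus> c \<otimes> b) \<otimes> (b' \<otimes> d')" using m by (simp add: l_distr r_distr m_ac)
 finally show "fraction R (a' \<otimes> d' \<oplus> c' \<otimes> b') (b' \<otimes> d') = fraction R (a \<otimes> d \<oplus> c \<otimes> b) (b \<otimes> d)"
  using m by (simp add: fraction_eq_iff nonzero_product)
qed (use assms fraction_nonempty in auto)

lemma frac_one: "\<one>\<^bsub>frac_field R\<^esub> = fraction R \<one> \<one>" and frac_zero: "\<zero>\<^bsub>frac_field R\<^esub> = fraction R \<zero> \<one>"
 by (simp_all add: frac_field_def)

lemma fracE:
 assumes "x \<in> carrier (frac_field R)"
 obtains a b where "a \<in> carrier R" "b \<in> carrier R" "b \<noteq> \<zero>" "x = fraction R a b"
 using assms unfolding frac_carrier by blast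

lemmas frac_simps = frac_mult frac_add frac_one frac_zero nonzero_product fraction_eq_iff

lemma frac_domain: "domain (frac_field R)"
proof (rule domainI)
 show "cring (frac_field R)"
 proof (rule cringI)
  show "abelian_group (frac_field R)"
  proof (rule abelian_groupI)
   show "\<exists>y\<in>carrier (frac_field R). y \<oplus>\<^bsub>frac_field R\<^esub> x = \<zero>\<^bsub>frac_field R\<^esub>"
    if "x \<in> carrier (frac_field R)" for x using that
   proof (rule fracE)
    fix a b assume x: "a \<in> carrier R" "b \<in> carrier R" "b \<noteq> \<zero>" "x = fraction R a b"
    have "\<ominus> a \<otimes> b \<oplus> a \<otimes> b = \<zero>" using x by (simp add: l_minus l_neg)
    thus ?thesis by (intro bexI[of _ "fraction R (\<ominus> a) b"]) (simp_all add: x frac_simps)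
   qed
  qed (auto elim!: fracE simp: frac_simps l_distr r_distr m_ac a_ac)
  show "comm_monoid (frac_field R)" by (rule comm_monoidI) (auto elim!: fracE simp: frac_simps m_ac)
 next
  fix x y z assume x: "x \<in> carrier (frac_field R)" and y: "y \<in> carrier (frac_field R)" and z: "z \<in> carrier (frac_field R)"
  obtain a b where a: "a \<in> carrier R" "b \<in> carrier R" "b \<noteq> \<zero>" "x = fraction R a b" using x by (rule fracE)
  obtain c d where c: "c \<in> carrier R" "d \<in> carrier R" "d \<noteq> \<zero>" "y = fraction R c d" using y by (rule fracE)
  obtain e f where e: "e \<in> carrier R" "f \<in> carrier R" "f \<noteq> \<zero>" "z = fraction R e f" using z by (rule fracE)
  note cl = a(1,2) c(1,2) e(1,2)
  have nz: "b \<otimes> d \<noteq> \<zero>" "b \<otimes> f \<noteq> \<zero>" "d \<otimes> f \<noteq> \<zero>" using a c e by (simp_all add: nonzero_product)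
  have "(a \<otimes> d \<oplus> c \<otimes> b) \<otimes> e \<otimes> (b \<otimes> f \<otimes> (d \<otimes> f)) = ((a \<otimes> e) \<otimes> (d \<otimes> f) \<oplus> (c \<otimes> e) \<otimes> (b \<otimes> f)) \<otimes> (b \<otimes> d \<otimes> f)"
   using cl by (simp add: l_distr r_distr m_ac)
  thus "(x \<oplus>\<^bsub>frac_field R\<^esub> y) \<otimes>\<^bsub>frac_field R\<^esub> z
    = x \<otimes>\<^bsub>frac_field R\<^esub> z \<oplus>\<^bsub>frac_field R\<^esub> y \<otimes>\<^bsub>frac_field R\<^esub> z"
   unfolding a(4) c(4) e(4) using a(1-3) c(1-3) e(1-3) nz by (simp add: frac_mult frac_add fraction_eq_iff nonzero_product)
 qed
 show "\<one>\<^bsub>frac_field R\<^esub> \<noteq> \<zero>\<^bsub>frac_field R\<^esub>" by (simp add: frac_simps)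
next
 fix x y assume xy: "x \<otimes>\<^bsub>frac_field R\<^esub> y = \<zero>\<^bsub>frac_field R\<^esub>" and x: "x \<in> carrier (frac_field R)" and y: "y \<in> carrier (frac_field R)"
 obtain a b where a: "a \<in> carrier R" "b \<in> carrier R" "b \<noteq> \<zero>" "x = fraction R a b" using x by (rule fracE)
 obtain c d where c: "c \<in> carrier R" "d \<in> carrier R" "d \<noteq> \<zero>" "y = fraction R c d" using y by (rule fracE)
 have "a \<otimes> c = \<zero>" using xy a c by (simp add: frac_simps)
 thus "x = \<zero>\<^bsub>frac_field R\<^esub> \<or> y = \<zero>\<^bsub>frac_field R\<^esub>" using a c integral[of a c] by (auto simp: frac_simps)
qed

end

text \<open>Ring elements as functions on general points. The laws hold only along the filter because fractions have no
 value at zeros of denominators. The last condition makes the evaluation injective, so identities between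
 iterated fractions can be checked pointwise.\<close>

definition generic_evaluation :: "'z filter => ('r, 'm) ring_scheme => ('r => 'z => complex) => bool" where
 "generic_evaluation G R ev \<longleftrightarrow>
  (\<forall>a\<in>carrier R. \<forall>b\<in>carrier R. (\<forall>\<^sub>F z in G. ev (a \<oplus>\<^bsub>R\<^esub> b) z = ev a z + ev b z)
    \<and> (\<forall>\<^sub>F z in G. ev (a \<otimes>\<^bsub>R\<^esub> b) z = ev a z * ev b z)) \<and>
  (\<forall>\<^sub>F z in G. ev \<one>\<^bsub>R\<^esub> z = 1) \<and>
  (\<forall>a\<in>carrier R. a \<noteq> \<zero>\<^bsub>R\<^esub> --> (\<forall>\<^sub>F z in G. ev a z \<noteq> 0))"

lemma generic_evaluationD:
 assumes "generic_evaluation G R ev"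
 shows "a \<in> carrier R ==> b \<in> carrier R ==> \<forall>\<^sub>F z in G. ev (a \<oplus>\<^bsub>R\<^esub> b) z = ev a z + ev b z"
  and "a \<in> carrier R ==> b \<in> carrier R ==> \<forall>\<^sub>F z in G. ev (a \<otimes>\<^bsub>R\<^esub> b) z = ev a z * ev b z"
  and "\<forall>\<^sub>F z in G. ev \<one>\<^bsub>R\<^esub> z = 1"
  and "a \<in> carrier R ==> a \<noteq> \<zero>\<^bsub>R\<^esub> ==> \<forall>\<^sub>F z in G. ev a z \<noteq> 0"
 using assms unfolding generic_evaluation_def by blast+

lemma generic_evaluation_zero:
 fixes R (structure)
 assumes "generic_evaluation G R ev" "ring R"
 shows "\<forall>\<^sub>F z in G. ev \<zero>\<^bsub>R\<^esub> z = 0"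
proof -
 interpret ring R by fact
 show ?thesis using generic_evaluationD(1)[OF assms(1), of \<zero> \<zero>] by simp
qed

lemma generic_evaluation_inject:
 fixes R (structure)
 assumes ev: "generic_evaluation G R ev" and R: "ring R" and G: "G \<noteq> bot"
  and ab: "a \<in> carrier R" "b \<in> carrier R" and eq: "\<forall>\<^sub>F z in G. ev a z = ev b z"
 shows "a = b"
proof (rule ccontr)
 interpret ring R by fact
 assume "a \<noteq> b"
 hence nz: "a \<ominus> b \<noteq> \<zero>" using ab by simp
 have sum: "(a \<ominus> b) \<oplus> b = a" using ab by (simp add: minus_eq a_assoc l_neg)
 have "\<forall>\<^sub>F z in G. ev ((a \<ominus> b) \<oplus> b) z = ev (a \<ominus> b) z + ev b z"
  by (rule generic_evaluationD(1)[OF ev]) (use ab in auto)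
 moreover have "\<forall>\<^sub>F z in G. ev (a \<ominus> b) z \<noteq> 0" by (rule generic_evaluationD(4)[OF ev _ nz]) (use ab in auto)
 ultimately have "\<forall>\<^sub>F z in G. False" using eq unfolding sum by eventually_elim simp
 with G show False by (simp add: trivial_limit_def)
qed

lemma generic_evaluation_subring:
 "generic_evaluation G R ev ==> H \<subseteq> carrier R ==> generic_evaluation G (R\<lparr>carrier := H\<rparr>) ev"
 unfolding generic_evaluation_def by (simp add: subset_iff)

text \<open>Any two representatives of a fraction give the same values along the filter.\<close>

definition frac_eval :: "('r => 'z => complex) => ('r \<times> 'r) set => 'z => complex" where
 "frac_eval ev x z = ev (fst (SOME p. p \<in> x)) z / ev (snd (SOME p. p \<in> x)) z"

lemma frac_eval_fraction:
 fixes R (structure)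
 assumes R: "domain R" and ev: "generic_evaluation G R ev"
  and a: "a \<in> carrier R" "b \<in> carrier R" "b \<noteq> \<zero>\<^bsub>R\<^esub>"
 shows "\<forall>\<^sub>F z in G. frac_eval ev (fraction R a b) z = ev a z / ev b z"
proof -
 interpret domain R by fact
 obtain c d where cd: "(SOME p. p \<in> fraction R a b) = (c, d)" by (cases "SOME p. p \<in> fraction R a b")
 have "(SOME p. p \<in> fraction R a b) \<in> fraction R a b" using fraction_nonempty[OF a] by (simp add: some_in_eq)
 hence m: "c \<in> carrier R" "d \<in> carrier R" "d \<noteq> \<zero>" "a \<otimes> d = c \<otimes> b"
  unfolding cd fraction_mem by auto
 have "\<forall>\<^sub>F z in G. ev (a \<otimes> d) z = ev a z * ev d z" "\<forall>\<^sub>F z in G. ev (c \<otimes> b) z = ev c z * ev b z"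
  "\<forall>\<^sub>F z in G. ev b z \<noteq> 0" "\<forall>\<^sub>F z in G. ev d z \<noteq> 0"
  using generic_evaluationD[OF ev] a m by blast+
 thus ?thesis
 proof eventually_elim
  case (elim z)
  hence "ev a z * ev d z = ev c z * ev b z" by (simp add: m(4))
  with elim show ?case by (simp add: frac_eval_def cd field_simps)
 qed
qed

lemma frac_eval_generic:
 fixes R (structure)
 assumes R: "domain R" and ev: "generic_evaluation G R ev"
 shows "generic_evaluation G (frac_field R) (frac_eval ev)" unfolding generic_evaluation_def
proof (intro conjI ballI impI)
 interpret domain R by fact
 note fe = frac_eval_fraction[OF R ev] and E = generic_evaluationD[OF ev]
 fix x y assume x: "x \<in> carrier (frac_field R)" and y: "y \<in> carrier (frac_field R)"
 obtain a b where a: "a \<in> carrier R" "b \<in> carrier R" "b \<noteq> \<zero>" "x = fraction R a b" using x by (rule fracE)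
 obtain c d where c: "c \<in> carrier R" "d \<in> carrier R" "d \<noteq> \<zero>" "y = fraction R c d" using y by (rule fracE)
 have bd: "b \<otimes> d \<noteq> \<zero>" using a c by (simp add: nonzero_product)
 have ex: "\<forall>\<^sub>F z in G. frac_eval ev x z = ev a z / ev b z" and ey: "\<forall>\<^sub>F z in G. frac_eval ev y z = ev c z / ev d z"
  unfolding a(4) c(4) by (rule fe[OF a(1-3)], rule fe[OF c(1-3)])
 have nz: "\<forall>\<^sub>F z in G. ev b z \<noteq> 0" "\<forall>\<^sub>F z in G. ev d z \<noteq> 0" using E(4) a c by auto
 have ebd: "\<forall>\<^sub>F z in G. ev (b \<otimes> d) z = ev b z * ev d z" using E(2) a c by auto
 have "\<forall>\<^sub>F z in G. frac_eval ev (x \<otimes>\<^bsub>frac_field R\<^esub> y) z = ev (a \<otimes> c) z / ev (b \<otimes> d) z"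
  using fe[of "a \<otimes> c" "b \<otimes> d"] a c bd by (simp add: frac_mult)
 moreover have "\<forall>\<^sub>F z in G. ev (a \<otimes> c) z = ev a z * ev c z" using E(2) a c by auto
 ultimately show "\<forall>\<^sub>F z in G. frac_eval ev (x \<otimes>\<^bsub>frac_field R\<^esub> y) z = frac_eval ev x z * frac_eval ev y z"
  using ebd ex ey by eventually_elim simp
 have "\<forall>\<^sub>F z in G. frac_eval ev (x \<oplus>\<^bsub>frac_field R\<^esub> y) z = ev (a \<otimes> d \<oplus> c \<otimes> b) z / ev (b \<otimes> d) z"
  using fe[of "a \<otimes> d \<oplus> c \<otimes> b" "b \<otimes> d"] a c bd by (simp add: frac_add)
 moreover have "\<forall>\<^sub>F z in G. ev (a \<otimes> d \<oplus> c \<otimes> b) z = ev (a \<otimes> d) z + ev (c \<otimes> b) z"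
  "\<forall>\<^sub>F z in G. ev (a \<otimes> d) z = ev a z * ev d z" "\<forall>\<^sub>F z in G. ev (c \<otimes> b) z = ev c z * ev b z"
  using E(1,2) a c by auto
 ultimately show "\<forall>\<^sub>F z in G. frac_eval ev (x \<oplus>\<^bsub>frac_field R\<^esub> y) z = frac_eval ev x z + frac_eval ev y z"
  using ebd ex ey nz by eventually_elim (simp add: add_frac_eq)
next
 interpret domain R by fact
 show "\<forall>\<^sub>F z in G. frac_eval ev \<one>\<^bsub>frac_field R\<^esub> z = 1"
  unfolding frac_one using frac_eval_fraction[OF R ev one_closed one_closed one_not_zero] generic_evaluationD(3)[OF ev]
  by eventually_elim simp
next
 interpret domain R by fact
 fix x assume x: "x \<in> carrier (frac_field R)" "x \<noteq> \<zero>\<^bsub>frac_field R\<^esub>"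
 obtain a b where a: "a \<in> carrier R" "b \<in> carrier R" "b \<noteq> \<zero>" "x = fraction R a b" using x(1) by (rule fracE)
 have "a \<noteq> \<zero>" using x(2) a by (auto simp: frac_simps)
 hence "\<forall>\<^sub>F z in G. ev a z \<noteq> 0" "\<forall>\<^sub>F z in G. ev b z \<noteq> 0" using generic_evaluationD(4)[OF ev] a by auto
 thus "\<forall>\<^sub>F z in G. frac_eval ev x z \<noteq> 0" unfolding a(4)
  using frac_eval_fraction[OF R ev a(1-3)] by eventually_elim simp
qed

lemma generic_evaluation_power:
 fixes R (structure)
 assumes ev: "generic_evaluation G R ev" and R: "ring R" and x: "x \<in> carrier R"
 shows "\<forall>\<^sub>F z in G. ev (x [^]\<^bsub>R\<^esub> (n::nat)) z = ev x z ^ n"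
proof (induction n)
 case 0
 interpret ring R by fact
 show ?case using generic_evaluationD(3)[OF ev] by simp
next
 case (Suc n)
 interpret ring R by fact
 have "\<forall>\<^sub>F z in G. ev (x [^] n \<otimes> x) z = ev (x [^] n) z * ev x z" using generic_evaluationD(2)[OF ev] x by simp
 with Suc show ?case by eventually_elim (simp add: mult.commute)
qed

lemma generic_evaluation_eval:
 fixes R (structure)
 assumes ev: "generic_evaluation G R ev" and R: "ring R" and x: "x \<in> carrier R" and p: "set p \<subseteq> carrier R"
 shows "ring.eval R p x \<in> carrier R \<and>
  (\<forall>\<^sub>F z in G. ev (ring.eval R p x) z = (\<Sum>i<length p. ev (rev p ! i) z * ev x z ^ i))" using p
proof (induction p)
 case Nil
 interpret ring R by fact
 show ?case using generic_evaluation_zero[OF ev R] by simp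
next
 case (Cons a p)
 interpret ring R by fact
 have a: "a \<in> carrier R" and p: "set p \<subseteq> carrier R" using Cons.prems by auto
 note IH = Cons.IH[OF p]
 have eval: "eval (a # p) x = a \<otimes> (x [^] length p) \<oplus> eval p x" by simp
 have cl: "a \<otimes> (x [^] length p) \<in> carrier R" using a x by simp
 have "\<forall>\<^sub>F z in G. ev (a \<otimes> (x [^] length p) \<oplus> eval p x) z = ev (a \<otimes> (x [^] length p)) z + ev (eval p x) z"
  "\<forall>\<^sub>F z in G. ev (a \<otimes> (x [^] length p)) z = ev a z * ev (x [^] length p) z"
  using generic_evaluationD(1,2)[OF ev] cl IH a x by auto
 hence "\<forall>\<^sub>F z in G. ev (eval (a # p) x) z = (\<Sum>i<Suc (length p). ev (rev (a # p) ! i) z * ev x z ^ i)"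
  using generic_evaluation_power[OF ev R x, of "length p"] conjunct2[OF IH] unfolding eval
 proof eventually_elim
  case (elim z)
  have "(\<Sum>i<length p. ev (rev (a # p) ! i) z * ev x z ^ i) = (\<Sum>i<length p. ev (rev p ! i) z * ev x z ^ i)"
   by (intro sum.cong refl) (simp add: nth_append)
  with elim show ?case by (simp add: nth_append)
 qed
 thus ?case using cl IH a by (simp del: sum.lessThan_Suc)
qed

section \<open>Integral rational functions are regular\<close>

lemma monic_root_bound:
 fixes u :: complex
 assumes "u ^ n + (\<Sum>i<n. c i * u ^ i) = 0"
 shows "cmod u \<le> 1 + (\<Sum>i<n. cmod (c i))"
proof (cases "cmod u \<le> 1")
 case True
 thus ?thesis using sum_nonneg[of "{..<n}" "\<lambda>i. cmod (c i)"] by simp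
next
 case False
 then obtain m where n: "n = Suc m" using assms by (cases n) auto
 have "u ^ n = - (\<Sum>i<n. c i * u ^ i)" using assms by (simp add: eq_neg_iff_add_eq_0)
 hence "cmod u ^ n = cmod (\<Sum>i<n. c i * u ^ i)" by (metis norm_minus_cancel norm_power)
 also have "... \<le> (\<Sum>i<n. cmod (c i) * cmod u ^ i)" by (rule sum_norm_le) (simp add: norm_mult norm_power)
 also have "... \<le> (\<Sum>i<n. cmod (c i) * cmod u ^ m)"
  using False n by (intro sum_mono mult_left_mono power_increasing) auto
 finally have "cmod u * cmod u ^ m \<le> (\<Sum>i<n. cmod (c i)) * cmod u ^ m" by (simp add: n sum_distrib_right distrib_right)
 moreover have "0 < cmod u" using False by linarith
 hence "cmod u ^ m > 0" by (rule zero_less_power)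
 ultimately show ?thesis by simp
qed

context hermitian_space
begin

text \<open>Each feature is bounded by \<open>1 + (z | z)\<close>, and \<open>f\<close> is a combination of products of \<open>n\<close> features.\<close>

lemma polys_growth:
 assumes "f \<in> polys"
 shows "\<exists>C k. \<forall>z. cmod (f z) \<le> C * (1 + Re (ip z z)) ^ k"
proof -
 define N where "N z = 1 + Re (ip z z)" for z
 have N1: "N z \<ge> 1" for z by (simp add: N_def herm.ip_nonneg)
 obtain A where A: "affine_features A" using affine_features_exist by blast
 have feature: "cmod (\<phi> z) \<le> N z" if "\<phi> \<in> A" for \<phi> z
 proof -
  have "complex_of_real (\<Sum>\<phi>\<in>A. (cmod (\<phi> z))\<^sup>2) = 1 + ip z z"
   using A by (simp add: affine_features_def complex_norm_square del: of_real_power)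
  hence "N z = (\<Sum>\<phi>\<in>A. (cmod (\<phi> z))\<^sup>2)" unfolding N_def by (metis Re_complex_of_real one_complex.sel(1) plus_complex.sel(1))
  hence "(cmod (\<phi> z))\<^sup>2 \<le> N z" using member_le_sum[of \<phi> A "\<lambda>\<phi>. (cmod (\<phi> z))\<^sup>2"] that A by (auto simp: affine_features_def)
  also have "N z \<le> (N z)\<^sup>2" using N1[of z] by (simp add: power2_eq_square)
  finally show ?thesis by (rule power2_le_imp_le) (use N1[of z] in simp)
 qed
 obtain n where "f \<in> polys_le n" using polys_degree[OF assms] by blast
 hence "f \<in> fun_space.span (products A n)" using polys_le_span[of A f n] A unfolding affine_features_def by blast
 hence "\<exists>C. \<forall>z. cmod (f z) \<le> C * N z ^ n"
 proof (induction rule: fun_span_induct)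
  case (base a)
  then obtain l where l: "set l \<subseteq> A" "length l = n" "a = list_product l" by (auto simp: products_def)
  have "cmod (list_product l z) \<le> N z ^ length l" for z using l(1)
   by (induction l) (auto simp: list_product_def norm_mult intro!: mult_mono feature order_trans[OF zero_le_one N1])
  thus ?case using l by (intro exI[of _ 1]) simp
 next
  case zero
  show ?case by (intro exI[of _ 0]) simp
 next
  case (add f g)
  then obtain C D where CD: "\<forall>z. cmod (f z) \<le> C * N z ^ n" "\<forall>z. cmod (g z) \<le> D * N z ^ n" by (elim exE)
  have "cmod (f z + g z) \<le> (C + D) * N z ^ n" for z
   using norm_triangle_ineq[of "f z" "g z"] spec[OF CD(1), of z] spec[OF CD(2), of z] by (simp add: distrib_right)
  thus ?case by (intro exI allI)
 next
  case (scale c f)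
  then obtain C where "\<forall>z. cmod (f z) \<le> C * N z ^ n" by (elim exE)
  thus ?case by (intro exI[of _ "cmod c * C"]) (simp add: norm_mult mult.assoc mult_left_mono)
 qed
 thus ?thesis unfolding N_def by (elim exE) (intro exI)
qed

lemma polys_sum_growth:
 assumes "\<And>i. i < n ==> c i \<in> polys"
 shows "\<exists>C k. \<forall>z. 1 + (\<Sum>i<(n::nat). cmod (c i z)) \<le> C * (1 + Re (ip z z)) ^ k" using assms
proof (induction n)
 case 0
 show ?case by (intro exI[of _ 1] exI[of _ 0]) simp
next
 case (Suc n)
 have IH: "\<exists>C k. \<forall>z. 1 + (\<Sum>i<n. cmod (c i z)) \<le> C * (1 + Re (ip z z)) ^ k" using Suc by simp
 obtain C k where f: "\<forall>z. 1 + (\<Sum>i<n. cmod (c i z)) \<le> C * (1 + Re (ip z z)) ^ k" using IH by (elim exE)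
 obtain D l where g: "\<forall>z. cmod (c n z) \<le> D * (1 + Re (ip z z)) ^ l"
  using polys_growth[OF Suc.prems[OF lessI]] by (elim exE)
 define N where "N z = 1 + Re (ip z z)" for z
 have N1: "N z \<ge> 1" for z by (simp add: N_def herm.ip_nonneg)
 have "1 + (\<Sum>i<Suc n. cmod (c i z)) \<le> (\<bar>C\<bar> + \<bar>D\<bar>) * N z ^ (k + l)" for z
 proof -
  have p: "N z ^ k \<le> N z ^ (k + l)" "N z ^ l \<le> N z ^ (k + l)" "0 \<le> N z ^ k" "0 \<le> N z ^ l"
   using N1[of z] by (simp_all add: power_increasing)
  have "1 + (\<Sum>i<Suc n. cmod (c i z)) \<le> C * N z ^ k + D * N z ^ l"
   using spec[OF f, of z] spec[OF g, of z] by (simp add: N_def)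
  also have "... \<le> \<bar>C\<bar> * N z ^ (k + l) + \<bar>D\<bar> * N z ^ (k + l)"
   using p by (intro add_mono mult_mono) auto
  finally show ?thesis by (simp add: distrib_right)
 qed
 thus ?case unfolding N_def by (intro exI allI)
qed

end

context unitary_cone
begin

abbreviation cone_ring :: "('b => complex) ring" where "cone_ring \<equiv> coordinate_ring scale V"

lemma cone_ring_carrier: "x \<in> carrier cone_ring \<longleftrightarrow> (\<exists>f\<in>polys. x = restrict f V)"
 by (auto simp: coordinate_ring_def)

lemma cone_ring_ops:
 "restrict f V \<oplus>\<^bsub>cone_ring\<^esub> restrict g V = restrict (\<lambda>z. f z + g z) V"
 "restrict f V \<otimes>\<^bsub>cone_ring\<^esub> restrict g V = restrict (\<lambda>z. f z * g z) V"
 "\<one>\<^bsub>cone_ring\<^esub> = restrict (\<lambda>z. 1) V" "\<zero>\<^bsub>cone_ring\<^esub> = restrict (\<lambda>z. 0) V"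
 by (auto simp: coordinate_ring_def fun_eq_iff)

lemma restrict_eq_iff: "restrict f V = restrict g V \<longleftrightarrow> (\<forall>z\<in>V. f z = g z)"
 by (auto simp: fun_eq_iff restrict_def)

lemma cone_ring_restrict: "f \<in> polys ==> restrict f V \<in> carrier cone_ring" by (auto simp: cone_ring_carrier)

lemma cone_ring_closed:
 assumes "x \<in> carrier cone_ring" "y \<in> carrier cone_ring"
 shows "x \<oplus>\<^bsub>cone_ring\<^esub> y \<in> carrier cone_ring" "x \<otimes>\<^bsub>cone_ring\<^esub> y \<in> carrier cone_ring"
proof -
 obtain f g where fg: "f \<in> polys" "x = restrict f V" "g \<in> polys" "y = restrict g V"
  using assms by (auto simp: cone_ring_carrier)
 show "x \<oplus>\<^bsub>cone_ring\<^esub> y \<in> carrier cone_ring" "x \<otimes>\<^bsub>cone_ring\<^esub> y \<in> carrier cone_ring"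
  unfolding fg(2,4) cone_ring_ops by (rule cone_ring_restrict[OF polys_add[OF fg(1,3)]], rule cone_ring_restrict[OF polys_mult[OF fg(1,3)]])
qed

lemma cone_ring_constants: "\<one>\<^bsub>cone_ring\<^esub> \<in> carrier cone_ring" "\<zero>\<^bsub>cone_ring\<^esub> \<in> carrier cone_ring"
 unfolding cone_ring_ops by (rule cone_ring_restrict[OF polys_const])+

lemma cone_ring_domain: "domain cone_ring"
proof (rule domainI)
 show "cring cone_ring"
 proof (rule cringI)
  show "abelian_group cone_ring"
  proof (rule abelian_groupI)
   fix x assume "x \<in> carrier cone_ring"
   then obtain f where f: "f \<in> polys" "x = restrict f V" by (auto simp: cone_ring_carrier)
   show "\<exists>y\<in>carrier cone_ring. y \<oplus>\<^bsub>cone_ring\<^esub> x = \<zero>\<^bsub>cone_ring\<^esub>"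
    by (rule bexI[OF _ cone_ring_restrict[OF polys_minus[OF f(1)]]]) (simp add: f cone_ring_ops)
  next
   fix x y assume "x \<in> carrier cone_ring" "y \<in> carrier cone_ring"
   thus "x \<oplus>\<^bsub>cone_ring\<^esub> y \<in> carrier cone_ring" by (rule cone_ring_closed)
  next
   show "\<zero>\<^bsub>cone_ring\<^esub> \<in> carrier cone_ring" by (rule cone_ring_constants)
  qed (auto simp: cone_ring_carrier cone_ring_ops restrict_eq_iff algebra_simps)
  show "Group.comm_monoid cone_ring"
  proof (rule Group.comm_monoidI)
   fix x y assume "x \<in> carrier cone_ring" "y \<in> carrier cone_ring"
   thus "x \<otimes>\<^bsub>cone_ring\<^esub> y \<in> carrier cone_ring" by (rule cone_ring_closed)
  next
   show "\<one>\<^bsub>cone_ring\<^esub> \<in> carrier cone_ring" by (rule cone_ring_constants)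
  qed (auto simp: cone_ring_carrier cone_ring_ops restrict_eq_iff algebra_simps)
 qed (auto simp: cone_ring_carrier cone_ring_ops restrict_eq_iff algebra_simps)
 show "\<one>\<^bsub>cone_ring\<^esub> \<noteq> \<zero>\<^bsub>cone_ring\<^esub>" using V_nonempty by (simp add: cone_ring_ops restrict_eq_iff)
next
 fix x y assume xy: "x \<otimes>\<^bsub>cone_ring\<^esub> y = \<zero>\<^bsub>cone_ring\<^esub>" "x \<in> carrier cone_ring" "y \<in> carrier cone_ring"
 obtain f g where fg: "f \<in> polys" "x = restrict f V" "g \<in> polys" "y = restrict g V" using xy(2,3) by (auto simp: cone_ring_carrier)
 have "\<forall>z\<in>V. f z * g z = 0" using xy(1) unfolding fg(2,4) cone_ring_ops restrict_eq_iff .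
 with V_irreducible[OF fg(1,3)] show "x = \<zero>\<^bsub>cone_ring\<^esub> \<or> y = \<zero>\<^bsub>cone_ring\<^esub>"
  unfolding fg(2,4) cone_ring_ops restrict_eq_iff by blast
qed

lemma generic_not_bot: "generic \<noteq> bot" by (auto simp: trivial_limit_def eventually_generic nonzero_def)

lemma eventually_on_V: "(\<And>z. z \<in> V ==> P z) ==> eventually P generic" by (rule eventually_mono[OF generic_V])

lemma cone_ring_generic: "generic_evaluation generic cone_ring (\<lambda>x. x)" unfolding generic_evaluation_def
proof (intro conjI ballI impI)
 fix x assume "x \<in> carrier cone_ring" "x \<noteq> \<zero>\<^bsub>cone_ring\<^esub>"
 then obtain f where f: "f \<in> polys" "x = restrict f V" "\<not> (\<forall>z\<in>V. f z = 0)"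
  by (auto simp: cone_ring_carrier cone_ring_ops restrict_eq_iff)
 hence "eventually (\<lambda>z. f z \<noteq> 0) generic" by (intro generic_nonzero) (auto simp: nonzero_def)
 thus "\<forall>\<^sub>F z in generic. x z \<noteq> 0" using generic_V by eventually_elim (simp add: f)
next
 show "\<forall>\<^sub>F z in generic. \<one>\<^bsub>cone_ring\<^esub> z = 1" by (rule eventually_on_V) (simp add: cone_ring_ops)
qed (rule eventually_on_V, simp add: coordinate_ring_def)+

definition regular_fractions :: "'b => (('b => complex) \<times> ('b => complex)) set set" where
 "regular_fractions p = {fraction cone_ring f g | f g. f \<in> carrier cone_ring \<and> g \<in> carrier cone_ring \<and> g p \<noteq> 0}"

lemma local_ring_eq: "local_ring scale V p = (frac_field cone_ring)\<lparr>carrier := regular_fractions p\<rparr>"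
 by (simp add: local_ring_def regular_fractions_def)

lemma regular_fractionsE:
 assumes "x \<in> regular_fractions p" "p \<in> V"
 obtains f g where "f \<in> polys" "g \<in> polys" "g p \<noteq> 0" "x = fraction cone_ring (restrict f V) (restrict g V)"
 using assms by (auto simp: regular_fractions_def cone_ring_carrier)

lemma restrict_nonzero: "p \<in> V ==> g p \<noteq> 0 ==> restrict g V \<noteq> \<zero>\<^bsub>cone_ring\<^esub>"
 by (auto simp: cone_ring_ops restrict_eq_iff)

lemma regular_fractionsI:
 "f \<in> polys ==> g \<in> polys ==> g p \<noteq> 0 ==> p \<in> V ==> fraction cone_ring (restrict f V) (restrict g V) \<in> regular_fractions p"
 unfolding regular_fractions_def using cone_ring_restrict by fastforce

lemma regular_fractions_sub:
 assumes p: "p \<in> V"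
 shows "regular_fractions p \<subseteq> carrier (frac_field cone_ring)"
proof
 fix x assume "x \<in> regular_fractions p"
 then obtain f g where "f \<in> polys" "g \<in> polys" "g p \<noteq> 0" "x = fraction cone_ring (restrict f V) (restrict g V)"
  using p by (rule regular_fractionsE)
 thus "x \<in> carrier (frac_field cone_ring)"
  using domain.fraction_closed[OF cone_ring_domain] cone_ring_restrict restrict_nonzero[OF p] by blast
qed

lemma local_ring_domain:
 assumes p: "p \<in> V"
 shows "domain (local_ring scale V p)"
proof -
 interpret C: domain cone_ring by (rule cone_ring_domain)
 interpret F: domain "frac_field cone_ring" by (rule C.frac_domain)
 note sub = regular_fractions_sub[OF p]
 have "subring (regular_fractions p) (frac_field cone_ring)"
 proof (rule F.subringI[OF sub])
  have "\<one>\<^bsub>frac_field cone_ring\<^esub> = fraction cone_ring (restrict (\<lambda>z. 1) V) (restrict (\<lambda>z. 1) V)"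
   by (simp add: C.frac_one cone_ring_ops)
  thus "\<one>\<^bsub>frac_field cone_ring\<^esub> \<in> regular_fractions p"
   using regular_fractionsI[OF polys_const[of 1] polys_const[of 1] _ p] by simp
 next
  fix x assume x: "x \<in> regular_fractions p"
  then obtain f g where fg: "f \<in> polys" "g \<in> polys" "g p \<noteq> 0" "x = fraction cone_ring (restrict f V) (restrict g V)"
   using p by (rule regular_fractionsE)
  define y where "y = fraction cone_ring (restrict (\<lambda>z. - f z) V) (restrict g V)"
  have y: "y \<in> regular_fractions p" unfolding y_def by (rule regular_fractionsI[OF polys_minus fg(2,3) p]) (rule fg)
  have g: "restrict g V \<noteq> \<zero>\<^bsub>cone_ring\<^esub>" by (rule restrict_nonzero[of p g, OF p fg(3)])
  note cl = cone_ring_restrict[OF polys_minus[OF fg(1)]] cone_ring_restrict[OF fg(1)] cone_ring_restrict[OF fg(2)]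
  define gg where "gg = restrict g V \<otimes>\<^bsub>cone_ring\<^esub> restrict g V"
  have gg: "gg \<in> carrier cone_ring" "gg \<noteq> \<zero>\<^bsub>cone_ring\<^esub>"
   unfolding gg_def by (rule C.m_closed[OF cl(3) cl(3)], rule C.nonzero_product[OF cl(3) cl(3) g g])
  have "restrict (\<lambda>z. - f z) V \<otimes>\<^bsub>cone_ring\<^esub> restrict g V \<oplus>\<^bsub>cone_ring\<^esub> restrict f V \<otimes>\<^bsub>cone_ring\<^esub> restrict g V = \<zero>\<^bsub>cone_ring\<^esub>"
   by (simp add: cone_ring_ops)
  hence "y \<oplus>\<^bsub>frac_field cone_ring\<^esub> x = fraction cone_ring \<zero>\<^bsub>cone_ring\<^esub> gg"
   unfolding y_def fg(4) C.frac_add[OF cl(1) cl(3) g cl(2) cl(3) g] gg_def by simp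
  also have "... = \<zero>\<^bsub>frac_field cone_ring\<^esub>"
   unfolding C.frac_zero using C.fraction_eq_iff[OF C.zero_closed gg C.zero_closed C.one_closed C.one_not_zero] gg(1) by simp
  finally have "y \<oplus>\<^bsub>frac_field cone_ring\<^esub> x = \<zero>\<^bsub>frac_field cone_ring\<^esub>" .
  hence "\<ominus>\<^bsub>frac_field cone_ring\<^esub> x = y" using x y sub by (intro F.minus_equality) auto
  with y show "\<ominus>\<^bsub>frac_field cone_ring\<^esub> x \<in> regular_fractions p" by simp
 next
  fix x y assume x: "x \<in> regular_fractions p" and y: "y \<in> regular_fractions p"
  obtain f g where fg: "f \<in> polys" "g \<in> polys" "g p \<noteq> 0" "x = fraction cone_ring (restrict f V) (restrict g V)"
   using x p by (rule regular_fractionsE)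
  obtain f' g' where fg': "f' \<in> polys" "g' \<in> polys" "g' p \<noteq> 0" "y = fraction cone_ring (restrict f' V) (restrict g' V)"
   using y p by (rule regular_fractionsE)
  note cl = cone_ring_restrict[OF fg(1)] cone_ring_restrict[OF fg(2)] restrict_nonzero[of p g, OF p fg(3)]
   cone_ring_restrict[OF fg'(1)] cone_ring_restrict[OF fg'(2)] restrict_nonzero[of p g', OF p fg'(3)]
  show "x \<otimes>\<^bsub>frac_field cone_ring\<^esub> y \<in> regular_fractions p"
   unfolding fg(4) fg'(4) C.frac_mult[OF cl] cone_ring_ops
   by (rule regular_fractionsI[OF polys_mult polys_mult _ p]) (use fg fg' in auto)
  show "x \<oplus>\<^bsub>frac_field cone_ring\<^esub> y \<in> regular_fractions p"
   unfolding fg(4) fg'(4) C.frac_add[OF cl] cone_ring_ops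
   by (rule regular_fractionsI[OF polys_add[OF polys_mult polys_mult] polys_mult _ p]) (use fg fg' in auto)
 qed
 hence "subdomain (regular_fractions p) (frac_field cone_ring)" by (rule F.subdomainI')
 thus ?thesis unfolding local_ring_eq using F.subdomain_iff[OF sub] by blast
qed

lemma regular_fraction_eval:
 assumes p: "p \<in> V" and x: "x \<in> regular_fractions p"
 shows "\<exists>f g. f \<in> polys \<and> g \<in> polys \<and> g p \<noteq> 0 \<and> (\<forall>\<^sub>F z in generic. g z * frac_eval (\<lambda>x. x) x z = f z)"
proof -
 obtain f g where fg: "f \<in> polys" "g \<in> polys" "g p \<noteq> 0" "x = fraction cone_ring (restrict f V) (restrict g V)"
  using x p by (rule regular_fractionsE)
 have "\<forall>\<^sub>F z in generic. frac_eval (\<lambda>x. x) x z = restrict f V z / restrict g V z" unfolding fg(4)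
  by (rule frac_eval_fraction[OF cone_ring_domain cone_ring_generic cone_ring_restrict[OF fg(1)]
     cone_ring_restrict[OF fg(2)] restrict_nonzero[of p g, OF p fg(3)]])
 moreover have "eventually (\<lambda>z. g z \<noteq> 0) generic" by (rule generic_nonzero) (use fg p in \<open>auto simp: nonzero_def\<close>)
 ultimately have "\<forall>\<^sub>F z in generic. g z * frac_eval (\<lambda>x. x) x z = f z" using generic_V by eventually_elim simp
 with fg show ?thesis by blast
qed

lemma common_regular_denominator:
 assumes p: "p \<in> V" and h: "\<And>a. a \<in> set q ==> \<exists>f g. f \<in> polys \<and> g \<in> polys \<and> g p \<noteq> 0 \<and> (\<forall>\<^sub>F z in generic. g z * h a z = f z)"
 shows "\<exists>g\<in>polys. g p \<noteq> 0 \<and> (\<forall>a\<in>set q. \<exists>b\<in>polys. \<forall>\<^sub>F z in generic. g z * h a z = b z)"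
 using h
proof (induction q)
 case Nil
 show ?case using polys_const[of 1] by (intro bexI[of _ "\<lambda>z. 1"]) auto
next
 case (Cons a q)
 obtain g where g: "g \<in> polys" "g p \<noteq> 0" "\<forall>a\<in>set q. \<exists>b\<in>polys. \<forall>\<^sub>F z in generic. g z * h a z = b z"
  using Cons.IH Cons.prems by auto
 obtain f g' where fg: "f \<in> polys" "g' \<in> polys" "g' p \<noteq> 0" "\<forall>\<^sub>F z in generic. g' z * h a z = f z"
  using Cons.prems[of a] by auto
 show ?case
 proof (rule bexI[of _ "\<lambda>z. g z * g' z"], intro conjI ballI)
  fix a' assume "a' \<in> set (a # q)"
  then consider "a' = a" | "a' \<in> set q" by auto
  thus "\<exists>b\<in>polys. \<forall>\<^sub>F z in generic. g z * g' z * h a' z = b z"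
  proof cases
   case 1
   have "\<forall>\<^sub>F z in generic. g z * g' z * h a' z = g z * f z" using fg(4) unfolding 1 by eventually_elim (simp add: mult.assoc)
   thus ?thesis using polys_mult[OF g(1) fg(1)] by (intro bexI[of _ "\<lambda>z. g z * f z"])
  next
   case 2
   then obtain b where b: "b \<in> polys" "\<forall>\<^sub>F z in generic. g z * h a' z = b z" using g(3) by blast
   have "\<forall>\<^sub>F z in generic. g z * g' z * h a' z = g' z * b z" using b(2) by eventually_elim (simp add: mult.assoc mult.left_commute)
   thus ?thesis using polys_mult[OF fg(2) b(1)] by (intro bexI[of _ "\<lambda>z. g' z * b z"])
  qed
 qed (use g fg in \<open>auto intro: polys_mult\<close>)
qed

text \<open>The bound fails only where some polynomial \<open>q\<close> vanishes; multiplying numerator and denominator by \<open>q\<close>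
 extends it to all of \<open>V\<close>.\<close>

lemma bounded_generic_quotient:
 assumes rep: "represents F G u" and bd: "\<forall>\<^sub>F z in generic. cmod (u z) \<le> C * (1 + Re (ip z z)) ^ k"
 shows "u \<in> bounded_rational k"
proof -
 have eq: "\<forall>\<^sub>F z in generic. G z * u z = F z" and FG: "F \<in> polys" "nonzero G" using rep by (auto simp: represents_def)
 have "\<forall>\<^sub>F z in generic. cmod (F z) \<le> C * (1 + Re (ip z z)) ^ k * cmod (G z)" using eq bd
 proof eventually_elim
  case (elim z)
  have "cmod (F z) = cmod (u z) * cmod (G z)" using elim(1) by (metis mult.commute norm_mult)
  also have "... \<le> C * (1 + Re (ip z z)) ^ k * cmod (G z)" by (rule mult_right_mono[OF elim(2)]) simp
  finally show ?case .
 qed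
 then obtain q where q: "nonzero q" "\<forall>z\<in>V. q z \<noteq> 0 --> cmod (F z) \<le> C * (1 + Re (ip z z)) ^ k * cmod (G z)"
  unfolding eventually_generic by (elim exE conjE)
 have "represents (\<lambda>z. F z * q z) (\<lambda>z. G z * q z) u" unfolding represents_def
 proof (intro conjI)
  show "(\<lambda>z. F z * q z) \<in> polys" using FG q by (auto simp: nonzero_def intro: polys_mult)
  show "nonzero (\<lambda>z. G z * q z)" by (rule nonzero_mult[OF FG(2) q(1)])
  show "\<forall>\<^sub>F z in generic. G z * q z * u z = F z * q z" using eq by eventually_elim (simp add: mult.commute mult.left_commute)
 qed
 moreover have "cmod (F z * q z) \<le> C * (1 + Re (ip z z)) ^ k * cmod (G z * q z)" if "z \<in> V" for z
 proof (cases "q z = 0")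
  case False
  hence "cmod (F z) * cmod (q z) \<le> C * (1 + Re (ip z z)) ^ k * cmod (G z) * cmod (q z)"
   using q(2) that by (intro mult_right_mono) auto
  thus ?thesis by (simp add: norm_mult mult.assoc)
 qed simp
 ultimately show ?thesis unfolding bounded_rational_def by blast
qed

text \<open>Two layers of fractions occur: elements of the local ring \<open>L\<close> are fractions of regular functions, evaluated
 by \<open>ev1\<close>, and elements of its field of fractions are evaluated by \<open>ev2\<close>. If \<open>g\<close> is a common denominator,
 non-zero at \<open>p\<close>, of the coefficients of the integral equation of \<open>x\<close>, then \<open>u = g x\<close> satisfies a monic
 equation with polynomial coefficients \<open>c i\<close>. So \<open>u\<close> is bounded, hence a polynomial \<open>a\<close>, and \<open>x = a / g\<close> is
 regular at \<open>p\<close>.\<close>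

lemma local_ring_integrally_closed:
 assumes p: "p \<in> V"
 shows "integrally_closed_domain (local_ring scale V p)"
proof -
 define L where "L = local_ring scale V p"
 have L: "domain L" unfolding L_def by (rule local_ring_domain[OF p])
 interpret L: domain L by (rule L)
 interpret FL: domain "frac_field L" by (rule L.frac_domain)
 have Lc: "carrier L = regular_fractions p" by (simp add: L_def local_ring_eq)
 define ev1 :: "(('b => complex) \<times> ('b => complex)) set => 'b => complex" where "ev1 = frac_eval (\<lambda>x. x)"
 have ev1: "generic_evaluation generic L ev1" unfolding L_def local_ring_eq ev1_def
  by (rule generic_evaluation_subring[OF frac_eval_generic[OF cone_ring_domain cone_ring_generic] regular_fractions_sub[OF p]])
 define ev2 where "ev2 = frac_eval ev1"
 have ev2: "generic_evaluation generic (frac_field L) ev2" unfolding ev2_def by (rule frac_eval_generic[OF L ev1])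
 define A where "A = (\<lambda>a. fraction L a \<one>\<^bsub>L\<^esub>) ` carrier L"
 have ev2_A: "\<forall>\<^sub>F z in generic. ev2 (fraction L a \<one>\<^bsub>L\<^esub>) z = ev1 a z" if a: "a \<in> carrier L" for a
  using frac_eval_fraction[OF L ev1 a L.one_closed L.one_not_zero] generic_evaluationD(3)[OF ev1]
  unfolding ev2_def by eventually_elim simp
 have A_eval: "\<exists>f g. f \<in> polys \<and> g \<in> polys \<and> g p \<noteq> 0 \<and> (\<forall>\<^sub>F z in generic. g z * ev2 x z = f z)" if x: "x \<in> A" for x
 proof -
  obtain a where a: "a \<in> carrier L" "x = fraction L a \<one>\<^bsub>L\<^esub>" using x by (auto simp: A_def)
  obtain f g where fg: "f \<in> polys" "g \<in> polys" "g p \<noteq> 0" "\<forall>\<^sub>F z in generic. g z * ev1 a z = f z"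
   using regular_fraction_eval[OF p a(1)[unfolded Lc]] unfolding ev1_def by (elim exE conjE)
  have "\<forall>\<^sub>F z in generic. g z * ev2 x z = f z" using fg(4) ev2_A[OF a(1)] unfolding a(2) by eventually_elim simp
  with fg show ?thesis by blast
 qed
 have "x \<in> A" if x: "x \<in> carrier (frac_field L)" and int: "integral_over (frac_field L) A x" for x
 proof -
  obtain q where q: "q \<noteq> []" "set q \<subseteq> A" "hd q = \<one>\<^bsub>frac_field L\<^esub>" "ring.eval (frac_field L) q x = \<zero>\<^bsub>frac_field L\<^esub>"
   using int unfolding integral_over_def polynomial_def by blast
  have A_sub: "A \<subseteq> carrier (frac_field L)" unfolding A_def using L.fraction_closed by auto
  define n where "n = length q - 1"
  have len: "length q = Suc n" using q(1) by (simp add: n_def)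
  have last: "rev q ! n = \<one>\<^bsub>frac_field L\<^esub>" using q(1,3) by (simp add: rev_nth len hd_conv_nth)
  define h where "h = ev2 x"
  have "\<forall>\<^sub>F z in generic. ev2 (ring.eval (frac_field L) q x) z = (\<Sum>i<Suc n. ev2 (rev q ! i) z * h z ^ i)"
   using generic_evaluation_eval[OF ev2 FL.ring_axioms x, of q] q(2) A_sub unfolding len h_def by blast
  hence eqn: "\<forall>\<^sub>F z in generic. h z ^ n + (\<Sum>i<n. ev2 (rev q ! i) z * h z ^ i) = 0"
   using generic_evaluation_zero[OF ev2 FL.ring_axioms] generic_evaluationD(3)[OF ev2] unfolding q(4)
   by eventually_elim (simp add: last add.commute)
  obtain g where g: "g \<in> polys" "g p \<noteq> 0" "\<forall>a\<in>set q. \<exists>b\<in>polys. \<forall>\<^sub>F z in generic. g z * ev2 a z = b z"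
   using common_regular_denominator[OF p, of q ev2] A_eval q(2) by blast
  have "\<forall>i\<in>{..<n}. \<exists>b. b \<in> polys \<and> (\<forall>\<^sub>F z in generic. g z * ev2 (rev q ! i) z = b z)"
   using g(3) nth_mem[of _ "rev q"] len by (simp add: Bex_def)
  from bchoice[OF this] obtain b where b: "\<forall>i\<in>{..<n}. b i \<in> polys \<and> (\<forall>\<^sub>F z in generic. g z * ev2 (rev q ! i) z = b i z)"
   by (elim exE)
  \<comment> \<open>the equation of \<open>h\<close> multiplied by \<open>g ^ n\<close>\<close>
  define c where "c i z = g z ^ (n - 1 - i) * b i z" for i z
  have c: "c i \<in> polys" if "i < n" for i
   unfolding c_def[abs_def] using b that g(1) by (intro polys_mult polys_power) auto
  define u where "u z = g z * h z" for z
  have "\<forall>\<^sub>F z in generic. \<forall>i\<in>{..<n}. g z * ev2 (rev q ! i) z = b i z"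
   using b by (intro eventually_ball_finite) auto
  hence "\<forall>\<^sub>F z in generic. cmod (u z) \<le> 1 + (\<Sum>i<n. cmod (c i z))" using eqn
  proof eventually_elim
   case (elim z)
   have "u z ^ n + (\<Sum>i<n. c i z * u z ^ i) = g z ^ n * (h z ^ n + (\<Sum>i<n. ev2 (rev q ! i) z * h z ^ i))"
   proof -
    have "c i z * u z ^ i = g z ^ n * (ev2 (rev q ! i) z * h z ^ i)" if i: "i < n" for i
    proof -
     have "c i z * u z ^ i = (g z ^ (n - 1 - i) * g z * g z ^ i) * (ev2 (rev q ! i) z * h z ^ i)"
      using elim(1) i by (simp add: c_def u_def power_mult_distrib mult_ac flip: bspec[OF elim(1)])
     also have "g z ^ (n - 1 - i) * g z * g z ^ i = g z ^ n"
     proof -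
      have "n = (n - 1 - i) + 1 + i" using i by simp
      thus ?thesis by (metis power_add power_one_right)
     qed
     finally show ?thesis .
    qed
    hence "(\<Sum>i<n. c i z * u z ^ i) = g z ^ n * (\<Sum>i<n. ev2 (rev q ! i) z * h z ^ i)"
     unfolding sum_distrib_left by (intro sum.cong) auto
    thus ?thesis unfolding distrib_left by (simp only: u_def power_mult_distrib)
   qed
   thus ?case using elim(2) by (intro monic_root_bound) simp
  qed
  moreover obtain C k where "\<forall>z. 1 + (\<Sum>i<n. cmod (c i z)) \<le> C * (1 + Re (ip z z)) ^ k"
   using polys_sum_growth[of n c] c by blast
  ultimately have bd: "\<forall>\<^sub>F z in generic. cmod (u z) \<le> C * (1 + Re (ip z z)) ^ k"
   by (elim eventually_mono) (meson order_trans)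
  obtain F G where FG: "represents F G h"
  proof -
   obtain \<alpha> \<beta> where ab: "\<alpha> \<in> carrier L" "\<beta> \<in> carrier L" "\<beta> \<noteq> \<zero>\<^bsub>L\<^esub>" "x = fraction L \<alpha> \<beta>" using x by (rule L.fracE)
   have hx: "\<forall>\<^sub>F z in generic. h z = ev1 \<alpha> z / ev1 \<beta> z" "\<forall>\<^sub>F z in generic. ev1 \<beta> z \<noteq> 0"
    unfolding h_def ev2_def ab(4) by (rule frac_eval_fraction[OF L ev1 ab(1-3)], rule generic_evaluationD(4)[OF ev1 ab(2,3)])
   obtain k where k: "k \<in> polys" "k p \<noteq> 0" "\<forall>a\<in>set [\<alpha>, \<beta>]. \<exists>b\<in>polys. \<forall>\<^sub>F z in generic. k z * ev1 a z = b z"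
    using common_regular_denominator[OF p, of "[\<alpha>, \<beta>]" ev1] regular_fraction_eval[OF p] ab(1,2) unfolding Lc ev1_def
    by auto
   then obtain F G where FG: "F \<in> polys" "\<forall>\<^sub>F z in generic. k z * ev1 \<alpha> z = F z"
    "G \<in> polys" "\<forall>\<^sub>F z in generic. k z * ev1 \<beta> z = G z" by auto
   have "\<forall>\<^sub>F z in generic. k z \<noteq> 0" by (rule generic_nonzero) (use k p in \<open>auto simp: nonzero_def\<close>)
   hence G: "\<forall>\<^sub>F z in generic. z \<in> V \<and> G z \<noteq> 0 \<and> G z * h z = F z"
    using generic_V hx FG(2,4)
   proof eventually_elim
    case (elim z)
    thus ?case by (simp flip: elim(5,6))
   qed
   hence "nonzero G" using FG(3) eventually_happens'[OF generic_not_bot G] by (auto simp: nonzero_def)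
   with FG(1) eventually_mono[OF G] show thesis by (intro that[of F G]) (simp add: represents_def)
  qed
  have "represents (\<lambda>z. g z * F z) G u"
  proof -
   have "\<forall>\<^sub>F z in generic. G z * h z = F z" using FG by (simp add: represents_def)
   hence "\<forall>\<^sub>F z in generic. G z * u z = g z * F z" unfolding u_def by eventually_elim (simp add: mult.left_commute)
   thus ?thesis using FG polys_mult[OF g(1)] by (auto simp: represents_def)
  qed
  from bounded_rational_polynomial[OF bounded_generic_quotient[OF this bd]]
  obtain a where a: "a \<in> polys" "sim u a" by blast
  define y where "y = fraction cone_ring (restrict a V) (restrict g V)"
  have y: "y \<in> carrier L" unfolding Lc y_def by (rule regular_fractionsI[OF a(1) g(1,2) p])
  have "\<forall>\<^sub>F z in generic. ev1 y z = restrict a V z / restrict g V z" unfolding ev1_def y_def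
   by (rule frac_eval_fraction[OF cone_ring_domain cone_ring_generic])
    (use a g restrict_nonzero[of p g, OF p g(2)] in \<open>auto intro: cone_ring_restrict\<close>)
  moreover have "eventually (\<lambda>z. g z \<noteq> 0) generic" by (rule generic_nonzero) (use g p in \<open>auto simp: nonzero_def\<close>)
  ultimately have "\<forall>\<^sub>F z in generic. ev2 x z = ev2 (fraction L y \<one>\<^bsub>L\<^esub>) z"
   using ev2_A[OF y] generic_V a(2)[unfolded sim_def u_def h_def]
  proof eventually_elim
   case (elim z)
   have "ev2 (fraction L y \<one>\<^bsub>L\<^esub>) z = a z / g z" using elim by simp
   also have "... = ev2 x z" using elim(2) by (simp flip: elim(5))
   finally show ?case ..
  qed
  hence "x = fraction L y \<one>\<^bsub>L\<^esub>"
   using generic_evaluation_inject[OF ev2 FL.ring_axioms generic_not_bot x] y L.fraction_closed by simp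
  thus ?thesis using y by (auto simp: A_def)
 qed
 thus ?thesis unfolding integrally_closed_domain_def Let_def L_def[symmetric] A_def[symmetric] using L by blast
qed

theorem normal_affine_variety:
 assumes alg: "algebraic_set scale V"
 shows "normal_affine_variety scale V" unfolding normal_affine_variety_def affine_variety_def
proof (intro conjI alg V_nonempty ballI local_ring_integrally_closed allI impI)
 fix A B assume A: "algebraic_set scale A" and B: "algebraic_set scale B" and V: "V = A \<union> B"
 obtain S where S: "S \<subseteq> polys" "A = {z. \<forall>f\<in>S. f z = 0}" using A by (auto simp: algebraic_set_def)
 obtain S' where S': "S' \<subseteq> polys" "B = {z. \<forall>f\<in>S'. f z = 0}" using B by (auto simp: algebraic_set_def)
 show "V = A \<or> V = B"
 proof (rule ccontr)
  assume "\<not> (V = A \<or> V = B)"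
  then obtain x y where x: "x \<in> V" "x \<notin> A" and y: "y \<in> V" "y \<notin> B" using V by blast
  obtain f where f: "f \<in> S" "f x \<noteq> 0" using x S by blast
  obtain g where g: "g \<in> S'" "g y \<noteq> 0" using y S' by blast
  have "f z * g z = 0" if "z \<in> V" for z using that V S(2) S'(2) f(1) g(1) by auto
  note fg = this
  have "f \<in> polys" "g \<in> polys" using f(1) g(1) S(1) S'(1) by auto
  from V_irreducible[OF this fg] have "(\<forall>z\<in>V. f z = 0) \<or> (\<forall>z\<in>V. g z = 0)" .
  with x(1) y(1) f(2) g(2) show False by blast
 qed
qed

end

theorem theorem2p3:
  fixes smul :: "complex \<Rightarrow> 'a::ab_group_add \<Rightarrow> 'a"
    and Basis :: "'a set"
    and tp :: "'a \<Rightarrow> 'a \<Rightarrow> 'a \<Rightarrow> 'a"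
    and e :: "nat \<Rightarrow> 'a"
    and r l :: nat
  assumes "irreducible_hermitian_jordan_triple smul Basis tp"
    and "hermitian_jordan_triple.is_frame smul tp r e"
    and "1 \<le> l" and "l \<le> r"
  shows "normal_affine_variety smul (hermitian_jordan_triple.kepler_variety smul tp r e l)"
proof -
  interpret J: irreducible_hermitian_jordan_triple smul Basis tp by fact
  interpret J: irreducible_framed_triple smul Basis tp r e
    by unfold_locales (rule assms(2))
  interpret U: unitary_cone smul Basis J.form "{z. J.rank_quad z \<le> J.peirce_dim l}" J.triple_automorphisms
    "J.kepler_chart (J.frame_sum {1..l})" "J.P1 (J.frame_sum {1..l})" "J.P2 (J.frame_sum {1..l})"
    "J.peirce_rotation (J.frame_sum {1..l})"
    by (rule J.kepler_unitary_cone[OF assms(4)])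
  show ?thesis
    unfolding J.kepler_variety_rank[OF assms(4)]
    by (rule U.normal_affine_variety[OF J.rank_variety_algebraic])
qed

end
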